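(* Let $D,k\in\mathbb{N}$, let $v_1,\dots,v_k\in\mathbb{Z}^D$ be nonzero vectors, and let $P_1,\dots,P_k\in\mathbb{Z}[y]$ be linearly independent polynomials with zero constant terms; set $d=\max_{1\le i\le k}\deg P_i$. Let $\theta:\mathbb{F}_p\to\mathbb{C}$ be $1$-bounded and strongly $(d+1)$-uniform. Then there exist $p_0=p_0(\{v_i\},\{P_i\},\theta)\in\mathbb{N}$ and $c=c(\{P_i\},\theta)>0$ such that for every prime $p>p_0$, \[ \mathbb{E}_{\underline{x}\in\mathbb{F}_p^D}\mathbb{E}_{y\in\mathbb{F}_p}\theta(y)f_0(\underline{x})\prod_{i=1}^k f_i(\underline{x}+P_i(y)v_i)=\mathbb{E}_{y\in\mathbb{F}_p}\theta(y)\cdot\mathbb{E}_{\underline{x}\in\mathbb{F}_p^D}f_0(\underline{x})\prod_{i=1}^k\mathbb{E}_{n_i\in\mathbb{F}_p}f_i(\underline{x}+n_iv_i)+O_{\{P_i\},\theta}\left(p^{-c}\right) \] for all $1$-bounded functions $f_0,\dots,f_k:\mathbb{F}_p^D\to\mathbb{C}$.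
   Context: $p$ denotes a prime; polynomials with integer coefficients and vectors in $\mathbb{Z}^D$ are reduced modulo $p$. $\mathbb{E}_{x\in X}f(x)=\frac1{|X|}\sum_{x\in X}f(x)$; a function is $1$-bounded if its absolute value is at most $1$ everywhere; $e_p(x)=e^{2\pi i x/p}$. For $\theta:\mathbb{F}_p\to\mathbb{C}$, $\|\theta\|_{u^s(\mathbb{F}_p)}:=\sup_{P\in\mathbb{Z}[y],\ \deg P\le s-1}\left|\mathbb{E}_{y\in\mathbb{F}_p}\theta(y)e_p(-P(y))\right|$, and $\mathbb{E}\theta=\mathbb{E}_{y\in\mathbb{F}_p}\theta(y)$. The function $\theta$ (understood as given for each prime $p$) is called strongly $s$-uniform if there exist $C=C(\theta,s),c=c(\theta,s)>0$ independent of $p$ with $\|\theta-\mathbb{E}\theta\|_{u^s(\mathbb{F}_p)}\le Cp^{-c}$. The notation $A=O_{X}(B)$ means $|A|\le C(X)B$ with $C(X)$ depending only on $X$. *)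

theory Defs
  imports Complex_Main "HOL-Library.FuncSet" "HOL-Computational_Algebra.Computational_Algebra"
begin

text \<open>
  The field \<open>\<bbbF>\<^sub>p\<close> is represented by the residues \<open>0, \<dots>, p - 1\<close>, and \<open>\<bbbF>\<^sub>p\<^sup>D\<close> by the extensional
  functions from \<open>{1..D}\<close> into them; only the values of functions on these sets are ever used.
\<close>

definition Fp :: "nat \<Rightarrow> int set" where
  "Fp p = {0..<int p}"

definition Fp_vec :: "nat \<Rightarrow> nat \<Rightarrow> (nat \<Rightarrow> int) set" where
  "Fp_vec p D = {1..D} \<rightarrow>\<^sub>E Fp p"

text \<open>The point \<open>x + n v\<close> of \<open>\<bbbF>\<^sub>p\<^sup>D\<close>, for an integer \<open>n\<close> and an integer vector \<open>v\<close>.\<close>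

definition translate :: "nat \<Rightarrow> nat \<Rightarrow> (nat \<Rightarrow> int) \<Rightarrow> int \<Rightarrow> (nat \<Rightarrow> int) \<Rightarrow> (nat \<Rightarrow> int)" where
  "translate p D x n v = (\<lambda>j\<in>{1..D}. (x j + n * v j) mod int p)"

definition avg :: "'a set \<Rightarrow> ('a \<Rightarrow> complex) \<Rightarrow> complex" where
  "avg X f = (\<Sum>x\<in>X. f x) / of_nat (card X)"

definition one_bounded_on :: "'a set \<Rightarrow> ('a \<Rightarrow> complex) \<Rightarrow> bool" where
  "one_bounded_on X f \<longleftrightarrow> (\<forall>x\<in>X. cmod (f x) \<le> 1)"

definition e_p :: "nat \<Rightarrow> int \<Rightarrow> complex" where
  "e_p p x = exp (2 * of_real pi * \<i> * of_int x / of_nat p)"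

text \<open>The norm \<open>\<parallel>\<theta>\<parallel>\<close> of index \<open>u\<^sup>s(\<bbbF>\<^sub>p)\<close>, meaningful for \<open>s \<ge> 1\<close>.\<close>

definition u_norm :: "nat \<Rightarrow> nat \<Rightarrow> (int \<Rightarrow> complex) \<Rightarrow> real" where
  "u_norm s p \<theta> =
     (SUP P\<in>{P :: int poly. degree P \<le> s - 1}. cmod (avg (Fp p) (\<lambda>y. \<theta> y * e_p p (- poly P y))))"

text \<open>Here \<open>\<theta>\<close> is a family of functions, \<open>\<theta> p\<close> being the function on \<open>\<bbbF>\<^sub>p\<close>.\<close>

definition strongly_uniform :: "nat \<Rightarrow> (nat \<Rightarrow> int \<Rightarrow> complex) \<Rightarrow> bool" where
  "strongly_uniform s \<theta> \<longleftrightarrow>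
     (\<exists>C>0. \<exists>c>0. \<forall>p. prime p \<longrightarrow>
        u_norm s p (\<lambda>y. \<theta> p y - avg (Fp p) (\<theta> p)) \<le> C * real p powr (- c))"

definition lin_indep_family :: "'i set \<Rightarrow> ('i \<Rightarrow> int poly) \<Rightarrow> bool" where
  "lin_indep_family I P \<longleftrightarrow>
     (\<forall>a :: 'i \<Rightarrow> int. (\<Sum>i\<in>I. smult (a i) (P i)) = 0 \<longrightarrow> (\<forall>i\<in>I. a i = 0))"

end

theory Submission
  imports Defs "HOL-Library.Function_Algebras" "HOL-Library.Multiset_Order"
begin

text \<open>
  The indices are split into a set \<open>S\<close> carrying arbitrary functions \<open>f\<^sub>i\<close> and its complement, which
  carries phases linear in \<open>P\<^sub>i\<close> with frequencies depending on \<open>x\<close>; the estimate is proved by induction on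
  \<open>S\<close>. For empty \<open>S\<close> it is Weyl's inequality, by linear independence. In the inductive step, PET induction bounds the average
  by a box norm of some \<open>f\<^sub>k\<close> along unknown directions outside a given subspace \<open>U\<close> along which \<open>f\<^sub>k\<close> is
  invariant. An unknown direction \<open>u\<close> is traded for \<open>v\<^sub>k\<close>, because for \<open>f\<^sub>k\<close> invariant along \<open>U + \<langle>u\<rangle>\<close> the
  estimate is known by induction on the codimension of \<open>U\<close>. PET induction fails only if \<open>U\<close> contains \<open>v\<^sub>k\<close>,
  and then \<open>k\<close> can be removed from \<open>S\<close>, or a difference of leading coefficients, and then \<open>v\<^sub>k\<close> can be replaced
  by a multiple of another \<open>v\<^sub>i\<close>. The resulting Gowers norm along \<open>v\<^sub>k\<close> is taken
  of a dual function; degree lowering reduces it to a \<open>U\<^sup>2\<close> norm, whose inverse theorem turns \<open>f\<^sub>k\<close> into an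
  eigenfunction, so that \<open>k\<close> joins the indices carrying phases. The weight \<open>\<theta>\<close> is put in by a
  second induction on \<open>S\<close>: one application of the Cauchy--Schwarz inequality removes it, and the unweighted
  estimate bounds a \<open>U\<^sup>2\<close> norm.
\<close>

section \<open>Averages\<close>

text \<open>The exponent \<open>c\<close> must not depend on \<open>D\<close> or on the directions.
  Everything is therefore proved for an abstract action and arbitrary directions nonzero modulo
  \<open>p\<close>, and a bound is a natural number \<open>B\<close>: the error is at most \<delta>
  whenever p \<delta>^B \<ge> 1. Such bounds are uniform because only finitely many sets
  \<open>S\<close>, labelings and PET weights have to be considered at each stage. Frequencies are
  functions of \<open>x\<close> because an eigenfunction along v_k has its own frequency on every
  orbit; multiplicative derivatives then keep the averages inside this class. The function f_k is
  split into its average along v_k and a part with zero average. For the second part the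
  eigenfunction found at the end has frequency nonzero modulo \<open>p\<close> on its support, and
  then the main term of the estimate for the smaller set vanishes, which gives a contradiction.
  Linear independence modulo \<open>p\<close> serves twice: in Weyl's inequality, and in PET for
  parallel directions, where c_k P_k - c_i P_i must be nonconstant. The uniformity of \<theta>
  enters only for empty \<open>S\<close>; later steps use its boundedness.\<close>

definition ravg :: "'a set \<Rightarrow> ('a \<Rightarrow> real) \<Rightarrow> real" where
  "ravg X f = (\<Sum>x\<in>X. f x) / real (card X)"

lemma avg_cong: "(\<And>x. x \<in> X \<Longrightarrow> f x = g x) \<Longrightarrow> avg X f = avg X g"
  by (simp add: avg_def cong: sum.cong)

lemma ravg_cong: "(\<And>x. x \<in> X \<Longrightarrow> f x = g x) \<Longrightarrow> ravg X f = ravg X g"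
  by (simp add: ravg_def cong: sum.cong)

lemma avg_diff: "avg X (\<lambda>x. f x - g x) = avg X f - avg X g"
  by (simp add: avg_def sum_subtractf diff_divide_distrib)

lemma avg_cmult: "avg X (\<lambda>x. c * f x) = c * avg X f"
  by (simp add: avg_def sum_distrib_left)

lemma avg_multc: "avg X (\<lambda>x. f x * c) = avg X f * c"
  by (simp add: avg_def sum_distrib_right)

lemma avg_const: "finite X \<Longrightarrow> X \<noteq> {} \<Longrightarrow> avg X (\<lambda>_. c) = c"
  by (simp add: avg_def)

lemma avg_cnj: "cnj (avg X f) = avg X (\<lambda>x. cnj (f x))"
  by (simp add: avg_def)

lemma avg_of_real: "avg X (\<lambda>x. of_real (f x)) = of_real (ravg X f)"
  by (simp add: avg_def ravg_def)

lemma avg_swap: "avg A (\<lambda>a. avg B (\<lambda>b. f a b)) = avg B (\<lambda>b. avg A (\<lambda>a. f a b))"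
  unfolding avg_def sum_divide_distrib[symmetric]
  by (subst sum.swap) (simp add: field_simps)

lemma avg_Times: "avg (A \<times> B) f = avg A (\<lambda>a. avg B (\<lambda>b. f (a, b)))"
  by (simp add: avg_def sum.cartesian_product sum_divide_distrib card_cartesian_product field_simps
      flip: sum_divide_distrib)

lemma avg_bij: "bij_betw h A B \<Longrightarrow> avg A (\<lambda>a. f (h a)) = avg B f"
  by (simp add: avg_def sum.reindex_bij_betw bij_betw_same_card)

lemma ravg_bij: "bij_betw h A B \<Longrightarrow> ravg A (\<lambda>a. f (h a)) = ravg B f"
  by (simp add: ravg_def sum.reindex_bij_betw bij_betw_same_card)

lemma ravg_mono: "(\<And>x. x \<in> X \<Longrightarrow> f x \<le> g x) \<Longrightarrow> ravg X f \<le> ravg X g"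
  unfolding ravg_def by (intro divide_right_mono sum_mono) auto

lemma ravg_nonneg: "(\<And>x. x \<in> X \<Longrightarrow> 0 \<le> f x) \<Longrightarrow> 0 \<le> ravg X f"
  unfolding ravg_def by (intro divide_nonneg_nonneg sum_nonneg) auto

lemma ravg_const: "finite X \<Longrightarrow> X \<noteq> {} \<Longrightarrow> ravg X (\<lambda>_. c) = c"
  by (simp add: ravg_def)

lemma ravg_add: "ravg X (\<lambda>x. f x + g x) = ravg X f + ravg X g"
  by (simp add: ravg_def sum.distrib add_divide_distrib)

lemma ravg_cmult: "ravg X (\<lambda>x. c * f x) = c * ravg X f"
  by (simp add: ravg_def sum_distrib_left)

lemma ravg_le: "\<lbrakk>\<And>x. x \<in> X \<Longrightarrow> f x \<le> c; finite X; X \<noteq> {}\<rbrakk> \<Longrightarrow> ravg X f \<le> c"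
  using ravg_mono[of X f "\<lambda>_. c"] by (simp add: ravg_const)

lemma ravg_swap: "ravg A (\<lambda>a. ravg B (\<lambda>b. f a b)) = ravg B (\<lambda>b. ravg A (\<lambda>a. f a b))"
  unfolding ravg_def sum_divide_distrib[symmetric]
  by (subst sum.swap) (simp add: field_simps)

lemma norm_avg_le: "cmod (avg X f) \<le> ravg X (\<lambda>x. cmod (f x))"
  by (simp add: avg_def ravg_def norm_divide divide_right_mono norm_sum)

lemma norm_avg_le_bound:
  assumes "\<And>x. x \<in> X \<Longrightarrow> cmod (f x) \<le> c" "0 \<le> c" shows "cmod (avg X f) \<le> c"
proof (cases "finite X \<and> X \<noteq> {}")
  case True
  then show ?thesis using norm_avg_le[of X f] ravg_le[of X "\<lambda>x. cmod (f x)" c] assms by force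
next
  case False
  then show ?thesis using assms by (auto simp: avg_def)
qed

lemma ravg_ex_ge:
  assumes "finite X" "X \<noteq> {}" "c \<le> ravg X f" shows "\<exists>x\<in>X. c \<le> f x"
proof (rule ccontr)
  assume "\<not> ?thesis"
  then have "(\<Sum>x\<in>X. f x) < (\<Sum>x\<in>X. c)" using assms by (intro sum_strict_mono) auto
  then show False using assms by (simp add: ravg_def field_simps card_gt_0_iff)
qed

lemma ravg_square: "(ravg X f)\<^sup>2 \<le> ravg X (\<lambda>x. (f x)\<^sup>2)"
proof (cases "finite X \<and> X \<noteq> {}")
  case True
  define m where "m = ravg X f"
  have "0 \<le> ravg X (\<lambda>x. (f x - m)\<^sup>2)" by (intro ravg_nonneg) auto
  also have "\<dots> = ravg X (\<lambda>x. (f x)\<^sup>2 + ((-2*m) * f x + m\<^sup>2))"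
    by (intro ravg_cong) (simp add: power2_eq_square algebra_simps)
  also have "\<dots> = ravg X (\<lambda>x. (f x)\<^sup>2) - m\<^sup>2"
    unfolding ravg_add ravg_cmult using True by (simp add: ravg_const power2_eq_square flip: m_def)
  finally show ?thesis by (simp add: m_def)
next
  case False
  then show ?thesis by (auto simp: ravg_def)
qed

lemma ravg_power:
  assumes "\<And>x. x \<in> X \<Longrightarrow> 0 \<le> f x"
  shows "(ravg X f) ^ (2 ^ n) \<le> ravg X (\<lambda>x. f x ^ (2 ^ n))"
proof (induction n)
  case 0
  then show ?case by simp
next
  case (Suc n)
  have "(ravg X f) ^ (2 ^ Suc n) = ((ravg X f) ^ (2 ^ n))\<^sup>2"
    by (simp add: power_mult mult.commute flip: power_mult)
  also have "\<dots> \<le> (ravg X (\<lambda>x. f x ^ (2 ^ n)))\<^sup>2"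
    using Suc assms by (intro power_mono zero_le_power ravg_nonneg) auto
  also have "\<dots> \<le> ravg X (\<lambda>x. (f x ^ (2 ^ n))\<^sup>2)" by (rule ravg_square)
  also have "\<dots> = ravg X (\<lambda>x. f x ^ (2 ^ Suc n))"
    by (intro ravg_cong) (simp add: power_mult mult.commute flip: power_mult)
  finally show ?case .
qed

lemma avg_cauchy_schwarz:
  assumes "\<And>x. x \<in> X \<Longrightarrow> cmod (g x) \<le> 1"
  shows "(cmod (avg X (\<lambda>x. g x * F x)))\<^sup>2 \<le> ravg X (\<lambda>x. (cmod (F x))\<^sup>2)"
proof -
  have "cmod (avg X (\<lambda>x. g x * F x)) \<le> ravg X (\<lambda>x. cmod (F x))"
    using assms by (intro order_trans[OF norm_avg_le] ravg_mono)
      (auto simp: norm_mult mult_left_le_one_le)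
  then have "(cmod (avg X (\<lambda>x. g x * F x)))\<^sup>2 \<le> (ravg X (\<lambda>x. cmod (F x)))\<^sup>2"
    by (intro power_mono) auto
  also have "\<dots> \<le> ravg X (\<lambda>x. (cmod (F x))\<^sup>2)" by (rule ravg_square)
  finally show ?thesis .
qed

lemma norm_avg_power:
  "cmod (avg X f) ^ (2 ^ n) \<le> ravg X (\<lambda>x. cmod (f x) ^ (2 ^ n))"
  by (intro order_trans[OF power_mono[OF norm_avg_le] ravg_power]) auto

section \<open>Reindexing averages over F_p and the van der Corput identity\<close>

lemma Fp_finite [simp]: "finite (Fp p)"
  by (simp add: Fp_def)

lemma Fp_card [simp]: "card (Fp p) = p"
  by (simp add: Fp_def)

lemma Fp_nonempty: "0 < p \<Longrightarrow> Fp p \<noteq> {}"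
  by (simp add: Fp_def)

definition per :: "nat \<Rightarrow> (int \<Rightarrow> 'a) \<Rightarrow> bool" where
  "per p G \<longleftrightarrow> (\<forall>y. G (y + int p) = G y)"

lemma per_mult: assumes "per p G" shows "G (y + int p * n) = G y"
proof (induction n rule: int_induct[where k = 0])
  case (step1 i)
  then show ?case using assms[unfolded per_def, rule_format, of "y + int p * i"]
    by (simp add: algebra_simps)
next
  case (step2 i)
  then show ?case using assms[unfolded per_def, rule_format, of "y + int p * (i - 1)"]
    by (simp add: algebra_simps)
qed simp

lemma per_mod: "per p G \<Longrightarrow> G (y mod int p) = G y"
  using per_mult[of p G "y mod int p" "y div int p"] by (simp add: mult.commute)

text \<open>An injection of a finite set into itself is onto, so injectivity modulo \<open>p\<close>
  suffices. Shifts, the reflection and dilations by units are the instances used.\<close>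

lemma avg_Fp_reindex:
  assumes "0 < p" "per p G" "\<And>a b. int p dvd s a - s b \<Longrightarrow> int p dvd a - b"
  shows "avg (Fp p) (\<lambda>y. G (s y)) = avg (Fp p) G"
proof -
  have inj: "inj_on (\<lambda>y. s y mod int p) (Fp p)"
  proof (rule inj_onI)
    fix a b assume ab: "a \<in> Fp p" "b \<in> Fp p" "s a mod int p = s b mod int p"
    then have "int p dvd a - b" using assms(3) by (simp add: mod_eq_dvd_iff)
    then have "a mod int p = b mod int p" by (simp add: mod_eq_dvd_iff)
    then show "a = b" using ab by (simp add: Fp_def)
  qed
  have "(\<lambda>y. s y mod int p) ` Fp p \<subseteq> Fp p" using assms(1) by (auto simp: Fp_def)
  then have "bij_betw (\<lambda>y. s y mod int p) (Fp p) (Fp p)"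
    using inj by (simp add: bij_betw_def endo_inj_surj)
  from avg_bij[OF this, of G] show ?thesis by (simp add: per_mod[OF assms(2)])
qed

lemma avg_Fp_shift: "0 < p \<Longrightarrow> per p G \<Longrightarrow> avg (Fp p) (\<lambda>y. G (y + h)) = avg (Fp p) G"
  by (rule avg_Fp_reindex) auto

lemma avg_Fp_minus: "0 < p \<Longrightarrow> per p G \<Longrightarrow> avg (Fp p) (\<lambda>y. G (- y)) = avg (Fp p) G"
  by (rule avg_Fp_reindex) (auto simp: dvd_diff_commute algebra_simps)

lemma avg_Fp_scale:
  assumes "prime p" "per p G" "\<not> int p dvd c"
  shows "avg (Fp p) (\<lambda>y. G (c * y)) = avg (Fp p) G"
proof (rule avg_Fp_reindex)
  fix a b assume "int p dvd c * a - c * b"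
  then have "int p dvd c * (a - b)" by (simp add: algebra_simps)
  then show "int p dvd a - b"
    using assms by (meson prime_dvd_mult_iff prime_nat_int_transfer)
qed (use assms prime_gt_0_nat in auto)

lemma avg_Fp_diff: "0 < p \<Longrightarrow> per p G \<Longrightarrow>
  avg (Fp p) (\<lambda>n. avg (Fp p) (\<lambda>m. G (n - m))) = avg (Fp p) G"
  using avg_Fp_shift[of p G] by (subst avg_swap) (simp add: avg_const Fp_nonempty diff_conv_add_uminus del: add_uminus_conv_diff)

text \<open>Differences run over the whole group F_p, so there are no boundary terms and this is an
  identity.\<close>

lemma van_der_corput:
  assumes "0 < p" "per p G"
  shows "of_real ((cmod (avg (Fp p) G))\<^sup>2) = avg (Fp p) (\<lambda>h. avg (Fp p) (\<lambda>y. G (y + h) * cnj (G y)))"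
proof -
  have "of_real ((cmod (avg (Fp p) G))\<^sup>2) = avg (Fp p) G * cnj (avg (Fp p) G)"
    by (simp only: complex_norm_square)
  also have "\<dots> = avg (Fp p) (\<lambda>y. avg (Fp p) (\<lambda>h. G (y + h)) * cnj (G y))"
    using avg_Fp_shift[OF assms] by (simp add: avg_cnj add.commute[of _ "_::int"] flip: avg_cmult)
  also have "\<dots> = avg (Fp p) (\<lambda>y. avg (Fp p) (\<lambda>h. G (y + h) * cnj (G y)))"
    by (simp only: avg_multc)
  finally show ?thesis by (subst avg_swap)
qed

section \<open>Additive characters\<close>

lemma e_p_cis: "e_p p x = cis (2 * pi * of_int x / of_nat p)"
  unfolding e_p_def cis_conv_exp by (simp add: algebra_simps)

lemma e_p_add: "e_p p (a + b) = e_p p a * e_p p b"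
  by (simp add: e_p_cis cis_mult add_divide_distrib distrib_left)

lemma e_p_0 [simp]: "e_p p 0 = 1"
  by (simp add: e_p_def)

lemma norm_e_p [simp]: "cmod (e_p p a) = 1"
  by (simp add: e_p_cis)

lemma cnj_e_p: "cnj (e_p p a) = e_p p (- a)"
  by (simp add: e_p_cis cis_cnj)

lemma e_p_eq_1_iff: assumes "0 < p" shows "e_p p t = 1 \<longleftrightarrow> int p dvd t"
proof
  assume "e_p p t = 1"
  then have "cos (2 * pi * of_int t / of_nat p) = 1" by (simp add: e_p_cis complex_eq_iff)
  then obtain n :: int where "2 * pi * of_int t / of_nat p = of_int n * 2 * pi"
    using cos_one_2pi_int by blast
  then have "real_of_int t = real_of_int (n * int p)" using assms by (simp add: field_simps)
  then have "t = n * int p" using of_int_eq_iff by blast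
  then show "int p dvd t" by simp
next
  assume "int p dvd t"
  then obtain n where "t = int p * n" by blast
  then have "e_p p t = cis (2 * pi * of_int n)" using assms by (simp add: e_p_cis field_simps)
  then show "e_p p t = 1" by (simp add: cis_multiple_2pi)
qed

lemma e_p_cong: assumes "0 < p" "int p dvd a - b" shows "e_p p a = e_p p b"
proof -
  have "e_p p a = e_p p (a - b) * e_p p b" by (simp flip: e_p_add)
  then show ?thesis using e_p_eq_1_iff[OF assms(1)] assms(2) by simp
qed

lemma per_e_p: "0 < p \<Longrightarrow> per p (\<lambda>n. e_p p (n * t))"
  unfolding per_def by (auto intro!: e_p_cong simp: algebra_simps)

lemma avg_e_p:
  assumes "0 < p" shows "avg (Fp p) (\<lambda>n. e_p p (n * t)) = (if int p dvd t then 1 else 0)"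
proof (cases "int p dvd t")
  case True
  then have "e_p p (n * t) = 1" for n using e_p_eq_1_iff[OF assms] by simp
  then show ?thesis using True assms by (simp add: avg_const Fp_nonempty)
next
  case False
  have "avg (Fp p) (\<lambda>n. e_p p (n * t)) = avg (Fp p) (\<lambda>n. e_p p ((n + 1) * t))"
    using avg_Fp_shift[OF assms per_e_p[OF assms], of 1 t] by simp
  also have "\<dots> = avg (Fp p) (\<lambda>n. e_p p (n * t)) * e_p p t"
    by (simp add: distrib_right e_p_add avg_multc)
  finally have "avg (Fp p) (\<lambda>n. e_p p (n * t)) * (e_p p t - 1) = 0" by (simp add: algebra_simps)
  then show ?thesis using False e_p_eq_1_iff[OF assms] by simp
qed

section \<open>The Fourier transform on F_p\<close>

definition ft :: "nat \<Rightarrow> (int \<Rightarrow> complex) \<Rightarrow> int \<Rightarrow> complex" where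
  "ft p c \<xi> = avg (Fp p) (\<lambda>n. c n * e_p p (- (n * \<xi>)))"

text \<open>Orthogonality of characters leaves the diagonal with weight 1/p. The transform is an
  average, hence frequencies are summed.\<close>

lemma parseval:
  assumes "0 < p"
  shows "(\<Sum>\<xi>\<in>Fp p. (cmod (ft p c \<xi>))\<^sup>2) = ravg (Fp p) (\<lambda>n. (cmod (c n))\<^sup>2)"
proof -
  have *: "of_real ((cmod (ft p c \<xi>))\<^sup>2) =
      avg (Fp p) (\<lambda>n. avg (Fp p) (\<lambda>m. c n * cnj (c m) * e_p p (\<xi> * (m - n))))" for \<xi>
  proof -
    have "of_real ((cmod (ft p c \<xi>))\<^sup>2) = ft p c \<xi> * cnj (ft p c \<xi>)" by (simp only: complex_norm_square)
    also have "\<dots> = avg (Fp p) (\<lambda>n. avg (Fp p) (\<lambda>m. (c n * e_p p (- (n * \<xi>))) * (cnj (c m) * e_p p (m * \<xi>))))"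
      by (simp add: ft_def avg_cnj cnj_e_p avg_cmult avg_multc)
    also have "\<dots> = avg (Fp p) (\<lambda>n. avg (Fp p) (\<lambda>m. c n * cnj (c m) * e_p p (\<xi> * (m - n))))"
      by (intro avg_cong) (simp add: algebra_simps flip: e_p_add)
    finally show ?thesis .
  qed
  have "of_real (\<Sum>\<xi>\<in>Fp p. (cmod (ft p c \<xi>))\<^sup>2) =
      of_nat p * avg (Fp p) (\<lambda>\<xi>. of_real ((cmod (ft p c \<xi>))\<^sup>2))"
    using assms by (simp add: avg_def)
  also have "avg (Fp p) (\<lambda>\<xi>. of_real ((cmod (ft p c \<xi>))\<^sup>2)) =
      avg (Fp p) (\<lambda>n. avg (Fp p) (\<lambda>m. c n * cnj (c m) * avg (Fp p) (\<lambda>\<xi>. e_p p (\<xi> * (m - n)))))"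
  proof -
    have "avg (Fp p) (\<lambda>\<xi>. avg (Fp p) (\<lambda>n. avg (Fp p) (\<lambda>m. c n * cnj (c m) * e_p p (\<xi> * (m - n))))) =
      avg (Fp p) (\<lambda>n. avg (Fp p) (\<lambda>\<xi>. avg (Fp p) (\<lambda>m. c n * cnj (c m) * e_p p (\<xi> * (m - n)))))"
      by (rule avg_swap)
    also have "\<dots> = avg (Fp p) (\<lambda>n. avg (Fp p) (\<lambda>m. avg (Fp p) (\<lambda>\<xi>. c n * cnj (c m) * e_p p (\<xi> * (m - n)))))"
      by (intro avg_cong avg_swap)
    finally show ?thesis by (simp only: * avg_cmult)
  qed
  also have "\<dots> = avg (Fp p) (\<lambda>n. of_real ((cmod (c n))\<^sup>2) / of_nat p)"
  proof (intro avg_cong)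
    fix n assume n: "n \<in> Fp p"
    have "int p dvd m - n \<longleftrightarrow> m = n" if "m \<in> Fp p" for m
      using that n by (auto simp: Fp_def mod_eq_dvd_iff[symmetric])
    then have "avg (Fp p) (\<lambda>m. c n * cnj (c m) * avg (Fp p) (\<lambda>\<xi>. e_p p (\<xi> * (m - n)))) =
      avg (Fp p) (\<lambda>m. if m = n then c n * cnj (c n) else 0)"
      by (intro avg_cong) (auto simp: avg_e_p[OF assms])
    then show "avg (Fp p) (\<lambda>m. c n * cnj (c m) * avg (Fp p) (\<lambda>\<xi>. e_p p (\<xi> * (m - n)))) =
      of_real ((cmod (c n))\<^sup>2) / of_nat p"
      using n complex_norm_square[of "c n"] by (simp add: avg_def)
  qed
  also have "of_nat p * avg (Fp p) (\<lambda>n. of_real ((cmod (c n))\<^sup>2) / of_nat p) =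
      of_real (ravg (Fp p) (\<lambda>n. (cmod (c n))\<^sup>2))"
    using assms by (simp add: avg_def ravg_def flip: sum_divide_distrib)
  finally show ?thesis using of_real_eq_iff by blast
qed

section \<open>Box norms for actions of a ring\<close>

definition bd :: "('x \<Rightarrow> complex) \<Rightarrow> bool" where
  "bd f \<longleftrightarrow> (\<forall>x. cmod (f x) \<le> 1)"

lemma bd_mult: "bd f \<Longrightarrow> bd g \<Longrightarrow> bd (\<lambda>x. f x * g x)"
  by (simp add: bd_def norm_mult mult_le_one)

lemma bd_cnj: "bd f \<Longrightarrow> bd (\<lambda>x. cnj (f x))"
  by (simp add: bd_def)

lemma bd_avg: "(\<And>z. z \<in> Z \<Longrightarrow> bd (f z)) \<Longrightarrow> bd (\<lambda>x. avg Z (\<lambda>z. f z x))"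
  by (auto simp: bd_def intro!: norm_avg_le_bound)

lemma bd_prod_list: "(\<And>z. z \<in> set Z \<Longrightarrow> bd (f z)) \<Longrightarrow> bd (\<lambda>x. prod_list (map (\<lambda>z. f z x) Z))"
  by (induction Z) (auto simp: bd_def norm_mult intro!: mult_le_one)

lemma bd_prod: "(\<And>z. z \<in> Z \<Longrightarrow> bd (f z)) \<Longrightarrow> bd (\<lambda>x. \<Prod>z\<in>Z. f z x)"
  by (auto simp: bd_def prod_norm[symmetric] intro!: prod_le_1)

lemma avg_swap3: "avg A (\<lambda>n. avg B (\<lambda>m. avg C (\<lambda>a. f n m a))) =
    avg C (\<lambda>a. avg A (\<lambda>n. avg B (\<lambda>m. f n m a)))"
  by (subst (2) avg_swap, subst avg_swap, rule refl)

lemma norm_avg_square: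
  "of_real ((cmod (avg A c))\<^sup>2) = avg A (\<lambda>n. avg A (\<lambda>m. c n * cnj (c m)))"
  by (simp only: complex_norm_square avg_cnj avg_cmult avg_multc)

text \<open>The action is total, so that functions need not be restricted to \<open>X\<close>: outside \<open>X\<close> it can be extended by
  the identity. The ring structure of \<open>'v\<close> is only used for integer multiples.\<close>

locale zact =
  fixes p :: nat and X :: "'x set" and act :: "'v::comm_ring_1 \<Rightarrow> 'x \<Rightarrow> 'x"
  assumes prime_p: "prime p" and fin: "finite X" and ne: "X \<noteq> {}"
    and act_add: "\<And>a b x. act (a + b) x = act a (act b x)"
    and act_p: "\<And>a x. act (of_nat p * a) x = x"
    and act_X: "\<And>a x. x \<in> X \<Longrightarrow> act a x \<in> X"
begin

lemma p_pos: "0 < p"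
  using prime_p prime_gt_0_nat by blast

lemma Fp_ne: "Fp p \<noteq> {}"
  using p_pos by (rule Fp_nonempty)

lemma act_0 [simp]: "act 0 x = x"
  using act_p[of 0] by simp

lemma act_uminus [simp]: "act (- a) (act a x) = x" "act a (act (- a) x) = x"
  using act_add[of "- a" a x] act_add[of a "- a" x] by simp_all

lemma act_cong: assumes "of_nat p dvd a - b" shows "act a x = act b x"
proof -
  obtain c where "a - b = of_nat p * c" using assms by blast
  then have "a = of_nat p * c + b" by (simp add: algebra_simps)
  then show ?thesis using act_add act_p by metis
qed

lemma act_comm: "act a (act b x) = act b (act a x)"
  using act_add by (metis add.commute)

lemma act_per: "act (of_int (n + int p) * u) x = act (of_int n * u) x"
  by (rule act_cong) (simp add: algebra_simps)

lemma per_act: "per p (\<lambda>n. f (act (of_int n * u) x))"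
  unfolding per_def using act_per by simp

lemma bij_act: "bij_betw (act a) X X"
proof (rule bij_betwI[where g = "act (- a)"])
qed (auto intro: act_X)

lemma E_shift: "avg X (\<lambda>x. f (act a x)) = avg X f"
  by (rule avg_bij[OF bij_act])

lemma ravg_shift: "ravg X (\<lambda>x. f (act a x)) = ravg X f"
  by (rule ravg_bij[OF bij_act])

lemma E_shift_cong: "(\<And>x. f (act a x) = g x) \<Longrightarrow> avg X f = avg X g"
  using E_shift[of f a] by simp

definition A :: "'v \<Rightarrow> ('x \<Rightarrow> complex) \<Rightarrow> 'x \<Rightarrow> complex" where
  "A u g x = avg (Fp p) (\<lambda>n. g (act (of_int n * u) x))"

definition D :: "'v \<Rightarrow> ('x \<Rightarrow> complex) \<Rightarrow> 'x \<Rightarrow> complex" where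
  "D a f x = f (act a x) * cnj (f x)"

text \<open>The iterated multiplicative derivative. Using \<open>hd\<close> and \<open>tl\<close>
  instead of a pattern for the parameters lets the algebraic laws hold without assumptions on
  lengths.\<close>

primrec dl :: "'v list \<Rightarrow> int list \<Rightarrow> ('x \<Rightarrow> complex) \<Rightarrow> 'x \<Rightarrow> complex" where
  "dl [] ns f = f"
| "dl (u # us) ns f = dl us (tl ns) (D (of_int (hd ns) * u) f)"

definition L :: "nat \<Rightarrow> int list set" where
  "L s = {ns. set ns \<subseteq> Fp p \<and> length ns = s}"

text \<open>For nonempty \<open>us\<close>, this is the \<open>2\<^sup>s\<close>-th power of the box norm along the directions \<open>us\<close>.\<close>

definition bx :: "'v list \<Rightarrow> ('x \<Rightarrow> complex) \<Rightarrow> complex" where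
  "bx us f = avg (L (length us)) (\<lambda>ns. avg X (dl us ns f))"

lemma L_0: "L 0 = {[]}"
  by (auto simp: L_def)

lemma L_finite: "finite (L s)"
  unfolding L_def by (rule finite_lists_length_eq) simp

lemma L_ne: "L s \<noteq> {}"
proof -
  have "replicate s 0 \<in> L s" using p_pos by (auto simp: L_def Fp_def)
  then show ?thesis by blast
qed

lemma avg_L_0 [simp]: "avg (L 0) \<Phi> = \<Phi> []"
  by (simp add: L_0 avg_def)

lemma avg_L_Suc: "avg (L (Suc s)) \<Phi> = avg (Fp p) (\<lambda>n. avg (L s) (\<lambda>ns. \<Phi> (n # ns)))"
proof -
  have "bij_betw (\<lambda>(n, ns). n # ns) (Fp p \<times> L s) (L (Suc s))"
    unfolding bij_betw_def
    by (auto simp: L_def inj_on_def image_iff length_Suc_conv)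
  from avg_bij[OF this, of \<Phi>] show ?thesis by (simp add: case_prod_beta avg_Times)
qed

lemma bx_Nil [simp]: "bx [] f = avg X f"
  by (simp add: bx_def)

lemma bx_Cons: "bx (u # us) f = avg (Fp p) (\<lambda>n. bx us (D (of_int n * u) f))"
  by (simp add: bx_def avg_L_Suc)

lemma bd_act: "bd f \<Longrightarrow> bd (\<lambda>x. f (act a x))"
  by (simp add: bd_def)

lemma bd_A: "bd f \<Longrightarrow> bd (A u f)"
  unfolding A_def[abs_def] by (intro bd_avg bd_act)

lemma bd_D: "bd f \<Longrightarrow> bd (D a f)"
  unfolding D_def[abs_def] by (intro bd_mult bd_act bd_cnj)

lemma bd_dl: "bd f \<Longrightarrow> bd (dl us ns f)"
  by (induction us arbitrary: ns f) (auto intro: bd_D)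

lemma D_mult: "D a (\<lambda>x. f x * g x) = (\<lambda>x. D a f x * D a g x)"
  by (simp add: D_def fun_eq_iff)

lemma D_cnj: "D a (\<lambda>x. cnj (f x)) = (\<lambda>x. cnj (D a f x))"
  by (simp add: D_def fun_eq_iff)

lemma D_act: "D a (\<lambda>x. f (act b x)) = (\<lambda>x. D a f (act b x))"
  by (simp add: D_def fun_eq_iff act_comm)

lemma D_comm: "D a (D b f) = D b (D a f)"
  by (simp add: D_def fun_eq_iff act_comm algebra_simps)

lemma dl_mult: "dl us ns (\<lambda>x. f x * g x) = (\<lambda>x. dl us ns f x * dl us ns g x)"
  by (induction us arbitrary: ns f g) (simp_all add: D_mult)

lemma dl_cnj: "dl us ns (\<lambda>x. cnj (f x)) = (\<lambda>x. cnj (dl us ns f x))"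
  by (induction us arbitrary: ns f) (simp_all add: D_cnj)

lemma dl_act: "dl us ns (\<lambda>x. f (act a x)) = (\<lambda>x. dl us ns f (act a x))"
  by (induction us arbitrary: ns f) (simp_all add: D_act)

lemma dl_D: "dl us ns (D a f) = D a (dl us ns f)"
  unfolding D_def[abs_def] by (simp add: dl_mult dl_cnj dl_act)

lemma bx_append: "bx (us @ vs) f = avg (L (length us)) (\<lambda>ns. bx vs (dl us ns f))"
  by (induction us arbitrary: f) (simp_all add: bx_Cons avg_L_Suc)

lemma bx_cnj: "bx us (\<lambda>x. cnj (f x)) = cnj (bx us f)"
  by (simp add: bx_def dl_cnj avg_cnj)

lemma bx_swap: "bx (a # b # us) f = bx (b # a # us) f"
  unfolding bx_Cons by (subst avg_swap) (simp add: D_comm)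

lemma bx_move: "bx (us @ u # vs) f = bx (u # us @ vs) f"
proof (induction us arbitrary: f)
  case (Cons a us)
  have "bx ((a # us) @ u # vs) f = bx (a # u # us @ vs) f"
    using Cons by (simp add: bx_Cons)
  then show ?case by (simp add: bx_swap)
qed simp

text \<open>Van der Corput on each line in direction \<open>u\<close> turns the averaged derivative
  into the square of the line average.\<close>

lemma bx_single: "bx [u] g = of_real (ravg X (\<lambda>x. (cmod (A u g x))\<^sup>2))"
proof -
  have "of_real (ravg X (\<lambda>x. (cmod (A u g x))\<^sup>2)) =
      avg X (\<lambda>x. avg (Fp p) (\<lambda>h. avg (Fp p) (\<lambda>y. g (act (of_int (y + h) * u) x) * cnj (g (act (of_int y * u) x)))))"
    by (simp only: avg_of_real[symmetric] A_def van_der_corput[OF p_pos per_act])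
  also have "\<dots> = avg (Fp p) (\<lambda>h. avg (Fp p) (\<lambda>y. avg X (\<lambda>x. D (of_int h * u) g (act (of_int y * u) x))))"
    by (simp only: avg_swap3[of "Fp p" "Fp p" X]) (intro avg_cong, simp add: D_def act_add[symmetric] algebra_simps)
  also have "\<dots> = bx [u] g" by (simp add: E_shift bx_Cons avg_const Fp_ne)
  finally show ?thesis by simp
qed

lemma bx_snoc: "bx (us @ [u]) f =
    of_real (ravg (L (length us)) (\<lambda>ns. ravg X (\<lambda>x. (cmod (A u (dl us ns f) x))\<^sup>2)))"
  by (simp add: bx_append bx_single avg_of_real)

text \<open>Splitting off the last direction gives an average of squares (\<open>bx_snoc\<close>);
  with no direction the value is a plain mean.\<close>

lemma bx_nonneg: assumes "us \<noteq> []" shows "bx us f = of_real (cmod (bx us f))"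
proof -
  obtain vs u where "us = vs @ [u]" using assms by (metis rev_exhaust)
  moreover have "0 \<le> ravg (L (length vs)) (\<lambda>ns. ravg X (\<lambda>x. (cmod (A u (dl vs ns f) x))\<^sup>2))"
    by (intro ravg_nonneg) auto
  ultimately show ?thesis by (simp add: bx_snoc)
qed

text \<open>Multiplying the parameter by a unit permutes F_p, so only the line spanned by a
  direction matters.\<close>

lemma bx_scale:
  assumes "of_nat p dvd u - of_int c * v" "\<not> int p dvd c"
  shows "bx (u # us) f = bx (v # us) f"
proof -
  have "D (of_int n * u) f = D (of_int (c * n) * v) f" for n
  proof -
    have "of_nat p dvd of_int n * (u - of_int c * v)" using assms(1) by (rule dvd_mult)
    then have "act (of_int n * u) x = act (of_int (c * n) * v) x" for x
      by (intro act_cong) (simp add: algebra_simps)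
    then show ?thesis by (simp add: D_def fun_eq_iff)
  qed
  moreover have "per p (\<lambda>n. bx us (D (of_int n * v) f))"
    by (simp add: per_def D_def[abs_def] act_per del: of_int_add)
  ultimately show ?thesis
    using avg_Fp_scale[OF prime_p _ assms(2), of "\<lambda>n. bx us (D (of_int n * v) f)"]
    by (simp add: bx_Cons)
qed

text \<open>The mean over \<open>X\<close> does not change when a derivative is first averaged along
  \<open>u\<close>; then Cauchy--Schwarz applies.\<close>

lemma bx_pad: "(cmod (bx us f))\<^sup>2 \<le> cmod (bx (us @ [u]) f)"
proof -
  have "cmod (avg X (dl us ns f)) ^ 2 \<le> ravg X (\<lambda>x. (cmod (A u (dl us ns f) x))\<^sup>2)" for ns
  proof -
    have "avg X (dl us ns f) = avg X (\<lambda>x. 1 * A u (dl us ns f) x)"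
      unfolding A_def by (simp add: avg_swap[of X] E_shift avg_const Fp_ne)
    then show ?thesis using avg_cauchy_schwarz[of X "\<lambda>_. 1" "A u (dl us ns f)"] by simp
  qed
  then have "(cmod (bx us f))\<^sup>2 \<le> ravg (L (length us)) (\<lambda>ns. ravg X (\<lambda>x. (cmod (A u (dl us ns f) x))\<^sup>2))"
    unfolding bx_def using norm_avg_power[of "L (length us)" "\<lambda>ns. avg X (dl us ns f)" 1]
    by (simp, elim order_trans) (intro ravg_mono, simp)
  then show ?thesis by (simp add: bx_snoc ravg_nonneg)
qed

lemma bx_pad_replicate:
  "cmod (bx us f) ^ (2 ^ j) \<le> cmod (bx (us @ replicate j u) f)"
proof (induction j)
  case (Suc j)
  have "cmod (bx us f) ^ (2 ^ Suc j) = (cmod (bx us f) ^ (2 ^ j))\<^sup>2"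
    by (simp add: power_mult mult.commute flip: power_mult)
  also have "\<dots> \<le> (cmod (bx (us @ replicate j u) f))\<^sup>2" using Suc by (intro power_mono) auto
  also have "\<dots> \<le> cmod (bx (us @ replicate (Suc j) u) f)"
    using bx_pad[of "us @ replicate j u" f u] by (simp add: replicate_append_same)
  finally show ?case .
qed simp

text \<open>The difference of two independent uniform residues is uniform. It may lie outside 0,
  ..., p - 1, so periodicity in the parameters is used.\<close>

lemma bx_diff_lists:
  "avg (L (length us)) (\<lambda>ns. avg (L (length us)) (\<lambda>ms. B (dl us (map2 (-) ns ms) f))) =
   avg (L (length us)) (\<lambda>ns. B (dl us ns f))"
proof (induction us arbitrary: f)
  case (Cons u us)
  let ?G = "\<lambda>n. avg (L (length us)) (\<lambda>ns. B (dl us ns (D (of_int n * u) f)))"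
  have per: "per p ?G" by (simp add: per_def D_def[abs_def] act_per del: of_int_add)
  have "avg (L (length (u # us))) (\<lambda>ns. avg (L (length (u # us))) (\<lambda>ms. B (dl (u # us) (map2 (-) ns ms) f))) =
    avg (Fp p) (\<lambda>n. avg (Fp p) (\<lambda>m. avg (L (length us)) (\<lambda>ns. avg (L (length us)) (\<lambda>ms.
       B (dl us (map2 (-) ns ms) (D (of_int (n - m) * u) f))))))"
    by (simp add: avg_L_Suc avg_swap[of "L (length us)" "Fp p"] del: of_int_diff)
  also have "\<dots> = avg (Fp p) ?G"
    using avg_Fp_diff[OF p_pos per] by (simp add: Cons.IH del: of_int_diff)
  finally show ?case by (simp add: avg_L_Suc)
qed simp

text \<open>The factor that \<open>interchange\<close> produces from \<chi>: a product over the
  vertices of a cube, where each vertex takes every parameter from \<open>ns\<close> or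
  \<open>ms\<close> and is conjugated once for each choice from \<open>ms\<close>. The translations
  come from the change of variables that moves the derivative of F back to \<open>x\<close>.\<close>

primrec Xc :: "'v list \<Rightarrow> (int list \<Rightarrow> 'x \<Rightarrow> complex) \<Rightarrow> int list \<Rightarrow> int list \<Rightarrow> 'x \<Rightarrow> complex" where
  "Xc [] \<chi> ns ms x = \<chi> [] x"
| "Xc (u # us) \<chi> ns ms x =
    Xc us (\<lambda>ls. \<chi> (hd ns # ls)) (tl ns) (tl ms) (act (- (of_int (hd ms) * u)) x) *
    cnj (Xc us (\<lambda>ls. \<chi> (hd ms # ls)) (tl ns) (tl ms) (act (- (of_int (hd ms) * u)) x))"

lemma bd_Xc: "(\<And>ns. bd (\<chi> ns)) \<Longrightarrow> bd (Xc us \<chi> ns ms)"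
proof (induction us arbitrary: \<chi> ns ms)
  case (Cons u us)
  then have "bd (\<lambda>x. Xc us (\<lambda>ls. \<chi> (hd ns # ls)) (tl ns) (tl ms) x *
    cnj (Xc us (\<lambda>ls. \<chi> (hd ms # ls)) (tl ns) (tl ms) x))"
    by (intro bd_mult bd_cnj) auto
  from bd_act[OF this] show ?case by (simp add: bd_def)
qed (simp add: bd_def)

definition ich :: "'z set \<Rightarrow> 'v list \<Rightarrow> (int list \<Rightarrow> 'x \<Rightarrow> complex) \<Rightarrow> ('z \<Rightarrow> 'x \<Rightarrow> complex) \<Rightarrow> complex" where
  "ich Z us \<chi> F = avg (L (length us)) (\<lambda>ns. avg (L (length us)) (\<lambda>ms. avg Z (\<lambda>z.
     avg X (\<lambda>x. Xc us \<chi> ns ms x * dl us (map2 (-) ns ms) (F z) x))))"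

text \<open>Expanding the square in \<open>n\<close> and \<open>m\<close> and translating
  \<open>x\<close> by - m u produces the recursion of \<open>Xc\<close> together with one more
  derivative.\<close>

lemma ich_Cons: "ich Z (u # us) \<chi> F = of_real (
   ravg (L (length us)) (\<lambda>ns. ravg (L (length us)) (\<lambda>ms. ravg Z (\<lambda>z. ravg X (\<lambda>x.
     (cmod (avg (Fp p) (\<lambda>n. Xc us (\<lambda>ls. \<chi> (n # ls)) ns ms x *
        dl us (map2 (-) ns ms) (F z) (act (of_int n * u) x))))\<^sup>2)))))" (is "_ = of_real ?R")
proof -
  let ?l = "length us"
  let ?c = "\<lambda>ns ms z x n. Xc us (\<lambda>ls. \<chi> (n # ls)) ns ms x * dl us (map2 (-) ns ms) (F z) (act (of_int n * u) x)"
  have sh: "avg X (\<lambda>x. ?c ns ms z x n * cnj (?c ns ms z x m)) =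
      avg X (\<lambda>x. Xc (u # us) \<chi> (n # ns) (m # ms) x * dl (u # us) (map2 (-) (n # ns) (m # ms)) (F z) x)"
    for ns ms z n m
  proof (rule E_shift_cong[of _ "- (of_int m * u)"])
    fix x
    have "act (of_int n * u) (act (- (of_int m * u)) x) = act (of_int (n - m) * u) x"
      by (simp add: act_add[symmetric] algebra_simps)
    then show "?c ns ms z (act (- (of_int m * u)) x) n * cnj (?c ns ms z (act (- (of_int m * u)) x) m) =
      Xc (u # us) \<chi> (n # ns) (m # ms) x * dl (u # us) (map2 (-) (n # ns) (m # ms)) (F z) x"
      by (simp add: dl_D D_def del: of_int_diff)
  qed
  have "of_real ?R = avg (L ?l) (\<lambda>ns. avg (L ?l) (\<lambda>ms. avg Z (\<lambda>z. avg X (\<lambda>x.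
      avg (Fp p) (\<lambda>n. avg (Fp p) (\<lambda>m. ?c ns ms z x n * cnj (?c ns ms z x m)))))))"
    by (simp only: avg_of_real[symmetric] norm_avg_square)
  also have "\<dots> = avg (Fp p) (\<lambda>n. avg (Fp p) (\<lambda>m. avg (L ?l) (\<lambda>ns. avg (L ?l) (\<lambda>ms. avg Z (\<lambda>z. avg X (\<lambda>x.
      ?c ns ms z x n * cnj (?c ns ms z x m)))))))"
    by (simp only: avg_swap3[of "Fp p" "Fp p"])
  also have "\<dots> = avg (Fp p) (\<lambda>n. avg (L ?l) (\<lambda>ns. avg (Fp p) (\<lambda>m. avg (L ?l) (\<lambda>ms. avg Z (\<lambda>z. avg X (\<lambda>x.
      ?c ns ms z x n * cnj (?c ns ms z x m)))))))"
    by (intro avg_cong avg_swap)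
  also have "\<dots> = ich Z (u # us) \<chi> F"
    unfolding ich_def length_Cons avg_L_Suc sh ..
  finally show ?thesis by simp
qed

text \<open>A single parameter \<open>z\<close> replaces one parameter for each vertex of the cube.\<close>

lemma interchange:
  assumes "\<And>z. z \<in> Z \<Longrightarrow> bd (F z)" "\<And>ns. bd (\<chi> ns)" "\<And>x. F0 x = avg Z (\<lambda>z. F z x)"
  shows "cmod (avg (L (length us)) (\<lambda>ns. avg X (\<lambda>x. \<chi> ns x * dl us ns F0 x))) ^ (2 ^ length us)
    \<le> cmod (ich Z us \<chi> F)"
  using assms
proof (induction us arbitrary: F F0 \<chi>)
  case Nil
  have "avg X (\<lambda>x. \<chi> [] x * F0 x) = avg Z (\<lambda>z. avg X (\<lambda>x. \<chi> [] x * F z x))"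
    by (subst avg_swap) (simp add: Nil avg_cmult)
  then show ?case by (simp add: ich_def)
next
  case (Cons u us)
  let ?l = "length us"
  define a where "a n = avg (L ?l) (\<lambda>ns. avg X (\<lambda>x. \<chi> (n # ns) x * dl us ns (D (of_int n * u) F0) x))" for n
  \<comment> \<open>Only one of the two copies of \<open>F0\<close> in the derivative is expanded as
    an average; keeping the other one intact is what makes a single \<open>z\<close>
    suffice.\<close>
  define F' where "F' n z x = F z (act (of_int n * u) x) * cnj (F0 x)" for n z x
  define b where "b n = ich Z us (\<lambda>ls. \<chi> (n # ls)) (F' n)" for n
  have bdF0: "bd F0" using bd_avg[of Z F] Cons.prems by (simp add: bd_def)
  have DF0: "D (of_int n * u) F0 x = avg Z (\<lambda>z. F' n z x)" for n x
    using Cons.prems(3) by (simp add: D_def F'_def avg_multc)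
  have bdF': "bd (F' n z)" if "z \<in> Z" for n z
    unfolding F'_def[abs_def] using Cons.prems(1)[OF that] bdF0 by (intro bd_mult bd_act bd_cnj)
  have ab: "cmod (a n) ^ (2 ^ ?l) \<le> cmod (b n)" for n
    unfolding a_def b_def by (intro Cons.IH bdF' DF0) (auto intro: Cons.prems)
  have main: "cmod (avg (Fp p) a) ^ (2 ^ ?l) \<le> cmod (avg (Fp p) b)"
  \<comment> \<open>Without further directions \<open>b n\<close> need not be a nonnegative real,
    but then the exponent 2^0 is 1 and the two sides agree. Otherwise nonnegativity allows the
    absolute values to be averaged.\<close>
  proof (cases us)
    case Nil
    have "a n = b n" for n
    proof -
      have "avg X (\<lambda>x. \<chi> [n] x * D (of_int n * u) F0 x) = avg Z (\<lambda>z. avg X (\<lambda>x. \<chi> [n] x * F' n z x))"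
        by (subst avg_swap) (simp add: DF0 avg_cmult)
      then show ?thesis using Nil by (simp add: a_def b_def ich_def)
    qed
    then have "a = b" by blast
    then show ?thesis using Nil by simp
  next
    case (Cons u' us')
    have b: "b n = of_real (cmod (b n))" for n
    proof -
      obtain r where "b n = of_real r" "0 \<le> r" unfolding b_def Cons ich_Cons
        using ravg_nonneg by (metis (no_types, lifting) zero_le_power2)
      then show ?thesis by simp
    qed
    have "cmod (avg (Fp p) a) ^ (2 ^ ?l) \<le> ravg (Fp p) (\<lambda>n. cmod (a n) ^ (2 ^ ?l))"
      by (rule norm_avg_power)
    also have "\<dots> \<le> ravg (Fp p) (\<lambda>n. cmod (b n))" by (intro ravg_mono ab)
    also have "\<dots> = cmod (of_real (ravg (Fp p) (\<lambda>n. cmod (b n))) :: complex)"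
      by (simp add: ravg_nonneg)
    also have "\<dots> = cmod (avg (Fp p) b)" unfolding avg_of_real[symmetric] by (simp flip: b)
    finally show ?thesis .
  qed
  have lhs: "avg (L (length (u # us))) (\<lambda>ns. avg X (\<lambda>x. \<chi> ns x * dl (u # us) ns F0 x)) = avg (Fp p) a"
    by (simp add: avg_L_Suc a_def[abs_def])
  let ?c = "\<lambda>ns ms z x n. Xc us (\<lambda>ls. \<chi> (n # ls)) ns ms x * dl us (map2 (-) ns ms) (F z) (act (of_int n * u) x)"
  \<comment> \<open>The derivative of the kept copy does not involve \<open>n\<close>, so
    Cauchy--Schwarz removes it and squares the average over \<open>n\<close>.\<close>
  let ?g = "\<lambda>ns ms x. cnj (dl us (map2 (-) ns ms) F0 x)"
  have "avg (Fp p) b = avg (Fp p) (\<lambda>n. avg (L ?l) (\<lambda>ns. avg (L ?l) (\<lambda>ms. avg Z (\<lambda>z. avg X (\<lambda>x.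
      ?g ns ms x * ?c ns ms z x n)))))"
    unfolding b_def ich_def F'_def[abs_def]
    by (intro avg_cong) (simp add: dl_mult dl_cnj dl_act algebra_simps)
  also have "\<dots> = avg (L ?l) (\<lambda>ns. avg (L ?l) (\<lambda>ms. avg Z (\<lambda>z. avg X (\<lambda>x. avg (Fp p) (\<lambda>n.
      ?g ns ms x * ?c ns ms z x n)))))"
    unfolding avg_swap[of "Fp p"] ..
  also have "\<dots> = avg (L ?l) (\<lambda>ns. avg (L ?l) (\<lambda>ms. avg Z (\<lambda>z. avg X (\<lambda>x.
      ?g ns ms x * avg (Fp p) (\<lambda>n. ?c ns ms z x n)))))"
    by (simp only: avg_cmult)
  finally have b2: "avg (Fp p) b = \<dots>" .
  have "(cmod (avg (Fp p) b))\<^sup>2 \<le> ravg (L ?l) (\<lambda>ns. ravg (L ?l) (\<lambda>ms. ravg Z (\<lambda>z. ravg X (\<lambda>x.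
     (cmod (avg (Fp p) (\<lambda>n. ?c ns ms z x n)))\<^sup>2))))"
    unfolding b2
    apply (rule order_trans[OF norm_avg_power[where n = 1, simplified]], rule ravg_mono)
    apply (rule order_trans[OF norm_avg_power[where n = 1, simplified]], rule ravg_mono)
    apply (rule order_trans[OF norm_avg_power[where n = 1, simplified]], rule ravg_mono)
    apply (rule avg_cauchy_schwarz)
    using bd_dl[OF bdF0] by (simp add: bd_def)
  also have "\<dots> = cmod (ich Z (u # us) \<chi> F)"
    unfolding ich_Cons by (simp add: ravg_nonneg)
  finally have fin2: "(cmod (avg (Fp p) b))\<^sup>2 \<le> cmod (ich Z (u # us) \<chi> F)" .
  have "cmod (avg (Fp p) a) ^ (2 ^ length (u # us)) = (cmod (avg (Fp p) a) ^ (2 ^ ?l))\<^sup>2"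
    by (simp add: power_mult mult.commute flip: power_mult)
  also have "\<dots> \<le> (cmod (avg (Fp p) b))\<^sup>2" using main by (intro power_mono) auto
  finally show ?case using fin2 unfolding lhs by linarith
qed

end

section \<open>Eigenfunctions and degree lowering\<close>

context zact
begin

definition invar :: "'v list \<Rightarrow> ('x \<Rightarrow> 'c) \<Rightarrow> bool" where
  "invar us f \<longleftrightarrow> (\<forall>u\<in>set us. \<forall>x n. f (act (of_int n * u) x) = f x)"

definition eig :: "'v \<Rightarrow> ('x \<Rightarrow> int) \<Rightarrow> ('x \<Rightarrow> complex) \<Rightarrow> bool" where
  "eig v \<psi> \<chi> \<longleftrightarrow> (\<forall>x n. \<chi> (act (of_int n * v) x) = e_p p (n * \<psi> x) * \<chi> x)"

definition fh :: "'v \<Rightarrow> ('x \<Rightarrow> complex) \<Rightarrow> 'x \<Rightarrow> int \<Rightarrow> complex" where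
  "fh v G x \<xi> = ft p (\<lambda>n. G (act (of_int n * v) x)) \<xi>"

text \<open>The choice depends on \<open>x\<close> only through the absolute values of the
  coefficients. These are constant along the orbit, hence so is the chosen frequency
  (\<open>mx_invar_self\<close>).\<close>

definition mx :: "'v \<Rightarrow> ('x \<Rightarrow> complex) \<Rightarrow> 'x \<Rightarrow> int" where
  "mx v G x = (SOME \<xi>. \<xi> \<in> Fp p \<and> (\<forall>\<zeta>\<in>Fp p. cmod (fh v G x \<zeta>) \<le> cmod (fh v G x \<xi>)))"

lemma mx: "mx v G x \<in> Fp p" "\<zeta> \<in> Fp p \<Longrightarrow> cmod (fh v G x \<zeta>) \<le> cmod (fh v G x (mx v G x))"
proof -
  let ?f = "\<lambda>\<xi>. cmod (fh v G x \<xi>)"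
  have "Max (?f ` Fp p) \<in> ?f ` Fp p" using Fp_ne by (intro Max_in) auto
  then obtain \<xi> where "\<xi> \<in> Fp p" "?f \<xi> = Max (?f ` Fp p)" by auto
  then have "\<exists>\<xi>. \<xi> \<in> Fp p \<and> (\<forall>\<zeta>\<in>Fp p. ?f \<zeta> \<le> ?f \<xi>)" by (intro exI[of _ \<xi>]) auto
  from someI_ex[OF this] show "mx v G x \<in> Fp p" "\<zeta> \<in> Fp p \<Longrightarrow> ?f \<zeta> \<le> ?f (mx v G x)"
    unfolding mx_def by auto
qed

lemma fh_act: "fh v G (act (of_int m * v) x) \<xi> = e_p p (m * \<xi>) * fh v G x \<xi>"
proof -
  let ?K = "\<lambda>n. G (act (of_int n * v) x) * e_p p (- ((n - m) * \<xi>))"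
  have "per p ?K" using p_pos
    by (auto simp: per_def act_per simp del: of_int_add intro!: e_p_cong) (simp add: algebra_simps)
  then have "avg (Fp p) (\<lambda>n. ?K (n + m)) = avg (Fp p) ?K" by (rule avg_Fp_shift[OF p_pos])
  moreover have "avg (Fp p) (\<lambda>n. ?K (n + m)) = fh v G (act (of_int m * v) x) \<xi>"
    by (simp add: fh_def ft_def act_add[symmetric] algebra_simps)
  moreover have "avg (Fp p) ?K = avg (Fp p) (\<lambda>n. e_p p (m * \<xi>) * (G (act (of_int n * v) x) * e_p p (- (n * \<xi>))))"
    by (intro avg_cong) (simp add: algebra_simps flip: e_p_add)
  ultimately show ?thesis by (simp add: avg_cmult fh_def ft_def)
qed

lemma fh_cong: "int p dvd \<xi> - \<zeta> \<Longrightarrow> fh v G x \<xi> = fh v G x \<zeta>"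
proof -
  assume "int p dvd \<xi> - \<zeta>"
  then have "int p dvd - n * (\<xi> - \<zeta>)" for n by (rule dvd_mult)
  moreover have "- n * (\<xi> - \<zeta>) = - (n * \<xi>) - - (n * \<zeta>)" for n by (simp add: algebra_simps)
  ultimately have "e_p p (- (n * \<xi>)) = e_p p (- (n * \<zeta>))" for n
    by (metis e_p_cong[OF p_pos])
  then show ?thesis unfolding fh_def ft_def by simp
qed

lemma norm_fh: "bd G \<Longrightarrow> cmod (fh v G x \<xi>) \<le> 1"
  unfolding fh_def ft_def by (rule norm_avg_le_bound) (auto simp: norm_mult bd_def)

lemma fh_invar: "invar us G \<Longrightarrow> u \<in> set us \<Longrightarrow> fh v G (act (of_int n * u) x) = fh v G x"
  by (rule ext) (simp add: fh_def invar_def act_comm[of "of_int _ * v"])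

lemma mx_invar: "invar us G \<Longrightarrow> invar us (mx v G)"
  using fh_invar by (fastforce simp: invar_def mx_def)

lemma mx_invar_self: "invar [v] (mx v G)"
  by (simp add: invar_def mx_def fh_act norm_mult)

lemma norm_fh_sq: "of_real ((cmod (fh v G x \<xi>))\<^sup>2) =
  avg (Fp p) (\<lambda>h. avg (Fp p) (\<lambda>y. e_p p (- (h * \<xi>)) * D (of_int h * v) G (act (of_int y * v) x)))"
proof -
  let ?K = "\<lambda>n. G (act (of_int n * v) x) * e_p p (- (n * \<xi>))"
  have "per p ?K" using p_pos
    by (auto simp: per_def act_per simp del: of_int_add intro!: e_p_cong) (simp add: algebra_simps)
  from van_der_corput[OF p_pos this]
  have "of_real ((cmod (fh v G x \<xi>))\<^sup>2) = avg (Fp p) (\<lambda>h. avg (Fp p) (\<lambda>y. ?K (y + h) * cnj (?K y)))"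
    unfolding fh_def ft_def .
  moreover have "?K (y + h) * cnj (?K y) = e_p p (- (h * \<xi>)) * D (of_int h * v) G (act (of_int y * v) x)" for y h
  proof -
    have "e_p p (- ((y + h) * \<xi>)) * e_p p (y * \<xi>) = e_p p (- (h * \<xi>))"
      by (simp add: algebra_simps flip: e_p_add)
    moreover have "act (of_int (y + h) * v) x = act (of_int h * v) (act (of_int y * v) x)"
      by (simp add: act_add[symmetric] algebra_simps)
    ultimately show ?thesis by (simp add: D_def cnj_e_p del: of_int_add)
  qed
  ultimately show ?thesis by simp
qed

lemma fh_sq_avg:
  assumes "invar [v] \<rho>"
  shows "of_real (ravg X (\<lambda>x. (cmod (fh v G x (\<rho> x)))\<^sup>2)) =
    avg (Fp p) (\<lambda>m. avg X (\<lambda>x. e_p p (- (m * \<rho> x)) * D (of_int m * v) G x))"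
proof -
  have "of_real (ravg X (\<lambda>x. (cmod (fh v G x (\<rho> x)))\<^sup>2)) =
     avg (Fp p) (\<lambda>h. avg (Fp p) (\<lambda>y. avg X (\<lambda>x.
       e_p p (- (h * \<rho> (act (of_int y * v) x))) * D (of_int h * v) G (act (of_int y * v) x))))"
    unfolding avg_of_real[symmetric] norm_fh_sq avg_swap3[of "Fp p" "Fp p" X]
    using assms by (simp add: invar_def)
  also have "\<dots> = avg (Fp p) (\<lambda>m. avg X (\<lambda>x. e_p p (- (m * \<rho> x)) * D (of_int m * v) G x))"
    by (simp add: E_shift[of "\<lambda>x. e_p p (- (_ * \<rho> x)) * D _ G x"] avg_const Fp_ne)
  finally show ?thesis .
qed

text \<open>The conjugate coefficient is an eigenfunction along \<open>v\<close>, so averaging its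
  product with \<open>G\<close> over an orbit reproduces the coefficient itself. The invariant
  cutoff \<open>b\<close> permits a restriction to large coefficients.\<close>

lemma fh_corr:
  assumes "invar [v] \<rho>" "invar [v] b"
  shows "avg X (\<lambda>x. (if b x then cnj (fh v G x (\<rho> x)) else 0) * G x) =
    of_real (ravg X (\<lambda>x. if b x then (cmod (fh v G x (\<rho> x)))\<^sup>2 else 0))"
proof -
  define \<chi> where "\<chi> x = (if b x then cnj (fh v G x (\<rho> x)) else 0)" for x
  have \<chi>: "\<chi> (act (of_int n * v) x) = e_p p (- (n * \<rho> x)) * \<chi> x" for n x
    using assms by (simp add: \<chi>_def invar_def fh_act cnj_e_p)
  have "of_real (ravg X (\<lambda>x. if b x then (cmod (fh v G x (\<rho> x)))\<^sup>2 else 0)) =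
      avg X (\<lambda>x. fh v G x (\<rho> x) * \<chi> x)"
    unfolding avg_of_real[symmetric] using complex_norm_square by (intro avg_cong) (auto simp: \<chi>_def)
  also have "\<dots> = avg X (\<lambda>x. avg (Fp p) (\<lambda>n. \<chi> (act (of_int n * v) x) * G (act (of_int n * v) x)))"
    unfolding fh_def ft_def avg_multc[symmetric] \<chi> by (simp only: mult_ac)
  also have "\<dots> = avg X (\<lambda>x. \<chi> x * G x)"
    by (subst avg_swap) (simp add: E_shift[of "\<lambda>x. \<chi> x * G x"] avg_const Fp_ne)
  finally show ?thesis unfolding \<chi>_def by simp
qed

text \<open>On one orbit the line averages of derivatives form the autocorrelation of
  \<open>G\<close>, whose Fourier transform is |fh|^2. By Parseval the norm is a sum of fourth
  powers: two of the four factors are bounded by the maximum, the other two are summed by Parseval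
  again.\<close>

lemma U2_inverse:
  assumes "bd G"
  shows "cmod (bx [v, v] G) \<le> ravg X (\<lambda>x. (cmod (fh v G x (mx v G x)))\<^sup>2)"
proof -
  have *: "ravg (Fp p) (\<lambda>n. (cmod (A v (D (of_int n * v) G) x))\<^sup>2) \<le> (cmod (fh v G x (mx v G x)))\<^sup>2" for x
  proof -
    let ?c = "\<lambda>n. A v (D (of_int n * v) G) x"
    let ?g = "\<lambda>n. G (act (of_int n * v) x)"
    have ft: "ft p ?c \<xi> = of_real ((cmod (fh v G x \<xi>))\<^sup>2)" for \<xi>
      unfolding ft_def norm_fh_sq A_def by (simp add: avg_cmult mult.commute)
    have "ravg (Fp p) (\<lambda>n. (cmod (?c n))\<^sup>2) = (\<Sum>\<xi>\<in>Fp p. (cmod (fh v G x \<xi>))\<^sup>2 * (cmod (fh v G x \<xi>))\<^sup>2)"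
      unfolding parseval[OF p_pos, symmetric] ft by (simp add: power2_eq_square norm_mult)
    also have "\<dots> \<le> (\<Sum>\<xi>\<in>Fp p. (cmod (fh v G x (mx v G x)))\<^sup>2 * (cmod (fh v G x \<xi>))\<^sup>2)"
      using mx(2) by (intro sum_mono mult_right_mono power_mono) auto
    also have "\<dots> = (cmod (fh v G x (mx v G x)))\<^sup>2 * ravg (Fp p) (\<lambda>n. (cmod (?g n))\<^sup>2)"
      unfolding sum_distrib_left[symmetric] fh_def parseval[OF p_pos] ..
    also have "\<dots> \<le> (cmod (fh v G x (mx v G x)))\<^sup>2 * 1"
      using assms Fp_ne by (intro mult_left_mono ravg_le) (auto simp: bd_def abs_square_le_1)
    finally show ?thesis by simp
  qed
  have "bx [v, v] G = of_real (ravg (Fp p) (\<lambda>n. ravg X (\<lambda>x. (cmod (A v (D (of_int n * v) G) x))\<^sup>2)))"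
    unfolding bx_Cons[of v "[v]"] bx_single by (simp add: avg_of_real)
  then have "cmod (bx [v, v] G) = ravg X (\<lambda>x. ravg (Fp p) (\<lambda>n. (cmod (A v (D (of_int n * v) G) x))\<^sup>2))"
    by (simp add: ravg_nonneg ravg_swap[of X])
  also have "\<dots> \<le> ravg X (\<lambda>x. (cmod (fh v G x (mx v G x)))\<^sup>2)" by (intro ravg_mono *)
  finally show ?thesis .
qed

text \<open>The eigenfunction is the conjugate of the largest coefficient. The coefficient at
  frequency 0 is the orbit average of \<open>H\<close>, which vanishes, so frequency 0 cannot occur
  where the eigenfunction is nonzero.\<close>

lemma U2_mean_zero:
  assumes "bd H" "\<And>x. A v H x = 0" "\<eta> \<le> cmod (bx [v, v] H)"
  obtains \<chi> \<psi> where "bd \<chi>" "eig v \<psi> \<chi>" "\<And>x. \<chi> x \<noteq> 0 \<Longrightarrow> \<not> int p dvd \<psi> x"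
    "\<And>us. invar us H \<Longrightarrow> invar us \<chi>" "\<eta> \<le> cmod (avg X (\<lambda>x. \<chi> x * H x))"
proof
  let ?\<chi> = "\<lambda>x. cnj (fh v H x (mx v H x))"
  show "bd ?\<chi>" using norm_fh[OF assms(1)] by (simp add: bd_def)
  show "eig v (\<lambda>x. - mx v H x) ?\<chi>"
    using mx_invar_self[of v H] by (simp add: eig_def invar_def fh_act cnj_e_p)
  show "\<not> int p dvd - mx v H x" if "?\<chi> x \<noteq> 0" for x
  proof
    assume "int p dvd - mx v H x"
    then have "fh v H x (mx v H x) = fh v H x 0" by (intro fh_cong) simp
    also have "\<dots> = 0" using assms(2)[of x] by (simp add: fh_def ft_def A_def)
    finally show False using that by simp
  qed
  show "invar us ?\<chi>" if "invar us H" for us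
    using fh_invar[OF that] mx_invar[OF that, of v] by (simp add: invar_def)
  have "avg X (\<lambda>x. ?\<chi> x * H x) = of_real (ravg X (\<lambda>x. (cmod (fh v H x (mx v H x)))\<^sup>2))"
    using fh_corr[OF mx_invar_self, of v "\<lambda>_. True" H] by (simp add: invar_def)
  then have "cmod (avg X (\<lambda>x. ?\<chi> x * H x)) = ravg X (\<lambda>x. (cmod (fh v H x (mx v H x)))\<^sup>2)"
    by (simp add: ravg_nonneg)
  then show "\<eta> \<le> cmod (avg X (\<lambda>x. ?\<chi> x * H x))"
    using U2_inverse[OF assms(1), of v] assms(3) by linarith
qed

section \<open>Alternating sums of frequencies over cubes, and degree lowering\<close>

primrec Ps :: "nat \<Rightarrow> (int list \<Rightarrow> 'x \<Rightarrow> int) \<Rightarrow> int list \<Rightarrow> int list \<Rightarrow> 'x \<Rightarrow> int" where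
  "Ps 0 \<psi> ns ms x = \<psi> [] x"
| "Ps (Suc r) \<psi> ns ms x =
    Ps r (\<lambda>ls. \<psi> (hd ns # ls)) (tl ns) (tl ms) x - Ps r (\<lambda>ls. \<psi> (hd ms # ls)) (tl ns) (tl ms) x"

lemma Ps_add: "Ps r (\<lambda>ls x. a ls x + b ls x) ns ms x = Ps r a ns ms x + Ps r b ns ms x"
  by (induction r arbitrary: a b ns ms) simp_all

lemma Ps_diff: "Ps r (\<lambda>ls x. a ls x - b ls x) ns ms x = Ps r a ns ms x - Ps r b ns ms x"
  by (induction r arbitrary: a b ns ms) simp_all

lemma Ps_uminus: "Ps r (\<lambda>ls x. - a ls x) ns ms x = - Ps r a ns ms x"
  by (induction r arbitrary: a ns ms) simp_all

text \<open>In the inner sum every vertex other than \<open>ls\<close> has some coordinate taken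
  from \<open>ks\<close>. Its term does not depend on that coordinate of \<open>ls\<close> and
  cancels in the outer alternating sum.\<close>

lemma Ps_idem: "Ps r (\<lambda>ls. Ps r \<psi> ls ks) ns ms x = Ps r \<psi> ns ms x"
proof (induction r arbitrary: \<psi> ks ns ms)
  case (Suc r)
  show ?case by (simp add: Ps_diff Suc.IH)
qed simp

lemma Ps_invar: "(\<And>ls. invar us (\<psi> ls)) \<Longrightarrow> invar us (Ps r \<psi> ns ms)"
  by (induction r arbitrary: \<psi> ns ms) (simp_all add: invar_def)

lemma Xc_invar: "(\<And>ls. invar us (\<chi> ls)) \<Longrightarrow> invar us (Xc vs \<chi> ns ms)"
proof (induction vs arbitrary: \<chi> ns ms)
  case (Cons v vs)
  have "invar us (Xc vs (\<lambda>ls. \<chi> (n # ls)) ns ms)" for n ns ms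
    by (intro Cons.IH Cons.prems)
  then show ?case unfolding invar_def Xc.simps act_comm[of "- (of_int (hd ms) * v)"] by simp
qed (simp add: invar_def)

text \<open>Frequencies add under products and change sign under conjugation, so \<open>Ps\<close>
  is the frequency that belongs to \<open>Xc\<close>.\<close>

lemma Xc_eig:
  assumes "\<And>ls. eig v (\<psi> ls) (\<chi> ls)" "\<And>ls. invar [v] (\<psi> ls)"
  shows "eig v (Ps r \<psi> ns ms) (Xc (replicate r v) \<chi> ns ms)"
  using assms
proof (induction r arbitrary: \<chi> \<psi> ns ms)
  case (Suc r)
  let ?m = "hd ms"
  have 1: "eig v (Ps r (\<lambda>ls. \<psi> (n # ls)) (tl ns) (tl ms)) (Xc (replicate r v) (\<lambda>ls. \<chi> (n # ls)) (tl ns) (tl ms))" for n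
    by (intro Suc.IH Suc.prems)
  have 2: "Ps r (\<lambda>ls. \<psi> (n # ls)) (tl ns) (tl ms) (act (- (of_int ?m * v)) x) = Ps r (\<lambda>ls. \<psi> (n # ls)) (tl ns) (tl ms) x" for n x
    using Ps_invar[of "[v]" "\<lambda>ls. \<psi> (n # ls)" r "tl ns" "tl ms"] Suc.prems(2)
    by (metis invar_def list.set_intros(1) minus_mult_left of_int_minus)
  show ?case unfolding eig_def
  proof (intro allI)
    fix x n
    have sw: "act (- (of_int ?m * v)) (act (of_int n * v) x) = act (of_int n * v) (act (- (of_int ?m * v)) x)"
      by (rule act_comm)
    show "Xc (replicate (Suc r) v) \<chi> ns ms (act (of_int n * v) x) =
      e_p p (n * Ps (Suc r) \<psi> ns ms x) * Xc (replicate (Suc r) v) \<chi> ns ms x"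
      using 1 unfolding eig_def by (simp add: sw 2 cnj_e_p right_diff_distrib diff_conv_add_uminus[of "_ * _"] e_p_add del: add_uminus_conv_diff)
  qed
qed (simp add: eig_def)

text \<open>One factor of \<open>Xc\<close>, that of the vertex \<open>ns\<close>, is
  \<open>\<chi> ns\<close> at a translate of \<open>x\<close> along \<open>v\<close>. This leads
  from the support of \<open>Xc\<close> back to the large coefficients.\<close>

lemma Xc_nonzero:
  assumes "Xc (replicate r v) \<chi> ns ms x \<noteq> 0" "length ns = r"
  shows "\<exists>m. \<chi> ns (act (of_int m * v) x) \<noteq> 0"
  using assms
proof (induction r arbitrary: \<chi> ns ms x)
  case 0
  then have "\<chi> ns (act (of_int 0 * v) x) \<noteq> 0" by simp
  then show ?case by blast
next
  case (Suc r)
  have "Xc (replicate r v) (\<lambda>ls. \<chi> (hd ns # ls)) (tl ns) (tl ms) (act (- (of_int (hd ms) * v)) x) \<noteq> 0"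
    using Suc.prems by auto
  from Suc.IH[OF this] Suc.prems(2)
  obtain m where "\<chi> (hd ns # tl ns) (act (of_int m * v) (act (- (of_int (hd ms) * v)) x)) \<noteq> 0" by auto
  moreover have "act (of_int m * v) (act (- (of_int (hd ms) * v)) x) = act (of_int (m - hd ms) * v) x"
    by (simp add: act_add[symmetric] algebra_simps)
  moreover have "hd ns # tl ns = ns" using Suc.prems(2) by (cases ns) auto
  ultimately show ?case by metis
qed

lemma Xc_phase:
  assumes "\<And>ls. invar [v] (\<rho> ls)"
  shows "Xc (replicate r v) (\<lambda>ls x. e_p p (- (m * \<rho> ls x))) ns ms x = e_p p (- (m * Ps r \<rho> ns ms x))"
  using assms
proof (induction r arbitrary: \<rho> ns ms x)
  case (Suc r)
  have 2: "Ps r (\<lambda>ls. \<rho> (n # ls)) (tl ns) (tl ms) (act (- (of_int k * v)) x) = Ps r (\<lambda>ls. \<rho> (n # ls)) (tl ns) (tl ms) x" for n k x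
    using Ps_invar[of "[v]" "\<lambda>ls. \<rho> (n # ls)" r "tl ns" "tl ms"] Suc.prems
    by (metis invar_def list.set_intros(1) minus_mult_left of_int_minus)
  show ?case using Suc by (simp add: 2 cnj_e_p right_diff_distrib flip: e_p_add)
qed simp

text \<open>
  The hypothesis \<open>star\<close> forces the frequency functions of the derivatives of \<open>H\<close> to be
  often equal to a sum of functions each of which omits one of the parameters; such sums are
  removed by the interchange lemma.
\<close>

lemma degree_lowering:
  fixes v :: 'v and Z :: "'z set"
  assumes Z: "\<And>z. z \<in> Z \<Longrightarrow> bd (F z)" "\<And>x. H x = avg Z (\<lambda>z. F z x)" and inv: "invar us H"
    and star: "\<And>ns \<chi> \<psi>. \<lbrakk>bd \<chi>; eig v \<psi> \<chi>; invar us \<chi>\<rbrakk> \<Longrightarrow>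
      cmod (avg Z (\<lambda>z. avg X (\<lambda>x. \<chi> x * dl (replicate r v) ns (F z) x))) \<le>
        ravg X (\<lambda>x. if \<chi> x \<noteq> 0 \<and> int p dvd \<psi> x then 1 else 0) + \<epsilon>"
    and r: "1 \<le> r" and \<eta>: "0 < \<eta>" "\<eta> \<le> cmod (bx (replicate (r + 2) v) H)"
    and \<epsilon>: "\<epsilon> \<le> (\<eta> / 2) ^ (2 ^ r) / 2"
  shows "((\<eta> / 2) ^ (2 ^ r) / 2 * (\<eta> / 2)) ^ (2 ^ r) \<le> cmod (bx (replicate (r + 1) v) H)"
proof -
  let ?vs = "replicate r v"
  \<comment> \<open>What is left after the first interchange once \<open>\<epsilon>\<close> has been
    subtracted.\<close>
  define \<kappa> where "\<kappa> = (\<eta> / 2) ^ (2 ^ r) / 2"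
  have bdH: "bd H" using bd_avg[of Z F] Z by (simp add: bd_def)
  define G where "G ns = dl ?vs ns H" for ns
  define \<psi>0 where "\<psi>0 ns = mx v (G ns)" for ns
  define q where "q ns x = (cmod (fh v (G ns) x (\<psi>0 ns x)))\<^sup>2" for ns x
  \<comment> \<open>The cutoff loses at most half of the average, and it supplies the pointwise
    lower bound needed later on the set where the frequencies agree.\<close>
  define big where "big ns x \<longleftrightarrow> \<eta> / 2 \<le> q ns x" for ns x
  define \<chi> where "\<chi> ns x = (if big ns x then cnj (fh v (G ns) x (\<psi>0 ns x)) else 0)" for ns x
  define \<psi> where "\<psi> ns x = - \<psi>0 ns x" for ns x
  have bdG: "bd (G ns)" for ns unfolding G_def using bdH by (rule bd_dl)
  have invG: "invar us (G ns)" for ns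
    using inv unfolding G_def
  proof (induction ?vs arbitrary: r ns H)
    case (Cons a xs)
    obtain r' where "r = Suc r'" using Cons(2) by (cases r) auto
    moreover have "invar us (D b H)" for b using Cons(3) by (simp add: invar_def D_def act_comm[of b])
    ultimately show ?case using Cons by simp
  qed simp
  have inv\<psi>0: "invar [v] (\<psi>0 ns)" for ns unfolding \<psi>0_def by (rule mx_invar_self)
  then have inv\<psi>: "invar [v] (\<psi> ns)" for ns by (simp add: \<psi>_def invar_def)
  have invbig: "invar [v] (big ns)" for ns
    using inv\<psi>0[of ns] by (simp add: big_def q_def invar_def fh_act norm_mult)
  have bd\<chi>: "bd (\<chi> ns)" for ns using norm_fh[OF bdG] by (simp add: \<chi>_def bd_def)
  have eig\<chi>: "eig v (\<psi> ns) (\<chi> ns)" for ns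
    using inv\<psi>0[of ns] invbig[of ns] by (simp add: eig_def \<chi>_def \<psi>_def invar_def fh_act cnj_e_p)
  have inv\<chi>: "invar us (\<chi> ns)" for ns
    using fh_invar[OF invG[of ns], of _ v] mx_invar[OF invG[of ns], of v]
    by (simp add: invar_def \<chi>_def big_def q_def \<psi>0_def)
  have "\<eta> \<le> cmod (bx (?vs @ [v, v]) H)"
    using \<eta>(2) unfolding replicate_add by (simp add: numeral_2_eq_2)
  also have "\<dots> \<le> ravg (L r) (\<lambda>ns. cmod (bx [v, v] (G ns)))"
    unfolding bx_append G_def length_replicate by (rule norm_avg_le)
  also have "\<dots> \<le> ravg (L r) (\<lambda>ns. ravg X (q ns))"
    unfolding q_def \<psi>0_def by (intro ravg_mono U2_inverse bdG)
  also have "\<dots> \<le> ravg (L r) (\<lambda>ns. ravg X (\<lambda>x. (if big ns x then q ns x else 0) + \<eta> / 2))"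
    using \<eta>(1) by (intro ravg_mono) (auto simp: big_def)
  also have "\<dots> = ravg (L r) (\<lambda>ns. ravg X (\<lambda>x. if big ns x then q ns x else 0)) + \<eta> / 2"
    by (simp add: ravg_add ravg_const fin ne L_finite L_ne)
  finally have "\<eta> / 2 \<le> ravg (L r) (\<lambda>ns. ravg X (\<lambda>x. if big ns x then q ns x else 0))" by simp
  also have "\<dots> = cmod (of_real \<dots> :: complex)"
    by (simp add: ravg_nonneg q_def)
  also have "\<dots> = cmod (avg (L (length ?vs)) (\<lambda>ns. avg X (\<lambda>x. \<chi> ns x * dl ?vs ns H x)))"
    unfolding \<chi>_def G_def[symmetric] fh_corr[OF inv\<psi>0 invbig] q_def avg_of_real[symmetric] by simp
  finally have "(\<eta> / 2) ^ (2 ^ r) \<le> cmod (avg (L (length ?vs)) (\<lambda>ns. avg X (\<lambda>x. \<chi> ns x * dl ?vs ns H x))) ^ (2 ^ r)"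
    using \<eta>(1) by (intro power_mono) auto
  also have "\<dots> \<le> cmod (ich Z ?vs \<chi> F)"
    using interchange[OF Z(1) bd\<chi> Z(2), of ?vs] by simp
  also have "\<dots> \<le> ravg (L r) (\<lambda>ns. ravg (L r) (\<lambda>ms. cmod (avg Z (\<lambda>z.
     avg X (\<lambda>x. Xc ?vs \<chi> ns ms x * dl ?vs (map2 (-) ns ms) (F z) x)))))"
    unfolding ich_def length_replicate
    by (intro order_trans[OF norm_avg_le] ravg_mono order_trans[OF norm_avg_le] order_refl)
  also have "\<dots> \<le> ravg (L r) (\<lambda>ns. ravg (L r) (\<lambda>ms. ravg X (\<lambda>x.
      if Xc ?vs \<chi> ns ms x \<noteq> 0 \<and> int p dvd Ps r \<psi> ns ms x then 1 else 0) + \<epsilon>))"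
    by (intro ravg_mono star bd_Xc bd\<chi> Xc_eig eig\<chi> inv\<psi> Xc_invar inv\<chi>)
  also have "\<dots> = ravg (L r) (\<lambda>ms. ravg (L r) (\<lambda>ns. ravg X (\<lambda>x.
      if Xc ?vs \<chi> ns ms x \<noteq> 0 \<and> int p dvd Ps r \<psi> ns ms x then 1 else 0) + \<epsilon>))"
    by (rule ravg_swap)
  finally obtain ms where "(\<eta> / 2) ^ (2 ^ r) \<le> ravg (L r) (\<lambda>ns. ravg X (\<lambda>x.
      if Xc ?vs \<chi> ns ms x \<noteq> 0 \<and> int p dvd Ps r \<psi> ns ms x then 1 else 0) + \<epsilon>)"
    using ravg_ex_ge[OF L_finite L_ne] by blast
  then have \<kappa>: "\<kappa> \<le> ravg (L r) (\<lambda>ns. ravg X (\<lambda>x.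
      if Xc ?vs \<chi> ns ms x \<noteq> 0 \<and> int p dvd Ps r \<psi> ns ms x then 1 else 0))"
    using \<epsilon> by (simp add: ravg_add ravg_const L_finite L_ne \<kappa>_def)
  \<comment> \<open>Since \<psi> = - \<psi>0, the first summand cancels against the vertex
    \<open>ns\<close> of the alternating sum. Thus \<rho> is a sum of functions each omitting one
    coordinate of \<open>ns\<close>, while it agrees with \<psi>0 modulo \<open>p\<close> wherever
    \<open>Ps\<close> vanishes modulo \<open>p\<close>.\<close>
  define \<rho> where "\<rho> ns x = \<psi>0 ns x + Ps r \<psi> ns ms x" for ns x
  have inv\<rho>: "invar [v] (\<rho> ns)" for ns
    using inv\<psi>0[of ns] Ps_invar[of "[v]" \<psi> r ns ms] inv\<psi> by (simp add: \<rho>_def invar_def)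
  have Ps\<rho>: "Ps r \<rho> ns ms' x = 0" for ns ms' x
  proof -
    have "Ps r \<psi>0 ns ms' x = - Ps r \<psi> ns ms' x"
      unfolding \<psi>_def Ps_uminus by simp
    then show ?thesis unfolding \<rho>_def Ps_add Ps_idem by simp
  qed
  have "\<kappa> * (\<eta> / 2) \<le> ravg (L r) (\<lambda>ns. ravg X (\<lambda>x.
      if Xc ?vs \<chi> ns ms x \<noteq> 0 \<and> int p dvd Ps r \<psi> ns ms x then 1 else 0)) * (\<eta> / 2)"
    using \<kappa> \<eta> by (intro mult_right_mono) auto
  also have "\<dots> = ravg (L r) (\<lambda>ns. ravg X (\<lambda>x.
      \<eta> / 2 * (if Xc ?vs \<chi> ns ms x \<noteq> 0 \<and> int p dvd Ps r \<psi> ns ms x then 1 else 0)))"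
    by (simp add: ravg_cmult mult.commute del: times_divide_eq_left times_divide_eq_right)
  also have "\<dots> \<le> ravg (L r) (\<lambda>ns. ravg X (\<lambda>x. (cmod (fh v (G ns) x (\<rho> ns x)))\<^sup>2))"
  proof (intro ravg_mono)
    fix ns x assume ns: "ns \<in> L r"
    show "\<eta> / 2 * (if Xc ?vs \<chi> ns ms x \<noteq> 0 \<and> int p dvd Ps r \<psi> ns ms x then 1 else 0) \<le>
      (cmod (fh v (G ns) x (\<rho> ns x)))\<^sup>2"
    proof (cases "Xc ?vs \<chi> ns ms x \<noteq> 0 \<and> int p dvd Ps r \<psi> ns ms x")
      case True
      then obtain m where "\<chi> ns (act (of_int m * v) x) \<noteq> 0"
        using Xc_nonzero[of r v \<chi> ns ms x] ns by (auto simp: L_def)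
      then have "\<chi> ns x \<noteq> 0" using eig\<chi>[of ns] unfolding eig_def by auto
      then have "big ns x" by (auto simp: \<chi>_def split: if_splits)
      moreover have "fh v (G ns) x (\<rho> ns x) = fh v (G ns) x (\<psi>0 ns x)"
        using True by (intro fh_cong) (simp add: \<rho>_def)
      ultimately show ?thesis using True by (simp add: big_def q_def)
    next
      case False
      show ?thesis by (subst if_not_P[OF False]) simp
    qed
  qed
  also have "\<dots> = cmod (of_real \<dots> :: complex)"
    by (simp add: ravg_nonneg)
  also have "(of_real (ravg (L r) (\<lambda>ns. ravg X (\<lambda>x. (cmod (fh v (G ns) x (\<rho> ns x)))\<^sup>2))) :: complex) =
      avg (Fp p) (\<lambda>m. avg (L r) (\<lambda>ns. avg X (\<lambda>x. e_p p (- (m * \<rho> ns x)) * dl ?vs ns (D (of_int m * v) H) x)))"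
    unfolding avg_of_real[symmetric]
    by (simp only: avg_of_real fh_sq_avg[OF inv\<rho>] dl_D G_def avg_swap[of "L r" "Fp p"])
  finally have "(\<kappa> * (\<eta> / 2)) ^ (2 ^ r) \<le> cmod (avg (Fp p) (\<lambda>m. avg (L r) (\<lambda>ns. avg X (\<lambda>x.
      e_p p (- (m * \<rho> ns x)) * dl ?vs ns (D (of_int m * v) H) x)))) ^ (2 ^ r)"
    using \<eta>(1) by (intro power_mono) (auto simp: \<kappa>_def)
  also have "\<dots> \<le> ravg (Fp p) (\<lambda>m. cmod (avg (L r) (\<lambda>ns. avg X (\<lambda>x.
      e_p p (- (m * \<rho> ns x)) * dl ?vs ns (D (of_int m * v) H) x))) ^ (2 ^ r))"
    by (rule norm_avg_power)
  \<comment> \<open>Interchange with a one-point index set. Afterwards the phases enter only through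
    \<open>Ps r \<rho>\<close>, which is 0, so only the derivatives of \<open>H\<close>
    remain.\<close>
  also have "\<dots> \<le> ravg (Fp p) (\<lambda>m. cmod (bx ?vs (D (of_int m * v) H)))"
  proof (intro ravg_mono)
    fix m
    have "cmod (avg (L (length ?vs)) (\<lambda>ns. avg X (\<lambda>x.
      e_p p (- (m * \<rho> ns x)) * dl ?vs ns (D (of_int m * v) H) x))) ^ (2 ^ length ?vs) \<le>
      cmod (ich {()} ?vs (\<lambda>ns x. e_p p (- (m * \<rho> ns x))) (\<lambda>_. D (of_int m * v) H))"
      using bdH by (intro interchange bd_D) (auto simp: bd_def avg_def)
    also have "ich {()} ?vs (\<lambda>ns x. e_p p (- (m * \<rho> ns x))) (\<lambda>_. D (of_int m * v) H) = bx ?vs (D (of_int m * v) H)"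
      unfolding ich_def Xc_phase[OF inv\<rho>] Ps\<rho> using bx_diff_lists[of ?vs "avg X"]
      by (simp add: avg_const bx_def)
    finally show "cmod (avg (L r) (\<lambda>ns. avg X (\<lambda>x.
      e_p p (- (m * \<rho> ns x)) * dl ?vs ns (D (of_int m * v) H) x))) ^ (2 ^ r) \<le> cmod (bx ?vs (D (of_int m * v) H))"
      by simp
  qed
  also have "\<dots> = cmod (of_real \<dots> :: complex)" by (simp add: ravg_nonneg)
  also have "\<dots> = cmod (bx (replicate (r + 1) v) H)"
  proof -
    have "?vs \<noteq> []" using r by simp
    from bx_nonneg[OF this] show ?thesis
      by (simp add: avg_of_real[symmetric] bx_Cons)
  qed
  finally show ?thesis unfolding \<kappa>_def .
qed

end

section \<open>Polynomial sequences\<close>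

definition pz :: "nat \<Rightarrow> 'v::comm_ring_1 \<Rightarrow> bool" where
  "pz p a \<longleftrightarrow> of_nat p dvd a"

lemma pz_simps [simp]: "pz p 0"
  by (simp add: pz_def)

lemma pz_add: "pz p a \<Longrightarrow> pz p b \<Longrightarrow> pz p (a + b)"
  and pz_diff: "pz p a \<Longrightarrow> pz p b \<Longrightarrow> pz p (a - b)"
  and pz_minus: "pz p (- a) \<longleftrightarrow> pz p a"
  and pz_mult: "pz p a \<Longrightarrow> pz p (c * a)"
  by (simp_all add: pz_def)

lemma pz_sym: "pz p (a - b) \<Longrightarrow> pz p (b - a)"
  using pz_minus[of p "a - b"] by simp

lemma pz_trans: "pz p (a - b) \<Longrightarrow> pz p (b - c) \<Longrightarrow> pz p (a - c)"
  using pz_add[of p "a - b" "b - c"] by simp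

lemma pz_dvd: "int p dvd n \<Longrightarrow> pz p (of_int n * a)"
  by (auto simp: pz_def dvd_def mult.assoc)

lemma pz_scale_cancel:
  assumes "prime p" "\<not> int p dvd h" "pz p (of_int h * a)" shows "pz p a"
proof -
  have "coprime (int p) h" using assms(1,2) by (intro prime_imp_coprime) auto
  then obtain u v where "u * int p + v * h = 1" using bezout_int[of "int p" h] by (metis coprime_iff_gcd_eq_1)
  then have "of_int u * of_nat p + of_int v * of_int h = (1::'a)"
    by (metis of_int_1 of_int_add of_int_mult of_int_of_nat_eq)
  then have "a = (of_int u * of_nat p + of_int v * of_int h) * a" by simp
  then have "a = of_nat p * (of_int u * a) + of_int v * (of_int h * a)" by (simp add: algebra_simps)
  moreover have "pz p (of_nat p * (of_int u * a))" by (simp add: pz_def)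
  ultimately show ?thesis using pz_mult[OF assms(3), of "of_int v"] pz_add by metis
qed

text \<open>\<open>pol p e w q\<close>: modulo \<open>p\<close>, the sequence \<open>q\<close> is polynomial of degree at most \<open>e\<close>, and
  \<open>w\<close> is \<open>e!\<close> times its coefficient of degree \<open>e\<close>.\<close>

primrec pol :: "nat \<Rightarrow> nat \<Rightarrow> 'v::comm_ring_1 \<Rightarrow> (int \<Rightarrow> 'v) \<Rightarrow> bool" where
  "pol p 0 w q \<longleftrightarrow> (\<forall>y. pz p (q y - w))"
| "pol p (Suc e) w q \<longleftrightarrow> (\<forall>h. pol p e (of_int h * w) (\<lambda>y. q (y + h) - q y))"

definition perq :: "nat \<Rightarrow> (int \<Rightarrow> 'v::comm_ring_1) \<Rightarrow> bool" where
  "perq p q \<longleftrightarrow> (\<forall>y. pz p (q (y + int p) - q y))"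

lemma perq_diff: "perq p q \<Longrightarrow> perq p r \<Longrightarrow> perq p (\<lambda>y. q y - r y)"
  unfolding perq_def
proof
  fix y assume "\<forall>y. pz p (q (y + int p) - q y)" "\<forall>y. pz p (r (y + int p) - r y)"
  then have "pz p ((q (y + int p) - q y) - (r (y + int p) - r y))" using pz_diff by blast
  then show "pz p (q (y + int p) - r (y + int p) - (q y - r y))" by (simp add: algebra_simps)
qed

lemma perq_shift: "perq p q \<Longrightarrow> perq p (\<lambda>y. q (y + h))"
  unfolding perq_def by (metis add.assoc add.commute)

lemma pol_cong: "pol p e w q \<Longrightarrow> pz p (w - w') \<Longrightarrow> (\<And>y. pz p (q y - q' y)) \<Longrightarrow> pol p e w' q'"
proof (induction e arbitrary: w w' q q')
  case 0
  show ?case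
  proof (simp, intro allI)
    fix y
    have "pz p (q' y - q y)" using 0(3) by (rule pz_sym)
    moreover have "pz p (q y - w)" using 0(1) by simp
    ultimately show "pz p (q' y - w')" using 0(2) by (blast intro: pz_trans[OF pz_trans])
  qed
next
  case (Suc e)
  show ?case
  proof (simp, intro allI)
    fix h
    have "pz p (of_int h * (w - w'))" using Suc.prems(2) by (rule pz_mult)
    then have 1: "pz p (of_int h * w - of_int h * w')" by (simp add: algebra_simps)
    have 2: "pz p ((q (y + h) - q y) - (q' (y + h) - q' y))" for y
    proof -
      have "pz p ((q (y + h) - q' (y + h)) - (q y - q' y))" by (rule pz_diff; rule Suc.prems(3))
      then show ?thesis by (simp add: algebra_simps)
    qed
    have "pol p e (of_int h * w) (\<lambda>y. q (y + h) - q y)" using Suc.prems(1) by simp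
    from Suc.IH[OF this 1 2] show "pol p e (of_int h * w') (\<lambda>y. q' (y + h) - q' y)" .
  qed
qed

lemma pol_cong_lead: "pol p e w q \<Longrightarrow> pz p (w - w') \<Longrightarrow> pol p e w' q"
  by (rule pol_cong) auto

lemma pol_diff: "pol p e w q \<Longrightarrow> pol p e w' q' \<Longrightarrow> pol p e (w - w') (\<lambda>y. q y - q' y)"
proof (induction e arbitrary: w w' q q')
  case 0
  show ?case
  proof (simp, intro allI)
    fix y
    have "pz p ((q y - w) - (q' y - w'))" by (rule pz_diff; use 0 in simp)
    then show "pz p (q y - q' y - (w - w'))" by (simp add: algebra_simps)
  qed
next
  case (Suc e)
  show ?case
  proof (simp, intro allI)
    fix h
    have "pol p e (of_int h * w) (\<lambda>y. q (y + h) - q y)" "pol p e (of_int h * w') (\<lambda>y. q' (y + h) - q' y)"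
      using Suc.prems by auto
    from Suc.IH[OF this] show "pol p e (of_int h * (w - w')) (\<lambda>y. q (y + h) - q' (y + h) - (q y - q' y))"
      by (simp add: algebra_simps)
  qed
qed

lemma pol_zero: "pol p e 0 (\<lambda>_. 0)"
  by (induction e) simp_all

lemma pol_uminus: "pol p e w q \<Longrightarrow> pol p e (- w) (\<lambda>y. - q y)"
  using pol_diff[OF pol_zero] by fastforce

lemma pol_add: "pol p e w q \<Longrightarrow> pol p e w' q' \<Longrightarrow> pol p e (w + w') (\<lambda>y. q y + q' y)"
  using pol_diff[OF _ pol_uminus] by fastforce

lemma pol_shift: "pol p e w q \<Longrightarrow> pol p e w (\<lambda>y. q (y + h))"
proof (induction e arbitrary: w q)
  case (Suc e)
  show ?case
  proof (simp, intro allI)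
    fix k
    have "pol p e (of_int k * w) (\<lambda>y. q (y + k) - q y)" using Suc.prems by simp
    from Suc.IH[OF this] show "pol p e (of_int k * w) (\<lambda>y. q (y + k + h) - q (y + h))"
      by (simp add: algebra_simps)
  qed
qed simp

lemma pol_up: "pol p e w q \<Longrightarrow> pol p (Suc e) 0 q"
proof (induction e arbitrary: w q)
  case 0
  have "pz p ((q (y + h) - w) - (q y - w))" for y h by (rule pz_diff; use 0 in simp)
  then show ?case by simp
next
  case (Suc e)
  show ?case unfolding pol.simps(2)[of p "Suc e"]
  proof (intro allI)
    fix h
    have "pol p e (of_int h * w) (\<lambda>y. q (y + h) - q y)" using Suc.prems by simp
    from Suc.IH[OF this] show "pol p (Suc e) (of_int h * 0) (\<lambda>y. q (y + h) - q y)" by simp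
  qed
qed

lemma pol_up_less: assumes "pol p e w q" "e < e'" shows "pol p e' 0 q"
  using assms(2)
proof (induction e')
  case (Suc e')
  then show ?case using pol_up[OF assms(1)] pol_up[of p e' 0 q] by (cases "e = e'") auto
qed simp

lemma pol_unique: "pol p e w q \<Longrightarrow> pol p e w' q \<Longrightarrow> pz p (w - w')"
proof (induction e arbitrary: w w' q)
  case 0
  have "pz p ((q 0 - w') - (q 0 - w))" by (rule pz_diff; use 0 in simp)
  then show ?case by simp
next
  case (Suc e)
  have "pol p e (of_int 1 * w) (\<lambda>y. q (y + 1) - q y)" "pol p e (of_int 1 * w') (\<lambda>y. q (y + 1) - q y)"
    using Suc.prems by (auto simp del: of_int_1 mult_1)
  then show ?case using Suc.IH by fastforce
qed

text \<open>By induction the differences of \<open>q\<close> drop in degree as well. Their top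
  coefficients \<open>W h\<close> are additive in \<open>h\<close> modulo \<open>p\<close>, by the
  cocycle identity for differences, and hence multiples of \<open>W 1\<close>.\<close>

lemma pol_lower: "pol p (Suc e) w q \<Longrightarrow> pz p w \<Longrightarrow> \<exists>w'. pol p e w' q"
proof (induction e arbitrary: w q)
  case 0
  have "pz p (q y - q 0)" for y
  proof -
    have "pz p ((q (0 + y) - q 0) - of_int y * w)" using 0(1) unfolding pol.simps by blast
    then show ?thesis using pz_add[OF _ pz_mult[OF 0(2), of "of_int y"]] by fastforce
  qed
  then show ?case by (auto intro!: exI[of _ "q 0"])
next
  case (Suc e)
  have "\<exists>w'. pol p e w' (\<lambda>y. q (y + h) - q y)" for h
  proof (rule Suc.IH)
    show "pol p (Suc e) (of_int h * w) (\<lambda>y. q (y + h) - q y)"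
      using Suc.prems(1) unfolding pol.simps(2)[of p "Suc e"] by blast
  qed (use Suc.prems(2) pz_mult in blast)
  then obtain W where W: "\<And>h. pol p e (W h) (\<lambda>y. q (y + h) - q y)" by metis
  have add: "pz p (W (h + k) - (W h + W k))" for h k
  proof (rule pol_unique[OF W])
    have "pol p e (W h + W k) (\<lambda>y. (q (y + k + h) - q (y + k)) + (q (y + k) - q y))"
      using pol_add[OF pol_shift[OF W[of h], of k] W[of k]] .
    then show "pol p e (W h + W k) (\<lambda>y. q (y + (h + k)) - q y)" by (simp add: algebra_simps)
  qed
  have lin: "pz p (W h - of_int h * W 1)" for h
  proof (induction h rule: int_induct[where k = 0])
    case base
    show ?case using pz_sym[OF add[of 0 0]] by simp
  next
    case (step1 i)
    have "pz p ((W (i + 1) - (W i + W 1)) + (W i - of_int i * W 1))" using add step1 pz_add by blast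
    then show ?case by (simp add: algebra_simps)
  next
    case (step2 i)
    have "pz p ((W i - of_int i * W 1) - (W i - (W (i - 1) + W 1)))"
      using add[of "i - 1" 1] step2 pz_diff by (metis diff_add_cancel)
    then show ?case by (simp add: algebra_simps)
  qed
  have "pol p (Suc e) (W 1) q" using pol_cong_lead[OF W lin] by simp
  then show ?case by blast
qed

section \<open>Degree and leading coefficient of a sequence modulo p\<close>

definition ispol :: "nat \<Rightarrow> (int \<Rightarrow> 'v::comm_ring_1) \<Rightarrow> bool" where
  "ispol p q \<longleftrightarrow> (\<exists>e w. pol p e w q)"

definition dg :: "nat \<Rightarrow> (int \<Rightarrow> 'v::comm_ring_1) \<Rightarrow> nat" where
  "dg p q = (LEAST e. \<exists>w. pol p e w q)"

text \<open>Determined only modulo \<open>p\<close> (\<open>pol_unique\<close>), so statements about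
  it are congruences.\<close>

definition ld :: "nat \<Rightarrow> (int \<Rightarrow> 'v::comm_ring_1) \<Rightarrow> 'v" where
  "ld p q = (SOME w. pol p (dg p q) w q)"

lemma pol_dg: assumes "ispol p q" shows "pol p (dg p q) (ld p q) q"
proof -
  have "\<exists>w. pol p (dg p q) w q" using assms LeastI_ex[of "\<lambda>e. \<exists>w. pol p e w q"] unfolding ispol_def dg_def by blast
  then show ?thesis unfolding ld_def by (rule someI_ex)
qed

lemma dg_le: "pol p e w q \<Longrightarrow> dg p q \<le> e"
  unfolding dg_def by (rule Least_le) blast

lemma dg_le_pol: assumes "ispol p q" "dg p q \<le> e"
  shows "pol p e (if dg p q = e then ld p q else 0) q"
  using pol_dg[OF assms(1)] pol_up_less[of p "dg p q" "ld p q" q e] assms(2) by auto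

lemma ld_nz: assumes "ispol p q" "1 \<le> dg p q" shows "\<not> pz p (ld p q)"
proof
  assume a: "pz p (ld p q)"
  obtain e where e: "dg p q = Suc e" using assms(2) by (cases "dg p q") auto
  obtain w' where "pol p e w' q" using pol_lower pol_dg[OF assms(1)] a e by metis
  from dg_le[OF this] show False using e by simp
qed

lemma dg_eq: assumes "pol p e w q" "\<not> pz p w" shows "dg p q = e" "pz p (ld p q - w)"
proof -
  have i: "ispol p q" using assms by (auto simp: ispol_def)
  show e: "dg p q = e"
  proof (rule ccontr)
    assume "dg p q \<noteq> e"
    then have "pol p e 0 q" using dg_le[OF assms(1)] pol_up_less[OF pol_dg[OF i]] by simp
    from pol_unique[OF assms(1) this] assms(2) show False by simp
  qed
  show "pz p (ld p q - w)" using pol_unique[OF pol_dg[OF i, unfolded e] assms(1)] .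
qed

lemma ispol_diff: assumes "ispol p q" "ispol p r" shows "ispol p (\<lambda>y. q y - r y)"
  using pol_diff[OF dg_le_pol[OF assms(1)] dg_le_pol[OF assms(2)], of "max (dg p q) (dg p r)"]
  unfolding ispol_def by fastforce

lemma ispol_shift: "ispol p q \<Longrightarrow> ispol p (\<lambda>y. q (y + h))"
  using pol_shift unfolding ispol_def by blast

lemma dg_diff_le: assumes "ispol p q" "ispol p r" "dg p q \<le> e" "dg p r \<le> e"
  shows "dg p (\<lambda>y. q y - r y) \<le> e"
  using dg_le[OF pol_diff[OF dg_le_pol[OF assms(1,3)] dg_le_pol[OF assms(2,4)]]] .

lemma dg_diff_less: assumes "ispol p q" "ispol p r" "dg p r < dg p q"
  shows "dg p (\<lambda>y. q y - r y) = dg p q" "pz p (ld p (\<lambda>y. q y - r y) - ld p q)"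
proof -
  have "pol p (dg p q) (ld p q - 0) (\<lambda>y. q y - r y)"
    using pol_diff[OF pol_dg[OF assms(1)] dg_le_pol[OF assms(2), of "dg p q"]] assms(3) by simp
  then have "pol p (dg p q) (ld p q) (\<lambda>y. q y - r y)" by simp
  from dg_eq[OF this] ld_nz[OF assms(1)] assms(3)
  show "dg p (\<lambda>y. q y - r y) = dg p q" "pz p (ld p (\<lambda>y. q y - r y) - ld p q)" by auto
qed

lemma dg_shift: assumes "ispol p q" "1 \<le> dg p q"
  shows "dg p (\<lambda>y. q (y + h)) = dg p q" "pz p (ld p (\<lambda>y. q (y + h)) - ld p q)"
  using dg_eq[OF pol_shift[OF pol_dg[OF assms(1)]] ld_nz[OF assms]] by auto

section \<open>PET weights\<close>

definition red :: "nat \<Rightarrow> 'v::comm_ring_1 \<Rightarrow> 'v" where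
  "red p w = (SOME w'. pz p (w' - w))"

lemma red: "pz p (red p w - w)"
  unfolding red_def by (rule someI[of _ w]) simp

lemma red_eq: "red p w = red p w' \<longleftrightarrow> pz p (w - w')"
proof
  assume "red p w = red p w'"
  then show "pz p (w - w')" using pz_trans[OF pz_sym[OF red[of p w]]] red[of p w'] by simp
next
  assume "pz p (w - w')"
  then have "pz p (v - w) \<longleftrightarrow> pz p (v - w')" for v
    using pz_trans[of p v w w'] pz_trans[of p v w' w] pz_sym[of p w w'] by blast
  then show "red p w = red p w'" unfolding red_def by simp
qed

definition cls :: "nat \<Rightarrow> (int \<Rightarrow> 'v::comm_ring_1) \<Rightarrow> nat \<times> 'v" where
  "cls p q = (dg p q, red p (ld p q))"

text \<open>One entry for every class of sequences with equal degree and congruent leading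
  coefficients. The multiset order compares multiplicities at the largest degree where they differ,
  which is the usual order on PET weights.\<close>

definition wt :: "nat \<Rightarrow> (int \<Rightarrow> 'v::comm_ring_1) set \<Rightarrow> nat multiset" where
  "wt p Qs = image_mset fst (mset_set (cls p ` Qs))"

lemma count_wt: "finite Qs \<Longrightarrow> count (wt p Qs) e = card {c \<in> cls p ` Qs. fst c = e}"
proof -
  assume "finite Qs"
  then have f: "finite (cls p ` Qs)" by simp
  show ?thesis unfolding wt_def count_image_mset using f
    by (auto simp: sum.If_cases vimage_def intro!: arg_cong[of _ _ card])
qed

text \<open>Classes of degree above that of the pivot \<open>m\<close> survive unchanged. In the
  degree of \<open>m\<close> its own class disappears and no new one arises; whatever appears in
  lower degrees counts less.\<close>

lemma wt_decreases:
  fixes m :: "int \<Rightarrow> 'v::comm_ring_1"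
  assumes fin: "finite Qs" and pol: "\<And>q. q \<in> Qs \<Longrightarrow> ispol p q \<and> 1 \<le> dg p q" and m: "m \<in> Qs"
    and min: "\<And>q. q \<in> Qs \<Longrightarrow> dg p m \<le> dg p q"
  shows "wt p {q'. 1 \<le> dg p q' \<and> (\<exists>q\<in>Qs. q' = (\<lambda>y. q y - m y))} < wt p Qs"
proof -
  let ?e = "dg p m"
  let ?sub = "\<lambda>q y. q y - m y"
  let ?Q' = "{q'. 1 \<le> dg p q' \<and> (\<exists>q\<in>Qs. q' = ?sub q)}"
  have fin': "finite ?Q'" using fin by (rule finite_subset[rotated, OF finite_imageI[of Qs ?sub]]) auto
  have pm: "ispol p m" "1 \<le> ?e" using pol[OF m] by auto
  have same: "cls p (?sub q) = cls p q" if "q \<in> Qs" "?e < dg p q" for q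
    using dg_diff_less[of p q m] pol that pm by (simp add: cls_def red_eq)
  have le: "dg p (?sub q) \<le> dg p q" if "q \<in> Qs" for q
    using dg_diff_le[of p q m "dg p q"] pol that pm min by simp
  have gt: "count (wt p ?Q') x = count (wt p Qs) x" if x: "?e < x" for x
  proof -
    have "{c \<in> cls p ` ?Q'. fst c = x} = {c \<in> cls p ` Qs. fst c = x}"
    proof (intro set_eqI iffI)
      fix c assume "c \<in> {c \<in> cls p ` ?Q'. fst c = x}"
      then obtain q where q: "q \<in> Qs" "c = cls p (?sub q)" "dg p (?sub q) = x" by (auto simp: cls_def)
      then have "?e < dg p q" using le[OF q(1)] x by linarith
      then show "c \<in> {c \<in> cls p ` Qs. fst c = x}" using q same[OF q(1)] by (auto simp: cls_def)
    next
      fix c assume "c \<in> {c \<in> cls p ` Qs. fst c = x}"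
      then obtain q where q: "q \<in> Qs" "c = cls p q" "dg p q = x" by (auto simp: cls_def)
      then have "c = cls p (?sub q)" "dg p (?sub q) = x" using same[OF q(1)] x by (auto simp: cls_def)
      then show "c \<in> {c \<in> cls p ` ?Q'. fst c = x}" using q x by (auto simp: cls_def)
    qed
    then show ?thesis by (simp add: count_wt fin fin')
  qed
  have eq: "count (wt p ?Q') ?e < count (wt p Qs) ?e"
  proof -
    let ?C' = "{c \<in> cls p ` ?Q'. fst c = ?e}" and ?C = "{c \<in> cls p ` Qs. fst c = ?e}"
    \<comment> \<open>Adding back the leading coefficient of \<open>m\<close> embeds the new classes
      of this degree into the old ones, and the class of \<open>m\<close> is missed.\<close>
    let ?\<phi> = "\<lambda>c. (fst c :: nat, red p (snd c + ld p m))"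
    have inj: "inj_on ?\<phi> ?C'"
    proof (rule inj_onI)
      fix c c' assume c: "c \<in> ?C'" "c' \<in> ?C'" and "?\<phi> c = ?\<phi> c'"
      then have "pz p (snd c - snd c')" by (simp add: red_eq)
      moreover obtain r r' where "snd c = red p r" "snd c' = red p r'" using c by (auto simp: cls_def)
      ultimately have "snd c = snd c'"
        using pz_trans[OF pz_sym[OF red[of p r]] pz_trans[OF _ red[of p r']]] by (simp add: red_eq)
      then show "c = c'" using c by (auto intro: prod_eqI)
    qed
    have sub: "?\<phi> ` ?C' \<subseteq> ?C - {cls p m}"
    proof
      fix c assume "c \<in> ?\<phi> ` ?C'"
      then obtain q where q: "q \<in> Qs" "dg p (?sub q) = ?e" "c = (?e, red p (red p (ld p (?sub q)) + ld p m))"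
        by (auto simp: cls_def)
      have dq: "dg p q = ?e"
        using dg_diff_less[of p q m] pol[OF q(1)] pm q(2) min[OF q(1)] by (metis le_neq_implies_less)
      have "pol p ?e (ld p q - ld p m) (?sub q)" using pol_diff pol_dg pol[OF q(1)] pm dq by metis
      moreover have "ispol p (?sub q)" using ispol_diff pol[OF q(1)] pm by blast
      ultimately have l: "pz p (ld p (?sub q) - (ld p q - ld p m))"
        using pol_unique[OF pol_dg] q(2) by metis
      have "pz p (red p (ld p (?sub q)) + ld p m - ld p q)"
        using pz_add[OF red[of p "ld p (?sub q)"] l] by (simp add: algebra_simps)
      then have c: "c = cls p q" unfolding q(3) cls_def by (simp add: dq red_eq)
      have "c \<noteq> cls p m"
      proof
        assume "c = cls p m"
        then have "pz p (ld p q - ld p m)" unfolding c by (simp add: cls_def red_eq)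
        then have "pz p (ld p (?sub q))" using pz_add[OF l] by fastforce
        moreover have "\<not> pz p (ld p (?sub q))" using ld_nz ispol_diff pol[OF q(1)] pm q(2) by metis
        ultimately show False by blast
      qed
      moreover have "c \<in> cls p ` Qs" unfolding c using q(1) by (rule imageI)
      moreover have "fst c = ?e" by (simp add: c cls_def dq)
      ultimately show "c \<in> ?C - {cls p m}" by blast
    qed
    have "card ?C' = card (?\<phi> ` ?C')" using inj by (rule card_image[symmetric])
    also have "\<dots> \<le> card (?C - {cls p m})" using sub fin by (intro card_mono) auto
    also have "\<dots> < card ?C" using m fin by (intro card_Diff1_less) (auto simp: cls_def)
    finally show ?thesis by (simp add: count_wt fin fin')
  qed
  show ?thesis unfolding less_multiset_less_multiset\<^sub>H\<^sub>O less_multiset\<^sub>H\<^sub>O_def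
  proof (intro conjI allI impI)
    show "wt p ?Q' \<noteq> wt p Qs" using eq by auto
    fix y assume y: "count (wt p Qs) y < count (wt p ?Q') y"
    then have "\<not> ?e < y" using gt[of y] by linarith
    moreover have "y \<noteq> ?e"
    proof
      assume "y = ?e"
      then show False using order_less_asym[OF eq] y by blast
    qed
    ultimately have "y < ?e" by linarith
    then show "\<exists>x>y. count (wt p ?Q') x < count (wt p Qs) x" using eq by (intro exI[of _ ?e] conjI)
  qed
qed

section \<open>PET induction\<close>

text \<open>Abstracts V - U for subspaces modulo \<open>p\<close>. Differencing produces leading
  coefficients of the form w - h w'; the last clause leaves at most one residue \<open>h\<close>
  that spoils each of them.\<close>

definition goodset :: "nat \<Rightarrow> 'v::comm_ring_1 set \<Rightarrow> bool" where
  "goodset p G \<longleftrightarrow> (\<forall>w\<in>G. \<not> pz p w) \<and> (\<forall>w\<in>G. \<forall>w'. pz p (w - w') \<longrightarrow> w' \<in> G) \<and>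
    (\<forall>w\<in>G. \<forall>h. \<not> int p dvd h \<longrightarrow> of_int h * w \<in> G) \<and>
    (\<forall>w\<in>G. \<forall>w'\<in>G. \<forall>h h'. w - of_int h * w' \<notin> G \<longrightarrow> w - of_int h' * w' \<notin> G \<longrightarrow> int p dvd h - h')"

lemma set_mset_wt: "finite Qs \<Longrightarrow> set_mset (wt p Qs) = dg p ` Qs"
  by (simp add: wt_def image_image cls_def)

text \<open>Pigeonhole outside an exceptional set, which carries at most N/p of the average.\<close>

lemma ravg_pick:
  assumes p: "0 < p" and c: "\<And>h. h \<in> Fp p \<Longrightarrow> c h \<le> 1" "a \<le> ravg (Fp p) c"
    and Bad: "card Bad \<le> N" "Bad \<subseteq> Fp p" and pos: "0 < a - real N / real p"
  shows "\<exists>h\<in>Fp p - Bad. a - real N / real p \<le> c h"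
proof (rule ccontr)
  let ?b = "a - real N / real p"
  assume "\<not> ?thesis"
  then have lt: "c h < ?b" if "h \<in> Fp p - Bad" for h using that by force
  have fB: "finite Bad" using Bad(2) by (rule finite_subset) simp
  have "real p * a \<le> (\<Sum>h\<in>Fp p. c h)" using c(2) p by (simp add: ravg_def field_simps)
  also have "\<dots> = (\<Sum>h\<in>Bad. c h) + (\<Sum>h\<in>Fp p - Bad. c h)"
    using sum.subset_diff[OF Bad(2)] by (simp add: add.commute)
  also have "(\<Sum>h\<in>Bad. c h) \<le> real (card Bad)"
    using sum_mono[of Bad c "\<lambda>_. 1"] c(1) Bad(2) by auto
  finally have 1: "real p * a \<le> real (card Bad) + (\<Sum>h\<in>Fp p - Bad. c h)" by simp
  have cB: "real (card Bad) + real (card (Fp p - Bad)) = real p"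
    using card_Diff_subset[OF fB Bad(2)] card_mono[OF Fp_finite Bad(2)] by simp
  show False
  proof (cases "Fp p - Bad = {}")
    case True
    have "real p * a \<le> real (card Bad)" using 1 unfolding True by simp
    then have "a \<le> real N / real p" using Bad(1) p by (simp add: field_simps)
    then show False using pos by simp
  next
    case False
    then have "(\<Sum>h\<in>Fp p - Bad. c h) < (\<Sum>h\<in>Fp p - Bad. ?b)" using lt by (intro sum_strict_mono) auto
    also have "\<dots> \<le> real p * ?b"
      using pos cB by (auto intro!: mult_right_mono)
    finally have "real p * a < real (card Bad) + real p * ?b" using 1 by simp
    also have "\<dots> \<le> real p * a" using Bad(1) p by (simp add: field_simps)
    finally show False by simp
  qed
qed

lemma prod_list_filter: fixes F :: "'a \<Rightarrow> complex"
  shows "prod_list (map F xs) = prod_list (map F (filter P xs)) * prod_list (map F (filter (\<lambda>x. \<not> P x) xs))"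
  by (induction xs) auto

lemma cnj_prod_list: "cnj (prod_list (map F xs)) = prod_list (map (\<lambda>x. cnj (F x)) xs)"
  by (induction xs) auto

lemma prod_list_mult: fixes F G :: "'a \<Rightarrow> complex"
  shows "prod_list (map F xs) * prod_list (map G xs) = prod_list (map (\<lambda>x. F x * G x) xs)"
  by (induction xs) auto

context zact
begin

lemma act_perq: "perq p q \<Longrightarrow> act (q (y + int p)) x = act (q y) x"
  unfolding perq_def pz_def by (rule act_cong) blast

text \<open>The factor \<open>g0\<close> does not depend on \<open>y\<close>, so Cauchy--Schwarz in
  \<open>x\<close> removes it, and van der Corput expands the remaining square.\<close>

lemma kill:
  assumes "bd g0" "\<And>x. per p (H x)"
  shows "(cmod (avg X (\<lambda>x. avg (Fp p) (\<lambda>y. g0 x * H x y))))\<^sup>2 \<le>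
    ravg (Fp p) (\<lambda>h. cmod (avg X (\<lambda>x. avg (Fp p) (\<lambda>y. H x (y + h) * cnj (H x y)))))"
proof -
  have "(cmod (avg X (\<lambda>x. avg (Fp p) (\<lambda>y. g0 x * H x y))))\<^sup>2 \<le> ravg X (\<lambda>x. (cmod (avg (Fp p) (H x)))\<^sup>2)"
    unfolding avg_cmult using assms(1) by (intro avg_cauchy_schwarz) (simp add: bd_def)
  also have "\<dots> = cmod (of_real \<dots> :: complex)" by (simp add: ravg_nonneg)
  also have "\<dots> = cmod (avg (Fp p) (\<lambda>h. avg X (\<lambda>x. avg (Fp p) (\<lambda>y. H x (y + h) * cnj (H x y)))))"
    unfolding avg_of_real[symmetric] van_der_corput[OF p_pos assms(2)] avg_swap[of X "Fp p" "\<lambda>x h. avg (Fp p) (\<lambda>y. H x (y + h) * cnj (H x y))"] ..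
  also have "\<dots> \<le> ravg (Fp p) (\<lambda>h. cmod (avg X (\<lambda>x. avg (Fp p) (\<lambda>y. H x (y + h) * cnj (H x y)))))"
    by (rule norm_avg_le)
  finally show ?thesis .
qed

lemma E_translate: "avg X (\<lambda>x. avg (Fp p) (\<lambda>y. T y (act (a y) x))) = avg X (\<lambda>x. avg (Fp p) (\<lambda>y. T y x))"
  by (subst (1 2) avg_swap) (simp add: E_shift)

text \<open>A translation makes one function independent of \<open>y\<close>, and
  \<open>kill\<close> removes it; \<open>f\<close> is replaced by a derivative along the direction
  of that function. With one function left, \<open>bx_single\<close> applies.\<close>

lemma linear_control:
  assumes "length Gs = Suc n" "bd f" "\<And>g u. (g, u) \<in> set Gs \<Longrightarrow> bd g"
  shows "cmod (avg X (\<lambda>x. avg (Fp p) (\<lambda>y. f x * prod_list (map (\<lambda>(g, u). g (act (of_int y * u) x)) Gs)))) ^ (2 ^ Suc n)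
    \<le> cmod (bx (map snd Gs) f)"
  using assms
proof (induction n arbitrary: f Gs)
  case 0
  then obtain g u where Gs: "Gs = [(g, u)]" by (cases Gs) auto
  have "avg X (\<lambda>x. avg (Fp p) (\<lambda>y. f x * g (act (of_int y * u) x))) =
      avg X (\<lambda>x. avg (Fp p) (\<lambda>y. f (act (- (of_int y * u)) x) * g x))"
    by (subst E_translate[of _ "\<lambda>y. - (of_int y * u)", symmetric]) simp
  also have "\<dots> = avg X (\<lambda>x. g x * A u f x)"
  proof -
    have "avg (Fp p) (\<lambda>y. f (act (- (of_int y * u)) x)) = A u f x" for x
      using avg_Fp_minus[OF p_pos per_act[of f u x]] by (simp add: A_def)
    then show ?thesis unfolding avg_multc by (simp add: mult.commute[of "g _"])
  qed
  finally show ?case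
    using avg_cauchy_schwarz[of X g "A u f"] 0 by (simp add: Gs bx_single ravg_nonneg bd_def)
next
  case (Suc n)
  obtain g u Gs' where Gs: "Gs = (g, u) # Gs'" "length Gs' = Suc n" using Suc.prems(1) by (cases Gs) auto
  have bdg: "bd g" using Suc.prems(3) Gs by auto
  define W where "W y x = prod_list (map (\<lambda>(g, u). g (act (of_int y * u) x)) Gs')" for y x
  define H where "H x y = f (act (- (of_int y * u)) x) * W y (act (- (of_int y * u)) x)" for x y
  have act_per': "act (- (of_int (y + int p) * w)) x = act (- (of_int y * w)) x" for y w x
    by (rule act_cong) (simp add: algebra_simps)
  have perH: "per p (H x)" for x
    unfolding per_def H_def W_def act_per' act_per by simp
  have "avg X (\<lambda>x. avg (Fp p) (\<lambda>y. f x * prod_list (map (\<lambda>(g, u). g (act (of_int y * u) x)) Gs))) =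
      avg X (\<lambda>x. avg (Fp p) (\<lambda>y. f x * (g (act (of_int y * u) x) * W y x)))"
    by (simp add: Gs W_def)
  also have "\<dots> = avg X (\<lambda>x. avg (Fp p) (\<lambda>y. g x * H x y))"
    by (subst E_translate[of _ "\<lambda>y. - (of_int y * u)", symmetric]) (simp add: H_def mult_ac)
  finally have T: "avg X (\<lambda>x. avg (Fp p) (\<lambda>y. f x * prod_list (map (\<lambda>(g, u). g (act (of_int y * u) x)) Gs))) =
      avg X (\<lambda>x. avg (Fp p) (\<lambda>y. g x * H x y))" .
  \<comment> \<open>The remaining functions keep their directions; the shift \<open>h\<close> only
    changes the functions.\<close>
  define K where "K h gu = (\<lambda>z. fst gu (act (of_int h * snd gu - of_int h * u) z) * cnj (fst gu z))" for h and gu :: "('x \<Rightarrow> complex) \<times> 'v"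
  define G' where "G' h = map (\<lambda>gu. (K h gu, snd gu)) Gs'" for h
  have c: "avg X (\<lambda>x. avg (Fp p) (\<lambda>y. H x (y + h) * cnj (H x y))) =
    avg X (\<lambda>x. avg (Fp p) (\<lambda>y. D (- (of_int h * u)) f x * prod_list (map (\<lambda>(g, u). g (act (of_int y * u) x)) (G' h))))" for h
  proof (subst E_translate[of _ "\<lambda>y. of_int y * u", symmetric], intro avg_cong)
    fix x y
    have 1: "act (- (of_int (y + h) * u)) (act (of_int y * u) x) = act (- (of_int h * u)) x"
      by (simp add: act_add[symmetric] algebra_simps)
    have 2: "act (of_int (y + h) * w) (act (- (of_int h * u)) x) =
        act (of_int h * w - of_int h * u) (act (of_int y * w) x)" for w
      by (simp add: act_add[symmetric] algebra_simps)
    have 3: "W (y + h) (act (- (of_int h * u)) x) * cnj (W y x) = prod_list (map (\<lambda>(g, u). g (act (of_int y * u) x)) (G' h))"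
      unfolding W_def G'_def cnj_prod_list prod_list_mult
      by (simp add: 2 case_prod_beta o_def K_def del: of_int_add)
    show "H (act (of_int y * u) x) (y + h) * cnj (H (act (of_int y * u) x) y) =
      D (- (of_int h * u)) f x * prod_list (map (\<lambda>(g, u). g (act (of_int y * u) x)) (G' h))"
      unfolding H_def 1 3[symmetric] D_def act_uminus by (simp only: complex_cnj_mult mult_ac)
  qed
  have bdG': "bd g'" if gu: "(g', u') \<in> set (G' h)" for g' u' h
  proof -
    obtain a where a: "(a, u') \<in> set Gs'" "g' = K h (a, u')" using gu by (auto simp: G'_def)
    then have "bd a" using Suc.prems(3) Gs by auto
    then show ?thesis unfolding a(2) K_def by (auto intro!: bd_mult bd_act bd_cnj)
  qed
  have len: "length (G' h) = Suc n" "map snd (G' h) = map snd Gs'" for h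
    using Gs by (auto simp: G'_def)
  have IH: "cmod (avg X (\<lambda>x. avg (Fp p) (\<lambda>y. H x (y + h) * cnj (H x y)))) ^ (2 ^ Suc n) \<le>
      cmod (bx (map snd Gs') (D (- (of_int h * u)) f))" for h
    using Suc.IH[OF len(1) bd_D[OF Suc.prems(2)] bdG', of h] unfolding c len(2) .
  have "cmod (avg X (\<lambda>x. avg (Fp p) (\<lambda>y. g x * H x y))) ^ (2 ^ Suc (Suc n)) =
      ((cmod (avg X (\<lambda>x. avg (Fp p) (\<lambda>y. g x * H x y))))\<^sup>2) ^ (2 ^ Suc n)"
    by (simp flip: power_mult)
  also have "\<dots> \<le> (ravg (Fp p) (\<lambda>h. cmod (avg X (\<lambda>x. avg (Fp p) (\<lambda>y. H x (y + h) * cnj (H x y)))))) ^ (2 ^ Suc n)"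
    by (intro power_mono kill bdg perH) auto
  also have "\<dots> \<le> ravg (Fp p) (\<lambda>h. cmod (avg X (\<lambda>x. avg (Fp p) (\<lambda>y. H x (y + h) * cnj (H x y)))) ^ (2 ^ Suc n))"
    by (rule ravg_power) auto
  also have "\<dots> \<le> ravg (Fp p) (\<lambda>h. cmod (bx (map snd Gs') (D (- (of_int h * u)) f)))"
    by (intro ravg_mono IH)
  also have "\<dots> = cmod (of_real \<dots> :: complex)" by (simp add: ravg_nonneg)
  also have "\<dots> = cmod (avg (Fp p) (\<lambda>h. bx (map snd Gs') (D (- (of_int h * u)) f)))"
  proof -
    have "map snd Gs' \<noteq> []" using Gs by auto
    from bx_nonneg[OF this] show ?thesis by (simp add: avg_of_real[symmetric])
  qed
  also have "avg (Fp p) (\<lambda>h. bx (map snd Gs') (D (- (of_int h * u)) f)) = bx (map snd Gs) f"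
  proof -
    have "per p (\<lambda>h. bx (map snd Gs') (D (of_int h * u) f))" by (simp add: per_def D_def[abs_def] act_per del: of_int_add)
    from avg_Fp_minus[OF p_pos this] show ?thesis by (simp add: Gs bx_Cons)
  qed
  finally show ?case unfolding T .
qed

section \<open>Polynomial systems: admissibility, doubling, recentring\<close>

definition gdp :: "'v set \<Rightarrow> (int \<Rightarrow> 'v) \<Rightarrow> bool" where
  "gdp G q \<longleftrightarrow> ispol p q \<and> 1 \<le> dg p q \<and> ld p q \<in> G"

lemma gdpI: "goodset p G \<Longrightarrow> pol p e w q \<Longrightarrow> 1 \<le> e \<Longrightarrow> w \<in> G \<Longrightarrow> gdp G q"
  using dg_eq[of p e w q] pz_sym[of p "ld p q" w] unfolding goodset_def gdp_def ispol_def by blast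

text \<open>\<open>R\<close> carries the function to be controlled. Admissible leading coefficients
  are demanded of \<open>R\<close> and of all R - Q because these become the directions in
  \<open>linear_stage\<close>.\<close>

definition valid :: "'v set \<Rightarrow> (int \<Rightarrow> 'v) \<Rightarrow> (('x \<Rightarrow> complex) \<times> (int \<Rightarrow> 'v)) list \<Rightarrow> bool" where
  "valid G R Gs \<longleftrightarrow> perq p R \<and> gdp G R \<and> (\<forall>(g, Q)\<in>set Gs. bd g \<and> perq p Q \<and> ispol p Q \<and>
     1 \<le> dg p Q \<and> dg p Q \<le> dg p R \<and> gdp G (\<lambda>y. R y - Q y))"

definition tm :: "(('x \<Rightarrow> complex) \<times> (int \<Rightarrow> 'v)) list \<Rightarrow> int \<Rightarrow> 'x \<Rightarrow> complex" where
  "tm Gs y x = prod_list (map (\<lambda>(g, Q). g (act (Q y) x)) Gs)"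

definition psum :: "('x \<Rightarrow> int \<Rightarrow> int) \<Rightarrow> ('x \<Rightarrow> complex) \<Rightarrow> ('x \<Rightarrow> complex) \<Rightarrow> (int \<Rightarrow> 'v) \<Rightarrow>
    (('x \<Rightarrow> complex) \<times> (int \<Rightarrow> 'v)) list \<Rightarrow> complex" where
  "psum \<Phi> g0 f R Gs = avg X (\<lambda>x. avg (Fp p) (\<lambda>y. g0 x * (e_p p (\<Phi> x y) * (f (act (R y) x) * tm Gs y x))))"

definition concl :: "'v set \<Rightarrow> ('x \<Rightarrow> complex) \<Rightarrow> real \<Rightarrow> nat \<Rightarrow> bool" where
  "concl G f \<delta> B \<longleftrightarrow> (\<exists>us. us \<noteq> [] \<and> length us \<le> B \<and> set us \<subseteq> G \<and> \<delta> ^ B \<le> cmod (bx us f))"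

definition pet_ok :: "nat multiset \<Rightarrow> nat \<Rightarrow> nat \<Rightarrow> bool" where
  "pet_ok M N B \<longleftrightarrow> (\<forall>G R Gs g0 f \<delta>. goodset p G \<longrightarrow> valid G R Gs \<longrightarrow> wt p (insert R (snd ` set Gs)) = M \<longrightarrow>
     length Gs \<le> N \<longrightarrow> bd g0 \<longrightarrow> bd f \<longrightarrow> 0 < \<delta> \<longrightarrow> \<delta> \<le> 1 / 2 \<longrightarrow> 1 \<le> real p * \<delta> ^ B \<longrightarrow>
     \<delta> \<le> cmod (psum (\<lambda>_ _. 0) g0 f R Gs) \<longrightarrow> concl G f \<delta> B)"

text \<open>Lowering the degree of the phase costs a doubling, and a doubling requires nonconstant
  differences of \<open>R\<close>; hence the degree of \<open>R\<close> is at least 2.\<close>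

definition ph_ok :: "nat \<Rightarrow> nat \<Rightarrow> nat \<Rightarrow> nat \<Rightarrow> bool" where
  "ph_ok d e N B \<longleftrightarrow> (\<forall>G R Gs g0 f \<delta> \<Phi>. goodset p G \<longrightarrow> valid G R Gs \<longrightarrow> 2 \<le> dg p R \<longrightarrow> dg p R \<le> d \<longrightarrow>
     length Gs \<le> N \<longrightarrow> bd g0 \<longrightarrow> bd f \<longrightarrow> 0 < \<delta> \<longrightarrow> \<delta> \<le> 1 / 2 \<longrightarrow> 1 \<le> real p * \<delta> ^ B \<longrightarrow>
     (\<forall>x. perq p (\<Phi> x) \<and> (\<exists>w. pol p e w (\<Phi> x))) \<longrightarrow>
     \<delta> \<le> cmod (psum \<Phi> g0 f R Gs) \<longrightarrow> concl G f \<delta> B)"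

lemma concl_mono: assumes "concl G f \<delta> B" "B \<le> B'" "0 < \<delta>" "\<delta> \<le> 1 / 2" shows "concl G f \<delta> B'"
proof -
  have "\<delta> ^ B' \<le> \<delta> ^ B" using assms by (intro power_decreasing) auto
  then show ?thesis using assms(1,2) unfolding concl_def by (meson order_trans)
qed

lemma power_cond_mono: assumes "1 \<le> real p * \<delta> ^ B'" "B \<le> B'" "0 < \<delta>" "\<delta> \<le> 1 / 2" shows "1 \<le> real p * \<delta> ^ B"
proof -
  have "\<delta> ^ B' \<le> \<delta> ^ B" using assms by (intro power_decreasing) auto
  then have "real p * \<delta> ^ B' \<le> real p * \<delta> ^ B" by (intro mult_left_mono) auto
  then show ?thesis using assms(1) by linarith
qed

lemma pet_ok_mono: "pet_ok M N B \<Longrightarrow> B \<le> B' \<Longrightarrow> pet_ok M N B'"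
  unfolding pet_ok_def
proof (intro allI impI, goal_cases)
  case (1 G R Gs g0 f \<delta>)
  have "concl G f \<delta> B"
    using 1(1)[rule_format, OF 1(3-10) power_cond_mono[OF 1(11) 1(2,9,10)] 1(12)] .
  then show ?case by (rule concl_mono) (use 1 in auto)
qed

text \<open>The terms of a van der Corput difference other than the conjugate of \<open>f\<close> at
  \<open>R\<close>, which stays the controlled function; the shifted copy of \<open>f\<close> joins
  the list.\<close>

definition dbl :: "int \<Rightarrow> ('x \<Rightarrow> complex) \<Rightarrow> (int \<Rightarrow> 'v) \<Rightarrow> (('x \<Rightarrow> complex) \<times> (int \<Rightarrow> 'v)) list \<Rightarrow>
    (('x \<Rightarrow> complex) \<times> (int \<Rightarrow> 'v)) list" where
  "dbl h f R Gs = (f, \<lambda>y. R (y + h)) # map (\<lambda>(g, Q). (g, \<lambda>y. Q (y + h))) Gs @ map (\<lambda>(g, Q). (\<lambda>x. cnj (g x), Q)) Gs"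

lemma length_dbl: "length (dbl h f R Gs) = 2 * length Gs + 1"
  by (simp add: dbl_def)

lemma tm_dbl: "f (act (R (y + h)) x) * tm Gs (y + h) x * cnj (tm Gs y x) = tm (dbl h f R Gs) y x"
  by (simp add: tm_def dbl_def cnj_prod_list case_prod_unfold o_def)

lemma bd_tm: "valid G R Gs \<Longrightarrow> bd (tm Gs y)"
  unfolding tm_def[abs_def] valid_def by (intro bd_prod_list) (auto intro: bd_act)

text \<open>The new differences are R(y) - R(y+h), bad for h = 0, and R(y) - Q(y+h) = (R - Q)(y+h) -
  (R(y+h) - R(y)). The two parts can cancel only in degree deg R - 1, where \<open>goodset\<close>
  allows at most one bad \<open>h\<close> for each \<open>Q\<close>.\<close>

lemma dbl_valid:
  assumes G: "goodset p G" and v: "valid G R Gs" and R2: "2 \<le> dg p R" and f: "bd f"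
  shows "\<exists>Bad\<subseteq>Fp p. card Bad \<le> length Gs + 1 \<and> (\<forall>h\<in>Fp p - Bad. valid G R (dbl h f R Gs))"
proof -
  define bad where "bad Q = {h\<in>Fp p. ld p (\<lambda>y. R y - Q y) - of_int h * ld p R \<notin> G}" for Q
  define Bad where "Bad = {0} \<union> (\<Union>gQ\<in>set Gs. bad (snd gQ))"
  have R: "ispol p R" "1 \<le> dg p R" "ld p R \<in> G" "perq p R" using v by (auto simp: valid_def gdp_def)
  have Q: "bd g" "perq p Q" "ispol p Q" "1 \<le> dg p Q" "dg p Q \<le> dg p R" "gdp G (\<lambda>y. R y - Q y)"
    if "(g, Q) \<in> set Gs" for g Q using v that by (auto simp: valid_def)
  obtain e where e: "dg p R = Suc e" "1 \<le> e" using R2 by (cases "dg p R") auto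
  have dR: "pol p e (of_int h * ld p R) (\<lambda>y. R (y + h) - R y)" for h
    using pol_dg[OF R(1)] unfolding e(1) by simp
  have hG: "of_int (- h) * ld p R \<in> G" if "h \<in> Fp p" "h \<noteq> 0" for h
  proof -
    have "\<not> int p dvd - h" using that by (auto simp: Fp_def dest: zdvd_imp_le)
    then show ?thesis using G R(3) unfolding goodset_def by blast
  qed
  have bad1: "card (bad Q) \<le> 1" if "(g, Q) \<in> set Gs" for g Q
  proof -
    have "ld p (\<lambda>y. R y - Q y) \<in> G" using Q(6)[OF that] by (simp add: gdp_def)
    then have "int p dvd h - h'" if "h \<in> bad Q" "h' \<in> bad Q" for h h'
      using that G R(3) unfolding goodset_def bad_def by blast
    then have "h = h'" if "h \<in> bad Q" "h' \<in> bad Q" for h h'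
      using that unfolding bad_def Fp_def by (fastforce simp: mod_eq_dvd_iff[symmetric])
    moreover have "finite (bad Q)" unfolding bad_def by simp
    ultimately show ?thesis unfolding One_nat_def using card_le_Suc0_iff_eq[of "bad Q"] by blast
  qed
  have "card (\<Union>gQ\<in>set Gs. bad (snd gQ)) \<le> (\<Sum>gQ\<in>set Gs. card (bad (snd gQ)))"
    by (rule card_UN_le) simp
  also have "\<dots> \<le> (\<Sum>gQ\<in>set Gs. 1)" using bad1 by (intro sum_mono) force
  also have "\<dots> \<le> length Gs" by (simp add: card_length)
  finally have cB: "card Bad \<le> length Gs + 1"
    unfolding Bad_def using card_Un_le[of "{0::int}" "\<Union>gQ\<in>set Gs. bad (snd gQ)"] by simp
  have "valid G R (dbl h f R Gs)" if h: "h \<in> Fp p - Bad" for h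
  proof -
    have h0: "h \<noteq> 0" "h \<in> Fp p" using h by (auto simp: Bad_def)
    have 1: "gdp G (\<lambda>y. R y - R (y + h))"
    proof (rule gdpI[OF G _ e(2) hG[OF h0(2,1)]])
      show "pol p e (of_int (- h) * ld p R) (\<lambda>y. R y - R (y + h))"
        using pol_uminus[OF dR[of h]] by simp
    qed
    have 2: "gdp G (\<lambda>y. R y - Q (y + h))" if gQ: "(g, Q) \<in> set Gs" for g Q
    proof -
      let ?D = "\<lambda>y. R y - Q y"
      have D: "ispol p ?D" "1 \<le> dg p ?D" "ld p ?D \<in> G" using Q(6)[OF gQ] by (auto simp: gdp_def)
      have eq: "(\<lambda>y. R y - Q (y + h)) = (\<lambda>y. ?D (y + h) - (R (y + h) - R y))" by auto
      consider "e < dg p ?D" | "dg p ?D = e" | "dg p ?D < e" by linarith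
      then show ?thesis
      proof cases
        case 1
        have "pol p (dg p ?D) (ld p ?D - 0) (\<lambda>y. ?D (y + h) - (R (y + h) - R y))"
          using pol_diff[OF pol_shift[OF pol_dg[OF D(1)]] pol_up_less[OF dR 1]] .
        then show ?thesis unfolding eq using D by (intro gdpI[OF G, of "dg p ?D" "ld p ?D"]) auto
      next
        case 2
        have "h \<notin> bad Q" using h gQ by (force simp: Bad_def)
        then have "ld p ?D - of_int h * ld p R \<in> G" using h0 by (simp add: bad_def)
        moreover have "pol p e (ld p ?D - of_int h * ld p R) (\<lambda>y. ?D (y + h) - (R (y + h) - R y))"
          using pol_diff[OF pol_shift[OF pol_dg[OF D(1)], unfolded 2] dR] .
        ultimately show ?thesis unfolding eq using e(2) by (intro gdpI[OF G])
      next
        case 3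
        have "pol p e (0 - of_int h * ld p R) (\<lambda>y. ?D (y + h) - (R (y + h) - R y))"
          using pol_diff[OF pol_shift[OF pol_up_less[OF pol_dg[OF D(1)] 3]] dR] .
        then show ?thesis unfolding eq using e(2) hG[OF h0(2,1)] by (intro gdpI[OF G, of e "of_int (- h) * ld p R"]) auto
      qed
    qed
    show ?thesis unfolding valid_def
    proof (intro conjI ballI)
      show "perq p R" "gdp G R" using v by (auto simp: valid_def)
      fix gQ assume "gQ \<in> set (dbl h f R Gs)"
      then consider "gQ = (f, \<lambda>y. R (y + h))" | g Q where "(g, Q) \<in> set Gs" "gQ = (g, \<lambda>y. Q (y + h))"
        | g Q where "(g, Q) \<in> set Gs" "gQ = (\<lambda>x. cnj (g x), Q)"
        by (auto simp: dbl_def)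
      then show "case gQ of (g, Q) \<Rightarrow> bd g \<and> perq p Q \<and> ispol p Q \<and> 1 \<le> dg p Q \<and> dg p Q \<le> dg p R \<and> gdp G (\<lambda>y. R y - Q y)"
      proof cases
        case 1
        then show ?thesis using f R dg_shift(1)[OF R(1,2)] \<open>gdp G (\<lambda>y. R y - R (y + h))\<close>
          by (auto intro: perq_shift ispol_shift)
      next
        case (2 g Q)
        then show ?thesis using Q[OF 2(1)] dg_shift(1)[OF Q(3,4)[OF 2(1)]] \<open>\<And>g Q. (g, Q) \<in> set Gs \<Longrightarrow> gdp G (\<lambda>y. R y - Q (y + h))\<close>[OF 2(1)]
          by (auto intro: perq_shift ispol_shift)
      next
        case (3 g Q)
        then show ?thesis using Q[OF 3(1)] by (auto intro: bd_cnj)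
      qed
    qed
  qed
  moreover have "Bad \<subseteq> Fp p" using p_pos by (auto simp: Bad_def bad_def Fp_def)
  ultimately show ?thesis using cB by blast
qed

text \<open>The exponent 3 absorbs the exceptional shifts: from p \<delta>^B \<ge> 1 and B \<ge> N +
  4 follows (N+1)/p \<le> (2\<delta>)^(N+1) \<delta>^3 \<le> \<delta>^3, and 2 \<delta>^3 \<le>
  \<delta>^2.\<close>

lemma double_step:
  assumes G: "goodset p G" and v: "valid G R Gs" and R2: "2 \<le> dg p R" and bd: "bd f" "bd g0"
    and \<Phi>: "\<And>x. perq p (\<Phi> x)" and N: "length Gs \<le> N"
    and \<delta>: "0 < \<delta>" "\<delta> \<le> 1 / 2" "1 \<le> real p * \<delta> ^ B" "N + 4 \<le> B" "\<delta> \<le> cmod (psum \<Phi> g0 f R Gs)"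
  shows "\<exists>h. valid G R (dbl h f R Gs) \<and>
    \<delta> ^ 3 \<le> cmod (psum (\<lambda>x y. \<Phi> x (y + h) - \<Phi> x y) (\<lambda>_. 1) (\<lambda>x. cnj (f x)) R (dbl h f R Gs))"
proof -
  define H where "H x y = e_p p (\<Phi> x y) * (f (act (R y) x) * tm Gs y x)" for x y
  have perR: "perq p R" "\<And>g Q. (g, Q) \<in> set Gs \<Longrightarrow> perq p Q" using v by (auto simp: valid_def)
  have perH: "per p (H x)" for x
  proof -
    have "e_p p (\<Phi> x (y + int p)) = e_p p (\<Phi> x y)" for y
      using \<Phi>[of x] by (intro e_p_cong p_pos) (simp add: perq_def pz_def)
    moreover have "tm Gs (y + int p) x = tm Gs y x" for y
      unfolding tm_def using perR(2) act_perq by (intro arg_cong[of _ _ prod_list] map_cong) auto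
    ultimately show ?thesis by (simp add: per_def H_def act_perq[OF perR(1)])
  qed
  define c where "c h = cmod (avg X (\<lambda>x. avg (Fp p) (\<lambda>y. H x (y + h) * cnj (H x y))))" for h
  have c_eq: "c h = cmod (psum (\<lambda>x y. \<Phi> x (y + h) - \<Phi> x y) (\<lambda>_. 1) (\<lambda>x. cnj (f x)) R (dbl h f R Gs))" for h
  proof -
    have "H x (y + h) * cnj (H x y) = e_p p (\<Phi> x (y + h) - \<Phi> x y) * (cnj (f (act (R y) x)) * tm (dbl h f R Gs) y x)" for x y
      unfolding tm_dbl[symmetric] H_def
      by (simp add: cnj_e_p diff_conv_add_uminus[of "\<Phi> _ _"] e_p_add mult_ac del: add_uminus_conv_diff)
    then show ?thesis by (simp add: c_def psum_def)
  qed
  have bdH: "cmod (H x y) \<le> 1" for x y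
    using bd(1) bd_tm[OF v, of y] unfolding H_def by (simp add: norm_mult bd_def mult_le_one)
  have c1: "c h \<le> 1" for h
    unfolding c_def by (intro norm_avg_le_bound) (auto simp: norm_mult bdH mult_le_one)
  have "\<delta>\<^sup>2 \<le> (cmod (avg X (\<lambda>x. avg (Fp p) (\<lambda>y. g0 x * H x y))))\<^sup>2"
    using \<delta> by (intro power_mono) (auto simp: psum_def H_def)
  also have "\<dots> \<le> ravg (Fp p) c" unfolding c_def by (rule kill[OF bd(2) perH])
  finally have c2: "\<delta>\<^sup>2 \<le> ravg (Fp p) c" .
  have "real (N + 1) \<le> 2 ^ (N + 1)" using of_nat_less_two_power less_imp_le by blast
  have "1 / real p \<le> \<delta> ^ B" using \<delta>(3) p_pos by (simp add: field_simps)
  then have "real (N + 1) * (1 / real p) \<le> real (N + 1) * \<delta> ^ B" by (intro mult_left_mono) auto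
  then have "real (N + 1) / real p \<le> real (N + 1) * \<delta> ^ B" by simp
  also have "\<dots> \<le> 2 ^ (N + 1) * \<delta> ^ (N + 4)"
    using \<delta> \<open>real (N + 1) \<le> 2 ^ (N + 1)\<close> by (intro mult_mono power_decreasing) auto
  also have "\<dots> = (2 * \<delta>) ^ (N + 1) * \<delta> ^ 3" by (simp add: power_mult_distrib power_add numeral_eq_Suc)
  also have "\<dots> \<le> 1 * \<delta> ^ 3" using \<delta> by (intro mult_right_mono power_le_one) auto
  finally have small: "real (N + 1) / real p \<le> \<delta> ^ 3" by simp
  have "\<delta> ^ 3 * 2 \<le> \<delta>\<^sup>2" using \<delta>(1,2) by (simp add: power2_eq_square power3_eq_cube)
  then have pos: "\<delta> ^ 3 \<le> \<delta>\<^sup>2 - real (N + 1) / real p" using small by linarith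
  obtain Bad where Bad: "Bad \<subseteq> Fp p" "card Bad \<le> length Gs + 1" "\<And>h. h \<in> Fp p - Bad \<Longrightarrow> valid G R (dbl h f R Gs)"
    using dbl_valid[OF G v R2 bd(1)] by blast
  have "0 < \<delta> ^ 3" using \<delta> by simp
  with pos have "0 < \<delta>\<^sup>2 - real (N + 1) / real p" by linarith
  then obtain h where "h \<in> Fp p - Bad" "\<delta>\<^sup>2 - real (N + 1) / real p \<le> c h"
    using ravg_pick[OF p_pos c1 c2, of Bad "N + 1"] Bad N by auto
  then show ?thesis using Bad(3) pos c_eq by (metis order_trans)
qed

text \<open>Translating \<open>x\<close> by - m(y) subtracts \<open>m\<close> from every polynomial.
  The terms that become constant modulo \<open>p\<close>, among them that of \<open>m\<close>, are
  collected in \<open>g0\<close>.\<close>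

lemma recenter:
  assumes G: "goodset p G" and v: "valid G R Gs" and m: "(gm, m) \<in> set Gs"
    and dom: "\<And>g Q. (g, Q) \<in> set Gs \<Longrightarrow> dg p (\<lambda>y. Q y - m y) \<le> dg p (\<lambda>y. R y - m y)"
  shows "\<exists>g0 Gs'. bd g0 \<and> valid G (\<lambda>y. R y - m y) Gs' \<and> length Gs' \<le> length Gs \<and>
    snd ` set Gs' = {q'. 1 \<le> dg p q' \<and> (\<exists>q\<in>snd ` set Gs. q' = (\<lambda>y. q y - m y))} \<and>
    psum (\<lambda>_ _. 0) (\<lambda>_. 1) f R Gs = psum (\<lambda>_ _. 0) g0 f (\<lambda>y. R y - m y) Gs'"
proof -
  have Q: "bd g" "perq p Q" "ispol p Q" "1 \<le> dg p Q" "dg p Q \<le> dg p R" "gdp G (\<lambda>y. R y - Q y)"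
    if "(g, Q) \<in> set Gs" for g Q using v that by (auto simp: valid_def)
  define cst where "cst = (\<lambda>(g::'x \<Rightarrow> complex, Q). dg p (\<lambda>y. Q y - m y) = 0)"
  define g0 where "g0 x = prod_list (map (\<lambda>(g, Q). g (act (ld p (\<lambda>y. Q y - m y)) x)) (filter cst Gs))" for x
  define Gs' where "Gs' = map (\<lambda>(g, Q). (g, \<lambda>y. Q y - m y)) (filter (\<lambda>gQ. \<not> cst gQ) Gs)"
  have bdg0: "bd g0"
    unfolding g0_def[abs_def] using Q(1) by (intro bd_prod_list) (auto intro!: bd_act)
  have val: "valid G (\<lambda>y. R y - m y) Gs'"
    unfolding valid_def
  proof (intro conjI ballI)
    show "perq p (\<lambda>y. R y - m y)" using v Q(2)[OF m] by (intro perq_diff) (auto simp: valid_def)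
    show "gdp G (\<lambda>y. R y - m y)" using Q(6)[OF m] .
    fix gq assume "gq \<in> set Gs'"
    then obtain g q where gq: "(g, q) \<in> set Gs" "gq = (g, \<lambda>y. q y - m y)" "dg p (\<lambda>y. q y - m y) \<noteq> 0"
      by (auto simp: Gs'_def cst_def)
    have "(\<lambda>y. R y - m y - (q y - m y)) = (\<lambda>y. R y - q y)" by auto
    then show "case gq of (g, q) \<Rightarrow> bd g \<and> perq p q \<and> ispol p q \<and> 1 \<le> dg p q \<and>
        dg p q \<le> dg p (\<lambda>y. R y - m y) \<and> gdp G (\<lambda>y. R y - m y - q y)"
      using gq Q[OF gq(1)] Q[OF m] dom[OF gq(1)] by (auto intro: perq_diff ispol_diff)
  qed
  have len: "length Gs' \<le> length Gs" by (simp add: Gs'_def)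
  have set: "snd ` set Gs' = {q'. 1 \<le> dg p q' \<and> (\<exists>q\<in>snd ` set Gs. q' = (\<lambda>y. q y - m y))}"
    by (force simp: Gs'_def cst_def image_iff)
  have "psum (\<lambda>_ _. 0) (\<lambda>_. 1) f R Gs =
      avg X (\<lambda>x. avg (Fp p) (\<lambda>y. f (act (R y) (act (- m y) x)) * tm Gs y (act (- m y) x)))"
    unfolding psum_def by (subst E_translate[of _ "\<lambda>y. - m y", symmetric]) simp
  also have "\<dots> = psum (\<lambda>_ _. 0) g0 f (\<lambda>y. R y - m y) Gs'"
    unfolding psum_def
  proof (intro avg_cong)
    fix x y
    have a: "act (q y) (act (- m y) x) = act (q y - m y) x" for q by (simp add: act_add[symmetric])
    have "tm Gs y (act (- m y) x) = prod_list (map (\<lambda>(g, Q). g (act (Q y - m y) x)) Gs)"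
      unfolding tm_def a ..
    also have "\<dots> = prod_list (map (\<lambda>(g, Q). g (act (Q y - m y) x)) (filter cst Gs)) *
        prod_list (map (\<lambda>(g, Q). g (act (Q y - m y) x)) (filter (\<lambda>gQ. \<not> cst gQ) Gs))"
      by (rule prod_list_filter)
    also have "prod_list (map (\<lambda>(g, Q). g (act (Q y - m y) x)) (filter cst Gs)) = g0 x"
      unfolding g0_def
    proof (intro arg_cong[of _ _ prod_list] map_cong refl)
      fix gq assume "gq \<in> set (filter cst Gs)"
      moreover obtain g q where "gq = (g, q)" by force
      ultimately have gq: "gq = (g, q)" "(g, q) \<in> set Gs" "dg p (\<lambda>y. q y - m y) = 0" by (auto simp: cst_def)
      have "pol p 0 (ld p (\<lambda>y. q y - m y)) (\<lambda>y. q y - m y)"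
        using pol_dg[OF ispol_diff[OF Q(3)[OF gq(2)] Q(3)[OF m]]] unfolding gq(3) .
      then have "act (q y - m y) x = act (ld p (\<lambda>y. q y - m y)) x" by (intro act_cong) (simp add: pz_def)
      then show "(case gq of (g, Q) \<Rightarrow> g (act (Q y - m y) x)) = (case gq of (g, Q) \<Rightarrow> g (act (ld p (\<lambda>y. Q y - m y)) x))"
        using gq(1) by simp
    qed
    also have "prod_list (map (\<lambda>(g, Q). g (act (Q y - m y) x)) (filter (\<lambda>gQ. \<not> cst gQ) Gs)) = tm Gs' y x"
      by (simp add: tm_def Gs'_def case_prod_unfold o_def)
    finally show "f (act (R y) (act (- m y) x)) * tm Gs y (act (- m y) x) =
       g0 x * (e_p p 0 * (f (act (R y - m y) x) * tm Gs' y x))"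
      by (simp add: a)
  qed
  finally show ?thesis using bdg0 val len set by blast
qed

text \<open>After recentring, R - m must still have the largest degree. If a pivot of minimal degree
  lies outside the class of \<open>R\<close>, then R - m keeps the degree of \<open>R\<close>.
  Otherwise all polynomials have the degree of \<open>R\<close>, and since q - m = (R - m) - (R -
  q), an \<open>m\<close> maximising deg(R - m) works.\<close>

lemma choose_pivot:
  assumes v: "valid G R Gs" and ne: "Gs \<noteq> []"
  obtains gm m where "(gm, m) \<in> set Gs" "\<And>g Q. (g, Q) \<in> set Gs \<Longrightarrow> dg p m \<le> dg p Q"
    "\<And>g Q. (g, Q) \<in> set Gs \<Longrightarrow> dg p (\<lambda>y. Q y - m y) \<le> dg p (\<lambda>y. R y - m y)"
proof -
  have R: "ispol p R" "1 \<le> dg p R" using v by (auto simp: valid_def gdp_def)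
  have Q: "ispol p Q" "1 \<le> dg p Q" "dg p Q \<le> dg p R" "ispol p (\<lambda>y. R y - Q y)"
    if "(g, Q) \<in> set Gs" for g Q using v that by (auto simp: valid_def gdp_def)
  show ?thesis
  proof (cases "\<exists>gm m. (gm, m) \<in> set Gs \<and> (\<forall>(g, Q)\<in>set Gs. dg p m \<le> dg p Q) \<and> \<not> (dg p m = dg p R \<and> pz p (ld p R - ld p m))")
    case True
    then obtain gm m where m: "(gm, m) \<in> set Gs" "\<And>g Q. (g, Q) \<in> set Gs \<Longrightarrow> dg p m \<le> dg p Q"
      and ncl: "\<not> (dg p m = dg p R \<and> pz p (ld p R - ld p m))" by blast
    have "dg p (\<lambda>y. R y - m y) = dg p R"
    proof (cases "dg p m = dg p R")
      case True
      have "pol p (dg p R) (ld p R - ld p m) (\<lambda>y. R y - m y)"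
        using pol_diff[OF pol_dg[OF R(1)] pol_dg[OF Q(1)[OF m(1)], unfolded True]] .
      from dg_eq(1)[OF this] ncl True show ?thesis by blast
    next
      case False
      then show ?thesis using dg_diff_less(1)[OF R(1) Q(1)[OF m(1)]] Q(3)[OF m(1)] by simp
    qed
    moreover have "dg p (\<lambda>y. q y - m y) \<le> dg p R" if "(g, q) \<in> set Gs" for g q
      using dg_diff_le[OF Q(1)[OF that] Q(1)[OF m(1)] Q(3)[OF that] Q(3)[OF m(1)]] .
    ultimately show ?thesis using that[OF m] by simp
  next
    case False
    obtain gm0 m0 where m0: "(gm0, m0) \<in> set Gs" "\<And>g Q. (g, Q) \<in> set Gs \<Longrightarrow> dg p m0 \<le> dg p Q"
      using ex_has_least_nat[of "\<lambda>gq. gq \<in> set Gs" "hd Gs" "\<lambda>gq. dg p (snd gq)"] ne by fastforce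
    then have "dg p m0 = dg p R" using False by blast
    then have all: "dg p q = dg p R" if "(g, q) \<in> set Gs" for g q
      using m0(2)[OF that] Q(3)[OF that] by simp
    let ?d = "\<lambda>gq. dg p (\<lambda>y. R y - snd gq y)"
    have "Max (?d ` set Gs) \<in> ?d ` set Gs" using ne by (intro Max_in) auto
    then obtain gq where gq: "gq \<in> set Gs" "?d gq = Max (?d ` set Gs)" by auto
    obtain gm m where "gq = (gm, m)" by force
    then have m: "(gm, m) \<in> set Gs" "?d (gm, m) = Max (?d ` set Gs)" using gq by auto
    have m2: "dg p (\<lambda>y. R y - Q y) \<le> dg p (\<lambda>y. R y - m y)" if "(g, Q) \<in> set Gs" for g Q
    proof -
      have "?d (g, Q) \<le> Max (?d ` set Gs)" by (rule Max_ge) (simp, rule imageI[OF that])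
      then show ?thesis using m(2) by simp
    qed
    have "dg p (\<lambda>y. q y - m y) \<le> dg p (\<lambda>y. R y - m y)" if "(g, q) \<in> set Gs" for g q
    proof -
      have "(\<lambda>y. q y - m y) = (\<lambda>y. (R y - m y) - (R y - q y))" by auto
      then show ?thesis
        using dg_diff_le[OF Q(4)[OF m(1)] Q(4)[OF that] order_refl m2[OF that]] by simp
    qed
    then show ?thesis using that m(1) all by simp
  qed
qed

text \<open>Translating by - R(y) frees \<open>f\<close> of \<open>y\<close>. Then \<open>g0\<close>
  moves in direction - ld R and each other function in direction - ld (R - Q), all in
  \<open>G\<close> by validity.\<close>

lemma linear_stage:
  assumes G: "goodset p G" and v: "valid G R Gs" and R1: "dg p R = 1" and bd: "bd f" "bd g0"
  shows "\<exists>us. length us = Suc (length Gs) \<and> set us \<subseteq> G \<and>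
    cmod (psum (\<lambda>_ _. 0) g0 f R Gs) ^ (2 ^ Suc (length Gs)) \<le> cmod (bx us f)"
proof -
  have lin: "pz p (q y - (q 0 + of_int y * ld p q))" if "ispol p q" "dg p q = 1" for q :: "int \<Rightarrow> 'v" and y
  proof -
    have "pol p (Suc 0) (ld p q) q" using pol_dg[OF that(1)] that(2) by simp
    then have "pz p (q (0 + y) - q 0 - of_int y * ld p q)" unfolding pol.simps by blast
    then show ?thesis by (simp add: algebra_simps)
  qed
  have neg: "- w \<in> G" if "w \<in> G" for w
  proof -
    have "\<not> int p dvd -1" using prime_p by auto
    then have "of_int (-1) * w \<in> G" using G that unfolding goodset_def by blast
    then show ?thesis by simp
  qed
  have R: "ispol p R" "ld p R \<in> G" using v by (auto simp: valid_def gdp_def)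
  have Q: "bd g" "ispol p (\<lambda>y. R y - Q y)" "dg p (\<lambda>y. R y - Q y) = 1" "ld p (\<lambda>y. R y - Q y) \<in> G"
    if "(g, Q) \<in> set Gs" for g Q
  proof -
    have *: "bd g" "ispol p Q" "dg p Q \<le> dg p R" "gdp G (\<lambda>y. R y - Q y)" using v that by (auto simp: valid_def)
    then show "bd g" "ispol p (\<lambda>y. R y - Q y)" "ld p (\<lambda>y. R y - Q y) \<in> G" by (auto simp: gdp_def)
    show "dg p (\<lambda>y. R y - Q y) = 1"
      using dg_diff_le[OF R(1) *(2) order_refl *(3)] *(4) R1 by (simp add: gdp_def)
  qed
  define K where "K gq = (\<lambda>z. fst gq (act (- (R 0 - snd gq 0)) z))" for gq :: "('x \<Rightarrow> complex) \<times> (int \<Rightarrow> 'v)"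
  define u where "u q = - ld p (\<lambda>y. R y - q y)" for q
  define Ks where "Ks = (\<lambda>z. g0 (act (- R 0) z), - ld p R) # map (\<lambda>gq. (K gq, u (snd gq))) Gs"
  have "psum (\<lambda>_ _. 0) g0 f R Gs = avg X (\<lambda>x. avg (Fp p) (\<lambda>y. f x * (g0 (act (- R y) x) * tm Gs y (act (- R y) x))))"
    unfolding psum_def by (subst E_translate[of _ "\<lambda>y. - R y", symmetric]) (simp add: mult_ac)
  also have "\<dots> = avg X (\<lambda>x. avg (Fp p) (\<lambda>y. f x * prod_list (map (\<lambda>(g, u). g (act (of_int y * u) x)) Ks)))"
  proof -
    have 1: "act (- R y) x = act (- R 0) (act (of_int y * (- ld p R)) x)" for x y
    proof -
      have "pz p (- (R y - (R 0 + of_int y * ld p R)))" using lin[OF R(1) R1, of y] by (simp only: pz_minus)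
      then show ?thesis unfolding act_add[symmetric] by (intro act_cong) (simp add: pz_def algebra_simps)
    qed
    have 2: "act (q y) (act (- R y) x) = act (- (R 0 - q 0)) (act (of_int y * u q) x)" if "(g, q) \<in> set Gs" for g q x y
    proof -
      have "pz p (- (R y - q y - (R 0 - q 0 + of_int y * ld p (\<lambda>y. R y - q y))))"
        using lin[OF Q(2,3)[OF that], of y] by (simp only: pz_minus)
      then show ?thesis unfolding act_add[symmetric] u_def by (intro act_cong) (simp add: pz_def algebra_simps)
    qed
    have 3: "tm Gs y (act (- R y) x) = prod_list (map (\<lambda>gq. K gq (act (of_int y * u (snd gq)) x)) Gs)" for x y
      unfolding tm_def by (intro arg_cong[of _ _ prod_list] map_cong refl) (auto simp: 2 K_def)
    have 4: "g0 (act (- R y) x) = g0 (act (- R 0) (act (of_int y * (- ld p R)) x))" for x y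
      by (rule arg_cong[OF 1])
    show ?thesis
    proof (intro avg_cong)
      fix x y
      show "f x * (g0 (act (- R y) x) * tm Gs y (act (- R y) x)) =
        f x * prod_list (map (\<lambda>(g, u). g (act (of_int y * u) x)) Ks)"
        unfolding 3 4[of y x] Ks_def by (simp add: case_prod_unfold o_def)
    qed
  qed
  finally have eq: "psum (\<lambda>_ _. 0) g0 f R Gs = avg X (\<lambda>x. avg (Fp p) (\<lambda>y. f x * prod_list (map (\<lambda>(g, u). g (act (of_int y * u) x)) Ks)))" .
  have "cmod (psum (\<lambda>_ _. 0) g0 f R Gs) ^ (2 ^ Suc (length Gs)) \<le> cmod (bx (map snd Ks) f)"
    unfolding eq
  proof (rule linear_control)
    show "length Ks = Suc (length Gs)" by (simp add: Ks_def)
    fix g w assume "(g, w) \<in> set Ks"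
    then show "bd g" using bd(2) Q(1) by (auto simp: Ks_def K_def intro!: bd_act)
  qed (rule bd(1))
  moreover have "set (map snd Ks) \<subseteq> G" using R(2) Q(4) neg by (auto simp: Ks_def u_def)
  ultimately show ?thesis by (intro exI[of _ "map snd Ks"]) (simp add: Ks_def)
qed

text \<open>A shift changes neither degree nor leading coefficient, so doubling does not affect the
  weight and the strict decrease comes from the pivot.\<close>

lemma cls_dbl: assumes "valid G R Gs" shows "wt p (insert R (snd ` set (dbl h f R Gs))) = wt p (insert R (snd ` set Gs))"
proof -
  have R: "ispol p R" "1 \<le> dg p R" using assms by (auto simp: valid_def gdp_def)
  have Q: "ispol p Q" "1 \<le> dg p Q" if "(g, Q) \<in> set Gs" for g Q using assms that by (auto simp: valid_def)
  have sh: "cls p (\<lambda>y. q (y + h)) = cls p q" if "ispol p q" "1 \<le> dg p q" for q :: "int \<Rightarrow> 'v"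
    using dg_shift[OF that, of h] by (simp add: cls_def red_eq)
  have set: "snd ` set (dbl h f R Gs) = insert (\<lambda>y. R (y + h)) ((\<lambda>q y. q (y + h)) ` snd ` set Gs \<union> snd ` set Gs)"
    by (simp add: dbl_def image_Un image_image case_prod_unfold)
  have "(\<lambda>q. cls p (\<lambda>y. q (y + h))) ` snd ` set Gs = cls p ` snd ` set Gs"
    using sh[OF Q] by (intro image_cong) auto
  then have "cls p ` insert R (snd ` set (dbl h f R Gs)) = cls p ` insert R (snd ` set Gs)"
    unfolding set by (simp add: image_Un image_image sh[OF R])
  then show ?thesis by (simp only: wt_def)
qed

text \<open>In the constant, 3 B pays for the passage from \<delta> to \<delta>^3, 2^(N+1) for
  \<open>linear_stage\<close>, and N + 4 is what \<open>double_step\<close> demands. Only finitely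
  many weights satisfy the restrictions on \<open>M'\<close>, so a common \<open>B\<close> exists
  for them.\<close>

lemma pet_step:
  assumes IH: "\<And>M'. M' < M \<Longrightarrow> size M' \<le> 2 * N + 2 \<Longrightarrow> set_mset M' \<subseteq> {..d} \<Longrightarrow> pet_ok M' (2 * N + 1) B"
    and M: "set_mset M \<subseteq> {..d}"
  shows "pet_ok M N (3 * B + 2 ^ Suc N + N + 4)"
  unfolding pet_ok_def
proof (intro allI impI)
  fix G R Gs g0 f \<delta>
  let ?B = "3 * B + 2 ^ Suc N + N + 4"
  assume G: "goodset p G" and v: "valid G R Gs" and wt: "wt p (insert R (snd ` set Gs)) = M" and N: "length Gs \<le> N"
    and bd: "bd g0" "bd f" and \<delta>: "0 < \<delta>" "\<delta> \<le> 1 / 2" "1 \<le> real p * \<delta> ^ ?B" "\<delta> \<le> cmod (psum (\<lambda>_ _. 0) g0 f R Gs)"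
  have R: "1 \<le> dg p R" using v by (auto simp: valid_def gdp_def)
  have Rd: "dg p R \<le> d"
  proof -
    have "dg p R \<in># M" unfolding wt[symmetric] wt_def by (auto simp: cls_def)
    then show ?thesis using M by auto
  qed
  show "concl G f \<delta> ?B"
  proof (cases "dg p R = 1")
    case True
    obtain us where us: "length us = Suc (length Gs)" "set us \<subseteq> G"
      "cmod (psum (\<lambda>_ _. 0) g0 f R Gs) ^ (2 ^ Suc (length Gs)) \<le> cmod (bx us f)"
      using linear_stage[OF G v True bd(2,1)] by blast
    have le: "2 ^ Suc (length Gs) \<le> (2::nat) ^ Suc N" using N by (intro power_increasing) auto
    then have "2 ^ Suc (length Gs) \<le> ?B" by linarith
    then have "\<delta> ^ ?B \<le> \<delta> ^ (2 ^ Suc (length Gs))" using \<delta>(1,2) by (intro power_decreasing) auto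
    also have "\<dots> \<le> cmod (psum (\<lambda>_ _. 0) g0 f R Gs) ^ (2 ^ Suc (length Gs))" using \<delta> by (intro power_mono) auto
    also note us(3)
    finally show ?thesis unfolding concl_def using us N by (intro exI[of _ us]) auto
  next
    case False
    then have R2: "2 \<le> dg p R" using R by simp
    obtain h where h: "valid G R (dbl h f R Gs)"
      "\<delta> ^ 3 \<le> cmod (psum (\<lambda>x y. 0 - 0) (\<lambda>_. 1) (\<lambda>x. cnj (f x)) R (dbl h f R Gs))"
      using double_step[OF G v R2 bd(2,1), of "\<lambda>_ _. 0" N \<delta> ?B] N \<delta> by (auto simp: perq_def)
    let ?Gs = "dbl h f R Gs"
    have "?Gs \<noteq> []" by (simp add: dbl_def)
    then obtain gm m where m: "(gm, m) \<in> set ?Gs" "\<And>g Q. (g, Q) \<in> set ?Gs \<Longrightarrow> dg p m \<le> dg p Q"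
      "\<And>g Q. (g, Q) \<in> set ?Gs \<Longrightarrow> dg p (\<lambda>y. Q y - m y) \<le> dg p (\<lambda>y. R y - m y)"
      using choose_pivot[OF h(1)] by blast
    let ?R = "\<lambda>y. R y - m y"
    obtain g0' Gs' where g': "bd g0'" "valid G ?R Gs'" "length Gs' \<le> length ?Gs"
      "snd ` set Gs' = {q'. 1 \<le> dg p q' \<and> (\<exists>q\<in>snd ` set ?Gs. q' = (\<lambda>y. q y - m y))}"
      "psum (\<lambda>_ _. 0) (\<lambda>_. 1) (\<lambda>x. cnj (f x)) R ?Gs = psum (\<lambda>_ _. 0) g0' (\<lambda>x. cnj (f x)) ?R Gs'"
      using recenter[OF G h(1) m(1), of "\<lambda>x. cnj (f x)"] m(3) by blast
    have R': "1 \<le> dg p ?R" using g'(2) by (auto simp: valid_def gdp_def)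
    have mQ: "ispol p q \<and> 1 \<le> dg p q \<and> dg p q \<le> dg p R" if "q \<in> insert R (snd ` set ?Gs)" for q
      using h(1) that by (auto simp: valid_def gdp_def)
    have set': "insert ?R (snd ` set Gs') = {q'. 1 \<le> dg p q' \<and> (\<exists>q\<in>insert R (snd ` set ?Gs). q' = (\<lambda>y. q y - m y))}"
      unfolding g'(4) using R' by auto
    have min: "dg p m \<le> dg p q" if "q \<in> insert R (snd ` set ?Gs)" for q
    proof -
      have "m \<in> insert R (snd ` set ?Gs)" using m(1) by force
      then show ?thesis using that m(2) mQ[of m] by auto
    qed
    have lt: "wt p (insert ?R (snd ` set Gs')) < M"
      unfolding set' wt[symmetric] cls_dbl[OF v, of h f, symmetric]
      using m(1) mQ min by (intro wt_decreases) force+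
    have len': "length Gs' \<le> 2 * N + 1" using g'(3) N by (simp add: length_dbl)
    have size': "size (wt p (insert ?R (snd ` set Gs'))) \<le> 2 * N + 2"
    proof -
      have "size (wt p (insert ?R (snd ` set Gs'))) = card (cls p ` insert ?R (snd ` set Gs'))" by (simp add: wt_def)
      also have "\<dots> \<le> card (insert ?R (snd ` set Gs'))" by (rule card_image_le) simp
      also have "\<dots> \<le> Suc (card (snd ` set Gs'))" by (rule card_insert_le_m1) auto
      also have "card (snd ` set Gs') \<le> length Gs'" using card_image_le card_length le_trans by blast
      finally show ?thesis using len' by simp
    qed
    have el': "set_mset (wt p (insert ?R (snd ` set Gs'))) \<subseteq> {..d}"
    proof -
      have "dg p q \<le> d" if q: "q \<in> insert ?R (snd ` set Gs')" for q
      proof -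
        have "q \<in> {q'. 1 \<le> dg p q' \<and> (\<exists>q\<in>insert R (snd ` set ?Gs). q' = (\<lambda>y. q y - m y))}"
          using q unfolding set' .
        then obtain q0 where q0: "q0 \<in> insert R (snd ` set ?Gs)" "q = (\<lambda>y. q0 y - m y)" by blast
        have "m \<in> insert R (snd ` set ?Gs)" using m(1) by force
        then have "dg p q \<le> dg p R" unfolding q0(2) using mQ[OF q0(1)] mQ[of m] by (intro dg_diff_le) auto
        then show ?thesis using Rd by linarith
      qed
      then show ?thesis by (subst set_mset_wt) (simp, rule image_subsetI, simp only: atMost_iff)
    qed
    have "pet_ok (wt p (insert ?R (snd ` set Gs'))) (2 * N + 1) B" by (rule IH[OF lt size' el'])
    moreover have "1 \<le> real p * (\<delta> ^ 3) ^ B"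
      unfolding power_mult[symmetric] by (rule power_cond_mono[OF \<delta>(3)]) (use \<delta> in auto)
    moreover have "\<delta> ^ 3 \<le> 1 / 2" using \<delta> power_decreasing[of 1 3 \<delta>] by simp
    moreover have "\<delta> ^ 3 \<le> cmod (psum (\<lambda>_ _. 0) g0' (\<lambda>x. cnj (f x)) ?R Gs')" using h(2) g'(5) by simp
    ultimately have "concl G (\<lambda>x. cnj (f x)) (\<delta> ^ 3) B"
      using G g'(1,2) len' bd \<delta>(1) bd_cnj[OF bd(2)] unfolding pet_ok_def by auto
    then have "concl G f \<delta> (3 * B)"
      unfolding concl_def bx_cnj by (auto simp: power_mult[symmetric])
    then show ?thesis by (rule concl_mono) (use \<delta> in auto)
  qed
qed

text \<open>A phase constant in \<open>y\<close> modulo \<open>p\<close> can be absorbed into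
  \<open>g0\<close>.\<close>

lemma ph_0:
  assumes "\<And>M. size M \<le> N + 1 \<Longrightarrow> set_mset M \<subseteq> {..d} \<Longrightarrow> pet_ok M N B"
  shows "ph_ok d 0 N B"
  unfolding ph_ok_def
proof (intro allI impI)
  fix G R Gs g0 f \<delta> \<Phi>
  assume G: "goodset p G" and v: "valid G R Gs" and Rd: "dg p R \<le> d" and N: "length Gs \<le> N"
    and bd: "bd g0" "bd f" and \<delta>: "0 < \<delta>" "\<delta> \<le> 1 / 2" "1 \<le> real p * \<delta> ^ B"
    and \<Phi>: "\<forall>x. perq p (\<Phi> x) \<and> (\<exists>w. pol p 0 w (\<Phi> x))" and ge: "\<delta> \<le> cmod (psum \<Phi> g0 f R Gs)"
  obtain c where c: "\<And>x y. pz p (\<Phi> x y - c x)" using \<Phi> by (metis pol.simps(1))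
  have "e_p p (\<Phi> x y) = e_p p (c x)" for x y using c[of x y] by (intro e_p_cong p_pos) (simp add: pz_def)
  then have "psum \<Phi> g0 f R Gs = psum (\<lambda>_ _. 0) (\<lambda>x. g0 x * e_p p (c x)) f R Gs" by (simp add: psum_def mult_ac)
  moreover have "bd (\<lambda>x. g0 x * e_p p (c x))" using bd(1) by (intro bd_mult) (auto simp: bd_def)
  moreover have "pet_ok (wt p (insert R (snd ` set Gs))) N B"
  proof (rule assms)
    have "size (wt p (insert R (snd ` set Gs))) \<le> card (insert R (snd ` set Gs))"
      by (simp add: wt_def card_image_le flip: image_insert)
    also have "\<dots> \<le> Suc (card (snd ` set Gs))" by (rule card_insert_le_m1) auto
    also have "card (snd ` set Gs) \<le> length Gs" using card_image_le card_length le_trans by blast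
    finally show "size (wt p (insert R (snd ` set Gs))) \<le> N + 1" using N by simp
    have "dg p q \<le> d" if "q \<in> insert R (snd ` set Gs)" for q
      using v that Rd by (auto simp: valid_def)
    then show "set_mset (wt p (insert R (snd ` set Gs))) \<subseteq> {..d}"
      by (subst set_mset_wt) (simp, rule image_subsetI, simp only: atMost_iff)
  qed
  ultimately show "concl G f \<delta> B" using G v N bd(2) \<delta> ge unfolding pet_ok_def by metis
qed

text \<open>Doubling replaces the phase by a difference of it, whose degree is lower, and keeps
  \<open>R\<close>.\<close>

lemma ph_Suc:
  assumes IH: "ph_ok d e (2 * N + 1) B"
  shows "ph_ok d (Suc e) N (3 * B + N + 4)"
  unfolding ph_ok_def
proof (intro allI impI)
  fix G R Gs g0 f \<delta> \<Phi>
  let ?B = "3 * B + N + 4"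
  assume G: "goodset p G" and v: "valid G R Gs" and R2: "2 \<le> dg p R" and Rd: "dg p R \<le> d" and N: "length Gs \<le> N"
    and bd: "bd g0" "bd f" and \<delta>: "0 < \<delta>" "\<delta> \<le> 1 / 2" "1 \<le> real p * \<delta> ^ ?B"
    and \<Phi>: "\<forall>x. perq p (\<Phi> x) \<and> (\<exists>w. pol p (Suc e) w (\<Phi> x))" and ge: "\<delta> \<le> cmod (psum \<Phi> g0 f R Gs)"
  obtain h where h: "valid G R (dbl h f R Gs)"
      "\<delta> ^ 3 \<le> cmod (psum (\<lambda>x y. \<Phi> x (y + h) - \<Phi> x y) (\<lambda>_. 1) (\<lambda>x. cnj (f x)) R (dbl h f R Gs))"
    using double_step[OF G v R2 bd(2,1), of \<Phi> N \<delta> ?B] N \<delta> \<Phi> ge by auto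
  have "\<forall>x. perq p (\<lambda>y. \<Phi> x (y + h) - \<Phi> x y) \<and> (\<exists>w. pol p e w (\<lambda>y. \<Phi> x (y + h) - \<Phi> x y))"
    using \<Phi> by (metis perq_diff perq_shift pol.simps(2))
  moreover have "1 \<le> real p * (\<delta> ^ 3) ^ B"
    unfolding power_mult[symmetric] by (rule power_cond_mono[OF \<delta>(3)]) (use \<delta> in auto)
  moreover have "\<delta> ^ 3 \<le> 1 / 2" using \<delta> power_decreasing[of 1 3 \<delta>] by simp
  moreover have "length (dbl h f R Gs) \<le> 2 * N + 1" using N by (simp add: length_dbl)
  moreover have "bd (\<lambda>_::'x. 1)" by (simp add: bd_def)
  ultimately have "concl G (\<lambda>x. cnj (f x)) (\<delta> ^ 3) B"
    using IH[unfolded ph_ok_def, rule_format, OF G h(1) R2 Rd _ _ bd_cnj[OF bd(2)] _ _ _ _ h(2)] \<delta>(1) by simp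
  then have "concl G f \<delta> (3 * B)"
    unfolding concl_def bx_cnj by (auto simp: power_mult[symmetric])
  then show "concl G f \<delta> ?B" by (rule concl_mono) (use \<delta> in auto)
qed

end

section \<open>PET bounds uniform in p and in the action\<close>

lemma finite_bounded_multisets: "finite {M :: nat multiset. size M \<le> n \<and> set_mset M \<subseteq> {..d}}"
proof -
  have "{M :: nat multiset. size M \<le> n \<and> set_mset M \<subseteq> {..d}} = (\<Union>i\<le>n. multisets_of_size {..d} i)"
    by (auto simp: multisets_of_size_def)
  then show ?thesis by auto
qed

lemma finite_uniform_bound:
  assumes "finite F" "\<And>a B B'. Q a B \<Longrightarrow> B \<le> B' \<Longrightarrow> Q a B'" "\<And>a. a \<in> F \<Longrightarrow> \<exists>B::nat. Q a B"
  shows "\<exists>B. \<forall>a\<in>F. Q a B"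
proof -
  obtain b where b: "\<And>a. a \<in> F \<Longrightarrow> Q a (b a)" using assms(3) by metis
  have "Q a (Max (b ` F))" if "a \<in> F" for a
    using assms(2)[OF b[OF that]] that assms(1) by simp
  then show ?thesis by blast
qed

text \<open>Well-founded induction along the multiset order. The smaller weights met in
  \<open>pet_step\<close> form a finite set that does not depend on \<open>p\<close>, so their
  bounds have a maximum.\<close>

lemma pet:
  "set_mset M \<subseteq> {..d} \<Longrightarrow> \<exists>B. \<forall>p (X::'x set) (act::'v::comm_ring_1 \<Rightarrow> 'x \<Rightarrow> 'x). zact p X act \<longrightarrow> zact.pet_ok p X act M N B"
proof (induction M arbitrary: N rule: less_induct)
  case (less M)
  let ?Q = "\<lambda>M' B. \<forall>p (X::'x set) (act::'v \<Rightarrow> 'x \<Rightarrow> 'x). zact p X act \<longrightarrow> zact.pet_ok p X act M' (2 * N + 1) B"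
  let ?F = "{M'. M' < M \<and> size M' \<le> 2 * N + 2 \<and> set_mset M' \<subseteq> {..d}}"
  have "finite ?F" by (rule finite_subset[OF _ finite_bounded_multisets[of "2 * N + 2" d]]) auto
  then have "\<exists>B. \<forall>M'\<in>?F. ?Q M' B"
    by (rule finite_uniform_bound) (use zact.pet_ok_mono less.IH in blast)+
  then obtain B where B: "\<And>M'. M' \<in> ?F \<Longrightarrow> ?Q M' B" by blast
  show ?case
  proof (intro exI allI impI)
    fix p and X :: "'x set" and act :: "'v \<Rightarrow> 'x \<Rightarrow> 'x"
    assume z: "zact p X act"
    show "zact.pet_ok p X act M N (3 * B + 2 ^ Suc N + N + 4)"
      by (rule zact.pet_step[OF z _ less.prems]) (use B z in blast)
  qed
qed

lemma pet_phase:
  "\<exists>B. \<forall>p (X::'x set) (act::'v::comm_ring_1 \<Rightarrow> 'x \<Rightarrow> 'x). zact p X act \<longrightarrow> zact.ph_ok p X act d e N B"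
proof (induction e arbitrary: N)
  case 0
  let ?Q = "\<lambda>M B. \<forall>p (X::'x set) (act::'v \<Rightarrow> 'x \<Rightarrow> 'x). zact p X act \<longrightarrow> zact.pet_ok p X act M N B"
  have "\<exists>B. \<forall>M\<in>{M. size M \<le> N + 1 \<and> set_mset M \<subseteq> {..d}}. ?Q M B"
  proof (rule finite_uniform_bound[OF finite_bounded_multisets])
    show "?Q M B \<Longrightarrow> B \<le> B' \<Longrightarrow> ?Q M B'" for M B B' using zact.pet_ok_mono by blast
    show "M \<in> {M. size M \<le> N + 1 \<and> set_mset M \<subseteq> {..d}} \<Longrightarrow> \<exists>B. ?Q M B" for M by (intro pet) auto
  qed
  then show ?case using zact.ph_0 by (metis (no_types, lifting) mem_Collect_eq)
next
  case (Suc e)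
  obtain B where "\<And>p (X::'x set) (act::'v \<Rightarrow> 'x \<Rightarrow> 'x). zact p X act \<Longrightarrow> zact.ph_ok p X act d e (2 * N + 1) B"
    using Suc[of "2 * N + 1"] by blast
  then show ?case using zact.ph_Suc by blast
qed

section \<open>Integer polynomials modulo \<open>p\<close>\<close>

lemma pol_cmult: "pol p e w q \<Longrightarrow> pol p e (c * w) (\<lambda>y. c * q y)"
proof (induction e arbitrary: w q)
  case 0
  have "pz p (c * (q y - w))" for y using 0 by (intro pz_mult) simp
  then show ?case by (simp add: algebra_simps)
next
  case (Suc e)
  show ?case unfolding pol.simps(2)
  proof
    fix h
    have "pol p e (c * (of_int h * w)) (\<lambda>y. c * (q (y + h) - q y))" by (rule Suc.IH) (use Suc.prems in simp)
    then show "pol p e (of_int h * (c * w)) (\<lambda>y. c * q (y + h) - c * q y)" by (simp add: algebra_simps)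
  qed
qed

lemma pol_sum: "finite I \<Longrightarrow> (\<And>i. i \<in> I \<Longrightarrow> pol p e (w i) (q i)) \<Longrightarrow> pol p e (\<Sum>i\<in>I. w i) (\<lambda>y. \<Sum>i\<in>I. q i y)"
  by (induction I rule: finite_induct) (auto simp: pol_zero intro: pol_add)

lemma pol_of_int: "pol p e z q \<Longrightarrow> pol p e (of_int z * v) (\<lambda>y. of_int (q y) * v)"
proof (induction e arbitrary: z q)
  case 0
  have "pz p (of_int (q y - z) * v)" for y using 0 by (intro pz_dvd) (simp add: pz_def)
  then show ?case by (simp add: algebra_simps)
next
  case (Suc e)
  show ?case unfolding pol.simps(2)
  proof
    fix h
    have "pol p e (of_int (of_int h * z) * v) (\<lambda>y. of_int (q (y + h) - q y) * v)" by (rule Suc.IH) (use Suc.prems in simp)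
    then show "pol p e (of_int h * (of_int z * v)) (\<lambda>y. of_int (q (y + h)) * v - of_int (q y) * v)" by (simp add: algebra_simps)
  qed
qed

lemma pol_power: "pol p n (fact n) (\<lambda>y::int. y ^ n)"
proof (induction n rule: less_induct)
  case (less n)
  show ?case
  proof (cases n)
    case (Suc m)
    show ?thesis unfolding Suc pol.simps(2)
    proof
      fix h :: int
      have lower: "pol p m (if i = m then of_nat (Suc m) * h * fact m else 0) (\<lambda>y. of_nat (Suc m choose i) * h ^ (Suc m - i) * y ^ i)"
        if "i \<in> {..m}" for i
      proof (cases "i = m")
        case True
        have "of_nat (Suc m choose i) * h ^ (Suc m - i) = of_nat (Suc m) * h" using True by simp
        then show ?thesis using pol_cmult[OF less.IH[of m], of "of_nat (Suc m) * h"] True Suc by (simp only: if_True) simp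
      next
        case False
        then have "pol p m 0 (\<lambda>y::int. y ^ i)" using that Suc by (intro pol_up_less[OF less.IH]) auto
        from pol_cmult[OF this] False show ?thesis by simp
      qed
      have "pol p m (\<Sum>i\<le>m. if i = m then of_nat (Suc m) * h * fact m else 0) (\<lambda>y. \<Sum>i\<le>m. of_nat (Suc m choose i) * h ^ (Suc m - i) * y ^ i)"
        by (rule pol_sum) (use lower in auto)
      moreover have "(\<Sum>i\<le>m. if i = m then of_nat (Suc m) * h * fact m else 0) = of_int h * fact (Suc m)"
        by (simp add: algebra_simps)
      moreover have "(\<Sum>i\<le>m. of_nat (Suc m choose i) * h ^ (Suc m - i) * y ^ i) = (y + h) ^ Suc m - y ^ Suc m" for y :: int
      proof -
        have "(y + h) ^ Suc m = (\<Sum>i\<le>Suc m. of_nat (Suc m choose i) * y ^ i * h ^ (Suc m - i))" by (rule binomial_ring)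
        also have "\<dots> = (\<Sum>i\<le>m. of_nat (Suc m choose i) * y ^ i * h ^ (Suc m - i)) + y ^ Suc m" by simp
        finally show ?thesis by (simp add: mult_ac)
      qed
      ultimately show "pol p m (of_int h * fact (Suc m)) (\<lambda>y. (y + h) ^ Suc m - y ^ Suc m)" by simp
    qed
  qed simp
qed

lemma pol_poly_trunc:
  assumes "\<And>n. e < n \<Longrightarrow> int p dvd coeff Q n"
  shows "pol p e (fact e * coeff Q e) (poly Q)"
proof (rule pol_cong)
  have "pol p e (if i = e then coeff Q e * fact e else 0) (\<lambda>y. coeff Q i * y ^ i)" if "i \<in> {..e}" for i
  proof (cases "i = e")
    case False
    then have "pol p e 0 (\<lambda>y::int. y ^ i)" using that by (intro pol_up_less[OF pol_power]) auto
    from pol_cmult[OF this] False show ?thesis by simp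
  qed (use pol_cmult[OF pol_power] in auto)
  then show "pol p e (\<Sum>i\<le>e. if i = e then coeff Q e * fact e else 0) (\<lambda>y. \<Sum>i\<le>e. coeff Q i * y ^ i)"
    by (intro pol_sum) auto
  show "pz p ((\<Sum>i\<le>e. if i = e then coeff Q e * fact e else 0) - fact e * coeff Q e)" by (simp add: mult.commute)
  fix y
  let ?d = "max e (degree Q)"
  have "poly Q y = (\<Sum>i\<le>?d. coeff Q i * y ^ i)" 
    unfolding poly_altdef by (rule sum.mono_neutral_left) (auto simp: coeff_eq_0)
  also have "\<dots> = (\<Sum>i\<le>e. coeff Q i * y ^ i) + (\<Sum>i\<in>{..?d} - {..e}. coeff Q i * y ^ i)"
    by (subst sum.subset_diff[of "{..e}"]) auto
  finally have "(\<Sum>i\<le>e. coeff Q i * y ^ i) - poly Q y = - (\<Sum>i\<in>{..?d} - {..e}. coeff Q i * y ^ i)" by simp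
  moreover have "int p dvd (\<Sum>i\<in>{..?d} - {..e}. coeff Q i * y ^ i)"
    using assms by (intro dvd_sum) auto
  ultimately show "pz p ((\<Sum>i\<le>e. coeff Q i * y ^ i) - poly Q y)" by (simp add: pz_def)
qed

lemma perq_poly: "perq p (poly (Q::int poly))"
  unfolding perq_def pz_def
proof
  fix y show "of_nat p dvd poly Q (y + int p) - poly Q y"
  proof (induction Q)
    case (pCons a Q)
    have "poly (pCons a Q) (y + int p) - poly (pCons a Q) y = y * (poly Q (y + int p) - poly Q y) + int p * poly Q (y + int p)"
      by (simp add: algebra_simps)
    then show ?case using pCons by (simp add: dvd_add)
  qed simp
qed

lemma perq_of_int: "perq p q \<Longrightarrow> perq p (\<lambda>y. of_int (q y) * (v::'v::comm_ring_1))"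
  unfolding perq_def
proof
  fix y assume "\<forall>y. pz p (q (y + int p) - q y)"
  then have "pz p (of_int (q (y + int p) - q y) * v)" by (intro pz_dvd) (simp add: pz_def)
  then show "pz p (of_int (q (y + int p)) * v - of_int (q y) * v)" by (simp add: algebra_simps)
qed

lemma not_dvd_fact_mult:
  assumes "prime p" "e < p" "\<not> int p dvd a" shows "\<not> int p dvd fact e * a"
proof
  assume "int p dvd fact e * a"
  then have "int p dvd fact e" using assms by (meson prime_dvd_mult_iff prime_nat_int_transfer)
  then have "p dvd fact e" by (metis int_dvd_int_iff of_nat_fact)
  then show False using assms prime_dvd_fact_iff by auto
qed

text \<open>Here \<open>e\<close> is the largest index of a coefficient not divisible by
  \<open>p\<close>; degree below \<open>p\<close> keeps e! invertible.\<close>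

lemma nonconst_type:
  assumes p: "prime p" "degree Q < p" and "coeff Q 0 = 0" "\<not> int p dvd coeff Q n"
  obtains e z where "1 \<le> e" "e \<le> degree Q" "\<not> int p dvd z" "pol p e z (poly Q)"
proof -
  let ?N = "{n. \<not> int p dvd coeff Q n}"
  have sub: "?N \<subseteq> {1..degree Q}"
  proof
    fix i assume "i \<in> ?N"
    then have "coeff Q i \<noteq> 0" by auto
    then show "i \<in> {1..degree Q}" using assms(3) le_degree by (cases "i = 0") auto
  qed
  then have f: "finite ?N" by (rule finite_subset) simp
  define e where "e = Max ?N"
  have e: "e \<in> ?N" unfolding e_def using f assms(4) by (intro Max_in) auto
  have "int p dvd coeff Q i" if "e < i" for i
    using Max_ge[OF f, of i] that unfolding e_def by force
  then have "pol p e (fact e * coeff Q e) (poly Q)" by (rule pol_poly_trunc)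
  moreover have "1 \<le> e" "e \<le> degree Q" using e sub by auto
  moreover have "\<not> int p dvd fact e * coeff Q e" using e p \<open>e \<le> degree Q\<close> by (intro not_dvd_fact_mult) auto
  ultimately show thesis using that by blast
qed

section \<open>Weyl's inequality\<close>

lemma weyl_step:
  assumes p: "prime p" and q: "perq p q" and \<delta>: "0 < \<delta>" "\<delta> \<le> 1 / 2" "1 \<le> real p * \<delta> ^ 3"
    and IH: "\<And>h. \<not> int p dvd h \<Longrightarrow> cmod (avg (Fp p) (\<lambda>y. e_p p (q (y + h) - q y))) \<le> \<delta> ^ 3"
  shows "cmod (avg (Fp p) (\<lambda>y. e_p p (q y))) \<le> \<delta>"
proof -
  have p0: "0 < p" using p prime_gt_0_nat by blast
  let ?c = "\<lambda>h. cmod (avg (Fp p) (\<lambda>y. e_p p (q (y + h) - q y)))"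
  have per: "per p (\<lambda>y. e_p p (q y))"
    using q p0 by (auto simp: per_def perq_def pz_def intro: e_p_cong)
  have "(cmod (avg (Fp p) (\<lambda>y. e_p p (q y))))\<^sup>2 = cmod (of_real ((cmod (avg (Fp p) (\<lambda>y. e_p p (q y))))\<^sup>2) :: complex)"
    by (simp only: norm_of_real abs_power2)
  also have "\<dots> = cmod (avg (Fp p) (\<lambda>h. avg (Fp p) (\<lambda>y. e_p p (q (y + h) - q y))))"
    unfolding van_der_corput[OF p0 per] by (simp add: cnj_e_p flip: e_p_add)
  also have "\<dots> \<le> ravg (Fp p) ?c" by (rule norm_avg_le)
  also have "\<dots> \<le> ravg (Fp p) (\<lambda>h. (if h = 0 then 1 else 0) + \<delta> ^ 3)"
  proof (rule ravg_mono)
    fix h assume h: "h \<in> Fp p"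
    show "?c h \<le> (if h = 0 then 1 else 0) + \<delta> ^ 3"
    proof (cases "h = 0")
      case True
      have "?c h \<le> 1" by (rule norm_avg_le_bound) auto
      then show ?thesis using True \<delta> by (simp add: add_increasing2)
    next
      case False
      then have "\<not> int p dvd h" using h by (auto simp: Fp_def dest: zdvd_imp_le)
      then show ?thesis using IH False by simp
    qed
  qed
  also have "\<dots> = 1 / real p + \<delta> ^ 3"
  proof -
    have "(0::int) \<in> Fp p" using p0 by (simp add: Fp_def)
    then show ?thesis unfolding ravg_add using ravg_const[OF Fp_finite Fp_nonempty[OF p0], of "\<delta> ^ 3"]
      by (simp add: ravg_def)
  qed
  also have "\<dots> \<le> \<delta> ^ 3 + \<delta> ^ 3" using \<delta>(3) p0 by (simp add: field_simps)
  also have "\<dots> \<le> \<delta>\<^sup>2" using \<delta> by (simp add: power2_eq_square power3_eq_cube)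
  finally show ?thesis using \<delta>(1) power2_le_imp_le by (metis less_imp_le)
qed

text \<open>One van der Corput step for each degree: nonzero shifts contribute at most \<delta>^3 by
  induction, the shift 0 contributes 1/p \<le> \<delta>^3, and 2 \<delta>^3 \<le> \<delta>^2. A
  linear phase averages to exactly 0.\<close>

lemma weyl:
  "\<exists>B. \<forall>p z q \<delta>. prime p \<longrightarrow> pol p (Suc e) z q \<longrightarrow> \<not> int p dvd z \<longrightarrow> perq p q \<longrightarrow> 0 < \<delta> \<longrightarrow> \<delta> \<le> 1 / 2 \<longrightarrow>
     1 \<le> real p * \<delta> ^ B \<longrightarrow> cmod (avg (Fp p) (\<lambda>y. e_p p (q y))) \<le> \<delta>"
proof (induction e)
  case 0
  show ?case
  proof (intro exI[of _ 0] allI impI)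
    fix p z and q :: "int \<Rightarrow> int" and \<delta> :: real
    assume p: "prime p" and q: "pol p (Suc 0) z q" "\<not> int p dvd z" and \<delta>: "0 < \<delta>"
    have p0: "0 < p" using p prime_gt_0_nat by blast
    have "e_p p (q y) = e_p p (q 0) * e_p p (y * z)" for y
    proof -
      have "pz p (q (0 + y) - q 0 - of_int y * z)" using q(1) unfolding pol.simps by blast
      then show ?thesis unfolding e_p_add[symmetric] using p0 by (intro e_p_cong) (auto simp: pz_def algebra_simps)
    qed
    then have "avg (Fp p) (\<lambda>y. e_p p (q y)) = avg (Fp p) (\<lambda>y. e_p p (q 0) * e_p p (y * z))"
      by (rule avg_cong)
    also have "\<dots> = 0" unfolding avg_cmult avg_e_p[OF p0, of z] using q(2) by simp
    finally show "cmod (avg (Fp p) (\<lambda>y. e_p p (q y))) \<le> \<delta>" using \<delta> by simp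
  qed
next
  case (Suc e)
  then obtain B where B: "\<And>p z q \<delta>. \<lbrakk>prime p; pol p (Suc e) z q; \<not> int p dvd z; perq p q; 0 < \<delta>; \<delta> \<le> 1 / 2;
     1 \<le> real p * \<delta> ^ B\<rbrakk> \<Longrightarrow> cmod (avg (Fp p) (\<lambda>y. e_p p (q y))) \<le> \<delta>" by blast
  show ?case
  proof (intro exI[of _ "3 * B + 3"] allI impI)
    fix p z and q :: "int \<Rightarrow> int" and \<delta> :: real
    assume p: "prime p" and q: "pol p (Suc (Suc e)) z q" "\<not> int p dvd z" "perq p q"
      and \<delta>: "0 < \<delta>" "\<delta> \<le> 1 / 2" "1 \<le> real p * \<delta> ^ (3 * B + 3)"
    have mono: "1 \<le> real p * \<delta> ^ n" if "n \<le> 3 * B + 3" for n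
    proof -
      have "real p * \<delta> ^ (3 * B + 3) \<le> real p * \<delta> ^ n" using \<delta> that by (intro mult_left_mono power_decreasing) auto
      then show ?thesis using \<delta>(3) by linarith
    qed
    show "cmod (avg (Fp p) (\<lambda>y. e_p p (q y))) \<le> \<delta>"
    proof (rule weyl_step[OF p q(3) \<delta>(1,2) mono])
      fix h assume h: "\<not> int p dvd h"
      show "cmod (avg (Fp p) (\<lambda>y. e_p p (q (y + h) - q y))) \<le> \<delta> ^ 3"
      proof (rule B[OF p])
        show "pol p (Suc e) (of_int h * z) (\<lambda>y. q (y + h) - q y)" using q(1) unfolding pol.simps(2)[of p "Suc e"] by blast
        show "\<not> int p dvd of_int h * z" using p q(2) h by (simp add: prime_dvd_mult_iff)
        show "perq p (\<lambda>y. q (y + h) - q y)" using q(3) by (intro perq_diff perq_shift)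
        show "\<delta> ^ 3 \<le> 1 / 2" using \<delta> power_decreasing[of 1 3 \<delta>] by simp
        show "1 \<le> real p * (\<delta> ^ 3) ^ B" unfolding power_mult[symmetric] by (rule mono) simp
      qed (use \<delta> in simp)
    qed simp
  qed
qed

section \<open>Linear independence modulo large primes\<close>

lemma lin_indep_nonzero:
  assumes "finite K" "lin_indep_family K P" "i \<in> K" shows "P i \<noteq> 0"
proof
  assume "P i = 0"
  then have "(\<Sum>j\<in>K. smult (if j = i then 1 else 0) (P j)) = 0" by (intro sum.neutral) auto
  then have "\<forall>j\<in>K. (if j = i then 1 else 0 :: int) = 0"
    using assms(2)[unfolded lin_indep_family_def, THEN spec[of _ "\<lambda>j. if j = i then 1 else 0"]] by simp
  then show False using assms(3) by auto
qed

text \<open>Gaussian elimination over the integers: \<open>P i\<close> is eliminated at one of its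
  nonzero coefficients, and \<open>m\<close> is the product of these pivots.\<close>

lemma lin_indep_mod_p:
  assumes "finite K" "lin_indep_family K P"
  shows "\<exists>m::int. m \<noteq> 0 \<and> (\<forall>p. prime p \<longrightarrow> \<not> int p dvd m \<longrightarrow>
    (\<forall>\<xi>. (\<forall>n. int p dvd coeff (\<Sum>i\<in>K. smult (\<xi> i) (P i)) n) \<longrightarrow> (\<forall>i\<in>K. int p dvd \<xi> i)))"
  using assms
proof (induction K arbitrary: P rule: finite_induct)
  case empty
  then show ?case by (intro exI[of _ 1]) auto
next
  case (insert i K)
  have "P i \<noteq> 0" using insert.hyps insert.prems by (intro lin_indep_nonzero[of "insert i K"]) auto
  then obtain n where n: "coeff (P i) n \<noteq> 0" by (metis leading_coeff_neq_0)
  let ?a = "coeff (P i) n"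
  define P' where "P' j = smult ?a (P j) - smult (coeff (P j) n) (P i)" for j
  have comb: "smult ?a (\<Sum>j\<in>insert i K. smult (\<xi> j) (P j)) =
      (\<Sum>j\<in>K. smult (\<xi> j) (P' j)) + smult (coeff (\<Sum>j\<in>insert i K. smult (\<xi> j) (P j)) n) (P i)" for \<xi>
    using insert.hyps by (intro poly_eqI)
      (simp add: coeff_sum P'_def right_diff_distrib sum_subtractf sum_distrib_left sum_distrib_right algebra_simps)
  have ind: "lin_indep_family K P'"
    unfolding lin_indep_family_def
  proof (intro allI impI ballI)
    fix b j assume b: "(\<Sum>j\<in>K. smult (b j) (P' j)) = 0" and j: "j \<in> K"
    define \<xi> where "\<xi> j = (if j = i then - (\<Sum>j\<in>K. b j * coeff (P j) n) else ?a * b j)" for j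
    have "(\<Sum>j\<in>insert i K. smult (\<xi> j) (P j)) = smult (\<xi> i) (P i) + (\<Sum>j\<in>K. smult (?a * b j) (P j))"
      using insert.hyps by (auto simp: \<xi>_def intro!: sum.cong)
    also have "\<dots> = (\<Sum>j\<in>K. smult (b j) (P' j))"
      by (intro poly_eqI) (simp add: \<xi>_def P'_def coeff_sum right_diff_distrib sum_subtractf sum_distrib_left sum_distrib_right algebra_simps)
    finally have "(\<Sum>j\<in>insert i K. smult (\<xi> j) (P j)) = 0" using b by simp
    then have "\<xi> j = 0" using insert.prems[unfolded lin_indep_family_def, THEN spec[of _ \<xi>]] j by simp
    then show "b j = 0" using j insert.hyps n by (auto simp: \<xi>_def split: if_splits)
  qed
  from insert.IH[OF ind] obtain m where m: "m \<noteq> 0" "\<And>p \<xi>. \<lbrakk>prime p; \<not> int p dvd m;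
     \<forall>n. int p dvd coeff (\<Sum>i\<in>K. smult (\<xi> i) (P' i)) n\<rbrakk> \<Longrightarrow> \<forall>i\<in>K. int p dvd \<xi> i" by blast
  show ?case
  proof (intro exI[of _ "m * ?a"] conjI allI impI)
    show "m * ?a \<noteq> 0" using m n by simp
    fix p \<xi> assume p: "prime p" "\<not> int p dvd m * ?a" and d: "\<forall>n. int p dvd coeff (\<Sum>i\<in>insert i K. smult (\<xi> i) (P i)) n"
    let ?S = "\<Sum>i\<in>insert i K. smult (\<xi> i) (P i)"
    have "int p dvd coeff (\<Sum>j\<in>K. smult (\<xi> j) (P' j)) l" for l
    proof -
      have "coeff (\<Sum>j\<in>K. smult (\<xi> j) (P' j)) l = ?a * coeff ?S l - coeff ?S n * coeff (P i) l"
        using arg_cong[OF comb[of \<xi>], of "\<lambda>q. coeff q l"] by simp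
      then show ?thesis using d[THEN spec[of _ n]] d[THEN spec[of _ l]] by (simp add: dvd_diff)
    qed
    moreover have "\<not> int p dvd m" using p(2) dvd_mult2 by blast
    ultimately have K: "\<forall>j\<in>K. int p dvd \<xi> j" using m(2)[OF p(1)] by blast
    have eq: "coeff ?S n = \<xi> i * ?a + (\<Sum>j\<in>K. \<xi> j * coeff (P j) n)" using insert.hyps by (simp add: coeff_sum)
    have "int p dvd (\<Sum>j\<in>K. \<xi> j * coeff (P j) n)" using K by (intro dvd_sum) auto
    moreover have "int p dvd \<xi> i * ?a + (\<Sum>j\<in>K. \<xi> j * coeff (P j) n)"
      using d[THEN spec[of _ n]] unfolding eq .
    ultimately have "int p dvd \<xi> i * ?a" using dvd_add_left_iff by blast
    moreover have "\<not> int p dvd ?a" using p(2) dvd_mult by blast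
    ultimately have "int p dvd \<xi> i" using p(1) by (simp add: prime_dvd_mult_iff)
    then show "\<forall>i\<in>insert i K. int p dvd \<xi> i" using K by simp
  qed
qed

text \<open>Degrees below \<open>p\<close> make the factorials in the leading coefficients of
  \<open>pol\<close> units; the last clause is linear independence over F_p.\<close>

definition goodp :: "nat set \<Rightarrow> (nat \<Rightarrow> int poly) \<Rightarrow> nat \<Rightarrow> bool" where
  "goodp K P p \<longleftrightarrow> prime p \<and> (\<forall>i\<in>K. degree (P i) < p \<and> \<not> int p dvd lead_coeff (P i)) \<and>
    (\<forall>\<xi>. (\<forall>n. int p dvd coeff (\<Sum>i\<in>K. smult (\<xi> i) (P i)) n) \<longrightarrow> (\<forall>i\<in>K. int p dvd \<xi> i))"

lemma goodp_large:
  assumes "finite K" "lin_indep_family K P"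
  shows "\<exists>N. \<forall>p. prime p \<longrightarrow> N < p \<longrightarrow> goodp K P p"
proof -
  obtain m where m: "m \<noteq> 0" "\<And>p. prime p \<Longrightarrow> \<not> int p dvd m \<Longrightarrow>
    (\<forall>\<xi>. (\<forall>n. int p dvd coeff (\<Sum>i\<in>K. smult (\<xi> i) (P i)) n) \<longrightarrow> (\<forall>i\<in>K. int p dvd \<xi> i))"
    using lin_indep_mod_p[OF assms] by blast
  define N where "N = nat \<bar>m\<bar> + (\<Sum>i\<in>K. degree (P i) + nat \<bar>lead_coeff (P i)\<bar>)"
  have nd: "\<not> int p dvd c" if "c \<noteq> 0" "nat \<bar>c\<bar> \<le> N" "N < p" for c p
    using that dvd_imp_le_int[of c "int p"] by auto
  have le: "degree (P i) + nat \<bar>lead_coeff (P i)\<bar> \<le> N" if "i \<in> K" for i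
    unfolding N_def using member_le_sum[of i K "\<lambda>i. degree (P i) + nat \<bar>lead_coeff (P i)\<bar>"] that assms(1) by simp
  show ?thesis
  proof (intro exI[of _ N] allI impI)
    fix p assume p: "prime p" "N < p"
    have "\<not> int p dvd m" by (rule nd[OF m(1) _ p(2)]) (simp add: N_def)
    moreover have "degree (P i) < p \<and> \<not> int p dvd lead_coeff (P i)" if "i \<in> K" for i
      using nd[of "lead_coeff (P i)" p] le[OF that] p(2) lin_indep_nonzero[OF assms that] by auto
    ultimately show "goodp K P p" unfolding goodp_def using m(2) p(1) by blast
  qed
qed

section \<open>Dual functions\<close>

lemma avg_bool: "avg (UNIV :: bool set) f = (f True + f False) / 2"
  by (simp add: avg_def UNIV_bool)

context zact
begin

primrec lc :: "'v list \<Rightarrow> int list \<Rightarrow> 'v" where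
  "lc [] ms = 0"
| "lc (u # us) ms = of_int (hd ms) * u + lc us (tl ms)"

text \<open>The conditional expectation onto the functions invariant along \<open>us\<close>;
  \<open>E_Av\<close> is its defining property.\<close>

definition Av :: "'v list \<Rightarrow> ('x \<Rightarrow> complex) \<Rightarrow> 'x \<Rightarrow> complex" where
  "Av us F x = avg (L (length us)) (\<lambda>ms. F (act (lc us ms) x))"

lemma invar_Nil [simp]: "invar [] f"
  by (simp add: invar_def)

lemma invar_Cons: "invar (u # us) f \<longleftrightarrow> invar [u] f \<and> invar us f"
  by (auto simp: invar_def)

lemma invar_act: "invar us f \<Longrightarrow> invar us (\<lambda>x. f (act a x))"
  by (simp add: invar_def act_comm[of a])

lemma invar_cnj: "invar us f \<Longrightarrow> invar us (\<lambda>x. cnj (f x))"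
  by (simp add: invar_def)

lemma invar_dl: "invar us f \<Longrightarrow> invar us (dl vs ns f)"
proof (induction vs arbitrary: ns f)
  case (Cons v vs)
  have "invar us (D a f)" for a using Cons.prems by (simp add: invar_def D_def act_comm[of a])
  then show ?case using Cons.IH by simp
qed simp

lemma invar_A_self: "invar [u] (A u f)"
proof -
  have "A u f (act (of_int n * u) x) = A u f x" for n x
    using avg_Fp_shift[OF p_pos per_act[of f u x], of n] by (simp add: A_def act_add[symmetric] distrib_right)
  then show ?thesis by (simp add: invar_def)
qed

lemma invar_A: "invar us f \<Longrightarrow> invar us (A u f)"
  by (simp add: invar_def A_def act_comm[of "of_int _ * u"])

lemma A_invar: "invar [u] f \<Longrightarrow> A u f = f"
  by (simp add: invar_def A_def fun_eq_iff avg_const Fp_ne)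

lemma invar_lc: "invar us f \<Longrightarrow> f (act (lc us ms) x) = f x"
proof (induction us arbitrary: ms x)
  case (Cons u us)
  then show ?case by (simp add: act_add invar_Cons[of u us]) (simp add: invar_def)
qed simp

lemma Av_Cons: "Av (u # us) F = A u (Av us F)"
  by (simp add: Av_def A_def avg_L_Suc fun_eq_iff act_add[symmetric] add.commute)

lemma Av_Nil [simp]: "Av [] F = F"
  by (simp add: Av_def fun_eq_iff)

lemma invar_Av: "invar us (Av us F)"
proof (induction us)
  case (Cons u us)
  then show ?case unfolding Av_Cons invar_Cons[of u us] using invar_A_self invar_A by blast
qed simp

lemma bd_Av: "bd F \<Longrightarrow> bd (Av us F)"
  unfolding Av_def[abs_def] by (intro bd_avg bd_act)

lemma E_Av: assumes "invar us f" shows "avg X (\<lambda>x. f x * Av us F x) = avg X (\<lambda>x. f x * F x)"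
proof -
  have "avg X (\<lambda>x. f x * Av us F x) = avg (L (length us)) (\<lambda>ms. avg X (\<lambda>x. f x * F (act (lc us ms) x)))"
    unfolding Av_def by (simp add: avg_cmult[symmetric] avg_swap[of X])
  also have "\<dots> = avg (L (length us)) (\<lambda>ms. avg X (\<lambda>x. f x * F x))"
  proof (rule avg_cong)
    fix ms
    show "avg X (\<lambda>x. f x * F (act (lc us ms) x)) = avg X (\<lambda>x. f x * F x)"
      using E_shift[of "\<lambda>x. f x * F x" "lc us ms"] by (simp add: invar_lc[OF assms])
  qed
  finally show ?thesis by (simp add: avg_const L_finite L_ne)
qed

lemma E_A: assumes "invar [u] f" shows "avg X (\<lambda>x. f x * A u F x) = avg X (\<lambda>x. f x * F x)"
  using E_Av[OF assms, of F] by (simp add: Av_Cons)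

lemma E_A_sym: "avg X (\<lambda>x. f x * A u F x) = avg X (\<lambda>x. A u f x * F x)"
proof -
  have "avg X (\<lambda>x. f x * A u F x) = avg X (\<lambda>x. A u F x * f x)" by (simp add: mult.commute)
  also have "\<dots> = avg X (\<lambda>x. A u f x * A u F x)" using E_A[OF invar_A_self, of u F f] by (simp add: mult.commute)
  also have "\<dots> = avg X (\<lambda>x. A u f x * F x)" by (rule E_A[OF invar_A_self])
  finally show ?thesis .
qed

text \<open>The square of a line average is the correlation of a derivative with a
  \<open>w\<close>-invariant function. This is the form to which \<open>interchange\<close>
  applies.\<close>

lemma bx_snoc_corr: "bx (vs @ [w]) F =
    avg (L (length vs)) (\<lambda>ns. avg X (\<lambda>x. cnj (A w (dl vs ns F) x) * dl vs ns F x))"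
proof -
  have "of_real (ravg X (\<lambda>x. (cmod (A w G x))\<^sup>2)) = avg X (\<lambda>x. cnj (A w G x) * G x)" for G
  proof -
    have "of_real (ravg X (\<lambda>x. (cmod (A w G x))\<^sup>2)) = avg X (\<lambda>x. cnj (A w G x) * A w G x)"
      unfolding avg_of_real[symmetric] using complex_norm_square by (intro avg_cong) (simp add: mult.commute)
    also have "\<dots> = avg X (\<lambda>x. cnj (A w G x) * G x)" by (rule E_A[OF invar_cnj[OF invar_A_self]])
    finally show ?thesis .
  qed
  then show ?thesis by (simp add: bx_snoc avg_of_real[symmetric])
qed

text \<open>By \<open>bx_snoc_corr\<close> the box norm of \<open>F0\<close> is a correlation of
  derivatives with \<open>w\<close>-invariant functions; \<open>interchange\<close> passes to the
  pieces \<open>F z\<close>, where \<open>star\<close> brings in \<open>h\<close>, and so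
  \<open>w\<close> is traded for \<open>u\<close>. In the exponent the summand 1 absorbs
  \<open>\<epsilon>\<close> and the factor 2 is a final squaring.\<close>

lemma push:
  assumes Z: "\<And>z. z \<in> Z \<Longrightarrow> bd (F z)" "\<And>x. F0 x = avg Z (\<lambda>z. F z x)" and inv: "invar us F0"
    and star: "\<And>\<chi> ns. \<lbrakk>bd \<chi>; invar (w # us) \<chi>\<rbrakk> \<Longrightarrow>
      cmod (avg Z (\<lambda>z. avg X (\<lambda>x. \<chi> x * dl vs ns (F z) x))) \<le> ravg X (\<lambda>x. cmod (A u (dl vs ns h) x)) + \<epsilon>"
    and \<eta>: "0 < \<eta>" "\<eta> \<le> 1 / 2" "\<eta> \<le> cmod (bx (vs @ [w]) F0)" and \<epsilon>: "\<epsilon> \<le> \<eta> ^ (2 ^ length vs + 1)"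
  shows "\<eta> ^ (2 * (2 ^ length vs + 1)) \<le> cmod (bx (vs @ [u]) h)"
proof -
  let ?l = "length vs"
  define \<chi> where "\<chi> ns x = cnj (A w (dl vs ns F0) x)" for ns x
  have bdF0: "bd F0" using bd_avg[of Z F] Z by (simp add: bd_def)
  have bd\<chi>: "bd (\<chi> ns)" for ns unfolding \<chi>_def[abs_def] by (intro bd_cnj bd_A bd_dl bdF0)
  have inv\<chi>: "invar (w # us) (\<chi> ns)" for ns
    unfolding \<chi>_def[abs_def] invar_Cons[of w us] using inv by (intro conjI invar_cnj invar_A_self invar_A invar_dl)
  have "\<eta> ^ (2 ^ ?l) \<le> cmod (avg (L ?l) (\<lambda>ns. avg X (\<lambda>x. \<chi> ns x * dl vs ns F0 x))) ^ (2 ^ ?l)"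
    using \<eta> unfolding bx_snoc_corr \<chi>_def by (intro power_mono) auto
  also have "\<dots> \<le> cmod (ich Z vs \<chi> F)" by (rule interchange[OF Z(1) bd\<chi> Z(2)])
  also have "\<dots> \<le> ravg (L ?l) (\<lambda>ns. ravg (L ?l) (\<lambda>ms. cmod (avg Z (\<lambda>z.
     avg X (\<lambda>x. Xc vs \<chi> ns ms x * dl vs (map2 (-) ns ms) (F z) x)))))"
    unfolding ich_def
    by (intro order_trans[OF norm_avg_le] ravg_mono order_trans[OF norm_avg_le] order_refl)
  also have "\<dots> \<le> ravg (L ?l) (\<lambda>ns. ravg (L ?l) (\<lambda>ms. ravg X (\<lambda>x. cmod (A u (dl vs (map2 (-) ns ms) h) x)) + \<epsilon>))"
    by (intro ravg_mono star bd_Xc bd\<chi> Xc_invar inv\<chi>)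
  also have "\<dots> = ravg (L ?l) (\<lambda>ns. ravg (L ?l) (\<lambda>ms. ravg X (\<lambda>x. cmod (A u (dl vs (map2 (-) ns ms) h) x)))) + \<epsilon>"
    by (simp add: ravg_add ravg_const L_finite L_ne)
  also have "ravg (L ?l) (\<lambda>ns. ravg (L ?l) (\<lambda>ms. ravg X (\<lambda>x. cmod (A u (dl vs (map2 (-) ns ms) h) x)))) =
      ravg (L ?l) (\<lambda>ns. ravg X (\<lambda>x. cmod (A u (dl vs ns h) x)))"
    using bx_diff_lists[of vs "\<lambda>G. of_real (ravg X (\<lambda>x. cmod (A u G x)))" h]
    unfolding avg_of_real of_real_eq_iff .
  finally have 1: "\<eta> ^ (2 ^ ?l) - \<epsilon> \<le> ravg (L ?l) (\<lambda>ns. ravg X (\<lambda>x. cmod (A u (dl vs ns h) x)))" by simp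
  have "\<eta> ^ (2 ^ ?l + 1) = \<eta> ^ (2 ^ ?l) * \<eta>" by simp
  also have "\<dots> \<le> \<eta> ^ (2 ^ ?l) * (1 / 2)" using \<eta> by (intro mult_left_mono) auto
  finally have "\<eta> ^ (2 ^ ?l + 1) \<le> \<eta> ^ (2 ^ ?l) - \<epsilon>" using \<epsilon> by linarith
  then have "(\<eta> ^ (2 ^ ?l + 1))\<^sup>2 \<le> (ravg (L ?l) (\<lambda>ns. ravg X (\<lambda>x. cmod (A u (dl vs ns h) x))))\<^sup>2"
    using 1 \<eta>(1) by (intro power_mono) auto
  also have "\<dots> \<le> ravg (L ?l) (\<lambda>ns. (ravg X (\<lambda>x. cmod (A u (dl vs ns h) x)))\<^sup>2)" by (rule ravg_square)
  also have "\<dots> \<le> ravg (L ?l) (\<lambda>ns. ravg X (\<lambda>x. (cmod (A u (dl vs ns h) x))\<^sup>2))" by (intro ravg_mono ravg_square)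
  also have "\<dots> = cmod (bx (vs @ [u]) h)" by (simp add: bx_snoc ravg_nonneg)
  finally show ?thesis by (simp only: power_mult[symmetric] mult.commute[of 2])
qed

text \<open>First summand: one use of \<open>degree_lowering\<close> with r = s + 1, estimated
  through \<eta>/2 \<ge> \<eta>^2 and 1/2 \<ge> \<eta>, times the cost of the remaining uses. Second
  summand: it ensures p \<epsilon>^B \<ge> 1 for the error \<epsilon> = \<eta>^(2^(s+2)+1) allowed
  there.\<close>

primrec DM :: "nat \<Rightarrow> nat \<Rightarrow> nat" where
  "DM B 0 = 1"
| "DM B (Suc s) = (2 ^ (s + 2) + 3) * 2 ^ (s + 1) * DM B s + (2 ^ (s + 2) + 1) * B"

lemma lower_all:
  fixes v :: 'v and Z :: "'z set"
  assumes Z: "\<And>z. z \<in> Z \<Longrightarrow> bd (F z)" "\<And>x. H x = avg Z (\<lambda>z. F z x)" and inv: "invar us H"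
    and star: "\<And>r ns \<chi> \<psi> \<epsilon>. \<lbrakk>bd \<chi>; eig v \<psi> \<chi>; 0 < \<epsilon>; \<epsilon> \<le> 1 / 2; 1 \<le> real p * \<epsilon> ^ B\<rbrakk> \<Longrightarrow>
      cmod (avg Z (\<lambda>z. avg X (\<lambda>x. \<chi> x * dl (replicate r v) ns (F z) x))) \<le>
        ravg X (\<lambda>x. if \<chi> x \<noteq> 0 \<and> int p dvd \<psi> x then 1 else 0) + \<epsilon>"
    and \<eta>: "0 < \<eta>" "\<eta> \<le> 1 / 2" "1 \<le> real p * \<eta> ^ DM B s" "\<eta> \<le> cmod (bx (replicate (s + 2) v) H)"
  shows "\<eta> ^ DM B s \<le> cmod (bx [v, v] H)"
  using \<eta>
proof (induction s arbitrary: \<eta>)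
  case 0
  then show ?case by (simp add: numeral_2_eq_2)
next
  case (Suc s)
  let ?R = "s + 1"
  let ?m = "(2 ^ (s + 2) + 3) * 2 ^ (s + 1)"
  define \<epsilon> where "\<epsilon> = \<eta> ^ (2 ^ (s + 2) + 1)"
  have \<eta>1: "\<eta> \<le> 1" using Suc.prems by simp
  have \<epsilon>: "0 < \<epsilon>" "\<epsilon> \<le> 1 / 2" "1 \<le> real p * \<epsilon> ^ B"
  proof -
    show "0 < \<epsilon>" using Suc.prems by (simp add: \<epsilon>_def)
    have "\<epsilon> \<le> \<eta> ^ 1" unfolding \<epsilon>_def using Suc.prems by (intro power_decreasing) auto
    then show "\<epsilon> \<le> 1 / 2" using Suc.prems by simp
    show "1 \<le> real p * \<epsilon> ^ B" unfolding \<epsilon>_def power_mult[symmetric]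
      by (rule power_cond_mono[OF Suc.prems(3)]) (use Suc.prems in auto)
  qed
  have half: "\<eta>\<^sup>2 \<le> \<eta> / 2" using Suc.prems by (simp add: power2_eq_square)
  have half': "\<eta> ^ (2 ^ (s + 2)) \<le> (\<eta> / 2) ^ (2 ^ ?R)"
  proof -
    have "\<eta> ^ (2 ^ (s + 2)) = (\<eta>\<^sup>2) ^ (2 ^ ?R)" by (simp flip: power_mult)
    also have "\<dots> \<le> (\<eta> / 2) ^ (2 ^ ?R)" using half by (intro power_mono) auto
    finally show ?thesis .
  qed
  have \<epsilon>2: "\<epsilon> \<le> (\<eta> / 2) ^ (2 ^ ?R) / 2"
  proof -
    have "\<epsilon> = \<eta> ^ (2 ^ (s + 2)) * \<eta>" by (simp add: \<epsilon>_def)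
    also have "\<dots> \<le> (\<eta> / 2) ^ (2 ^ ?R) * (1 / 2)" using half' Suc.prems by (intro mult_mono) auto
    finally show ?thesis by simp
  qed
  have step: "((\<eta> / 2) ^ (2 ^ ?R) / 2 * (\<eta> / 2)) ^ (2 ^ ?R) \<le> cmod (bx (replicate (?R + 1) v) H)"
  proof (rule degree_lowering[OF Z inv])
    show "cmod (avg Z (\<lambda>z. avg X (\<lambda>x. \<chi> x * dl (replicate ?R v) ns (F z) x))) \<le>
        ravg X (\<lambda>x. if \<chi> x \<noteq> 0 \<and> int p dvd \<psi> x then 1 else 0) + \<epsilon>"
      if "bd \<chi>" "eig v \<psi> \<chi>" "invar us \<chi>" for ns \<chi> \<psi>
      by (rule star[OF that(1,2) \<epsilon>])
    show "\<eta> \<le> cmod (bx (replicate (?R + 2) v) H)" using Suc.prems(4) by simp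
  qed (use Suc.prems \<epsilon>2 in auto)
  have "\<eta> ^ ?m = (\<eta> ^ (2 ^ (s + 2)) * \<eta> * \<eta>\<^sup>2) ^ (2 ^ ?R)"
    by (simp flip: power_mult add: power2_eq_square power_add[symmetric] numeral_eq_Suc algebra_simps)
  also have "\<dots> \<le> ((\<eta> / 2) ^ (2 ^ ?R) * (1 / 2) * (\<eta> / 2)) ^ (2 ^ ?R)"
    using half half' Suc.prems by (intro power_mono mult_mono) auto
  also have "\<dots> \<le> cmod (bx (replicate (s + 2) v) H)" using step by simp
  finally have m: "\<eta> ^ ?m \<le> cmod (bx (replicate (s + 2) v) H)" .
  have "(\<eta> ^ ?m) ^ DM B s \<le> cmod (bx [v, v] H)"
  proof (rule Suc.IH[OF _ _ _ m])
    show "0 < \<eta> ^ ?m" using Suc.prems by simp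
    have "\<eta> ^ ?m \<le> \<eta> ^ 1" using Suc.prems by (intro power_decreasing) auto
    then show "\<eta> ^ ?m \<le> 1 / 2" using Suc.prems by simp
    show "1 \<le> real p * (\<eta> ^ ?m) ^ DM B s" unfolding power_mult[symmetric]
      by (rule power_cond_mono[OF Suc.prems(3)]) (use Suc.prems in auto)
  qed
  moreover have "\<eta> ^ DM B (Suc s) \<le> (\<eta> ^ ?m) ^ DM B s" unfolding power_mult[symmetric]
    using Suc.prems \<eta>1 by (intro power_decreasing) auto
  ultimately show ?case by linarith
qed

end

section \<open>Polynomial averages\<close>

locale zpoly = zact p X act for p and X :: "'x set" and act :: "'v::comm_ring_1 \<Rightarrow> 'x \<Rightarrow> 'x" +
  fixes K :: "nat set" and P :: "nat \<Rightarrow> int poly"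
  assumes finK: "finite K" and good: "goodp K P p" and P0: "\<And>i. i \<in> K \<Longrightarrow> coeff (P i) 0 = 0"
begin

text \<open>The indices in \<open>S\<close> carry arbitrary functions \<open>f i\<close>; those in \<open>I\<close> carry phases, linear in
  \<open>P i\<close> with an arbitrary frequency \<open>\<phi> i x\<close>.\<close>

definition kern :: "nat set \<Rightarrow> nat set \<Rightarrow> (nat \<Rightarrow> 'v) \<Rightarrow> ('x \<Rightarrow> complex) \<Rightarrow> (nat \<Rightarrow> 'x \<Rightarrow> complex) \<Rightarrow>
    (nat \<Rightarrow> 'x \<Rightarrow> int) \<Rightarrow> int \<Rightarrow> 'x \<Rightarrow> complex" where
  "kern I S v g f \<phi> y x = g x * e_p p (\<Sum>i\<in>I. \<phi> i x * poly (P i) y) *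
     (\<Prod>i\<in>S. f i (act (of_int (poly (P i) y) * v i) x))"

definition lam where
  "lam I S v \<theta> g f \<phi> = avg X (\<lambda>x. avg (Fp p) (\<lambda>y. \<theta> y * kern I S v g f \<phi> y x))"

text \<open>The expected value: a frequency nonzero modulo \<open>p\<close> averages the phase away,
  and the values of the \<open>P i\<close> behave like independent residues.\<close>

definition mn where
  "mn I S v g f \<phi> = avg X (\<lambda>x. g x * (if \<forall>i\<in>I. int p dvd \<phi> i x then 1 else 0) * (\<Prod>i\<in>S. A (v i) (f i) x))"

text \<open>Averaged over \<open>y\<close>, this is the dual function of slot \<open>l\<close>
  (\<open>lam_dual\<close>).\<close>

definition du where
  "du I S v g f \<phi> l y x = kern I (S - {l}) v g f \<phi> y (act (- (of_int (poly (P l) y) * v l)) x)"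

abbreviation one :: "int \<Rightarrow> complex" where "one \<equiv> \<lambda>_. 1"

text \<open>In effect, \<open>\<bar>z\<bar> \<le> p\<^bsup>-1/B\<^esup>\<close>; this form composes without rational exponents.\<close>

definition small :: "nat \<Rightarrow> complex \<Rightarrow> bool" where
  "small B z \<longleftrightarrow> (\<forall>\<delta>. 0 < \<delta> \<longrightarrow> \<delta> \<le> 1 / 2 \<longrightarrow> 1 \<le> real p * \<delta> ^ B \<longrightarrow> cmod z \<le> \<delta>)"

text \<open>The list \<open>us\<close> spans the subspace along which \<open>f k\<close> is already
  invariant; its codimension drives an induction.\<close>

definition Q_ok :: "nat set \<Rightarrow> (nat \<Rightarrow> 'v) \<Rightarrow> (int \<Rightarrow> complex) \<Rightarrow> nat \<Rightarrow> 'v list \<Rightarrow> nat \<Rightarrow> bool" where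
  "Q_ok S v \<theta> k us B \<longleftrightarrow> (\<forall>g f \<phi>. bd g \<longrightarrow> (\<forall>i. bd (f i)) \<longrightarrow> invar us (f k) \<longrightarrow>
     small B (lam (K - S) S v \<theta> g f \<phi> - avg (Fp p) \<theta> * mn (K - S) S v g f \<phi>))"

definition T_ok :: "nat set \<Rightarrow> (nat \<Rightarrow> 'v) \<Rightarrow> (int \<Rightarrow> complex) \<Rightarrow> nat \<Rightarrow> bool" where
  "T_ok S v \<theta> B \<longleftrightarrow> (\<forall>g f \<phi>. bd g \<longrightarrow> (\<forall>i. bd (f i)) \<longrightarrow>
     small B (lam (K - S) S v \<theta> g f \<phi> - avg (Fp p) \<theta> * mn (K - S) S v g f \<phi>))"

text \<open>Of the directions, \<open>t\<close> are unknown members of \<open>G\<close> and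
  \<open>s\<close> are already \<open>v k\<close>; \<open>smoothing\<close> turns one kind into the
  other.\<close>

definition ctl :: "nat set \<Rightarrow> (nat \<Rightarrow> 'v) \<Rightarrow> nat \<Rightarrow> 'v list \<Rightarrow> 'v set \<Rightarrow> nat \<Rightarrow> nat \<Rightarrow> nat \<Rightarrow> bool" where
  "ctl S v k us G t s B \<longleftrightarrow> (\<forall>g f \<phi> \<delta>. bd g \<longrightarrow> (\<forall>i. bd (f i)) \<longrightarrow> invar us (f k) \<longrightarrow>
     0 < \<delta> \<longrightarrow> \<delta> \<le> 1 / 2 \<longrightarrow> 1 \<le> real p * \<delta> ^ B \<longrightarrow> \<delta> \<le> cmod (lam (K - S) S v one g f \<phi>) \<longrightarrow>
     (\<exists>ws. length ws = t \<and> set ws \<subseteq> G \<and> \<delta> ^ B \<le> cmod (bx (ws @ replicate s (v k)) (f k))))"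

lemma small_mono: "small B z \<Longrightarrow> B \<le> B' \<Longrightarrow> small B' z"
  unfolding small_def using power_cond_mono by blast

lemma T_ok_mono: "T_ok S v \<theta> B \<Longrightarrow> B \<le> B' \<Longrightarrow> T_ok S v \<theta> B'"
  unfolding T_ok_def using small_mono by blast

lemma Q_ok_mono: "Q_ok S v \<theta> k us B \<Longrightarrow> B \<le> B' \<Longrightarrow> Q_ok S v \<theta> k us B'"
  unfolding Q_ok_def using small_mono by blast

lemma Q_ok_Nil: "Q_ok S v \<theta> k [] B \<longleftrightarrow> T_ok S v \<theta> B"
  unfolding T_ok_def Q_ok_def by simp

lemma bd_kern: "bd g \<Longrightarrow> (\<And>i. bd (f i)) \<Longrightarrow> bd (kern I S v g f \<phi> y)"
  unfolding kern_def[abs_def] by (intro bd_mult bd_prod bd_act) (auto simp: bd_def)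

lemma bd_du: "bd g \<Longrightarrow> (\<And>i. bd (f i)) \<Longrightarrow> bd (du I S v g f \<phi> l y)"
  unfolding du_def[abs_def] by (intro bd_act bd_kern)

lemma kern_split:
  assumes "finite S" "l \<in> S"
  shows "kern I S v g f \<phi> y x = f l (act (of_int (poly (P l) y) * v l) x) * kern I (S - {l}) v g f \<phi> y x"
  unfolding kern_def prod.remove[OF assms] by simp

lemma kern_cong: "(\<And>i. i \<in> S \<Longrightarrow> f i = f' i) \<Longrightarrow> kern I S v g f \<phi> y x = kern I S v g f' \<phi> y x"
  unfolding kern_def by (simp cong: prod.cong)

lemma du_upd: "du I S v g (f(l := \<chi>)) \<phi> l y x = du I S v g f \<phi> l y x"
  unfolding du_def by (rule kern_cong) auto

lemma lam_dual:
  assumes "finite S" "l \<in> S"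
  shows "lam I S v \<theta> g f \<phi> = avg X (\<lambda>x. f l x * avg (Fp p) (\<lambda>y. \<theta> y * du I S v g f \<phi> l y x))"
proof -
  have "lam I S v \<theta> g f \<phi> = avg X (\<lambda>x. avg (Fp p) (\<lambda>y. f l x * (\<theta> y * du I S v g f \<phi> l y x)))"
    unfolding lam_def kern_split[OF assms] du_def
    by (subst E_translate[of _ "\<lambda>y. - (of_int (poly (P l) y) * v l)", symmetric]) (simp add: mult_ac)
  then show ?thesis by (simp only: avg_cmult)
qed

lemma lam_upd:
  assumes "finite S" "l \<in> S"
  shows "lam I S v \<theta> g (f(l := \<chi>)) \<phi> = avg X (\<lambda>x. \<chi> x * avg (Fp p) (\<lambda>y. \<theta> y * du I S v g f \<phi> l y x))"
  unfolding lam_dual[OF assms] du_upd by simp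

lemma lam_upd': "finite S \<Longrightarrow> l \<in> S \<Longrightarrow>
    lam I S v one g (f(l := \<chi>)) \<phi> = avg (Fp p) (\<lambda>y. avg X (\<lambda>x. \<chi> x * du I S v g f \<phi> l y x))"
  by (simp add: lam_upd avg_cmult[symmetric] avg_swap[of X])

text \<open>Differentiation replaces each frequency by a difference of it in \<open>x\<close> and
  keeps the factor \<open>poly (P i) y\<close>. This closure requires frequencies that are arbitrary
  functions of \<open>x\<close>.\<close>

lemma kern_D: "D a (kern I S v g f \<phi> y) =
    kern I S v (D a g) (\<lambda>i. D a (f i)) (\<lambda>i x. \<phi> i (act a x) - \<phi> i x) y"
proof
  fix x
  have e: "e_p p (\<Sum>i\<in>I. (\<phi> i (act a x) - \<phi> i x) * poly (P i) y) =
    e_p p (\<Sum>i\<in>I. \<phi> i (act a x) * poly (P i) y) * cnj (e_p p (\<Sum>i\<in>I. \<phi> i x * poly (P i) y))"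
    by (simp add: cnj_e_p left_diff_distrib sum_subtractf flip: e_p_add)
  show "D a (kern I S v g f \<phi> y) x = kern I S v (D a g) (\<lambda>i. D a (f i)) (\<lambda>i x. \<phi> i (act a x) - \<phi> i x) y x"
    unfolding kern_def D_def e by (simp add: prod.distrib act_comm[of a] mult_ac)
qed

lemma kern_dl: "\<exists>\<phi>'. \<forall>y. dl us ns (kern I S v g f \<phi> y) = kern I S v (dl us ns g) (\<lambda>i. dl us ns (f i)) \<phi>' y"
proof (induction us arbitrary: ns g f \<phi>)
  case (Cons u us)
  show ?case using Cons.IH[of "tl ns" "D (of_int (hd ns) * u) g" "\<lambda>i. D (of_int (hd ns) * u) (f i)"]
    by (simp add: kern_D)
qed auto

lemma du_dl: "\<exists>\<phi>'. \<forall>y. dl us ns (du I S v g f \<phi> l y) = du I S v (dl us ns g) (\<lambda>i. dl us ns (f i)) \<phi>' l y"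
proof -
  obtain \<phi>' where "\<And>y. dl us ns (kern I (S - {l}) v g f \<phi> y) = kern I (S - {l}) v (dl us ns g) (\<lambda>i. dl us ns (f i)) \<phi>' y"
    using kern_dl by blast
  then show ?thesis unfolding du_def[abs_def] by (auto simp: dl_act)
qed

text \<open>A derivative of a dual function is again a dual function, so correlating it with \<chi>
  gives an average of the original form with a translate of \<chi> in slot \<open>l\<close>.\<close>

lemma dual_corr:
  assumes "finite S" "l \<in> S"
  shows "\<exists>\<phi>'. avg (Fp p) (\<lambda>y. avg X (\<lambda>x. \<chi> x * dl us ns (\<lambda>x. du I S v g f \<phi> l y (act a x)) x)) =
    lam I S v one (dl us ns g) ((\<lambda>i. dl us ns (f i))(l := \<lambda>x. \<chi> (act (- a) x))) \<phi>'"
proof -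
  obtain \<phi>' where \<phi>': "\<And>y. dl us ns (du I S v g f \<phi> l y) = du I S v (dl us ns g) (\<lambda>i. dl us ns (f i)) \<phi>' l y"
    using du_dl by blast
  have "avg X (\<lambda>x. \<chi> x * dl us ns (\<lambda>x. du I S v g f \<phi> l y (act a x)) x) =
      avg X (\<lambda>x. \<chi> (act (- a) x) * du I S v (dl us ns g) (\<lambda>i. dl us ns (f i)) \<phi>' l y x)" for y
    using E_shift[of "\<lambda>x. \<chi> (act (- a) x) * du I S v (dl us ns g) (\<lambda>i. dl us ns (f i)) \<phi>' l y x" a]
    by (simp add: dl_act \<phi>')
  then show ?thesis unfolding lam_upd'[OF assms] by auto
qed

text \<open>On an eigenfunction the shift by a multiple P_l(y) of v_l acts as a phase linear in
  P_l(y), so \<open>l\<close> passes from \<open>S\<close> to the phases.\<close>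

lemma lam_eig:
  assumes "finite S" "l \<in> S" "finite I" "l \<notin> I" "eig (v l) \<psi> \<chi>"
  shows "lam I S v \<theta> g (f(l := \<chi>)) \<phi> = lam (insert l I) (S - {l}) v \<theta> (\<lambda>x. g x * \<chi> x) f (\<phi>(l := \<psi>))"
proof -
  have "kern I S v g (f(l := \<chi>)) \<phi> y x = kern (insert l I) (S - {l}) v (\<lambda>x. g x * \<chi> x) f (\<phi>(l := \<psi>)) y x" for y x
  proof -
    have 1: "\<chi> (act (of_int (poly (P l) y) * v l) x) = e_p p (\<psi> x * poly (P l) y) * \<chi> x"
      using assms(5) by (simp add: eig_def mult.commute[of "\<psi> x"])
    have 2: "(\<Sum>i\<in>insert l I. (\<phi>(l := \<psi>)) i x * poly (P i) y) = \<psi> x * poly (P l) y + (\<Sum>i\<in>I. \<phi> i x * poly (P i) y)"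
    proof -
      have "(\<Sum>i\<in>I. (\<phi>(l := \<psi>)) i x * poly (P i) y) = (\<Sum>i\<in>I. \<phi> i x * poly (P i) y)"
        using assms(4) by (intro sum.cong) auto
      then show ?thesis using assms(3,4) by simp
    qed
    have 3: "(\<Prod>i\<in>S - {l}. (f(l := \<chi>)) i (act (of_int (poly (P i) y) * v i) x)) = (\<Prod>i\<in>S - {l}. f i (act (of_int (poly (P i) y) * v i) x))"
      by (intro prod.cong) auto
    show ?thesis unfolding kern_split[OF assms(1,2)] unfolding kern_def 2 3 e_p_add fun_upd_same 1 by (simp only: mult_ac)
  qed
  then show ?thesis unfolding lam_def by simp
qed

lemma eig_0: "invar [w] \<chi> \<Longrightarrow> eig w (\<lambda>_. 0) \<chi>"
  by (simp add: eig_def invar_def)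

lemma mn_inv:
  assumes "finite S" "l \<in> S" "finite I" "l \<notin> I" "invar [v l] \<chi>"
  shows "mn I S v g (f(l := \<chi>)) \<phi> = mn (insert l I) (S - {l}) v (\<lambda>x. g x * \<chi> x) f (\<phi>(l := \<lambda>_. 0))"
proof -
  have 1: "(\<Prod>i\<in>S. A (v i) ((f(l := \<chi>)) i) x) = \<chi> x * (\<Prod>i\<in>S - {l}. A (v i) (f i) x)" for x
  proof -
    have "(\<Prod>i\<in>S - {l}. A (v i) ((f(l := \<chi>)) i) x) = (\<Prod>i\<in>S - {l}. A (v i) (f i) x)" by (intro prod.cong) auto
    then show ?thesis unfolding prod.remove[OF assms(1,2)] by (simp add: A_invar[OF assms(5)])
  qed
  have 2: "(\<forall>i\<in>insert l I. int p dvd (\<phi>(l := \<lambda>_. 0)) i x) \<longleftrightarrow> (\<forall>i\<in>I. int p dvd \<phi> i x)" for x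
    using assms(4) by auto
  show ?thesis unfolding mn_def 1 2 by (simp add: mult_ac)
qed

lemma mn_le_freq:
  assumes "bd g" "\<And>i. bd (f i)" "l \<in> I"
  shows "cmod (mn I S v g f \<phi>) \<le> ravg X (\<lambda>x. if g x \<noteq> 0 \<and> int p dvd \<phi> l x then 1 else 0)"
  unfolding mn_def
proof (rule order_trans[OF norm_avg_le ravg_mono])
  fix x
  have "cmod (\<Prod>i\<in>S. A (v i) (f i) x) \<le> 1" using bd_prod[of S "\<lambda>i. A (v i) (f i)"] bd_A assms(2) by (simp add: bd_def)
  moreover have "cmod (g x) \<le> 1" using assms(1) by (simp add: bd_def)
  ultimately show "cmod (g x * (if \<forall>i\<in>I. int p dvd \<phi> i x then 1 else 0) * (\<Prod>i\<in>S. A (v i) (f i) x)) \<le>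
      (if g x \<noteq> 0 \<and> int p dvd \<phi> l x then 1 else 0)"
    using assms(3) by (auto simp: norm_mult mult_le_one)
qed

lemma mn_le_A:
  assumes "bd g" "\<And>i. bd (f i)" "finite S" "j \<in> S"
  shows "cmod (mn I S v g f \<phi>) \<le> ravg X (\<lambda>x. cmod (A (v j) (f j) x))"
  unfolding mn_def
proof (rule order_trans[OF norm_avg_le ravg_mono])
  fix x
  have 1: "cmod (\<Prod>i\<in>S - {j}. A (v i) (f i) x) \<le> 1"
    using bd_prod[of "S - {j}" "\<lambda>i. A (v i) (f i)"] bd_A assms(2) by (simp add: bd_def)
  have "cmod (g x * (if \<forall>i\<in>I. int p dvd \<phi> i x then 1 else 0)) \<le> 1" using assms(1) by (auto simp: bd_def norm_mult)
  then have "cmod (g x * (if \<forall>i\<in>I. int p dvd \<phi> i x then 1 else 0)) * cmod (\<Prod>i\<in>S - {j}. A (v i) (f i) x) \<le> 1"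
    using 1 by (intro mult_le_one) auto
  then have "cmod (g x * (if \<forall>i\<in>I. int p dvd \<phi> i x then 1 else 0)) * cmod (\<Prod>i\<in>S - {j}. A (v i) (f i) x) *
      cmod (A (v j) (f j) x) \<le> 1 * cmod (A (v j) (f j) x)" by (intro mult_right_mono) auto
  then show "cmod (g x * (if \<forall>i\<in>I. int p dvd \<phi> i x then 1 else 0) * (\<Prod>i\<in>S. A (v i) (f i) x)) \<le> cmod (A (v j) (f j) x)"
    unfolding prod.remove[OF assms(3,4)] by (simp add: norm_mult mult_ac)
qed

lemma avg_one [simp]: "avg (Fp p) one = 1"
  by (simp add: avg_const Fp_ne)

lemma bd_upd: "(\<And>i. bd (f i)) \<Longrightarrow> bd \<chi> \<Longrightarrow> bd ((f(l := \<chi>)) i)"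
  by simp

lemma smallD: "small B z \<Longrightarrow> 0 < \<delta> \<Longrightarrow> \<delta> \<le> 1 / 2 \<Longrightarrow> 1 \<le> real p * \<delta> ^ B \<Longrightarrow> cmod z \<le> \<delta>"
  by (simp add: small_def)

lemma norm_le_add: "cmod (a - b) \<le> \<delta> \<Longrightarrow> cmod b \<le> r \<Longrightarrow> cmod a \<le> r + \<delta>"
  using norm_triangle_ineq2[of a b] by linarith

text \<open>Supplies the hypothesis \<open>star\<close> of degree lowering: once \<open>l\<close>
  carries a phase, the estimate for S - {l} applies, and its main term lives where the frequency
  vanishes modulo \<open>p\<close>.\<close>

lemma T_eig:
  assumes S: "S \<subseteq> K" "l \<in> S" and T: "T_ok (S - {l}) v \<theta> B" and \<theta>: "cmod (avg (Fp p) \<theta>) \<le> 1"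
    and bd: "bd g" "\<And>i. bd (f i)" "bd \<chi>" "eig (v l) \<psi> \<chi>"
    and \<delta>: "0 < \<delta>" "\<delta> \<le> 1 / 2" "1 \<le> real p * \<delta> ^ B"
  shows "cmod (lam (K - S) S v \<theta> g (f(l := \<chi>)) \<phi>) \<le> ravg X (\<lambda>x. if \<chi> x \<noteq> 0 \<and> int p dvd \<psi> x then 1 else 0) + \<delta>"
proof -
  have finS: "finite S" using S finK finite_subset by blast
  have K: "K - (S - {l}) = insert l (K - S)" using S by auto
  have bdg: "bd (\<lambda>x. g x * \<chi> x)" using bd by (intro bd_mult)
  have eq: "lam (K - S) S v \<theta> g (f(l := \<chi>)) \<phi> = lam (K - (S - {l})) (S - {l}) v \<theta> (\<lambda>x. g x * \<chi> x) f (\<phi>(l := \<psi>))"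
    unfolding K using S finS finK bd(4) by (intro lam_eig) auto
  have "cmod (lam (K - (S - {l})) (S - {l}) v \<theta> (\<lambda>x. g x * \<chi> x) f (\<phi>(l := \<psi>)) -
      avg (Fp p) \<theta> * mn (K - (S - {l})) (S - {l}) v (\<lambda>x. g x * \<chi> x) f (\<phi>(l := \<psi>))) \<le> \<delta>"
    using T bdg bd(2) \<delta> unfolding T_ok_def small_def by blast
  moreover have "cmod (avg (Fp p) \<theta> * mn (K - (S - {l})) (S - {l}) v (\<lambda>x. g x * \<chi> x) f (\<phi>(l := \<psi>))) \<le>
      ravg X (\<lambda>x. if \<chi> x \<noteq> 0 \<and> int p dvd \<psi> x then 1 else 0)"
  proof -
    have "cmod (mn (K - (S - {l})) (S - {l}) v (\<lambda>x. g x * \<chi> x) f (\<phi>(l := \<psi>))) \<le>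
        ravg X (\<lambda>x. if g x * \<chi> x \<noteq> 0 \<and> int p dvd (\<phi>(l := \<psi>)) l x then 1 else 0)"
      using bdg bd(2) by (intro mn_le_freq) (auto simp: K)
    also have "\<dots> \<le> ravg X (\<lambda>x. if \<chi> x \<noteq> 0 \<and> int p dvd \<psi> x then 1 else 0)" by (intro ravg_mono) auto
    finally have "cmod (mn (K - (S - {l})) (S - {l}) v (\<lambda>x. g x * \<chi> x) f (\<phi>(l := \<psi>))) \<le>
        ravg X (\<lambda>x. if \<chi> x \<noteq> 0 \<and> int p dvd \<psi> x then 1 else 0)" .
    moreover have "cmod (avg (Fp p) \<theta> * m) \<le> cmod m" for m
      using \<theta> by (simp add: norm_mult mult_left_le_one_le)
    ultimately show ?thesis using order_trans by blast
  qed
  ultimately show ?thesis unfolding eq by (rule norm_le_add)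
qed

lemma Q_bound:
  assumes S: "S \<subseteq> K" "j \<in> S" and Q: "Q_ok S v one k us B" and bd: "bd g" "\<And>i. bd (f i)" "invar us (f k)"
    and \<delta>: "0 < \<delta>" "\<delta> \<le> 1 / 2" "1 \<le> real p * \<delta> ^ B"
  shows "cmod (lam (K - S) S v one g f \<phi>) \<le> ravg X (\<lambda>x. cmod (A (v j) (f j) x)) + \<delta>"
proof -
  have finS: "finite S" using S finK finite_subset by blast
  have "cmod (lam (K - S) S v one g f \<phi> - mn (K - S) S v g f \<phi>) \<le> \<delta>"
    using Q bd \<delta> unfolding Q_ok_def small_def by (metis avg_one mult_1)
  moreover have "cmod (mn (K - S) S v g f \<phi>) \<le> ravg X (\<lambda>x. cmod (A (v j) (f j) x))"
    using bd S finS by (intro mn_le_A) auto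
  ultimately show ?thesis by (rule norm_le_add)
qed

text \<open>A function invariant along \<open>v j\<close> is an eigenfunction of frequency 0. So
  \<open>j\<close> leaves \<open>S\<close>, and the main term for the smaller set still contains the
  average of \<open>f k\<close>.\<close>

lemma T_inv_bound:
  assumes S: "S \<subseteq> K" "j \<in> S" "k \<in> S" "j \<noteq> k" and T: "T_ok (S - {j}) v one B" and bd: "bd g" "\<And>i. bd (f i)" "bd \<chi>" "invar [v j] \<chi>"
    and \<delta>: "0 < \<delta>" "\<delta> \<le> 1 / 2" "1 \<le> real p * \<delta> ^ B"
  shows "cmod (lam (K - S) S v one g (f(j := \<chi>)) \<phi>) \<le> ravg X (\<lambda>x. cmod (A (v k) (f k) x)) + \<delta>"
proof -
  have finS: "finite S" using S finK finite_subset by blast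
  have K: "K - (S - {j}) = insert j (K - S)" using S by auto
  have "lam (K - S) S v one g (f(j := \<chi>)) \<phi> = lam (K - (S - {j})) (S - {j}) v one (\<lambda>x. g x * \<chi> x) f (\<phi>(j := \<lambda>_. 0))"
    unfolding K using S finS finK eig_0[OF bd(4)] by (intro lam_eig) auto
  then show ?thesis
    using Q_bound[of "S - {j}" k v k "[]" B "\<lambda>x. g x * \<chi> x" f \<delta> "\<phi>(j := \<lambda>_. 0)"] S T bd \<delta> bd_mult[OF bd(1,3)]
    by (auto simp: Q_ok_Nil)
qed

end

section \<open>From box norm control to the main estimate\<close>

context zpoly
begin

lemma power_le_half: "0 < \<delta> \<Longrightarrow> \<delta> \<le> 1 / 2 \<Longrightarrow> 1 \<le> n \<Longrightarrow> \<delta> ^ n \<le> (1 / 2 :: real)"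
  using power_decreasing[of 1 n \<delta>] by simp

lemma A_half: "A u (\<lambda>x. (f x - g x) / 2) x = (A u f x - A u g x) / 2"
  unfolding A_def avg_diff[symmetric] using avg_cmult[of "Fp p" "1 / 2"] by simp

text \<open>By Cauchy--Schwarz an arbitrary function may be replaced by the conjugate of its dual
  function at the cost of a square.\<close>

lemma dual_square:
  assumes "bd h" "0 < \<delta>" "\<delta> \<le> cmod (avg X (\<lambda>x. h x * F x))"
  shows "\<delta>\<^sup>2 \<le> cmod (avg X (\<lambda>x. cnj (F x) * F x))"
proof -
  have "\<delta>\<^sup>2 \<le> (cmod (avg X (\<lambda>x. h x * F x)))\<^sup>2" using assms by (intro power_mono) auto
  also have "\<dots> \<le> ravg X (\<lambda>x. (cmod (F x))\<^sup>2)" using assms(1) by (intro avg_cauchy_schwarz) (simp add: bd_def)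
  also have "\<dots> = cmod (of_real (ravg X (\<lambda>x. (cmod (F x))\<^sup>2)) :: complex)" by (simp add: ravg_nonneg)
  also have "(of_real (ravg X (\<lambda>x. (cmod (F x))\<^sup>2)) :: complex) = avg X (\<lambda>x. cnj (F x) * F x)"
    unfolding avg_of_real[symmetric] using complex_norm_square by (intro avg_cong) (simp add: mult.commute)
  finally show ?thesis .
qed

text \<open>The symmetrised dual function of \<open>f k\<close>, written as an average so that the interchange
  lemma applies: the sign in \<open>F - A F\<close> is absorbed into \<open>g\<close>.\<close>

lemma mean_zero_dual:
  fixes us :: "'v list" and v :: "nat \<Rightarrow> 'v" and \<phi> :: "nat \<Rightarrow> 'x \<Rightarrow> int"
  assumes S: "S \<subseteq> K" "k \<in> S" and bd: "bd g" "\<And>i. bd (f i)"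
  defines "F \<equiv> Av us (\<lambda>x. avg (Fp p) (\<lambda>y. du (K - S) S v g f \<phi> k y x))"
  defines "H \<equiv> \<lambda>x. (F x - A (v k) F x) / 2"
  shows "\<exists>(Z :: (bool \<times> int \<times> int list \<times> int) set) Fz. (\<forall>z. bd (Fz z)) \<and> (\<forall>x. H x = avg Z (\<lambda>z. Fz z x)) \<and>
    (\<forall>\<chi> ns vs M. (\<forall>a g'. bd g' \<longrightarrow> (\<forall>\<phi>' f'. (\<forall>i. bd (f' i)) \<longrightarrow> cmod (lam (K - S) S v one g' (f'(k := \<lambda>x. \<chi> (act (- a) x))) \<phi>') \<le> M)) \<longrightarrow>
        0 \<le> M \<longrightarrow> cmod (avg Z (\<lambda>z. avg X (\<lambda>x. \<chi> x * dl vs ns (Fz z) x))) \<le> M)"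
proof -
  have finS: "finite S" using S finK finite_subset by blast
  define gs where "gs \<sigma> = (if \<sigma> then (\<lambda>x. - g x) else g)" for \<sigma>
  \<comment> \<open>The value \<open>True\<close> selects the term - A F with \<open>n\<close> as
    averaging variable; for \<open>False\<close> the function is constant in
    \<open>n\<close>.\<close>
  define sh where "sh \<sigma> n ms = lc us ms + (if \<sigma> then of_int n * v k else 0)" for \<sigma> and n :: int and ms
  define Fz where "Fz z = (case z of (\<sigma>, n, ms, y) \<Rightarrow> (\<lambda>x. du (K - S) S v (gs \<sigma>) f \<phi> k y (act (sh \<sigma> n ms) x)))" for z
  define Z where "Z = (UNIV :: bool set) \<times> Fp p \<times> L (length us) \<times> Fp p"
  have bdgs: "bd (gs \<sigma>)" for \<sigma> using bd(1) by (auto simp: gs_def bd_def)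
  have bdFz: "bd (Fz z)" for z
    unfolding Fz_def by (cases z) (auto intro!: bd_act bd_du bdgs bd(2))
  have neg: "du (K - S) S v (\<lambda>x. - g x) f \<phi> k y x = - du (K - S) S v g f \<phi> k y x" for y x
    by (simp add: du_def kern_def)
  have H: "H x = avg Z (\<lambda>z. Fz z x)" for x
  proof -
    have T: "avg (Fp p) (\<lambda>n. avg (L (length us)) (\<lambda>ms. avg (Fp p) (\<lambda>y. Fz (True, n, ms, y) x))) = - A (v k) F x"
    proof -
      have "avg (L (length us)) (\<lambda>ms. avg (Fp p) (\<lambda>y. Fz (True, n, ms, y) x)) = - 1 * F (act (of_int n * v k) x)" for n
        unfolding F_def Av_def avg_cmult[symmetric] Fz_def
        by (intro avg_cong) (simp add: sh_def gs_def act_add neg)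
      then show ?thesis by (simp add: A_def avg_cmult[of _ "-1", simplified])
    qed
    have F: "avg (Fp p) (\<lambda>n. avg (L (length us)) (\<lambda>ms. avg (Fp p) (\<lambda>y. Fz (False, n, ms, y) x))) = F x"
      by (simp add: Fz_def sh_def gs_def F_def Av_def avg_const Fp_ne)
    show ?thesis unfolding Z_def avg_Times avg_bool T F H_def by simp
  qed
  have star: "cmod (avg Z (\<lambda>z. avg X (\<lambda>x. \<chi> x * dl vs ns (Fz z) x))) \<le> M"
    if M: "\<And>a g' \<phi>' f'. bd g' \<Longrightarrow> (\<And>i. bd (f' i)) \<Longrightarrow> cmod (lam (K - S) S v one g' (f'(k := \<lambda>x. \<chi> (act (- a) x))) \<phi>') \<le> M" "0 \<le> M"
    for \<chi> ns vs M
  proof -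
    have 1: "cmod (avg (Fp p) (\<lambda>y. avg X (\<lambda>x. \<chi> x * dl vs ns (Fz (\<sigma>, n, ms, y)) x))) \<le> M" for \<sigma> n ms
    proof -
      obtain \<phi>' where "avg (Fp p) (\<lambda>y. avg X (\<lambda>x. \<chi> x * dl vs ns (Fz (\<sigma>, n, ms, y)) x)) =
        lam (K - S) S v one (dl vs ns (gs \<sigma>)) ((\<lambda>i. dl vs ns (f i))(k := \<lambda>x. \<chi> (act (- sh \<sigma> n ms) x))) \<phi>'"
        using dual_corr[OF finS S(2)] unfolding Fz_def by fastforce
      then show ?thesis using M(1)[OF bd_dl[OF bdgs] bd_dl[OF bd(2)]] by simp
    qed
    have "cmod (avg (L (length us)) (\<lambda>ms. avg (Fp p) (\<lambda>y. avg X (\<lambda>x. \<chi> x * dl vs ns (Fz (\<sigma>, n, ms, y)) x)))) \<le> M" for \<sigma> n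
      by (rule norm_avg_le_bound[OF 1 M(2)])
    then have "cmod (avg (Fp p) (\<lambda>n. avg (L (length us)) (\<lambda>ms. avg (Fp p) (\<lambda>y. avg X (\<lambda>x. \<chi> x * dl vs ns (Fz (\<sigma>, n, ms, y)) x))))) \<le> M" for \<sigma>
      by (rule norm_avg_le_bound[OF _ M(2)])
    then show ?thesis unfolding Z_def avg_Times by (rule norm_avg_le_bound[OF _ M(2)])
  qed
  show ?thesis
    apply (rule exI[of _ Z], rule exI[of _ Fz])
    using bdFz H star by blast
qed

text \<open>The factor 3 pays for the dual function, as \<delta>^2/2 \<ge> \<delta>^3; B1 + 1 pays
  for \<open>ctl\<close>, with + 1 keeping \<eta> \<le> 1/2 for B1 = 0; \<open>DM\<close> pays for
  degree lowering; 2 B2 + 1 admits the error \<eta>2^2 in the final comparison.\<close>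

definition DB :: "nat \<Rightarrow> nat \<Rightarrow> nat \<Rightarrow> nat" where
  "DB s B1 B2 = 3 * (B1 + 1) * DM B2 s * (2 * B2 + 1)"

text \<open>By contradiction: the symmetrised dual function \<open>H\<close> has a large box norm by
  \<open>ctl\<close>, then a large U^2 norm. Its zero average along \<open>v k\<close> excludes
  frequency 0 for the correlating eigenfunction, and then the estimate for S - {k} has main term
  0.\<close>

lemma mean_zero_small:
  assumes S: "S \<subseteq> K" "k \<in> S" and ctl: "ctl S v k us G 0 (s + 2) B1" and T: "T_ok (S - {k}) v one B2"
    and bd: "bd g" "\<And>i. bd (f i)" "invar us (f k)" "\<And>x. A (v k) (f k) x = 0"
    and \<delta>: "0 < \<delta>" "\<delta> \<le> 1 / 2" "1 \<le> real p * \<delta> ^ DB s B1 B2"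
  shows "cmod (lam (K - S) S v one g f \<phi>) \<le> \<delta>"
proof (rule ccontr)
  assume "\<not> ?thesis"
  then have big: "\<delta> \<le> cmod (lam (K - S) S v one g f \<phi>)" by simp
  have finS: "finite S" using S finK finite_subset by blast
  let ?v = "v k"
  define F0 where "F0 x = avg (Fp p) (\<lambda>y. du (K - S) S v g f \<phi> k y x)" for x
  define F where "F = Av us F0"
  define H where "H x = (F x - A ?v F x) / 2" for x
  have bdF: "bd F" unfolding F_def F0_def[abs_def] by (intro bd_Av bd_avg bd_du bd)
  have AH: "A ?v H x = 0" for x
    unfolding H_def[abs_def] A_half A_invar[OF invar_A_self[of ?v F]] by simp
  have invF: "invar us F" unfolding F_def by (rule invar_Av)
  have invH: "invar us H" using invF invar_A[OF invF, of ?v] unfolding H_def[abs_def] by (simp add: invar_def)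
  have bdH: "bd H"
    unfolding bd_def
  proof
    fix x
    have "cmod (F x) \<le> 1" "cmod (A ?v F x) \<le> 1" using bdF bd_A[OF bdF] by (auto simp: bd_def)
    then have "cmod (F x - A ?v F x) \<le> 2" using norm_triangle_ineq4[of "F x" "A ?v F x"] by linarith
    then show "cmod (H x) \<le> 1" by (simp add: H_def norm_divide)
  qed
  obtain Z :: "(bool \<times> int \<times> int list \<times> int) set" and Fz where Z': "\<forall>z. bd (Fz z)" "\<forall>x. H x = avg Z (\<lambda>z. Fz z x)"
    "\<forall>\<chi> ns vs M. (\<forall>a g'. bd g' \<longrightarrow> (\<forall>\<phi>' f'. (\<forall>i. bd (f' i)) \<longrightarrow> cmod (lam (K - S) S v one g' (f'(k := \<lambda>x. \<chi> (act (- a) x))) \<phi>') \<le> M)) \<longrightarrow>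
        0 \<le> M \<longrightarrow> cmod (avg Z (\<lambda>z. avg X (\<lambda>x. \<chi> x * dl vs ns (Fz z) x))) \<le> M"
    using mean_zero_dual[where us = us and v = v and \<phi> = \<phi> and g = g and f = f, OF S bd(1,2)]
    unfolding H_def[abs_def] F_def F0_def[abs_def] by (elim exE conjE)
  have Z: "bd (Fz z)" "H x = avg Z (\<lambda>z. Fz z x)" for z x using Z'(1,2) by blast+
  have Zs: "cmod (avg Z (\<lambda>z. avg X (\<lambda>x. \<chi> x * dl vs ns (Fz z) x))) \<le> M"
    if "\<And>a g' \<phi>' f'. bd g' \<Longrightarrow> (\<And>i. bd (f' i)) \<Longrightarrow> cmod (lam (K - S) S v one g' (f'(k := \<lambda>x. \<chi> (act (- a) x))) \<phi>') \<le> M" "0 \<le> M"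
    for \<chi> ns vs M
    using that by (intro Z'(3)[rule_format]) auto
  have star: "cmod (avg Z (\<lambda>z. avg X (\<lambda>x. \<chi> x * dl (replicate r ?v) ns (Fz z) x))) \<le>
        ravg X (\<lambda>x. if \<chi> x \<noteq> 0 \<and> int p dvd \<psi> x then 1 else 0) + \<epsilon>"
    if \<chi>: "bd \<chi>" "eig ?v \<psi> \<chi>" and \<epsilon>: "0 < \<epsilon>" "\<epsilon> \<le> 1 / 2" "1 \<le> real p * \<epsilon> ^ B2" for r ns \<chi> \<psi> \<epsilon>
  proof (rule Zs)
    fix a and g' :: "'x \<Rightarrow> complex" and \<phi>' and f' :: "nat \<Rightarrow> 'x \<Rightarrow> complex" assume g': "bd g'" "\<And>i. bd (f' i)"
    have e: "eig ?v (\<lambda>x. \<psi> (act (- a) x)) (\<lambda>x. \<chi> (act (- a) x))"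
      using \<chi>(2) by (simp add: eig_def act_comm[of "- a"])
    have "cmod (lam (K - S) S v one g' (f'(k := \<lambda>x. \<chi> (act (- a) x))) \<phi>') \<le>
        ravg X (\<lambda>x. if \<chi> (act (- a) x) \<noteq> 0 \<and> int p dvd \<psi> (act (- a) x) then 1 else 0) + \<epsilon>"
      by (rule T_eig[OF S T _ g' bd_act[OF \<chi>(1)] e \<epsilon>]) simp
    then show "cmod (lam (K - S) S v one g' (f'(k := \<lambda>x. \<chi> (act (- a) x))) \<phi>') \<le>
        ravg X (\<lambda>x. if \<chi> x \<noteq> 0 \<and> int p dvd \<psi> x then 1 else 0) + \<epsilon>"
      using ravg_shift[of "\<lambda>x. if \<chi> x \<noteq> 0 \<and> int p dvd \<psi> x then 1 else 0" "- a"] by simp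
  next
    show "0 \<le> ravg X (\<lambda>x. if \<chi> x \<noteq> 0 \<and> int p dvd \<psi> x then 1 else 0) + \<epsilon>"
      using \<epsilon> by (intro add_nonneg_nonneg ravg_nonneg) auto
  qed
  have Lf: "lam (K - S) S v one g (f(k := \<chi>)) \<phi> = 2 * avg X (\<lambda>x. \<chi> x * H x)"
    if "invar us \<chi>" "\<And>x. A ?v \<chi> x = 0" for \<chi>
  proof -
    have "2 * avg X (\<lambda>x. \<chi> x * H x) = avg X (\<lambda>x. \<chi> x * F x - \<chi> x * A ?v F x)"
      unfolding avg_cmult[symmetric] by (intro avg_cong) (simp add: H_def field_simps)
    also have "\<dots> = avg X (\<lambda>x. \<chi> x * F x)"
      unfolding avg_diff E_A_sym using that(2) by (simp add: avg_const fin ne)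
    also have "\<dots> = avg X (\<lambda>x. \<chi> x * F0 x)" unfolding F_def by (rule E_Av[OF that(1)])
    also have "\<dots> = lam (K - S) S v one g (f(k := \<chi>)) \<phi>" by (simp add: lam_upd[OF finS S(2)] F0_def)
    finally show ?thesis by simp
  qed
  have "\<delta> \<le> cmod (2 * avg X (\<lambda>x. f k x * H x))" using big Lf[OF bd(3,4)] by simp
  then have "\<delta> / 2 \<le> cmod (avg X (\<lambda>x. f k x * H x))" by (simp add: norm_mult)
  from dual_square[OF bd(2) _ this] \<delta>(1) have "(\<delta> / 2)\<^sup>2 \<le> cmod (avg X (\<lambda>x. cnj (H x) * H x))" by simp
  then have "\<delta>\<^sup>2 / 2 \<le> cmod (2 * avg X (\<lambda>x. cnj (H x) * H x))" by (simp add: norm_mult power2_eq_square field_simps)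
  moreover have "\<delta> ^ 3 \<le> \<delta>\<^sup>2 / 2" using \<delta> by (simp add: power2_eq_square power3_eq_cube)
  moreover have "A ?v (\<lambda>x. cnj (H x)) x = 0" for x
    using arg_cong[OF AH[of x], of cnj] by (simp add: A_def avg_cnj)
  ultimately have L2: "\<delta> ^ 3 \<le> cmod (lam (K - S) S v one g (f(k := \<lambda>x. cnj (H x))) \<phi>)"
    using Lf[OF invar_cnj[OF invH]] by simp
  have DM1: "1 \<le> DM B2 s'" for s'
  proof -
    have "0 < DM B2 s'" by (induction s') auto
    then show ?thesis by simp
  qed
  have cond: "1 \<le> real p * \<delta> ^ n" if "n \<le> DB s B1 B2" for n
    by (rule power_cond_mono[OF \<delta>(3) that \<delta>(1,2)])
  have dm: "1 * 1 \<le> DM B2 s * (2 * B2 + 1)" using DM1[of s] by (intro mult_mono) auto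
  have c1: "3 * B1 \<le> DB s B1 B2"
  proof -
    have "3 * B1 \<le> 3 * (B1 + 1) * (1 * 1)" by simp
    also have "\<dots> \<le> 3 * (B1 + 1) * (DM B2 s * (2 * B2 + 1))" using dm by (intro mult_left_mono) auto
    finally show ?thesis unfolding DB_def by (simp only: mult.assoc)
  qed
  have "\<exists>ws. length ws = 0 \<and> set ws \<subseteq> G \<and> (\<delta> ^ 3) ^ B1 \<le> cmod (bx (ws @ replicate (s + 2) ?v) ((f(k := \<lambda>x. cnj (H x))) k))"
  proof (rule ctl[unfolded ctl_def, rule_format, OF bd(1) _ _ _ _ _ L2])
    show "bd ((f(k := \<lambda>x. cnj (H x))) i)" for i using bd(2) bd_cnj[OF bdH] by simp
    show "invar us ((f(k := \<lambda>x. cnj (H x))) k)" using invar_cnj[OF invH] by simp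
    show "0 < \<delta> ^ 3" "\<delta> ^ 3 \<le> 1 / 2" using \<delta> power_le_half[of \<delta> 3] by auto
    show "1 \<le> real p * (\<delta> ^ 3) ^ B1" unfolding power_mult[symmetric] by (rule cond[OF c1])
  qed
  then have "(\<delta> ^ 3) ^ B1 \<le> cmod (bx (replicate (s + 2) ?v) H)" by (simp add: bx_cnj del: replicate_Suc)
  moreover define \<eta> where "\<eta> = \<delta> ^ (3 * (B1 + 1))"
  moreover have "\<eta> \<le> (\<delta> ^ 3) ^ B1" unfolding \<eta>_def power_mult[symmetric] using \<delta> by (intro power_decreasing) auto
  ultimately have \<eta>: "\<eta> \<le> cmod (bx (replicate (s + 2) ?v) H)" by linarith
  have \<eta>0: "0 < \<eta>" "\<eta> \<le> 1 / 2" unfolding \<eta>_def using \<delta> power_le_half[of \<delta> "3 * (B1 + 1)"] by auto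
  have "\<eta> ^ DM B2 s \<le> cmod (bx [?v, ?v] H)"
  proof (rule lower_all[OF Z(1,2) invH star \<eta>0 _ \<eta>])
    show "1 \<le> real p * \<eta> ^ DM B2 s" unfolding \<eta>_def power_mult[symmetric]
      by (rule cond) (auto simp: DB_def)
  qed auto
  from U2_mean_zero[OF bdH AH this] obtain \<chi> \<psi> where \<chi>: "bd \<chi>" "eig ?v \<psi> \<chi>" "\<And>x. \<chi> x \<noteq> 0 \<Longrightarrow> \<not> int p dvd \<psi> x"
    "\<eta> ^ DM B2 s \<le> cmod (avg X (\<lambda>x. \<chi> x * H x))" by metis
  define \<eta>2 where "\<eta>2 = \<eta> ^ DM B2 s"
  have \<eta>2: "0 < \<eta>2" "\<eta>2 \<le> 1 / 2" unfolding \<eta>2_def using \<eta>0 power_le_half[OF \<eta>0 DM1] by auto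
  \<comment> \<open>With r = 0, \<open>star\<close> bounds the correlation with \<open>H\<close>
    itself.\<close>
  have "cmod (avg Z (\<lambda>z. avg X (\<lambda>x. \<chi> x * dl (replicate 0 ?v) [] (Fz z) x))) \<le>
        ravg X (\<lambda>x. if \<chi> x \<noteq> 0 \<and> int p dvd \<psi> x then 1 else 0) + \<eta>2\<^sup>2"
  proof (rule star[OF \<chi>(1,2)])
    show "0 < \<eta>2\<^sup>2" "\<eta>2\<^sup>2 \<le> 1 / 2" using \<eta>2 power_le_half[of \<eta>2 2] by auto
    show "1 \<le> real p * (\<eta>2\<^sup>2) ^ B2" unfolding \<eta>2_def \<eta>_def power_mult[symmetric]
      by (rule cond) (auto simp: DB_def algebra_simps)
  qed
  moreover have "avg Z (\<lambda>z. avg X (\<lambda>x. \<chi> x * dl (replicate 0 ?v) [] (Fz z) x)) = avg X (\<lambda>x. \<chi> x * H x)"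
    by (subst avg_swap) (simp add: avg_cmult Z(2))
  moreover have "ravg X (\<lambda>x. if \<chi> x \<noteq> 0 \<and> int p dvd \<psi> x then 1 else 0) = 0"
  proof -
    have "ravg X (\<lambda>x. if \<chi> x \<noteq> 0 \<and> int p dvd \<psi> x then 1 else 0) = ravg X (\<lambda>x. 0)" using \<chi>(3) by (intro ravg_cong) auto
    then show ?thesis by (simp add: ravg_def)
  qed
  ultimately have "\<eta>2 \<le> \<eta>2\<^sup>2" using \<chi>(4) unfolding \<eta>2_def by simp
  then show False using \<eta>2 by (simp add: power2_eq_square)
qed

lemma lam_diff_upd: assumes "finite S" "k \<in> S"
  shows "lam I S v \<theta> g f \<phi> - lam I S v \<theta> g (f(k := h)) \<phi> = 2 * lam I S v \<theta> g (f(k := \<lambda>x. (f k x - h x) / 2)) \<phi>"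
proof -
  have "lam I S v \<theta> g f \<phi> = lam I S v \<theta> g (f(k := f k)) \<phi>" by simp
  also have "\<dots> - lam I S v \<theta> g (f(k := h)) \<phi> = 2 * lam I S v \<theta> g (f(k := \<lambda>x. (f k x - h x) / 2)) \<phi>"
    unfolding lam_upd[OF assms] avg_diff[symmetric] avg_cmult[symmetric] by (intro avg_cong) (simp add: algebra_simps)
  finally show ?thesis .
qed

lemma mn_upd_A: assumes "finite S" "k \<in> S" shows "mn I S v g (f(k := A (v k) (f k))) \<phi> = mn I S v g f \<phi>"
proof -
  have "(\<Prod>i\<in>S. A (v i) ((f(k := A (v k) (f k))) i) x) = (\<Prod>i\<in>S. A (v i) (f i) x)" for x
    by (intro prod.cong) (auto simp: A_invar[OF invar_A_self])
  then show ?thesis unfolding mn_def by simp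
qed

text \<open>\<open>f k\<close> is its average along \<open>v k\<close> plus a function of zero
  average. With the average in slot \<open>k\<close>, that index carries frequency 0 and the
  estimate for S - {k} applies with the same main term; the rest, halved to stay bounded, falls
  under \<open>mz\<close>. The factor 3 in the bound comes from 3 \<delta>^3 \<le> \<delta>.\<close>

lemma from_mean_zero:
  assumes S: "S \<subseteq> K" "k \<in> S" and T: "T_ok (S - {k}) v \<theta> B2"
    and mz: "\<And>g f \<phi> \<delta>. \<lbrakk>bd g; \<And>i. bd (f i); invar us (f k); \<And>x. A (v k) (f k) x = 0; 0 < \<delta>; \<delta> \<le> 1 / 2;
       1 \<le> real p * \<delta> ^ B\<rbrakk> \<Longrightarrow> cmod (lam (K - S) S v \<theta> g f \<phi>) \<le> \<delta>"
  shows "Q_ok S v \<theta> k us (3 * (B + B2))"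
  unfolding Q_ok_def small_def
proof (intro allI impI)
  fix g :: "'x \<Rightarrow> complex" and f :: "nat \<Rightarrow> 'x \<Rightarrow> complex" and \<phi> :: "nat \<Rightarrow> 'x \<Rightarrow> int" and \<delta> :: real
  assume bd: "bd g" "\<forall>i. bd (f i)" "invar us (f k)"
    and \<delta>: "0 < \<delta>" "\<delta> \<le> 1 / 2" "1 \<le> real p * \<delta> ^ (3 * (B + B2))"
  have finS: "finite S" using S finK finite_subset by blast
  let ?A = "A (v k) (f k)"
  have cond: "1 \<le> real p * (\<delta> ^ 3) ^ n" if "n \<le> B + B2" for n
    unfolding power_mult[symmetric] by (rule power_cond_mono[OF \<delta>(3) _ \<delta>(1,2)]) (use that in auto)
  have d3: "0 < \<delta> ^ 3" "\<delta> ^ 3 \<le> 1 / 2" using \<delta> power_le_half[of \<delta> 3] by auto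
  have bdA: "bd ?A" using bd by (intro bd_A) auto
  have K: "K - (S - {k}) = insert k (K - S)" using S by auto
  have "lam (K - S) S v \<theta> g (f(k := ?A)) \<phi> = lam (K - (S - {k})) (S - {k}) v \<theta> (\<lambda>x. g x * ?A x) f (\<phi>(k := \<lambda>_. 0))"
    unfolding K using S finS finK eig_0[OF invar_A_self] by (intro lam_eig) auto
  moreover have "mn (K - S) S v g (f(k := ?A)) \<phi> = mn (K - (S - {k})) (S - {k}) v (\<lambda>x. g x * ?A x) f (\<phi>(k := \<lambda>_. 0))"
    unfolding K using S finS finK invar_A_self by (intro mn_inv) auto
  moreover have "cmod (lam (K - (S - {k})) (S - {k}) v \<theta> (\<lambda>x. g x * ?A x) f (\<phi>(k := \<lambda>_. 0)) -
      avg (Fp p) \<theta> * mn (K - (S - {k})) (S - {k}) v (\<lambda>x. g x * ?A x) f (\<phi>(k := \<lambda>_. 0))) \<le> \<delta> ^ 3"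
    using T bd_mult[OF bd(1) bdA] bd(2) d3 cond[of B2] unfolding T_ok_def small_def by simp
  ultimately have 1: "cmod (lam (K - S) S v \<theta> g (f(k := ?A)) \<phi> - avg (Fp p) \<theta> * mn (K - S) S v g f \<phi>) \<le> \<delta> ^ 3"
    by (simp add: mn_upd_A[OF finS S(2)])
  let ?h = "\<lambda>x. (f k x - ?A x) / 2"
  have "cmod (lam (K - S) S v \<theta> g (f(k := ?h)) \<phi>) \<le> \<delta> ^ 3"
  proof (rule mz[OF bd(1) _ _ _ d3 cond])
    have "cmod (?h x) \<le> 1" for x
    proof -
      have "cmod (f k x) \<le> 1" "cmod (?A x) \<le> 1" using bd(2) bdA by (auto simp: bd_def)
      then have "cmod (f k x - ?A x) \<le> 2" using norm_triangle_ineq4[of "f k x" "?A x"] by linarith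
      then show ?thesis by (simp add: norm_divide)
    qed
    then show "bd ((f(k := ?h)) i)" for i using bd(2) by (simp add: bd_def)
    show "invar us ((f(k := ?h)) k)" using bd(3) invar_A[OF bd(3), of "v k"] by (simp add: invar_def)
    have "A (v k) ?h x = (A (v k) (f k) x - A (v k) ?A x) / 2" for x by (rule A_half)
    then show "A (v k) ((f(k := ?h)) k) x = 0" for x using A_invar[OF invar_A_self[of "v k" "f k"]] by simp
  qed simp
  then have 2: "cmod (lam (K - S) S v \<theta> g f \<phi> - lam (K - S) S v \<theta> g (f(k := ?A)) \<phi>) \<le> 2 * \<delta> ^ 3"
    unfolding lam_diff_upd[OF finS S(2)] by (simp add: norm_mult)
  have "cmod (lam (K - S) S v \<theta> g f \<phi> - avg (Fp p) \<theta> * mn (K - S) S v g f \<phi>) \<le> 2 * \<delta> ^ 3 + \<delta> ^ 3"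
    using 1 2 norm_triangle_ineq[of "lam (K - S) S v \<theta> g f \<phi> - lam (K - S) S v \<theta> g (f(k := ?A)) \<phi>"
      "lam (K - S) S v \<theta> g (f(k := ?A)) \<phi> - avg (Fp p) \<theta> * mn (K - S) S v g f \<phi>"] by simp
  also have "\<dots> = 3 * \<delta>\<^sup>2 * \<delta>" by (simp add: power2_eq_square power3_eq_cube)
  also have "\<dots> \<le> 1 * \<delta>"
  proof -
    have "\<delta>\<^sup>2 \<le> (1 / 2)\<^sup>2" using \<delta> by (intro power_mono) auto
    then show ?thesis using \<delta> by (intro mult_right_mono) (auto simp: power2_eq_square)
  qed
  finally show "cmod (lam (K - S) S v \<theta> g f \<phi> - avg (Fp p) \<theta> * mn (K - S) S v g f \<phi>) \<le> \<delta>" by simp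
qed

lemma ctl_imp_Q:
  assumes "S \<subseteq> K" "k \<in> S" "ctl S v k us G 0 (s + 2) B1" "T_ok (S - {k}) v one B2"
  shows "Q_ok S v one k us (3 * (DB s B1 B2 + B2))"
  by (rule from_mean_zero[OF assms(1,2,4)]) (rule mean_zero_small[OF assms])

end

section \<open>Smoothing the directions\<close>

context zpoly
begin

text \<open>Two passages to dual functions give \<delta>^4, \<open>ctl\<close> the power B1 + 1, and
  each of two uses of \<open>push\<close> the power 2 (2^l + 1). The last factor accommodates the
  errors of the two estimates.\<close>

definition SM :: "nat \<Rightarrow> nat \<Rightarrow> nat \<Rightarrow> nat \<Rightarrow> nat" where
  "SM l B1 B2 B3 = 16 * (B1 + 1) * (2 ^ l + 1) * (2 ^ l + 1) * (B2 + B3 + 1)"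

text \<open>One unknown direction is traded for \<open>v k\<close>: correlation with a function invariant in the unknown
  direction \<open>w\<close> is pushed to \<open>f j\<close>, where the estimate for \<open>w\<close>-invariant \<open>f k\<close> gives the direction \<open>v j\<close>,
  and then back to \<open>f k\<close>.\<close>

lemma smoothing:
  assumes S: "S \<subseteq> K" "j \<in> S" "k \<in> S" "j \<noteq> k" and ctl: "ctl S v k us G (Suc t) s B1"
    and Q: "\<And>u. u \<in> G \<Longrightarrow> Q_ok S v one k (u # us) B2" and T: "T_ok (S - {j}) v one B3"
  shows "ctl S v k us G t (Suc s) (SM (t + s) B1 B2 B3)"
  unfolding ctl_def
proof (intro allI impI)
  fix g :: "'x \<Rightarrow> complex" and f :: "nat \<Rightarrow> 'x \<Rightarrow> complex" and \<phi> :: "nat \<Rightarrow> 'x \<Rightarrow> int" and \<delta> :: real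
  let ?B = "SM (t + s) B1 B2 B3"
  assume bdg: "bd g" and bdf': "\<forall>i. bd (f i)" and inv: "invar us (f k)" and \<delta>: "0 < \<delta>" "\<delta> \<le> 1 / 2" "1 \<le> real p * \<delta> ^ ?B"
    and big: "\<delta> \<le> cmod (lam (K - S) S v one g f \<phi>)"
  have bdf: "bd (f i)" for i using bdf' by blast
  have finS: "finite S" using S finK finite_subset by blast
  define m :: nat where "m = 2 ^ (t + s) + 1"
  have m1: "1 \<le> m" by (simp add: m_def)
  have B: "?B = 16 * (B1 + 1) * m * m * (B2 + B3 + 1)" by (simp add: SM_def m_def)
  have cond: "1 \<le> real p * \<delta> ^ n" if "n \<le> ?B" for n by (rule power_cond_mono[OF \<delta>(3) that \<delta>(1,2)])
  have Bge: "a * b * c * e \<le> ?B" if "a \<le> 16 * (B1 + 1)" "b \<le> m" "c \<le> m" "e \<le> B2 + B3 + 1" for a b c e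
    unfolding B using that by (intro mult_mono) auto
  define Fj where "Fj x = avg (Fp p) (\<lambda>y. du (K - S) S v g f \<phi> j y x)" for x
  have bdFj: "bd Fj" unfolding Fj_def[abs_def] by (intro bd_avg bd_du bdg bdf)
  \<comment> \<open>Slot \<open>j\<close> is replaced first, so that the dual function of slot
    \<open>k\<close> is built from \<open>Fj\<close> and the first push can arrive at
    \<open>Fj\<close>.\<close>
  define f1 where "f1 = f(j := \<lambda>x. cnj (Fj x))"
  have bdf1: "bd (f1 i)" for i unfolding f1_def by (rule bd_upd[OF bdf bd_cnj[OF bdFj]])
  have f1k: "f1 k = f k" using S by (simp add: f1_def)
  have "\<delta> \<le> cmod (avg X (\<lambda>x. f j x * Fj x))" using big unfolding lam_dual[OF finS S(2)] Fj_def by simp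
  from dual_square[OF bdf \<delta>(1) this]
  have big1: "\<delta>\<^sup>2 \<le> cmod (lam (K - S) S v one g f1 \<phi>)" unfolding f1_def lam_upd[OF finS S(2)] Fj_def by simp
  define Fk0 where "Fk0 x = avg (Fp p) (\<lambda>y. du (K - S) S v g f1 \<phi> k y x)" for x
  \<comment> \<open>Averaging along \<open>us\<close> restores the invariance that
    \<open>ctl\<close> and \<open>Q_ok\<close> require; it does not change the correlation because
    \<open>f k\<close> is invariant.\<close>
  define Fk where "Fk = Av us Fk0"
  have bdFk: "bd Fk" unfolding Fk_def Fk0_def[abs_def] by (intro bd_Av bd_avg bd_du bdg bdf1)
  have invFk: "invar us Fk" unfolding Fk_def by (rule invar_Av)
  define f2 where "f2 = f1(k := \<lambda>x. cnj (Fk x))"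
  have bdf2: "bd (f2 i)" for i unfolding f2_def by (rule bd_upd[OF bdf1 bd_cnj[OF bdFk]])
  have "lam (K - S) S v one g f1 \<phi> = avg X (\<lambda>x. f k x * Fk0 x)" unfolding lam_dual[OF finS S(3)] Fk0_def f1k by simp
  also have "\<dots> = avg X (\<lambda>x. f k x * Fk x)" unfolding Fk_def by (rule E_Av[OF inv, symmetric])
  finally have "\<delta>\<^sup>2 \<le> cmod (avg X (\<lambda>x. f k x * Fk x))" using big1 by simp
  from dual_square[OF bdf _ this] \<delta>(1) have "(\<delta>\<^sup>2)\<^sup>2 \<le> cmod (avg X (\<lambda>x. cnj (Fk x) * Fk x))" by simp
  also have "avg X (\<lambda>x. cnj (Fk x) * Fk x) = avg X (\<lambda>x. cnj (Fk x) * Fk0 x)"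
    using E_Av[OF invar_cnj[OF invFk], of Fk0] by (simp add: Fk_def)
  also have "\<dots> = lam (K - S) S v one g f2 \<phi>" unfolding f2_def lam_upd[OF finS S(3)] Fk0_def by simp
  finally have big2: "\<delta> ^ 4 \<le> cmod (lam (K - S) S v one g f2 \<phi>)" by (simp flip: power_mult)
  have "\<exists>ws. length ws = Suc t \<and> set ws \<subseteq> G \<and> (\<delta> ^ 4) ^ B1 \<le> cmod (bx (ws @ replicate s (v k)) (f2 k))"
  proof (rule ctl[unfolded ctl_def, rule_format, OF bdg bdf2 _ _ _ _ big2])
    show "invar us (f2 k)" unfolding f2_def using invar_cnj[OF invFk] by simp
    show "0 < \<delta> ^ 4" "\<delta> ^ 4 \<le> 1 / 2" using \<delta> power_le_half[of \<delta> 4] by auto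
    have "4 * B1 \<le> ?B" using Bge[of "4 * B1" 1 1 1] m1 by simp
    then show "1 \<le> real p * (\<delta> ^ 4) ^ B1" unfolding power_mult[symmetric] by (rule cond)
  qed
  then obtain w ws where ws: "length ws = t" "w \<in> G" "set ws \<subseteq> G" "(\<delta> ^ 4) ^ B1 \<le> cmod (bx ((w # ws) @ replicate s (v k)) (f2 k))"
    by (auto simp: length_Suc_conv)
  define vs where "vs = ws @ replicate s (v k)"
  have lvs: "2 ^ length vs + 1 = m" by (simp add: vs_def ws m_def)
  define \<eta> where "\<eta> = \<delta> ^ (4 * (B1 + 1))"
  have \<eta>0: "0 < \<eta>" "\<eta> \<le> 1 / 2" unfolding \<eta>_def using \<delta> power_le_half[of \<delta> "4 * (B1 + 1)"] by auto
  have "\<eta> \<le> (\<delta> ^ 4) ^ B1" unfolding \<eta>_def power_mult[symmetric] using \<delta> by (intro power_decreasing) auto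
  also note ws(4)
  also have "cmod (bx ((w # ws) @ replicate s (v k)) (f2 k)) = cmod (bx (vs @ [w]) Fk)"
    using bx_move[of vs w "[]" Fk] by (simp add: f2_def bx_cnj vs_def)
  finally have \<eta>: "\<eta> \<le> cmod (bx (vs @ [w]) Fk)" .
  define F where "F z = (\<lambda>x. du (K - S) S v g f1 \<phi> k (snd z) (act (lc us (fst z)) x))" for z :: "int list \<times> int"
  \<comment> \<open>From slot \<open>k\<close> to slot \<open>j\<close>: the test functions are
    invariant along \<open>w\<close> and \<open>us\<close>, so the estimate for the larger subspace
    applies.\<close>
  have 1: "\<eta> ^ (2 * (2 ^ length vs + 1)) \<le> cmod (bx (vs @ [v j]) (\<lambda>x. cnj (Fj x)))"
  proof (rule push[where Z = "L (length us) \<times> Fp p" and F = F and \<epsilon> = "\<eta> ^ m", OF _ _ invFk _ \<eta>0 \<eta>])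
    show "bd (F z)" for z unfolding F_def by (intro bd_act bd_du bdg bdf1)
    show "Fk x = avg (L (length us) \<times> Fp p) (\<lambda>z. F z x)" for x
      by (simp add: F_def avg_Times Fk_def Av_def Fk0_def)
    show "\<eta> ^ m \<le> \<eta> ^ (2 ^ length vs + 1)" unfolding lvs by simp
    fix \<chi> ns assume \<chi>: "bd \<chi>" "invar (w # us) \<chi>"
    let ?M = "ravg X (\<lambda>x. cmod (A (v j) (dl vs ns (\<lambda>x. cnj (Fj x))) x)) + \<eta> ^ m"
    have M: "0 \<le> ?M" using \<eta>0 by (intro add_nonneg_nonneg ravg_nonneg) auto
    have "cmod (avg (Fp p) (\<lambda>y. avg X (\<lambda>x. \<chi> x * dl vs ns (F (ms, y)) x))) \<le> ?M" for ms
    proof -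
      let ?f = "(\<lambda>i. dl vs ns (f1 i))(k := \<lambda>x. \<chi> (act (- lc us ms) x))"
      obtain \<phi>' where eq: "avg (Fp p) (\<lambda>y. avg X (\<lambda>x. \<chi> x * dl vs ns (F (ms, y)) x)) =
        lam (K - S) S v one (dl vs ns g) ?f \<phi>'"
        using dual_corr[OF finS S(3)] unfolding F_def by fastforce
      have "cmod (lam (K - S) S v one (dl vs ns g) ?f \<phi>') \<le> ravg X (\<lambda>x. cmod (A (v j) (?f j) x)) + \<eta> ^ m"
      proof (rule Q_bound[OF S(1,2) Q[OF ws(2)] bd_dl[OF bdg]])
        show "bd (?f i)" for i by (rule bd_upd[OF bd_dl[OF bdf1] bd_act[OF \<chi>(1)]])
        show "invar (w # us) (?f k)" using invar_act[OF \<chi>(2)] by simp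
        show "0 < \<eta> ^ m" "\<eta> ^ m \<le> 1 / 2" using \<eta>0 power_le_half[OF \<eta>0 m1] by auto
        show "1 \<le> real p * (\<eta> ^ m) ^ B2" unfolding \<eta>_def power_mult[symmetric]
          by (rule cond) (use Bge[of "4 * (B1 + 1)" m 1 B2] m1 in simp)
      qed
      moreover have "?f j = dl vs ns (\<lambda>x. cnj (Fj x))" using S(4) by (simp add: f1_def)
      ultimately show ?thesis unfolding eq by simp
    qed
    from norm_avg_le_bound[OF this M]
    show "cmod (avg (L (length us) \<times> Fp p) (\<lambda>z. avg X (\<lambda>x. \<chi> x * dl vs ns (F z) x))) \<le> ?M"
      unfolding avg_Times .
  qed
  define \<eta>2 where "\<eta>2 = \<eta> ^ (2 * m)"
  have \<eta>2: "0 < \<eta>2" "\<eta>2 \<le> 1 / 2" unfolding \<eta>2_def using \<eta>0 power_le_half[OF \<eta>0, of "2 * m"] m1 by auto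
  have \<eta>2b: "\<eta>2 \<le> cmod (bx (vs @ [v j]) Fj)" using 1 unfolding lvs \<eta>2_def by (simp add: bx_cnj)
  \<comment> \<open>Back from slot \<open>j\<close> to slot \<open>k\<close>: the test functions are
    invariant along \<open>v j\<close>, so \<open>j\<close> becomes a phase of frequency 0.\<close>
  have 2: "\<eta>2 ^ (2 * (2 ^ length vs + 1)) \<le> cmod (bx (vs @ [v k]) (f k))"
  proof (rule push[where Z = "Fp p" and us = "[]" and F = "\<lambda>y. du (K - S) S v g f \<phi> j y" and \<epsilon> = "\<eta>2 ^ m",
      OF _ _ invar_Nil _ \<eta>2 \<eta>2b])
    show "bd (du (K - S) S v g f \<phi> j y)" for y by (intro bd_du bdg bdf)
    show "Fj x = avg (Fp p) (\<lambda>y. du (K - S) S v g f \<phi> j y x)" for x by (simp add: Fj_def)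
    show "\<eta>2 ^ m \<le> \<eta>2 ^ (2 ^ length vs + 1)" unfolding lvs by simp
    fix \<chi> ns assume \<chi>: "bd \<chi>" "invar [v j] \<chi>"
    obtain \<phi>' where eq: "avg (Fp p) (\<lambda>y. avg X (\<lambda>x. \<chi> x * dl vs ns (\<lambda>x. du (K - S) S v g f \<phi> j y (act 0 x)) x)) =
      lam (K - S) S v one (dl vs ns g) ((\<lambda>i. dl vs ns (f i))(j := \<lambda>x. \<chi> (act (- 0) x))) \<phi>'"
      using dual_corr[OF finS S(2)] by meson
    have "cmod (lam (K - S) S v one (dl vs ns g) ((\<lambda>i. dl vs ns (f i))(j := \<chi>)) \<phi>') \<le>
       ravg X (\<lambda>x. cmod (A (v k) (dl vs ns (f k)) x)) + \<eta>2 ^ m"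
    proof (rule T_inv_bound[OF S T bd_dl[OF bdg] bd_dl[OF bdf] \<chi>])
      show "0 < \<eta>2 ^ m" "\<eta>2 ^ m \<le> 1 / 2" using \<eta>2 power_le_half[OF \<eta>2 m1] by auto
      show "1 \<le> real p * (\<eta>2 ^ m) ^ B3" unfolding \<eta>2_def \<eta>_def power_mult[symmetric]
        by (rule cond) (use Bge[of "8 * (B1 + 1)" m m B3] in \<open>simp add: algebra_simps\<close>)
    qed
    then show "cmod (avg (Fp p) (\<lambda>y. avg X (\<lambda>x. \<chi> x * dl vs ns (du (K - S) S v g f \<phi> j y) x))) \<le>
       ravg X (\<lambda>x. cmod (A (v k) (dl vs ns (f k)) x)) + \<eta>2 ^ m" using eq by simp
  qed
  have "\<delta> ^ ?B \<le> \<eta>2 ^ (2 * m)" unfolding \<eta>2_def \<eta>_def power_mult[symmetric]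
    using \<delta> Bge[of "16 * (B1 + 1)" m m 1] by (intro power_decreasing) (auto simp: algebra_simps)
  also have "\<dots> \<le> cmod (bx (vs @ [v k]) (f k))" using 2 unfolding lvs .
  finally have "\<delta> ^ ?B \<le> cmod (bx (ws @ replicate (Suc s) (v k)) (f k))"
    unfolding vs_def by (simp add: replicate_append_same)
  then show "\<exists>ws. length ws = t \<and> set ws \<subseteq> G \<and> \<delta> ^ ?B \<le> cmod (bx (ws @ replicate (Suc s) (v k)) (f k))"
    using ws by blast
qed

primrec SMI :: "nat \<Rightarrow> nat \<Rightarrow> nat \<Rightarrow> nat \<Rightarrow> nat \<Rightarrow> nat" where
  "SMI 0 s B1 B2 B3 = B1"
| "SMI (Suc t) s B1 B2 B3 = SMI t (Suc s) (SM (t + s) B1 B2 B3) B2 B3"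

lemma smoothing_all:
  assumes S: "S \<subseteq> K" "j \<in> S" "k \<in> S" "j \<noteq> k" and ctl: "ctl S v k us G t s B1"
    and Q: "\<And>u. u \<in> G \<Longrightarrow> Q_ok S v one k (u # us) B2" and T: "T_ok (S - {j}) v one B3"
  shows "ctl S v k us G 0 (t + s) (SMI t s B1 B2 B3)"
  using ctl
proof (induction t arbitrary: s B1)
  case (Suc t)
  then show ?case using smoothing[OF S Suc.prems Q T] by fastforce
qed simp

end

section \<open>Subspaces modulo \<open>p\<close>\<close>

text \<open>The F_p-subspaces of the directions modulo \<open>p\<close>, described without a
  quotient.\<close>

definition spc :: "nat \<Rightarrow> 'v::comm_ring_1 set \<Rightarrow> bool" where
  "spc p U \<longleftrightarrow> (\<forall>a. pz p a \<longrightarrow> a \<in> U) \<and> (\<forall>a\<in>U. \<forall>b\<in>U. a + b \<in> U) \<and> (\<forall>n. \<forall>a\<in>U. of_int n * a \<in> U)"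

lemma spc_pz: "spc p U \<Longrightarrow> pz p a \<Longrightarrow> a \<in> U"
  and spc_add: "spc p U \<Longrightarrow> a \<in> U \<Longrightarrow> b \<in> U \<Longrightarrow> a + b \<in> U"
  and spc_scale: "spc p U \<Longrightarrow> a \<in> U \<Longrightarrow> of_int n * a \<in> U"
  by (auto simp: spc_def)

lemma spc_diff: "spc p U \<Longrightarrow> a \<in> U \<Longrightarrow> b \<in> U \<Longrightarrow> a - b \<in> U"
  using spc_add[of p U a "- b"] spc_scale[of p U b "-1"] by simp

lemma spc_cong: "spc p U \<Longrightarrow> a \<in> U \<Longrightarrow> pz p (a - b) \<Longrightarrow> b \<in> U"
  using spc_diff[of p U a "a - b"] spc_pz[of p U "a - b"] by simp

lemma spc_cancel:
  assumes "spc p U" "prime p" "\<not> int p dvd h" "of_int h * a \<in> U" shows "a \<in> U"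
proof -
  have "coprime (int p) h" using assms(2,3) by (intro prime_imp_coprime) auto
  then obtain u v where uv: "u * int p + v * h = 1" using bezout_int[of "int p" h] by (metis coprime_iff_gcd_eq_1)
  have "of_int v * (of_int h * a) \<in> U" by (rule spc_scale[OF assms(1,4)])
  moreover have "pz p (of_int v * (of_int h * a) - a)"
  proof -
    have "v * h - 1 = - (u * int p)" using uv by simp
    then have "int p dvd v * h - 1" by simp
    from pz_dvd[OF this, of a] show ?thesis by (simp add: algebra_simps)
  qed
  ultimately show ?thesis by (rule spc_cong[OF assms(1)])
qed

text \<open>If w - h w' and w - h' w' both lie in \<open>U\<close>, so does (h - h') w', while w'
  does not.\<close>

lemma goodset_diff:
  assumes p: "prime p" and U: "spc p U" and V: "spc p V" shows "goodset p (V - U)"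
  unfolding goodset_def
proof (intro conjI ballI allI impI)
  fix w assume w: "w \<in> V - U"
  then show "\<not> pz p w" using spc_pz[OF U] by blast
  show "w' \<in> V - U" if "pz p (w - w')" for w'
    using w spc_cong[OF V _ that] spc_cong[OF U _ pz_sym[OF that]] by blast
  show "of_int h * w \<in> V - U" if "\<not> int p dvd h" for h
    using w spc_scale[OF V] spc_cancel[OF U p that] by blast
  fix w' h h' assume w': "w' \<in> V - U" and h: "w - of_int h * w' \<notin> V - U" "w - of_int h' * w' \<notin> V - U"
  have "w - of_int n * w' \<in> V" for n using w w' spc_diff[OF V] spc_scale[OF V] by blast
  then have "w - of_int h * w' \<in> U" "w - of_int h' * w' \<in> U" using h by blast+
  from spc_diff[OF U this(2,1)] have "of_int (h - h') * w' \<in> U" by (simp add: algebra_simps)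
  then show "int p dvd h - h'" using spc_cancel[OF U p] w' by blast
qed

definition sp :: "nat \<Rightarrow> 'v::comm_ring_1 set \<Rightarrow> 'v set" where
  "sp p W = \<Inter>{U. spc p U \<and> W \<subseteq> U}"

lemma spc_sp: "spc p (sp p W)"
  unfolding spc_def sp_def by blast

lemma sp_inc: "W \<subseteq> sp p W"
  unfolding sp_def by blast

lemma sp_least: "spc p U \<Longrightarrow> W \<subseteq> U \<Longrightarrow> sp p W \<subseteq> U"
  unfolding sp_def by blast

lemma sp_mono: "W \<subseteq> W' \<Longrightarrow> sp p W \<subseteq> sp p W'"
  unfolding sp_def by blast

lemma sp_sub: "W \<subseteq> sp p W' \<Longrightarrow> sp p W \<subseteq> sp p W'"
  using sp_least spc_sp by blast

lemma sp_insert: assumes "x \<in> sp p (insert e W)" shows "\<exists>n. x - of_int n * e \<in> sp p W"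
proof -
  let ?U = "{x. \<exists>n. x - of_int n * e \<in> sp p W}"
  have "spc p ?U" unfolding spc_def
  proof (intro conjI allI impI ballI)
    show "a \<in> ?U" if "pz p a" for a
    proof -
      have "a - of_int 0 * e \<in> sp p W" using spc_pz[OF spc_sp that, of W] by simp
      then show ?thesis by blast
    qed
    show "a + b \<in> ?U" if ab: "a \<in> ?U" "b \<in> ?U" for a b
    proof -
      obtain n m where nm: "a - of_int n * e \<in> sp p W" "b - of_int m * e \<in> sp p W" using ab by blast
      from spc_add[OF spc_sp nm] have "a + b - of_int (n + m) * e \<in> sp p W" by (simp add: algebra_simps)
      then show ?thesis by blast
    qed
    show "of_int k * a \<in> ?U" if a: "a \<in> ?U" for k a
    proof -
      obtain n where n: "a - of_int n * e \<in> sp p W" using a by blast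
      from spc_scale[OF spc_sp n, of k] have "of_int k * a - of_int (k * n) * e \<in> sp p W" by (simp add: algebra_simps)
      then show ?thesis by blast
    qed
  qed
  moreover have "insert e W \<subseteq> ?U"
  proof -
    have "e - of_int 1 * e \<in> sp p W" using spc_pz[OF spc_sp pz_simps] by simp
    moreover have "w - of_int 0 * e \<in> sp p W" if "w \<in> W" for w using that sp_inc by auto
    ultimately show ?thesis by blast
  qed
  ultimately show ?thesis using sp_least assms by blast
qed

text \<open>Steinitz exchange. The size of \<open>F\<close> serves as a bound for the codimension,
  which a new vector \<open>u\<close> lowers.\<close>

lemma sp_exchange:
  assumes "finite F" "prime p" "u \<in> sp p (W \<union> F)" "u \<notin> sp p W"
  shows "\<exists>F'. finite F' \<and> card F' < card F \<and> F \<subseteq> sp p (insert u W \<union> F')"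
  using assms
proof (induction F arbitrary: W rule: finite_induct)
  case (insert e F)
  show ?case
  proof (cases "u \<in> sp p (insert e W)")
    case True
    then obtain n where n: "u - of_int n * e \<in> sp p W" using sp_insert by blast
    have "\<not> int p dvd n"
    proof
      assume "int p dvd n"
      then have "pz p ((u - of_int n * e) - u)" using pz_dvd[of p n e] by (simp add: pz_minus)
      then show False using spc_cong[OF spc_sp n] insert.prems(3) by blast
    qed
    moreover have "of_int n * e \<in> sp p (insert u W)"
    proof -
      have "u \<in> sp p (insert u W)" "u - of_int n * e \<in> sp p (insert u W)"
        using sp_inc[of "insert u W" p] sp_mono[of W "insert u W" p] n by auto
      from spc_diff[OF spc_sp this] show ?thesis by simp
    qed
    ultimately have "e \<in> sp p (insert u W)" using spc_cancel[OF spc_sp insert.prems(1)] by blast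
    then have "insert e F \<subseteq> sp p (insert u W \<union> F)"
      using sp_mono[of "insert u W" "insert u W \<union> F" p] sp_inc[of "insert u W \<union> F" p] by blast
    then show ?thesis using insert.hyps by (intro exI[of _ F]) auto
  next
    case False
    have "u \<in> sp p (insert e W \<union> F)" using insert.prems(2) by simp
    from insert.IH[OF insert.prems(1) this False]
    obtain F' where F': "finite F'" "card F' < card F" "F \<subseteq> sp p (insert u (insert e W) \<union> F')" by blast
    have eq: "insert u (insert e W) \<union> F' = insert u W \<union> insert e F'" by auto
    have "e \<in> sp p (insert u W \<union> insert e F')" by (rule subsetD[OF sp_inc]) simp
    moreover have "card (insert e F') < card (insert e F)" using insert.hyps F'(1,2)
      by (simp add: card_insert_if)
    moreover have "F \<subseteq> sp p (insert u W \<union> insert e F')" using F'(3) unfolding eq .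
    ultimately show ?thesis using F'(1) by (intro exI[of _ "insert e F'"]) simp
  qed
qed simp

section \<open>Invariance along subspaces, and linear averages with a phase\<close>

context zact
begin

lemma invar_sp: assumes "invar us f" "u \<in> sp p (set us)" shows "f (act u x) = f x"
proof -
  let ?U = "{u. \<forall>n x. f (act (of_int n * u) x) = f x}"
  have "spc p ?U" unfolding spc_def
  proof (intro conjI allI impI ballI)
    show "a \<in> ?U" if "pz p a" for a
    proof -
      have "act (of_int n * a) x = x" for n x using act_cong[of "of_int n * a" 0 x] pz_mult[OF that] by (simp add: pz_def)
      then show ?thesis by simp
    qed
    show "a + b \<in> ?U" if "a \<in> ?U" "b \<in> ?U" for a b using that by (simp add: distrib_left act_add)
    show "of_int k * a \<in> ?U" if a: "a \<in> ?U" for k a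
    proof (clarify)
      fix n x show "f (act (of_int n * (of_int k * a)) x) = f x" using a[simplified, rule_format, of "n * k" x] by (simp add: mult.assoc)
    qed
  qed
  moreover have "set us \<subseteq> ?U" using assms(1) by (auto simp: invar_def)
  ultimately have "u \<in> ?U" using sp_least assms(2) by blast
  then have "f (act (of_int 1 * u) x) = f x" by blast
  then show ?thesis by simp
qed

lemma bx_scale_list:
  assumes "\<And>u. u \<in> set ws \<Longrightarrow> \<exists>c. \<not> int p dvd c \<and> pz p (u - of_int c * v)"
  shows "bx (ws @ us) f = bx (replicate (length ws) v @ us) f"
  using assms
proof (induction ws arbitrary: f)
  case (Cons w ws)
  obtain c where c: "\<not> int p dvd c" "pz p (w - of_int c * v)" using Cons.prems by auto
  have "bx ((w # ws) @ us) f = bx (w # replicate (length ws) v @ us) f"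
    using Cons by (simp add: bx_Cons)
  also have "\<dots> = bx (v # replicate (length ws) v @ us) f" using c by (intro bx_scale) (auto simp: pz_def)
  finally show ?case by simp
qed simp

text \<open>Each use of \<open>kill\<close> lowers the degree of the phase and differentiates
  \<open>f\<close> along \<open>u\<close>; the constant phase left at the end joins
  \<open>g\<close>.\<close>

lemma linear_phase:
  assumes "bd g" "bd f" "\<And>x. perq p (\<Phi> x)" "\<And>x. \<exists>w. pol p r w (\<Phi> x)"
  shows "cmod (avg X (\<lambda>x. avg (Fp p) (\<lambda>y. g x * (e_p p (\<Phi> x y) * f (act (of_int y * u) x))))) ^ (2 ^ Suc r)
     \<le> cmod (bx (replicate (Suc r) u) f)"
  using assms
proof (induction r arbitrary: g f \<Phi>)
  case 0
  obtain W where W: "\<And>x y. pz p (\<Phi> x y - W x)" using 0(4) by simp metis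
  have e: "e_p p (\<Phi> x y) = e_p p (W x)" for x y using W[of x y] by (intro e_p_cong[OF p_pos]) (simp add: pz_def)
  have "avg X (\<lambda>x. avg (Fp p) (\<lambda>y. g x * (e_p p (\<Phi> x y) * f (act (of_int y * u) x)))) =
      avg X (\<lambda>x. (g x * e_p p (W x)) * A u f x)"
    unfolding e A_def by (simp add: avg_cmult[symmetric] mult.assoc)
  moreover have "cmod (g x * e_p p (W x)) \<le> 1" for x using 0(1) by (simp add: bd_def norm_mult)
  ultimately show ?case using avg_cauchy_schwarz[of X "\<lambda>x. g x * e_p p (W x)" "A u f"]
    by (simp add: bx_single ravg_nonneg)
next
  case (Suc r)
  define H where "H x y = e_p p (\<Phi> x y) * f (act (of_int y * u) x)" for x y
  have perH: "per p (H x)" for x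
  proof -
    have "e_p p (\<Phi> x (y + int p)) = e_p p (\<Phi> x y)" for y
      using Suc.prems(3)[of x] by (intro e_p_cong[OF p_pos]) (auto simp: perq_def pz_def)
    then show ?thesis unfolding per_def H_def act_per by simp
  qed
  have IH: "cmod (avg X (\<lambda>x. avg (Fp p) (\<lambda>y. H x (y + h) * cnj (H x y)))) ^ (2 ^ Suc r) \<le>
      cmod (bx (replicate (Suc r) u) (D (of_int h * u) f))" for h
  proof -
    have eq: "H x (y + h) * cnj (H x y) = 1 * (e_p p (\<Phi> x (y + h) - \<Phi> x y) * D (of_int h * u) f (act (of_int y * u) x))" for x y
      unfolding H_def D_def by (simp add: act_add[symmetric] algebra_simps cnj_e_p e_p_add[of p _ "- _", simplified])
    show ?thesis unfolding eq
    proof (rule Suc.IH)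
      show "bd (\<lambda>x. 1)" by (simp add: bd_def)
      show "bd (D (of_int h * u) f)" by (rule bd_D[OF Suc.prems(2)])
      show "perq p (\<lambda>y. \<Phi> x (y + h) - \<Phi> x y)" for x by (intro perq_diff perq_shift Suc.prems(3))
      show "\<exists>w. pol p r w (\<lambda>y. \<Phi> x (y + h) - \<Phi> x y)" for x using Suc.prems(4)[of x] by auto
    qed
  qed
  have "cmod (avg X (\<lambda>x. avg (Fp p) (\<lambda>y. g x * H x y))) ^ (2 ^ Suc (Suc r)) =
      ((cmod (avg X (\<lambda>x. avg (Fp p) (\<lambda>y. g x * H x y))))\<^sup>2) ^ (2 ^ Suc r)"
    by (simp flip: power_mult)
  also have "\<dots> \<le> (ravg (Fp p) (\<lambda>h. cmod (avg X (\<lambda>x. avg (Fp p) (\<lambda>y. H x (y + h) * cnj (H x y)))))) ^ (2 ^ Suc r)"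
    by (intro power_mono kill Suc.prems(1) perH) auto
  also have "\<dots> \<le> ravg (Fp p) (\<lambda>h. cmod (avg X (\<lambda>x. avg (Fp p) (\<lambda>y. H x (y + h) * cnj (H x y)))) ^ (2 ^ Suc r))"
    by (rule ravg_power) auto
  also have "\<dots> \<le> ravg (Fp p) (\<lambda>h. cmod (bx (replicate (Suc r) u) (D (of_int h * u) f)))"
    by (intro ravg_mono IH)
  also have "\<dots> = cmod (of_real \<dots> :: complex)" by (simp add: ravg_nonneg)
  also have "\<dots> = cmod (bx (replicate (Suc (Suc r)) u) f)"
    using bx_nonneg[of "replicate (Suc r) u"]
    by (simp only: avg_of_real[symmetric] replicate_Suc[of "Suc r"] bx_Cons[of u "replicate (Suc r) u"]) simp
  finally show ?case unfolding H_def .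
qed

end

section \<open>The individual cases\<close>

context zpoly
begin

text \<open>\<open>f k\<close> is then invariant along \<open>v k\<close> itself, an eigenfunction
  of frequency 0.\<close>

lemma Q_invariant_case:
  assumes S: "S \<subseteq> K" "k \<in> S" and T: "T_ok (S - {k}) v \<theta> B" and U: "v k \<in> sp p (set us)"
  shows "Q_ok S v \<theta> k us B"
  unfolding Q_ok_def
proof (intro allI impI)
  fix g :: "'x \<Rightarrow> complex" and f :: "nat \<Rightarrow> 'x \<Rightarrow> complex" and \<phi> :: "nat \<Rightarrow> 'x \<Rightarrow> int"
  assume bd: "bd g" "\<forall>i. bd (f i)" "invar us (f k)"
  have finS: "finite S" using S finK finite_subset by blast
  have K: "K - (S - {k}) = insert k (K - S)" using S by auto
  have inv: "invar [v k] (f k)" using invar_sp[OF bd(3) spc_scale[OF spc_sp U]] by (simp add: invar_def)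
  have "lam (K - S) S v \<theta> g (f(k := f k)) \<phi> = lam (K - (S - {k})) (S - {k}) v \<theta> (\<lambda>x. g x * f k x) f (\<phi>(k := \<lambda>_. 0))"
    unfolding K using S finS finK eig_0[OF inv] by (intro lam_eig) auto
  moreover have "mn (K - S) S v g (f(k := f k)) \<phi> = mn (K - (S - {k})) (S - {k}) v (\<lambda>x. g x * f k x) f (\<phi>(k := \<lambda>_. 0))"
    unfolding K using S finS finK inv by (intro mn_inv) auto
  moreover have "bd (\<lambda>x. g x * f k x)" using bd by (intro bd_mult) auto
  ultimately show "small B (lam (K - S) S v \<theta> g f \<phi> - avg (Fp p) \<theta> * mn (K - S) S v g f \<phi>)"
    using T bd(2) unfolding T_ok_def by simp
qed

text \<open>\<open>f k\<close> does not change along the subspace, so moving by a multiple of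
  \<open>v k\<close> or of \<open>v'\<close> yields the same values on both sides of the
  estimate.\<close>

lemma Q_replace_case:
  assumes S: "S \<subseteq> K" "k \<in> S" and T: "T_ok S (v(k := v')) \<theta> B" and U: "v k - v' \<in> sp p (set us)"
  shows "Q_ok S v \<theta> k us B"
  unfolding Q_ok_def
proof (intro allI impI)
  fix g :: "'x \<Rightarrow> complex" and f :: "nat \<Rightarrow> 'x \<Rightarrow> complex" and \<phi> :: "nat \<Rightarrow> 'x \<Rightarrow> int"
  assume bd: "bd g" "\<forall>i. bd (f i)" "invar us (f k)"
  have eq: "f k (act (of_int n * v k) x) = f k (act (of_int n * v') x)" for n x
  proof -
    have "act (of_int n * v k) x = act (of_int n * (v k - v')) (act (of_int n * v') x)"
      by (simp add: act_add[symmetric] algebra_simps)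
    then show ?thesis using invar_sp[OF bd(3) spc_scale[OF spc_sp U]] by simp
  qed
  have "kern (K - S) S v g f \<phi> y x = kern (K - S) S (v(k := v')) g f \<phi> y x" for y x
    unfolding kern_def using eq by (auto intro!: prod.cong)
  then have "lam (K - S) S v \<theta> g f \<phi> = lam (K - S) S (v(k := v')) \<theta> g f \<phi>" by (simp add: lam_def)
  moreover have "A (v i) (f i) x = A ((v(k := v')) i) (f i) x" for i x by (simp add: A_def eq)
  then have "mn (K - S) S v g f \<phi> = mn (K - S) S (v(k := v')) g f \<phi>" by (simp add: mn_def)
  ultimately show "small B (lam (K - S) S v \<theta> g f \<phi> - avg (Fp p) \<theta> * mn (K - S) S v g f \<phi>)"
    using T bd unfolding T_ok_def by simp
qed

lemma phase_pol:
  assumes "I \<subseteq> K" "\<And>i. i \<in> K \<Longrightarrow> degree (P i) \<le> e"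
  shows "perq p (\<lambda>y. \<Sum>i\<in>I. c i * poly (P i) y)" "\<exists>w. pol p e w (\<lambda>y. \<Sum>i\<in>I. c i * poly (P i) y)"
proof -
  have eq: "(\<lambda>y. \<Sum>i\<in>I. c i * poly (P i) y) = poly (\<Sum>i\<in>I. smult (c i) (P i))"
    by (simp add: fun_eq_iff poly_sum)
  show "perq p (\<lambda>y. \<Sum>i\<in>I. c i * poly (P i) y)" unfolding eq by (rule perq_poly)
  have "degree (\<Sum>i\<in>I. smult (c i) (P i)) \<le> e"
    using assms by (intro degree_sum_le[OF finite_subset[OF _ finK]]) (auto intro: order_trans[OF degree_smult_le])
  then have "coeff (\<Sum>i\<in>I. smult (c i) (P i)) n = 0" if "e < n" for n using that by (intro coeff_eq_0) auto
  then show "\<exists>w. pol p e w (\<lambda>y. \<Sum>i\<in>I. c i * poly (P i) y)" unfolding eq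
    by (intro exI[of _ "fact e * coeff _ e"]) (rule pol_poly_trunc, simp)
qed

lemma good_degree: assumes "i \<in> K" shows "1 \<le> degree (P i)" "degree (P i) < p" "\<not> int p dvd lead_coeff (P i)"
proof -
  show *: "degree (P i) < p" "\<not> int p dvd lead_coeff (P i)" using good assms by (auto simp: goodp_def)
  show "1 \<le> degree (P i)"
  proof (rule ccontr)
    assume "\<not> ?thesis"
    then have d: "degree (P i) = 0" by simp
    show False using *(2) unfolding d P0[OF assms] by simp
  qed
qed

lemma good_indep2:
  assumes "i \<in> K" "k \<in> K" "i \<noteq> k" "\<not> int p dvd a"
  shows "\<exists>n. \<not> int p dvd coeff (smult a (P k) - smult b (P i)) n"
proof (rule ccontr)
  assume *: "\<not> ?thesis"
  let ?\<xi> = "(\<lambda>_. 0)(k := a, i := - b)"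
  have "(\<Sum>j\<in>K. smult (?\<xi> j) (P j)) = (\<Sum>j\<in>{i, k}. smult (?\<xi> j) (P j))"
    using assms by (intro sum.mono_neutral_right finK) auto
  also have "\<dots> = smult a (P k) - smult b (P i)" using assms by simp
  finally have "\<forall>n. int p dvd coeff (\<Sum>j\<in>K. smult (?\<xi> j) (P j)) n" using * by simp
  then have "int p dvd ?\<xi> k" using good assms(2) unfolding goodp_def by blast
  then show False using assms(3,4) by simp
qed

text \<open>Two linear polynomials without constant term are proportional, against independence
  modulo \<open>p\<close>. This provides the degree that \<open>ph_ok\<close> demands.\<close>

lemma degree_ge_2:
  assumes "i \<in> K" "k \<in> K" "i \<noteq> k" "degree (P i) \<le> degree (P k)" shows "2 \<le> degree (P k)"
proof (rule ccontr)
  assume "\<not> ?thesis"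
  then have d: "degree (P i) = 1" "degree (P k) = 1" using good_degree(1)[of i] good_degree(1)[of k] assms by auto
  let ?Q = "smult (lead_coeff (P i)) (P k) - smult (lead_coeff (P k)) (P i)"
  have "coeff ?Q n = 0" for n
  proof -
    consider "n = 0" | "n = 1" | "1 < n" by linarith
    then show ?thesis
    proof cases
      case 1
      show ?thesis unfolding 1 using P0[OF assms(1)] P0[OF assms(2)] by simp
    next
      case 2
      show ?thesis unfolding 2 d by simp
    next
      case 3
      then have "coeff (P i) n = 0" "coeff (P k) n = 0" using d by (auto intro: coeff_eq_0)
      then show ?thesis by simp
    qed
  qed
  then show False using good_indep2[OF assms(1-3) good_degree(3)[OF assms(1)], of "lead_coeff (P k)"] by simp
qed

lemma pol_lead: assumes "i \<in> K"
  shows "pol p (degree (P i)) (of_int (fact (degree (P i)) * lead_coeff (P i)) * u) (\<lambda>y. of_int (poly (P i) y) * u)"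
  by (intro pol_of_int pol_poly_trunc) (simp add: coeff_eq_0)

lemma fact_lead: assumes "i \<in> K" shows "\<not> int p dvd fact (degree (P i)) * lead_coeff (P i)"
  using good_degree[OF assms] by (intro not_dvd_fact_mult prime_p)

text \<open>The difference of the terms of \<open>k\<close> and \<open>i\<close> is admissible for
  one of three reasons: equal labels give (c_k P_k - c_i P_i) E(w_k), nonconstant by independence; a
  smaller degree of P_i leaves the leading coefficient of \<open>k\<close>; in the remaining case
  \<open>sep\<close> applies.\<close>

lemma pet_init:
  fixes G :: "'v set"
  assumes S: "S \<subseteq> K" "k \<in> S" and max: "\<And>i. i \<in> S \<Longrightarrow> degree (P i) \<le> degree (P k)" and d2: "2 \<le> degree (P k)"
    and v: "\<And>i. i \<in> S \<Longrightarrow> v i = of_int (c i) * E (w i)" "\<And>i. i \<in> S \<Longrightarrow> \<not> int p dvd c i" "\<And>i. i \<in> S \<Longrightarrow> \<not> pz p (E (w i))"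
    and U: "spc p U" "spc p V" "E (w k) \<notin> U" "\<And>i. i \<in> S \<Longrightarrow> E (w i) \<in> V"
    and sep: "\<And>i. \<lbrakk>i \<in> S; degree (P i) = degree (P k); w i \<noteq> w k\<rbrakk> \<Longrightarrow>
       of_int (lead_coeff (P k)) * v k - of_int (lead_coeff (P i)) * v i \<notin> U"
    and ok: "ph_ok (degree (P k)) e N B" "card S \<le> N" "\<And>i. i \<in> K \<Longrightarrow> degree (P i) \<le> e"
    and bd: "bd g" "\<And>i. bd (f i)" and \<delta>: "0 < \<delta>" "\<delta> \<le> 1 / 2" "1 \<le> real p * \<delta> ^ B"
    and big: "\<delta> \<le> cmod (lam (K - S) S v one g f \<phi>)"
  shows "concl (V - U) (f k) \<delta> B"
proof -
  let ?G = "V - U"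
  have finS: "finite S" using S finK finite_subset by blast
  have G: "goodset p ?G" by (rule goodset_diff[OF prime_p U(1,2)])
  have vV: "v i \<in> V" if "i \<in> S" for i using v(1)[OF that] spc_scale[OF U(2) U(4)[OF that]] by simp
  have vnz: "\<not> pz p (v i)" if "i \<in> S" for i
    using v[OF that] pz_scale_cancel[OF prime_p v(2)[OF that]] by auto
  have scG: "of_int z * x \<in> ?G" if "\<not> int p dvd z" "x \<in> ?G" for z x using G that unfolding goodset_def by blast
  have EG: "E (w k) \<in> ?G" using U(3) U(4)[OF S(2)] by blast
  have vG: "v k \<in> ?G" using scG[OF v(2)[OF S(2)] EG] v(1)[OF S(2)] by simp
  define Q where "Q i y = of_int (poly (P i) y) * v i" for i y
  define Gs where "Gs = map (\<lambda>i. (f i, Q i)) (sorted_list_of_set (S - {k}))"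
  define \<Phi> where "\<Phi> x y = (\<Sum>i\<in>K - S. \<phi> i x * poly (P i) y)" for x y
  have perQ: "perq p (Q i)" for i unfolding Q_def[abs_def] by (intro perq_of_int perq_poly)
  have polQ: "pol p (degree (P i)) (of_int (fact (degree (P i)) * lead_coeff (P i)) * v i) (Q i)" if "i \<in> S" for i
    unfolding Q_def[abs_def] using that S by (intro pol_lead) auto
  have dgQ: "dg p (Q i) = degree (P i)" if "i \<in> S" for i
  proof (rule dg_eq(1)[OF polQ[OF that]])
    show "\<not> pz p (of_int (fact (degree (P i)) * lead_coeff (P i)) * v i)"
      using pz_scale_cancel[OF prime_p fact_lead] vnz[OF that] S that by blast
  qed
  have RG: "of_int (fact (degree (P k)) * lead_coeff (P k)) * v k \<in> ?G"
    using S by (intro scG fact_lead vG) auto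
  have dk: "1 \<le> degree (P k)" using d2 by simp
  have gd: "gdp ?G (\<lambda>y. Q k y - Q i y)" if i: "i \<in> S - {k}" for i
  proof -
    have iS: "i \<in> S" "i \<noteq> k" and iK: "i \<in> K" "k \<in> K" using i S by auto
    consider "w i = w k" | "w i \<noteq> w k" "degree (P i) < degree (P k)" | "w i \<noteq> w k" "degree (P i) = degree (P k)"
      using max[OF iS(1)] by linarith
    then show ?thesis
    proof cases
      case 1
      let ?R = "smult (c k) (P k) - smult (c i) (P i)"
      have eq: "(\<lambda>y. Q k y - Q i y) = (\<lambda>y. of_int (poly ?R y) * E (w k))"
        unfolding Q_def v(1)[OF iS(1)] v(1)[OF S(2)] 1 by (simp add: fun_eq_iff algebra_simps)
      have "degree ?R \<le> degree (P k)" using max[OF iS(1)]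
        by (intro degree_diff_le) (auto intro: order_trans[OF degree_smult_le])
      then have deg: "degree ?R < p" using good_degree(2)[of k] S by auto
      have c0: "coeff ?R 0 = 0" using P0[OF iK(1)] P0[OF iK(2)] by simp
      obtain n where n: "\<not> int p dvd coeff ?R n" using good_indep2[OF iK iS(2) v(2)[OF S(2)], of "c i"] by (elim exE)
      obtain e z where "1 \<le> e" "e \<le> degree ?R" "\<not> int p dvd z" "pol p e z (poly ?R)"
        by (rule nonconst_type[OF prime_p deg c0 n])
      then show ?thesis unfolding eq by (intro gdpI[OF G pol_of_int _ scG[OF _ EG]])
    next
      case 2
      have "pol p (degree (P k)) (of_int (fact (degree (P k)) * lead_coeff (P k)) * v k - 0) (\<lambda>y. Q k y - Q i y)"
        by (rule pol_diff[OF polQ[OF S(2)] pol_up_less[OF polQ[OF iS(1)] 2(2)]])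
      then show ?thesis using RG dk by (intro gdpI[OF G]) auto
    next
      case 3
      let ?F = "fact (degree (P k)) :: int"
      have "\<not> int p dvd ?F" using fact_lead[OF iK(2)] by (meson dvd_mult2)
      moreover have "of_int (lead_coeff (P k)) * v k - of_int (lead_coeff (P i)) * v i \<in> ?G"
        using sep[OF iS(1) 3(2,1)] spc_diff[OF U(2) spc_scale[OF U(2) vV[OF S(2)]] spc_scale[OF U(2) vV[OF iS(1)]]] by simp
      ultimately have "of_int ?F * (of_int (lead_coeff (P k)) * v k - of_int (lead_coeff (P i)) * v i) \<in> ?G"
        by (rule scG)
      moreover have "pol p (degree (P k)) (of_int (?F * lead_coeff (P k)) * v k - of_int (?F * lead_coeff (P i)) * v i) (\<lambda>y. Q k y - Q i y)"
        using pol_diff[OF polQ[OF S(2)] polQ[OF iS(1), unfolded 3(2)]] 3(2) by simp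
      ultimately show ?thesis using dk by (intro gdpI[OF G, of "degree (P k)"]) (auto simp: algebra_simps)
    qed
  qed
  have valid: "valid ?G (Q k) Gs"
    unfolding valid_def
  proof (intro conjI ballI)
    show "perq p (Q k)" by (rule perQ)
    show "gdp ?G (Q k)" by (rule gdpI[OF G polQ[OF S(2)] dk RG])
    fix z assume "z \<in> set Gs"
    then obtain i where i: "i \<in> S - {k}" "z = (f i, Q i)" using finS by (auto simp: Gs_def)
    then have iS: "i \<in> S" by simp
    show "case z of (g, R) \<Rightarrow> bd g \<and> perq p R \<and> ispol p R \<and> 1 \<le> dg p R \<and> dg p R \<le> dg p (Q k) \<and> gdp ?G (\<lambda>y. Q k y - R y)"
      using bd(2) perQ polQ[OF iS] dgQ[OF iS] dgQ[OF S(2)] max[OF iS] good_degree(1)[of i] gd[OF i(1)] iS S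
      unfolding i(2) by (auto simp: ispol_def)
  qed
  have len: "length Gs \<le> N" using ok(2) finS S(2) by (simp add: Gs_def)
  have dd: "2 \<le> dg p (Q k)" "dg p (Q k) \<le> degree (P k)" using d2 dgQ[OF S(2)] by simp_all
  have ph: "\<forall>x. perq p (\<Phi> x) \<and> (\<exists>w. pol p e w (\<Phi> x))"
    unfolding \<Phi>_def[abs_def] using phase_pol[OF _ ok(3)] by simp
  have "lam (K - S) S v one g f \<phi> = psum \<Phi> g (f k) (Q k) Gs"
  proof -
    have "(\<Prod>i\<in>S - {k}. f i (act (Q i y) x)) = tm Gs y x" for x y
    proof -
      have "tm Gs y x = prod_list (map (\<lambda>i. f i (act (Q i y) x)) (sorted_list_of_set (S - {k})))"
        by (simp add: tm_def Gs_def o_def)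
      then show ?thesis using finS prod.distinct_set_conv_list[of "sorted_list_of_set (S - {k})" "\<lambda>i. f i (act (Q i y) x)"]
        by simp
    qed
    then have "kern (K - S) S v g f \<phi> y x = g x * (e_p p (\<Phi> x y) * (f k (act (Q k y) x) * tm Gs y x))" for x y
      unfolding kern_def prod.remove[OF finS S(2)] \<Phi>_def Q_def by (simp add: mult.assoc)
    then show ?thesis unfolding lam_def psum_def by simp
  qed
  then have "\<delta> \<le> cmod (psum \<Phi> g (f k) (Q k) Gs)" using big by simp
  then show ?thesis by (rule ok(1)[unfolded ph_ok_def, rule_format, OF G valid dd len bd(1,2) \<delta> spec[OF ph]])
qed

text \<open>\<open>ctl\<close> fixes the number of directions, so the list from PET is padded with
  \<open>E (w k)\<close>; each added direction squares the bound, whence 2^(B+2).\<close>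

lemma pet_ctl:
  assumes "S \<subseteq> K" "k \<in> S" "\<And>i. i \<in> S \<Longrightarrow> degree (P i) \<le> degree (P k)" "2 \<le> degree (P k)"
    "\<And>i. i \<in> S \<Longrightarrow> v i = of_int (c i) * E (w i)" "\<And>i. i \<in> S \<Longrightarrow> \<not> int p dvd c i" "\<And>i. i \<in> S \<Longrightarrow> \<not> pz p (E (w i))"
    "spc p U" "spc p V" "E (w k) \<notin> U" "\<And>i. i \<in> S \<Longrightarrow> E (w i) \<in> V"
    "\<And>i. \<lbrakk>i \<in> S; degree (P i) = degree (P k); w i \<noteq> w k\<rbrakk> \<Longrightarrow>
       of_int (lead_coeff (P k)) * v k - of_int (lead_coeff (P i)) * v i \<notin> U"
    "ph_ok (degree (P k)) e N B" "card S \<le> N" "\<And>i. i \<in> K \<Longrightarrow> degree (P i) \<le> e"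
  shows "ctl S v k us (V - U) (B + 2) 0 (B * 2 ^ (B + 2))"
  unfolding ctl_def
proof (intro allI impI)
  fix g :: "'x \<Rightarrow> complex" and f :: "nat \<Rightarrow> 'x \<Rightarrow> complex" and \<phi> :: "nat \<Rightarrow> 'x \<Rightarrow> int" and \<delta> :: real
  let ?B = "B * 2 ^ (B + 2)"
  assume bd: "bd g" "\<forall>i. bd (f i)" and \<delta>: "0 < \<delta>" "\<delta> \<le> 1 / 2" "1 \<le> real p * \<delta> ^ ?B"
    and big: "\<delta> \<le> cmod (lam (K - S) S v one g f \<phi>)"
  have "1 \<le> real p * \<delta> ^ B" by (rule power_cond_mono[OF \<delta>(3) _ \<delta>(1,2)]) simp
  from pet_init[where v = v and c = c and E = E and w = w and g = g and f = f, OF assms bd(1) bd(2)[rule_format] \<delta>(1,2) this big]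
  obtain ws where ws: "length ws \<le> B" "set ws \<subseteq> V - U" "\<delta> ^ B \<le> cmod (bx ws (f k))" unfolding concl_def by blast
  define j where "j = B + 2 - length ws"
  have Ek: "E (w k) \<in> V - U" using assms(10) assms(11)[OF assms(2)] by blast
  have "(2::nat) ^ j \<le> 2 ^ (B + 2)" by (rule power_increasing) (auto simp: j_def)
  then have "B * 2 ^ j \<le> ?B" by (rule mult_left_mono) simp
  then have "\<delta> ^ ?B \<le> \<delta> ^ (B * 2 ^ j)" using \<delta> by (intro power_decreasing) auto
  also have "\<dots> = (\<delta> ^ B) ^ (2 ^ j)" by (simp add: power_mult)
  also have "\<dots> \<le> cmod (bx ws (f k)) ^ (2 ^ j)" using ws(3) \<delta> by (intro power_mono) auto
  also have "\<dots> \<le> cmod (bx (ws @ replicate j (E (w k))) (f k))" by (rule bx_pad_replicate)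
  finally have "\<delta> ^ ?B \<le> cmod (bx ((ws @ replicate j (E (w k))) @ replicate 0 (v k)) (f k))" by simp
  moreover have "length (ws @ replicate j (E (w k))) = B + 2" using ws(1) by (simp add: j_def)
  moreover have "set (ws @ replicate j (E (w k))) \<subseteq> V - U" using ws(2) Ek by auto
  ultimately show "\<exists>ws. length ws = B + 2 \<and> set ws \<subseteq> V - U \<and> \<delta> ^ ?B \<le> cmod (bx (ws @ replicate 0 (v k)) (f k))" by blast
qed

text \<open>In degree at least 2, PET inside the span of \<open>v k\<close> yields unit multiples of
  \<open>v k\<close>; in degree 1, \<open>linear_phase\<close> does. Both lists are padded to the
  common length B + e + 2.\<close>

lemma single_ctl:
  assumes k: "k \<in> K" and vk: "\<not> pz p (v k)" and ok: "2 \<le> degree (P k) \<Longrightarrow> ph_ok (degree (P k)) e 1 B"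
    and e: "\<And>i. i \<in> K \<Longrightarrow> degree (P i) \<le> e"
  shows "ctl {k} v k us {} 0 (B + e + 2) ((B + 1) * 2 ^ (B + e + 2))"
  unfolding ctl_def
proof (intro allI impI)
  fix g :: "'x \<Rightarrow> complex" and f :: "nat \<Rightarrow> 'x \<Rightarrow> complex" and \<phi> :: "nat \<Rightarrow> 'x \<Rightarrow> int" and \<delta> :: real
  let ?B = "(B + 1) * 2 ^ (B + e + 2)"
  assume bd: "bd g" "\<forall>i. bd (f i)" and inv: "invar us (f k)" and \<delta>: "0 < \<delta>" "\<delta> \<le> 1 / 2" "1 \<le> real p * \<delta> ^ ?B"
    and big: "\<delta> \<le> cmod (lam (K - {k}) {k} v one g f \<phi>)"
  have "\<exists>r m. r \<le> B + e + 2 \<and> m * 2 ^ (B + e + 2 - r) \<le> ?B \<and> \<delta> ^ m \<le> cmod (bx (replicate r (v k)) (f k))"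
  proof (cases "2 \<le> degree (P k)")
    case True
    let ?U = "{a. pz p a} :: 'v set"
    have U: "spc p ?U" by (auto simp: spc_def pz_add pz_mult)
    have "ctl {k} v k us (sp p {v k} - ?U) (B + 2) 0 (B * 2 ^ (B + 2))"
    proof (rule pet_ctl[where c = "\<lambda>_. 1" and E = v and w = id, OF _ _ _ True _ _ _ U spc_sp])
      show "ph_ok (degree (P k)) e 1 B" by (rule ok[OF True])
      show "\<not> int p dvd 1" using prime_p by auto
      show "v (id k) \<notin> ?U" using vk by simp
      show "{k} \<subseteq> K" using k by simp
      show "v (id i) \<in> sp p {v k}" if "i \<in> {k}" for i using that sp_inc[of "{v k}" p] by simp
      show "\<not> pz p (v (id i))" if "i \<in> {k}" for i using that vk by simp
      show "degree (P i) \<le> e" if "i \<in> K" for i by (rule e[OF that])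
    qed simp_all
    moreover have "B * 2 ^ (B + 2) \<le> ?B" by (intro mult_mono power_increasing) auto
    then have "1 \<le> real p * \<delta> ^ (B * 2 ^ (B + 2))" using power_cond_mono[OF \<delta>(3) _ \<delta>(1,2)] by blast
    ultimately have "\<exists>ws. length ws = B + 2 \<and> set ws \<subseteq> sp p {v k} - ?U \<and>
        \<delta> ^ (B * 2 ^ (B + 2)) \<le> cmod (bx (ws @ replicate 0 (v k)) (f k))"
      unfolding ctl_def using bd inv \<delta>(1,2) big by simp
    then obtain ws where ws: "length ws = B + 2" "set ws \<subseteq> sp p {v k} - ?U" "\<delta> ^ (B * 2 ^ (B + 2)) \<le> cmod (bx ws (f k))"
      by auto
    have "bx (ws @ []) (f k) = bx (replicate (length ws) (v k) @ []) (f k)"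
    proof (rule bx_scale_list)
      fix u assume "u \<in> set ws"
      then have u: "u \<in> sp p {v k}" "\<not> pz p u" using ws(2) by auto
      obtain n where n: "u - of_int n * v k \<in> sp p {}" using sp_insert[of u p "v k" "{}"] u(1) by auto
      have pn: "pz p (u - of_int n * v k)" using sp_least[OF U, of "{}"] n by auto
      moreover have "\<not> int p dvd n" using pz_add[OF pn pz_dvd[of p n "v k"]] u(2) by auto
      ultimately show "\<exists>c. \<not> int p dvd c \<and> pz p (u - of_int c * v k)" by blast
    qed
    then have "\<delta> ^ (B * 2 ^ (B + 2)) \<le> cmod (bx (replicate (B + 2) (v k)) (f k))" using ws by simp
    moreover have "B * 2 ^ (B + 2) * 2 ^ (B + e + 2 - (B + 2)) \<le> ?B" by (simp add: power_add)
    ultimately show ?thesis by (intro exI[of _ "B + 2"] exI[of _ "B * 2 ^ (B + 2)"]) simp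
  next
    case False
    then have d1: "degree (P k) = 1" using good_degree(1)[OF k] by simp
    let ?a = "lead_coeff (P k)"
    have Pk: "poly (P k) y = y * ?a" for y
      using P0[OF k] d1 by (simp add: poly_altdef)
    define \<Phi> where "\<Phi> x y = (\<Sum>i\<in>K - {k}. \<phi> i x * poly (P i) y)" for x y
    have "kern (K - {k}) {k} v g f \<phi> y x = g x * (e_p p (\<Phi> x y) * f k (act (of_int y * (of_int ?a * v k)) x))" for x y
      by (simp add: kern_def Pk \<Phi>_def mult.assoc)
    then have "\<delta> \<le> cmod (avg X (\<lambda>x. avg (Fp p) (\<lambda>y. g x * (e_p p (\<Phi> x y) * f k (act (of_int y * (of_int ?a * v k)) x)))))"
      using big by (simp add: lam_def)
    then have "\<delta> ^ (2 ^ Suc e) \<le> cmod (avg X (\<lambda>x. avg (Fp p) (\<lambda>y. g x * (e_p p (\<Phi> x y) * f k (act (of_int y * (of_int ?a * v k)) x))))) ^ (2 ^ Suc e)"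
      using \<delta>(1) by (intro power_mono) auto
    also have "\<dots> \<le> cmod (bx (replicate (Suc e) (of_int ?a * v k)) (f k))"
      unfolding \<Phi>_def using bd phase_pol[OF _ e] by (intro linear_phase) auto
    also have "bx (replicate (Suc e) (of_int ?a * v k) @ []) (f k) = bx (replicate (length (replicate (Suc e) (of_int ?a * v k))) (v k) @ []) (f k)"
      using good_degree(3)[OF k] by (intro bx_scale_list exI[of _ ?a]) auto
    then have "cmod (bx (replicate (Suc e) (of_int ?a * v k)) (f k)) = cmod (bx (replicate (Suc e) (v k)) (f k))" by simp
    finally have 1: "\<delta> ^ (2 ^ Suc e) \<le> cmod (bx (replicate (Suc e) (v k)) (f k))" .
    have "(2::nat) ^ Suc e * 2 ^ (B + e + 2 - Suc e) = 1 * 2 ^ (B + e + 2)" by (simp flip: power_add)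
    also have "\<dots> \<le> ?B" by (intro mult_right_mono) auto
    finally show ?thesis using 1 by (intro exI[of _ "Suc e"] exI[of _ "2 ^ Suc e"]) simp
  qed
  then obtain r m where r: "r \<le> B + e + 2" "m * 2 ^ (B + e + 2 - r) \<le> ?B" "\<delta> ^ m \<le> cmod (bx (replicate r (v k)) (f k))" by blast
  let ?j = "B + e + 2 - r"
  have "\<delta> ^ ?B \<le> (\<delta> ^ m) ^ (2 ^ ?j)" unfolding power_mult[symmetric] using \<delta> r(2) by (intro power_decreasing) auto
  also have "\<dots> \<le> cmod (bx (replicate r (v k)) (f k)) ^ (2 ^ ?j)" using r(3) \<delta> by (intro power_mono) auto
  also have "\<dots> \<le> cmod (bx (replicate r (v k) @ replicate ?j (v k)) (f k))" by (rule bx_pad_replicate)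
  also have "replicate r (v k) @ replicate ?j (v k) = replicate (B + e + 2) (v k)"
    using r(1) by (simp only: replicate_add[symmetric]) simp
  finally show "\<exists>ws. length ws = 0 \<and> set ws \<subseteq> {} \<and> \<delta> ^ ?B \<le> cmod (bx (ws @ replicate (B + e + 2) (v k)) (f k))"
    by (intro exI[of _ "[]"]) simp
qed

end

section \<open>The unweighted estimate\<close>

context zpoly
begin

lemma T_empty:
  assumes "\<And>c. \<exists>i\<in>K. \<not> int p dvd c i \<Longrightarrow> small B (avg (Fp p) (\<lambda>y. \<theta> y * e_p p (\<Sum>i\<in>K. c i * poly (P i) y)))"
  shows "T_ok {} v \<theta> B"
  unfolding T_ok_def small_def
proof (intro allI impI)
  fix g :: "'x \<Rightarrow> complex" and f :: "nat \<Rightarrow> 'x \<Rightarrow> complex" and \<phi> :: "nat \<Rightarrow> 'x \<Rightarrow> int" and \<delta> :: real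
  assume bd: "bd g" and \<delta>: "0 < \<delta>" "\<delta> \<le> 1 / 2" "1 \<le> real p * \<delta> ^ B"
  define h where "h x = avg (Fp p) (\<lambda>y. \<theta> y * e_p p (\<Sum>i\<in>K. \<phi> i x * poly (P i) y)) -
     avg (Fp p) \<theta> * (if \<forall>i\<in>K. int p dvd \<phi> i x then 1 else 0)" for x
  have "lam K {} v \<theta> g f \<phi> = avg X (\<lambda>x. g x * avg (Fp p) (\<lambda>y. \<theta> y * e_p p (\<Sum>i\<in>K. \<phi> i x * poly (P i) y)))"
    unfolding lam_def kern_def avg_cmult[symmetric] by (simp add: mult_ac)
  moreover have "avg (Fp p) \<theta> * mn K {} v g f \<phi> = avg X (\<lambda>x. g x * (avg (Fp p) \<theta> * (if \<forall>i\<in>K. int p dvd \<phi> i x then 1 else 0)))"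
    unfolding mn_def avg_cmult[symmetric] by (simp add: mult_ac)
  ultimately have eq: "lam K {} v \<theta> g f \<phi> - avg (Fp p) \<theta> * mn K {} v g f \<phi> = avg X (\<lambda>x. g x * h x)"
    unfolding h_def right_diff_distrib avg_diff by simp
  have h: "cmod (h x) \<le> \<delta>" for x
  proof (cases "\<forall>i\<in>K. int p dvd \<phi> i x")
    case True
    have "e_p p (\<Sum>i\<in>K. \<phi> i x * poly (P i) y) = 1" for y
      unfolding e_p_eq_1_iff[OF p_pos] using True by (intro dvd_sum) auto
    then show ?thesis using True \<delta> by (simp add: h_def)
  next
    case False
    then have "\<exists>i\<in>K. \<not> int p dvd \<phi> i x" by blast
    from smallD[OF assms[OF this] \<delta>] show ?thesis unfolding h_def if_not_P[OF False] by simp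
  qed
  have "cmod (avg X (\<lambda>x. g x * h x)) \<le> \<delta>"
  proof (rule norm_avg_le_bound)
    fix x
    have "cmod (g x) * cmod (h x) \<le> 1 * \<delta>" using bd h[of x] \<delta> by (intro mult_mono) (auto simp: bd_def)
    then show "cmod (g x * h x) \<le> \<delta>" by (simp add: norm_mult)
  qed (use \<delta> in simp)
  then show "cmod (lam (K - {}) {} v \<theta> g f \<phi> - avg (Fp p) \<theta> * mn (K - {}) {} v g f \<phi>) \<le> \<delta>"
    using eq by simp
qed

lemma phase_type:
  assumes "\<exists>i\<in>K. \<not> int p dvd c i" "\<And>i. i \<in> K \<Longrightarrow> degree (P i) \<le> n"
  obtains e z where "Suc e \<le> n" "\<not> int p dvd z" "pol p (Suc e) z (\<lambda>y. \<Sum>i\<in>K. c i * poly (P i) y)"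
proof -
  let ?Q = "\<Sum>i\<in>K. smult (c i) (P i)"
  have eq: "(\<lambda>y. \<Sum>i\<in>K. c i * poly (P i) y) = poly ?Q" by (simp add: fun_eq_iff poly_sum)
  obtain m where m: "\<not> int p dvd coeff ?Q m" using good assms(1) unfolding goodp_def by blast
  have "degree (smult (c i) (P i)) \<le> min n (p - 1)" if "i \<in> K" for i
    using degree_smult_le[of "c i" "P i"] assms(2)[OF that] good_degree(2)[OF that] by linarith
  then have d: "degree ?Q \<le> min n (p - 1)" by (intro degree_sum_le[OF finK])
  then have "degree ?Q < p" using p_pos by linarith
  moreover have "coeff ?Q 0 = 0" using P0 by (simp add: coeff_sum)
  ultimately obtain e z where e: "1 \<le> e" "e \<le> degree ?Q" "\<not> int p dvd z" "pol p e z (poly ?Q)"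
    by (rule nonconst_type[OF prime_p _ _ m])
  obtain e' where "e = Suc e'" using e(1) by (cases e) auto
  then show ?thesis using that[of e' z] e d unfolding eq by simp
qed

lemma Q_step:
  assumes S: "S \<subseteq> K" "k \<in> S" "j \<in> S" "j \<noteq> k" and w: "w ` S \<subseteq> K"
    and max: "\<And>i. i \<in> S \<Longrightarrow> degree (P i) \<le> degree (P k)" and e: "\<And>i. i \<in> K \<Longrightarrow> degree (P i) \<le> e"
    and ok: "ph_ok (degree (P k)) e (card S) B0"
    and E: "\<And>l. l \<in> K \<Longrightarrow> \<not> pz p (E l)" and c: "\<And>i. i \<in> S \<Longrightarrow> \<not> int p dvd c i"
    and v: "v = (\<lambda>i. of_int (c i) * E (w i))"
    and T1: "\<And>i. i \<in> S \<Longrightarrow> T_ok (S - {i}) v one B1"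
    and T2: "\<And>i c'. \<lbrakk>i \<in> S; degree (P i) = degree (P k); w i \<noteq> w k; \<not> int p dvd c'\<rbrakk> \<Longrightarrow>
       T_ok S (v(k := of_int c' * E (w i))) one B2"
    and Q: "\<And>u. u \<in> sp p (E ` K) - sp p (set us) \<Longrightarrow> Q_ok S v one k (u # us) B3"
  shows "Q_ok S v one k us (B1 + B2 + 3 * (DB B0 (SMI (B0 + 2) 0 (B0 * 2 ^ (B0 + 2)) B3 B1) B1 + B1))"
proof -
  let ?B = "3 * (DB B0 (SMI (B0 + 2) 0 (B0 * 2 ^ (B0 + 2)) B3 B1) B1 + B1)"
  let ?U = "sp p (set us)" and ?V = "sp p (E ` K)"
  let ?a = "\<lambda>i. lead_coeff (P i)"
  consider "E (w k) \<in> ?U" | i where "i \<in> S" "degree (P i) = degree (P k)" "w i \<noteq> w k" "of_int (?a k) * v k - of_int (?a i) * v i \<in> ?U"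
    | "E (w k) \<notin> ?U" "\<And>i. \<lbrakk>i \<in> S; degree (P i) = degree (P k); w i \<noteq> w k\<rbrakk> \<Longrightarrow> of_int (?a k) * v k - of_int (?a i) * v i \<notin> ?U"
    by blast
  then show ?thesis
  proof cases
    case 1
    then have "v k \<in> ?U" unfolding v by (intro spc_scale[OF spc_sp])
    then show ?thesis using Q_ok_mono[OF Q_invariant_case[OF S(1,2) T1[OF S(2)]]] by simp
  next
    case 2
    have iK: "i \<in> K" "k \<in> K" using 2 S by auto
    have "coprime (int p) (?a k)" using good_degree(3)[OF iK(2)] prime_p by (intro prime_imp_coprime) auto
    then obtain u b where "u * int p + b * ?a k = 1" using bezout_int[of "int p" "?a k"] by (metis coprime_iff_gcd_eq_1)
    then have "?a k * b - 1 = - (u * int p)" by (simp add: algebra_simps)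
    then have b: "int p dvd ?a k * b - 1" by simp
    \<comment> \<open>Solves a_k c' = a_i c_i modulo \<open>p\<close>, for the leading coefficients
      a_k and a_i, so that \<open>v k\<close> and c' E(w_i) agree modulo the subspace.\<close>
    define c' where "c' = b * (?a i * c i)"
    have kc': "int p dvd ?a k * c' - ?a i * c i"
    proof -
      have "?a k * c' - ?a i * c i = (?a k * b - 1) * (?a i * c i)" unfolding c'_def by (simp add: algebra_simps)
      then show ?thesis using b by simp
    qed
    have "\<not> int p dvd ?a i * c i" using good_degree(3)[OF iK(1)] c[OF 2(1)] prime_p by (auto simp: prime_dvd_mult_iff)
    then have nc': "\<not> int p dvd c'" using dvd_diff[OF dvd_mult[of "int p" c' "?a k"] kc'] by auto
    have "of_int (?a k) * (v k - of_int c' * E (w i)) \<in> ?U"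
    proof (rule spc_cong[OF spc_sp 2(4)])
      have "of_int (?a k) * v k - of_int (?a i) * v i - of_int (?a k) * (v k - of_int c' * E (w i)) =
          of_int (?a k * c' - ?a i * c i) * E (w i)"
        unfolding v by (simp add: algebra_simps)
      then show "pz p (of_int (?a k) * v k - of_int (?a i) * v i - of_int (?a k) * (v k - of_int c' * E (w i)))"
        using pz_dvd[OF kc'] by simp
    qed
    then have "v k - of_int c' * E (w i) \<in> ?U" by (rule spc_cancel[OF spc_sp prime_p good_degree(3)[OF iK(2)]])
    then show ?thesis using Q_ok_mono[OF Q_replace_case[OF S(1,2) T2[OF 2(1-3) nc']]] by simp
  next
    case 3
    have d2: "2 \<le> degree (P k)" using degree_ge_2[of j k] S max by auto
    have "ctl S v k us (?V - ?U) (B0 + 2) 0 (B0 * 2 ^ (B0 + 2))"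
    proof (rule pet_ctl[where v = v and c = c and E = E and w = w, OF S(1,2) max d2 _ c _ spc_sp spc_sp 3(1) _ 3(2) ok order_refl e])
      show "v i = of_int (c i) * E (w i)" for i by (simp add: v)
      show "\<not> pz p (E (w i))" if "i \<in> S" for i using E w that by auto
      show "E (w i) \<in> ?V" if "i \<in> S" for i using sp_inc[of "E ` K" p] w that by auto
    qed
    from smoothing_all[OF S(1,3,2,4) this Q T1[OF S(3)]]
    have "ctl S v k us (?V - ?U) 0 (B0 + 2) (SMI (B0 + 2) 0 (B0 * 2 ^ (B0 + 2)) B3 B1)" by simp
    from ctl_imp_Q[OF S(1,2) this T1[OF S(2)]] show ?thesis by (rule Q_ok_mono) simp
  qed
qed

end

text \<open>The labels \<open>w\<close> record which directions have been made parallel. The bound \<open>B\<close> is uniform in \<open>p\<close>, in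
  the action and in the directions.\<close>

definition TS :: "nat set \<Rightarrow> (nat \<Rightarrow> int poly) \<Rightarrow> nat set \<Rightarrow> (nat \<Rightarrow> nat) \<Rightarrow> nat \<Rightarrow> bool" where
  "TS K P S w B \<longleftrightarrow> (\<forall>p (X :: (nat \<Rightarrow> int) set) (act :: (nat \<Rightarrow> int) \<Rightarrow> (nat \<Rightarrow> int) \<Rightarrow> (nat \<Rightarrow> int)) E c.
     zpoly p X act K P \<longrightarrow> (\<forall>l\<in>K. \<not> pz p (E l)) \<longrightarrow> (\<forall>i\<in>S. \<not> int p dvd c i) \<longrightarrow>
     zpoly.T_ok p X act K P S (\<lambda>i. of_int (c i) * E (w i)) (\<lambda>_. 1) B)"

lemma TS_mono: "TS K P S w B \<Longrightarrow> B \<le> B' \<Longrightarrow> TS K P S w B'"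
  unfolding TS_def using zpoly.T_ok_mono by blast

lemma weyl_uniform:
  "\<exists>B. \<forall>e<n. \<forall>p z q \<delta>. prime p \<longrightarrow> pol p (Suc e) z q \<longrightarrow> \<not> int p dvd z \<longrightarrow> perq p q \<longrightarrow> 0 < \<delta> \<longrightarrow> \<delta> \<le> 1 / 2 \<longrightarrow>
     1 \<le> real p * \<delta> ^ B \<longrightarrow> cmod (avg (Fp p) (\<lambda>y. e_p p (q y))) \<le> \<delta>"
proof -
  define W where "W e B \<longleftrightarrow> (\<forall>p z q \<delta>. prime p \<longrightarrow> pol p (Suc e) z q \<longrightarrow> \<not> int p dvd z \<longrightarrow> perq p q \<longrightarrow> 0 < \<delta> \<longrightarrow> \<delta> \<le> 1 / 2 \<longrightarrow>
     1 \<le> real p * \<delta> ^ B \<longrightarrow> cmod (avg (Fp p) (\<lambda>y. e_p p (q y))) \<le> \<delta>)" for e B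
  have mono: "W e B'" if WB: "W e B" "B \<le> B'" for e B B'
    unfolding W_def
  proof (intro allI impI)
    fix p z q \<delta>
    assume a: "prime p" "pol p (Suc e) z q" "\<not> int p dvd z" "perq p q" "0 < \<delta>" "\<delta> \<le> 1 / 2" "1 \<le> real p * \<delta> ^ B'"
    have "real p * \<delta> ^ B' \<le> real p * \<delta> ^ B" using a WB(2) by (intro mult_left_mono power_decreasing) auto
    then have "1 \<le> real p * \<delta> ^ B" using a by linarith
    then show "cmod (avg (Fp p) (\<lambda>y. e_p p (q y))) \<le> \<delta>" using WB(1) a unfolding W_def by blast
  qed
  have "\<exists>B. W e B" for e unfolding W_def by (rule weyl)
  then have "\<exists>B. \<forall>e\<in>{..<n}. W e B" using finite_uniform_bound[of "{..<n}" W] mono by blast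
  then have "\<exists>B. \<forall>e<n. W e B" by auto
  then show ?thesis unfolding W_def .
qed

lemma degree_bound: "finite K \<Longrightarrow> \<exists>e. \<forall>i\<in>K. degree (P i) \<le> e"
  by (rule exI[of _ "Max ((\<lambda>i. degree (P i)) ` K)"]) simp

lemma weyl_zpoly:
  assumes "\<And>i. i \<in> K \<Longrightarrow> degree (P i) \<le> n"
  shows "\<exists>B. \<forall>p (X :: 'x set) (act :: 'v::comm_ring_1 \<Rightarrow> 'x \<Rightarrow> 'x) c. zpoly p X act K P \<longrightarrow> (\<exists>i\<in>K. \<not> int p dvd c i) \<longrightarrow>
    zpoly.small p B (avg (Fp p) (\<lambda>y. e_p p (\<Sum>i\<in>K. c i * poly (P i) y)))"
proof -
  obtain B where B: "\<And>e p z q \<delta>. \<lbrakk>e < n; prime p; pol p (Suc e) z q; \<not> int p dvd z; perq p q; 0 < \<delta>; \<delta> \<le> 1 / 2;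
     1 \<le> real p * \<delta> ^ B\<rbrakk> \<Longrightarrow> cmod (avg (Fp p) (\<lambda>y. e_p p (q y))) \<le> \<delta>"
    using weyl_uniform[of n] by blast
  show ?thesis
  proof (intro exI[of _ B] allI impI)
    fix p and X :: "'x set" and act :: "'v \<Rightarrow> 'x \<Rightarrow> 'x" and c
    assume z: "zpoly p X act K P" and c: "\<exists>i\<in>K. \<not> int p dvd c i"
    interpret zpoly p X act K P by (rule z)
    obtain e z where e: "Suc e \<le> n" "\<not> int p dvd z" "pol p (Suc e) z (\<lambda>y. \<Sum>i\<in>K. c i * poly (P i) y)"
      using phase_type[OF c assms] by blast
    have per: "perq p (\<lambda>y. \<Sum>i\<in>K. c i * poly (P i) y)" by (rule phase_pol(1)[OF order_refl assms])
    show "small B (avg (Fp p) (\<lambda>y. e_p p (\<Sum>i\<in>K. c i * poly (P i) y)))"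
      unfolding small_def using B[OF _ prime_p e(3,2) per] e(1) by simp
  qed
qed

lemma TS_empty: assumes "finite K" shows "\<exists>B. TS K P {} w B"
proof -
  obtain n where "\<forall>i\<in>K. degree (P i) \<le> n" using degree_bound[OF assms] by blast
  then obtain B where B: "\<And>p (X :: (nat \<Rightarrow> int) set) (act :: (nat \<Rightarrow> int) \<Rightarrow> (nat \<Rightarrow> int) \<Rightarrow> (nat \<Rightarrow> int)) c.
    zpoly p X act K P \<Longrightarrow> \<exists>i\<in>K. \<not> int p dvd c i \<Longrightarrow>
    zpoly.small p B (avg (Fp p) (\<lambda>y. e_p p (\<Sum>i\<in>K. c i * poly (P i) y)))"
    using weyl_zpoly[of K P n] by blast
  have "TS K P {} w B" unfolding TS_def
  proof (intro allI impI)
    fix p and X :: "(nat \<Rightarrow> int) set" and act :: "(nat \<Rightarrow> int) \<Rightarrow> (nat \<Rightarrow> int) \<Rightarrow> (nat \<Rightarrow> int)" and E :: "nat \<Rightarrow> nat \<Rightarrow> int" and c :: "nat \<Rightarrow> int"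
    assume z: "zpoly p X act K P"
    interpret zpoly p X act K P by (rule z)
    show "T_ok {} (\<lambda>i. of_int (c i) * E (w i)) one B"
      by (rule T_empty) (use B[OF z] in simp)
  qed
  then show ?thesis by blast
qed

lemma scale_nz: "prime p \<Longrightarrow> \<not> int p dvd c \<Longrightarrow> \<not> pz p a \<Longrightarrow> \<not> pz p (of_int c * a)"
  using pz_scale_cancel by blast

lemma TS_single: assumes K: "finite K" "k \<in> K" "w k \<in> K" shows "\<exists>B. TS K P {k} w B"
proof -
  obtain e where e: "\<And>i. i \<in> K \<Longrightarrow> degree (P i) \<le> e" using degree_bound[OF K(1)] by blast
  obtain B2 where B2: "TS K P {} w B2" using TS_empty[OF K(1)] by blast
  obtain B0 where B0: "\<And>p (X :: (nat \<Rightarrow> int) set) (act :: (nat \<Rightarrow> int) \<Rightarrow> (nat \<Rightarrow> int) \<Rightarrow> (nat \<Rightarrow> int)).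
      zact p X act \<Longrightarrow> zact.ph_ok p X act (degree (P k)) e 1 B0"
    using pet_phase[of "degree (P k)" e 1] by blast
  have "TS K P {k} w (3 * (zpoly.DB (B0 + e) ((B0 + 1) * 2 ^ (B0 + e + 2)) B2 + B2))" unfolding TS_def
  proof (intro allI impI)
    fix p and X :: "(nat \<Rightarrow> int) set" and act :: "(nat \<Rightarrow> int) \<Rightarrow> (nat \<Rightarrow> int) \<Rightarrow> (nat \<Rightarrow> int)" and E :: "nat \<Rightarrow> nat \<Rightarrow> int" and c :: "nat \<Rightarrow> int"
    assume z: "zpoly p X act K P" and E: "\<forall>l\<in>K. \<not> pz p (E l)" and c: "\<forall>i\<in>{k}. \<not> int p dvd c i"
    interpret zpoly p X act K P by (rule z)
    let ?v = "\<lambda>i. of_int (c i) * E (w i)"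
    have v: "\<not> pz p (?v k)" using E K c by (intro scale_nz[OF prime_p]) auto
    have "ctl {k} ?v k [] {} 0 (B0 + e + 2) ((B0 + 1) * 2 ^ (B0 + e + 2))"
      by (rule single_ctl[where v = ?v and k = k, OF K(2) v B0[OF zact_axioms] e])
    moreover have "T_ok ({k} - {k}) ?v one B2" using B2 z E unfolding TS_def by simp
    ultimately have "Q_ok {k} ?v one k [] (3 * (DB (B0 + e) ((B0 + 1) * 2 ^ (B0 + e + 2)) B2 + B2))"
      using K by (intro ctl_imp_Q) auto
    then show "T_ok {k} ?v one (3 * (DB (B0 + e) ((B0 + 1) * 2 ^ (B0 + e + 2)) B2 + B2))" unfolding Q_ok_Nil .
  qed
  then show ?thesis by blast
qed

text \<open>Induction on \<open>n\<close>, a strict bound for the number of vectors needed to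
  complete \<open>us\<close> to a set spanning the directions; by \<open>sp_exchange\<close> it
  drops when a vector outside the span of \<open>us\<close> is added. The claim is the case of empty
  \<open>us\<close>.\<close>

lemma TS_step:
  assumes K: "finite K" and S: "S \<subseteq> K" "k \<in> S" "j \<in> S" "j \<noteq> k" "w ` S \<subseteq> K"
    and max: "\<And>i. i \<in> S \<Longrightarrow> degree (P i) \<le> degree (P k)"
    and T1: "\<And>i. i \<in> S \<Longrightarrow> TS K P (S - {i}) w B1"
    and T2: "\<And>i. \<lbrakk>i \<in> S; degree (P i) = degree (P k); w i \<noteq> w k\<rbrakk> \<Longrightarrow> TS K P S (w(k := w i)) B2"
  shows "\<exists>B. TS K P S w B"
proof -
  obtain e where e: "\<And>i. i \<in> K \<Longrightarrow> degree (P i) \<le> e" using degree_bound[OF K(1)] by blast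
  obtain B0 where B0: "\<And>p (X :: (nat \<Rightarrow> int) set) (act :: (nat \<Rightarrow> int) \<Rightarrow> (nat \<Rightarrow> int) \<Rightarrow> (nat \<Rightarrow> int)).
      zact p X act \<Longrightarrow> zact.ph_ok p X act (degree (P k)) e (card S) B0"
    using pet_phase[of "degree (P k)" e "card S"] by blast
  define C where "C n B \<longleftrightarrow> (\<forall>p (X :: (nat \<Rightarrow> int) set) (act :: (nat \<Rightarrow> int) \<Rightarrow> (nat \<Rightarrow> int) \<Rightarrow> (nat \<Rightarrow> int)) E c us F.
     zpoly p X act K P \<longrightarrow> (\<forall>l\<in>K. \<not> pz p (E l)) \<longrightarrow> (\<forall>i\<in>S. \<not> int p dvd c i) \<longrightarrow>
     finite F \<longrightarrow> card F < n \<longrightarrow> E ` K \<subseteq> sp p (set us \<union> F) \<longrightarrow>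
     zpoly.Q_ok p X act K P S (\<lambda>i. of_int (c i) * E (w i)) (\<lambda>_. 1) k us B)" for n B
  have "\<exists>B. C n B" for n
  proof (induction n)
    case 0
    show ?case unfolding C_def by simp
  next
    case (Suc n)
    then obtain B3 where B3: "C n B3" by blast
    have "C (Suc n) (B1 + B2 + 3 * (zpoly.DB B0 (zpoly.SMI (B0 + 2) 0 (B0 * 2 ^ (B0 + 2)) B3 B1) B1 + B1))"
      unfolding C_def
    proof (intro allI impI)
      fix p and X :: "(nat \<Rightarrow> int) set" and act :: "(nat \<Rightarrow> int) \<Rightarrow> (nat \<Rightarrow> int) \<Rightarrow> (nat \<Rightarrow> int)" and E :: "nat \<Rightarrow> nat \<Rightarrow> int" and c :: "nat \<Rightarrow> int"
        and us F
      assume z: "zpoly p X act K P" and E: "\<forall>l\<in>K. \<not> pz p (E l)" and c: "\<forall>i\<in>S. \<not> int p dvd c i"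
        and F: "finite F" "card F < Suc n" "E ` K \<subseteq> sp p (set us \<union> F)"
      interpret zpoly p X act K P by (rule z)
      let ?v = "\<lambda>i. of_int (c i) * E (w i)"
      show "Q_ok S ?v one k us (B1 + B2 + 3 * (DB B0 (SMI (B0 + 2) 0 (B0 * 2 ^ (B0 + 2)) B3 B1) B1 + B1))"
      proof (rule Q_step[OF S max e B0[OF zact_axioms] _ _ refl])
        show "\<not> pz p (E l)" if "l \<in> K" for l using E that by blast
        show "\<not> int p dvd c i" if "i \<in> S" for i using c that by blast
        show "T_ok (S - {i}) ?v one B1" if "i \<in> S" for i
          using T1[OF that] z E c unfolding TS_def by simp
        show "T_ok S (?v(k := of_int c' * E (w i))) one B2"
          if i: "i \<in> S" "degree (P i) = degree (P k)" "w i \<noteq> w k" and c': "\<not> int p dvd c'" for i c'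
        proof -
          have eq: "?v(k := of_int c' * E (w i)) = (\<lambda>l. of_int ((c(k := c')) l) * E ((w(k := w i)) l))" by auto
          show ?thesis unfolding eq
          proof (rule T2[OF i, unfolded TS_def, rule_format, OF z])
            show "\<not> pz p (E l)" if "l \<in> K" for l using E that by blast
            show "\<not> int p dvd (c(k := c')) l" if "l \<in> S" for l using c c' that by simp
          qed
        qed
        show "Q_ok S ?v one k (u # us) B3" if u: "u \<in> sp p (E ` K) - sp p (set us)" for u
        proof -
          have "u \<in> sp p (set us \<union> F)" using u sp_sub[OF F(3)] by blast
          then obtain F' where F': "finite F'" "card F' < card F" "F \<subseteq> sp p (insert u (set us) \<union> F')"
            using sp_exchange[OF F(1) prime_p] u by blast
          have "set us \<subseteq> sp p (insert u (set us) \<union> F')" using sp_inc[of "insert u (set us) \<union> F'" p] by auto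
          then have "sp p (set us \<union> F) \<subseteq> sp p (insert u (set us) \<union> F')" using F'(3) by (intro sp_sub) auto
          then have "E ` K \<subseteq> sp p (set (u # us) \<union> F')" using F(3) by auto
          moreover have "card F' < n" using F'(2) F(2) by simp
          ultimately show ?thesis using B3[unfolded C_def, rule_format, OF z _ _ F'(1)] E c by simp
        qed
      qed
    qed
    then show ?case by blast
  qed
  then obtain B where B: "C (Suc (card K)) B" by blast
  have "TS K P S w B" unfolding TS_def
  proof (intro allI impI)
    fix p and X :: "(nat \<Rightarrow> int) set" and act :: "(nat \<Rightarrow> int) \<Rightarrow> (nat \<Rightarrow> int) \<Rightarrow> (nat \<Rightarrow> int)" and E :: "nat \<Rightarrow> nat \<Rightarrow> int" and c :: "nat \<Rightarrow> int"
    assume z: "zpoly p X act K P" and E: "\<forall>l\<in>K. \<not> pz p (E l)" and c: "\<forall>i\<in>S. \<not> int p dvd c i"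
    interpret zpoly p X act K P by (rule z)
    have "card (E ` K) < Suc (card K)" using card_image_le[OF K, of E] by simp
    then have "Q_ok S (\<lambda>i. of_int (c i) * E (w i)) one k [] B"
      using B[unfolded C_def, rule_format, OF z _ _ finite_imageI[OF K, of E], of E c "[]"] E c sp_inc[of "E ` K" p] by simp
    then show "T_ok S (\<lambda>i. of_int (c i) * E (w i)) one B" unfolding Q_ok_Nil .
  qed
  then show ?thesis by blast
qed

text \<open>Replacing \<open>v k\<close> keeps \<open>S\<close>, so a second measure is needed: the
  sum of the labels. It drops because \<open>k\<close> is chosen with the largest label among the
  indices of maximal degree.\<close>

lemma TS_all: assumes K: "finite K" shows "S \<subseteq> K \<Longrightarrow> w ` S \<subseteq> K \<Longrightarrow> \<exists>B. TS K P S w B"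
proof (induction "card S" arbitrary: S w rule: less_induct)
  case less
  note outer = less.hyps
  have finS: "finite S" using less.prems K finite_subset by blast
  consider "S = {}" | k where "S = {k}" | "\<not> card S \<le> 1"
    using finS card_1_singletonE[of S] by (metis One_nat_def card_0_eq le_Suc_eq le_zero_eq)
  then show ?case
  proof cases
    case 1
    then show ?thesis using TS_empty[OF K] by simp
  next
    case 2
    then show ?thesis using TS_single[OF K] less.prems by simp
  next
    case 3
    show ?thesis using less.prems(2)
    proof (induction "\<Sum>i\<in>S. w i" arbitrary: w rule: less_induct)
      case less
      define T where "T = {i\<in>S. degree (P i) = Max ((\<lambda>i. degree (P i)) ` S)}"
      have Sne: "S \<noteq> {}" using 3 by auto
      have "Max ((\<lambda>i. degree (P i)) ` S) \<in> (\<lambda>i. degree (P i)) ` S" using finS Sne by (intro Max_in) auto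
      then have "T \<noteq> {}" by (auto simp: T_def)
      moreover have finT: "finite T" using finS by (simp add: T_def)
      ultimately have "Max (w ` T) \<in> w ` T" by (intro Max_in) auto
      then obtain k where k: "k \<in> T" "Max (w ` T) = w k" by blast
      have kmax: "w i \<le> w k" if "i \<in> T" for i using that finT k(2)[symmetric] by simp
      have kS: "k \<in> S" and kd: "degree (P k) = Max ((\<lambda>i. degree (P i)) ` S)" using k(1) by (auto simp: T_def)
      have max: "degree (P i) \<le> degree (P k)" if "i \<in> S" for i using that finS by (simp add: kd)
      obtain j where j: "j \<in> S" "j \<noteq> k"
        using 3 card_le_Suc0_iff_eq[OF finS] kS by auto
      have "\<exists>B. \<forall>i\<in>S. TS K P (S - {i}) w B"
      proof (rule finite_uniform_bound[OF finS TS_mono])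
        fix i assume i: "i \<in> S"
        have "card (S - {i}) < card S" using finS i by (rule card_Diff1_less)
        then show "\<exists>B. TS K P (S - {i}) w B" using \<open>S \<subseteq> K\<close> less.prems by (intro outer) auto
      qed
      then obtain B1 where B1: "\<And>i. i \<in> S \<Longrightarrow> TS K P (S - {i}) w B1" by blast
      let ?T = "{i\<in>S. degree (P i) = degree (P k) \<and> w i \<noteq> w k}"
      have "\<exists>B. \<forall>i\<in>?T. TS K P S (w(k := w i)) B"
      proof (rule finite_uniform_bound[OF _ TS_mono])
        show "finite ?T" using finS by simp
        fix i assume i: "i \<in> ?T"
        then have "i \<in> T" by (simp add: T_def kd)
        then have lt: "w i < w k" using kmax[of i] i by auto
        have "(\<Sum>l\<in>S. (w(k := w i)) l) < (\<Sum>l\<in>S. w l)"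
          by (rule sum_strict_mono_ex1[OF finS]) (use lt kS in auto)
        then show "\<exists>B. TS K P S (w(k := w i)) B" using less.prems i by (intro less.hyps) auto
      qed
      then obtain B2 where B2: "\<And>i. i \<in> ?T \<Longrightarrow> TS K P S (w(k := w i)) B2" by blast
      show ?case
        by (rule TS_step[OF K \<open>S \<subseteq> K\<close> kS j less.prems max B1 B2]) auto
    qed
  qed
qed

section \<open>The weighted estimate\<close>

context zpoly
begin

text \<open>Averaging over \<open>x\<close> first isolates the weight, which Cauchy--Schwarz in
  \<open>y\<close> removes. The squared means are bounded by box norms in an auxiliary direction
  \<open>u\<close>, and \<open>kern_D\<close> returns to averages of the same form.\<close>

lemma lam_weight_square:
  assumes \<theta>: "\<And>y. y \<in> Fp p \<Longrightarrow> cmod (\<theta> y) \<le> 1"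
  shows "(cmod (lam I S v \<theta> g f \<phi>))\<^sup>2 \<le> cmod (avg (Fp p) (\<lambda>h.
     lam I S v one (D (of_int h * u) g) (\<lambda>i. D (of_int h * u) (f i)) (\<lambda>i x. \<phi> i (act (of_int h * u) x) - \<phi> i x)))"
proof -
  let ?k = "\<lambda>y. kern I S v g f \<phi> y"
  have "lam I S v \<theta> g f \<phi> = avg (Fp p) (\<lambda>y. \<theta> y * avg X (?k y))"
    unfolding lam_def avg_cmult[symmetric] by (rule avg_swap)
  then have "(cmod (lam I S v \<theta> g f \<phi>))\<^sup>2 \<le> ravg (Fp p) (\<lambda>y. (cmod (avg X (?k y)))\<^sup>2)"
    using avg_cauchy_schwarz[of "Fp p" \<theta> "\<lambda>y. avg X (?k y)"] \<theta> by simp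
  also have "\<dots> \<le> ravg (Fp p) (\<lambda>y. cmod (bx [u] (?k y)))"
    using bx_pad[of "[]"] by (intro ravg_mono) simp
  also have "\<dots> = cmod (of_real \<dots> :: complex)" by (simp add: ravg_nonneg)
  also have "(of_real (ravg (Fp p) (\<lambda>y. cmod (bx [u] (?k y)))) :: complex) = avg (Fp p) (\<lambda>y. bx [u] (?k y))"
    unfolding avg_of_real[symmetric] using bx_nonneg[of "[u]"] by simp
  also have "\<dots> = avg (Fp p) (\<lambda>y. avg (Fp p) (\<lambda>h. avg X (\<lambda>x. D (of_int h * u) (?k y) x)))"
    by (simp add: bx_Cons)
  also have "\<dots> = avg (Fp p) (\<lambda>h. avg (Fp p) (\<lambda>y. avg X (\<lambda>x. D (of_int h * u) (?k y) x)))"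
    by (rule avg_swap)
  also have "\<dots> = avg (Fp p) (\<lambda>h. avg X (\<lambda>x. avg (Fp p) (\<lambda>y. D (of_int h * u) (?k y) x)))"
    by (intro avg_cong) (rule avg_swap)
  finally show ?thesis unfolding kern_D lam_def by simp
qed

lemma A_eig_0: assumes "eig u \<psi> \<chi>" "\<And>x. \<chi> x \<noteq> 0 \<Longrightarrow> \<not> int p dvd \<psi> x" shows "A u \<chi> x = 0"
proof -
  have "A u \<chi> x = avg (Fp p) (\<lambda>n. e_p p (n * \<psi> x)) * \<chi> x"
    unfolding A_def avg_multc[symmetric] using assms(1) by (simp add: eig_def)
  then show ?thesis using assms(2)[of x] avg_e_p[OF p_pos] by auto
qed

text \<open>With \<open>v k\<close> as the auxiliary direction the squared bounds for the
  derivatives average to the U^2 norm. Exponents: 3 for the dual function, doubled to 6, raised to 7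
  to absorb the error, doubled to 14.\<close>

lemma theta_mean_zero:
  assumes S: "S \<subseteq> K" "k \<in> S" and \<theta>: "\<And>y. y \<in> Fp p \<Longrightarrow> cmod (\<theta> y) \<le> 1"
    and T1: "T_ok S v one B1" and T2: "T_ok (S - {k}) v \<theta> B2"
    and bd: "bd g" "\<And>i. bd (f i)" "\<And>x. A (v k) (f k) x = 0"
    and \<delta>: "0 < \<delta>" "\<delta> \<le> 1 / 2" "1 \<le> real p * \<delta> ^ (14 * (B1 + B2))"
  shows "cmod (lam (K - S) S v \<theta> g f \<phi>) \<le> \<delta>"
proof (rule ccontr)
  assume "\<not> ?thesis"
  then have big: "\<delta> \<le> cmod (lam (K - S) S v \<theta> g f \<phi>)" by simp
  have finS: "finite S" using S finK finite_subset by blast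
  let ?v = "v k"
  define F where "F x = avg (Fp p) (\<lambda>y. \<theta> y * du (K - S) S v g f \<phi> k y x)" for x
  define H where "H x = (F x - A ?v F x) / 2" for x
  have bdF: "bd F" unfolding F_def[abs_def]
  proof (rule bd_avg)
    fix y assume "y \<in> Fp p"
    then show "bd (\<lambda>x. \<theta> y * du (K - S) S v g f \<phi> k y x)"
      using \<theta> bd_du[OF bd(1,2)] by (auto simp: bd_def norm_mult intro!: mult_le_one)
  qed
  have AH: "A ?v H x = 0" for x
    unfolding H_def[abs_def] A_half A_invar[OF invar_A_self[of ?v F]] by simp
  have bdH: "bd H"
    unfolding bd_def
  proof
    fix x
    have "cmod (F x) \<le> 1" "cmod (A ?v F x) \<le> 1" using bdF bd_A[OF bdF] by (auto simp: bd_def)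
    then have "cmod (F x - A ?v F x) \<le> 2" using norm_triangle_ineq4[of "F x" "A ?v F x"] by linarith
    then show "cmod (H x) \<le> 1" by (simp add: H_def norm_divide)
  qed
  have Lf: "lam (K - S) S v \<theta> g (f(k := \<chi>)) \<phi> = 2 * avg X (\<lambda>x. \<chi> x * H x)" if "\<And>x. A ?v \<chi> x = 0" for \<chi>
  proof -
    have "2 * avg X (\<lambda>x. \<chi> x * H x) = avg X (\<lambda>x. \<chi> x * F x - \<chi> x * A ?v F x)"
      unfolding avg_cmult[symmetric] by (intro avg_cong) (simp add: H_def field_simps)
    also have "\<dots> = avg X (\<lambda>x. \<chi> x * F x)"
      unfolding avg_diff E_A_sym using that by (simp add: avg_const fin ne)
    also have "\<dots> = lam (K - S) S v \<theta> g (f(k := \<chi>)) \<phi>" by (simp add: lam_upd[OF finS S(2)] F_def)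
    finally show ?thesis by simp
  qed
  have "\<delta> \<le> cmod (2 * avg X (\<lambda>x. f k x * H x))" using big Lf[OF bd(3)] by simp
  then have "\<delta> / 2 \<le> cmod (avg X (\<lambda>x. f k x * H x))" by (simp add: norm_mult)
  from dual_square[OF bd(2) _ this] \<delta>(1) have "(\<delta> / 2)\<^sup>2 \<le> cmod (avg X (\<lambda>x. cnj (H x) * H x))" by simp
  then have "\<delta>\<^sup>2 / 2 \<le> cmod (2 * avg X (\<lambda>x. cnj (H x) * H x))" by (simp add: norm_mult power2_eq_square field_simps)
  moreover have "\<delta> ^ 3 \<le> \<delta>\<^sup>2 / 2" using \<delta> by (simp add: power2_eq_square power3_eq_cube)
  moreover have "A ?v (\<lambda>x. cnj (H x)) x = 0" for x
    using arg_cong[OF AH[of x], of cnj] by (simp add: A_def avg_cnj)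
  define f' where "f' = f(k := \<lambda>x. cnj (H x))"
  have bdf': "bd (f' i)" for i unfolding f'_def by (rule bd_upd[OF bd(2) bd_cnj[OF bdH]])
  ultimately have L2: "\<delta> ^ 3 \<le> cmod (lam (K - S) S v \<theta> g f' \<phi>)"
    using Lf \<open>\<And>x. A ?v (\<lambda>x. cnj (H x)) x = 0\<close> unfolding f'_def by simp
  have cond: "1 \<le> real p * (\<delta> ^ m) ^ n" if "m * n \<le> 14 * (B1 + B2)" for m n
    unfolding power_mult[symmetric] by (rule power_cond_mono[OF \<delta>(3) that \<delta>(1,2)])
  let ?D = "\<lambda>h. D (of_int h * ?v)"
  let ?a = "\<lambda>h. ravg X (\<lambda>x. cmod (A ?v (?D h (\<lambda>x. cnj (H x))) x))"
  have lam1: "cmod (lam (K - S) S v one (?D h g) (\<lambda>i. ?D h (f' i)) \<phi>') \<le> ?a h + \<delta> ^ 7" for h \<phi>'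
  proof -
    have "cmod (lam (K - S) S v one (?D h g) (\<lambda>i. ?D h (f' i)) \<phi>') \<le> ravg X (\<lambda>x. cmod (A ?v (?D h (f' k)) x)) + \<delta> ^ 7"
      by (rule Q_bound[OF S T1[folded Q_ok_Nil[of _ _ _ k]] bd_D[OF bd(1)] bd_D[OF bdf'] invar_Nil])
        (use \<delta> power_le_half[of \<delta> 7] cond[of 7 B1] in auto)
    then show ?thesis by (simp add: f'_def)
  qed
  have "(\<delta> ^ 3)\<^sup>2 \<le> (cmod (lam (K - S) S v \<theta> g f' \<phi>))\<^sup>2" using L2 \<delta>(1) by (intro power_mono) auto
  also have "\<dots> \<le> cmod (avg (Fp p) (\<lambda>h. lam (K - S) S v one (?D h g) (\<lambda>i. ?D h (f' i)) (\<lambda>i x. \<phi> i (act (of_int h * ?v) x) - \<phi> i x)))"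
    by (rule lam_weight_square[OF \<theta>])
  also have "\<dots> \<le> ravg (Fp p) (\<lambda>h. ?a h + \<delta> ^ 7)"
    by (rule order_trans[OF norm_avg_le]) (rule ravg_mono, rule lam1)
  also have "\<dots> = ravg (Fp p) ?a + \<delta> ^ 7" by (simp add: ravg_add ravg_const Fp_ne)
  finally have "\<delta> ^ 6 - \<delta> ^ 7 \<le> ravg (Fp p) ?a" by (simp flip: power_mult)
  moreover have "\<delta> ^ 7 \<le> \<delta> ^ 6 - \<delta> ^ 7"
  proof -
    have "\<delta> ^ 7 = \<delta> ^ 6 * \<delta>" by (simp add: power_Suc2[symmetric])
    also have "\<dots> \<le> \<delta> ^ 6 * (1 / 2)" using \<delta> by (intro mult_left_mono) auto
    finally show ?thesis by simp
  qed
  ultimately have "\<delta> ^ 7 \<le> ravg (Fp p) ?a" by linarith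
  then have "(\<delta> ^ 7)\<^sup>2 \<le> (ravg (Fp p) ?a)\<^sup>2" using \<delta>(1) by (intro power_mono) auto
  also have "\<dots> \<le> ravg (Fp p) (\<lambda>h. (?a h)\<^sup>2)" by (rule ravg_square)
  also have "\<dots> \<le> ravg (Fp p) (\<lambda>h. ravg X (\<lambda>x. (cmod (A ?v (?D h (\<lambda>x. cnj (H x))) x))\<^sup>2))"
    by (intro ravg_mono ravg_square)
  also have "\<dots> = cmod (of_real \<dots> :: complex)" by (simp add: ravg_nonneg)
  also have "\<dots> = cmod (bx [?v, ?v] (\<lambda>x. cnj (H x)))"
    unfolding bx_Cons[of ?v "[?v]"] bx_single avg_of_real ..
  finally have "\<delta> ^ 14 \<le> cmod (bx [?v, ?v] H)" by (simp add: bx_cnj flip: power_mult)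
  from U2_mean_zero[OF bdH AH this] obtain \<chi> \<psi> where \<chi>: "bd \<chi>" "eig ?v \<psi> \<chi>" "\<And>x. \<chi> x \<noteq> 0 \<Longrightarrow> \<not> int p dvd \<psi> x"
    "\<delta> ^ 14 \<le> cmod (avg X (\<lambda>x. \<chi> x * H x))" by metis
  have "cmod (avg (Fp p) \<theta>) \<le> 1" by (rule norm_avg_le_bound[OF \<theta>]) auto
  then have "cmod (lam (K - S) S v \<theta> g (f(k := \<chi>)) \<phi>) \<le> ravg X (\<lambda>x. if \<chi> x \<noteq> 0 \<and> int p dvd \<psi> x then 1 else 0) + \<delta> ^ 14"
    by (rule T_eig[OF S T2 _ bd(1,2) \<chi>(1,2)]) (use \<delta> power_le_half[of \<delta> 14] cond[of 14 B2] in auto)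
  moreover have "ravg X (\<lambda>x. if \<chi> x \<noteq> 0 \<and> int p dvd \<psi> x then 1 else 0) = 0"
  proof -
    have "ravg X (\<lambda>x. if \<chi> x \<noteq> 0 \<and> int p dvd \<psi> x then 1 else 0) = ravg X (\<lambda>x. 0)" using \<chi>(3) by (intro ravg_cong) auto
    then show ?thesis by (simp add: ravg_def)
  qed
  moreover have "lam (K - S) S v \<theta> g (f(k := \<chi>)) \<phi> = 2 * avg X (\<lambda>x. \<chi> x * H x)"
    by (rule Lf) (rule A_eig_0[OF \<chi>(2,3)])
  ultimately have "2 * cmod (avg X (\<lambda>x. \<chi> x * H x)) \<le> \<delta> ^ 14" by (simp add: norm_mult)
  moreover have "0 < \<delta> ^ 14" using \<delta>(1) by simp
  ultimately show False using \<chi>(4) by linarith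
qed

primrec TH :: "nat \<Rightarrow> nat \<Rightarrow> nat \<Rightarrow> nat" where
  "TH B1 B2 0 = B2"
| "TH B1 B2 (Suc n) = 3 * (14 * (B1 + TH B1 B2 n) + TH B1 B2 n)"

lemma theta_all:
  assumes \<theta>: "\<And>y. y \<in> Fp p \<Longrightarrow> cmod (\<theta> y) \<le> 1"
    and T1: "\<And>S. S \<subseteq> K \<Longrightarrow> T_ok S v one B1" and T2: "T_ok {} v \<theta> B2"
  shows "S \<subseteq> K \<Longrightarrow> T_ok S v \<theta> (TH B1 B2 (card S))"
proof (induction "card S" arbitrary: S)
  case 0
  then show ?case using T2 finite_subset[OF 0(2) finK] by simp
next
  case (Suc n)
  have finS: "finite S" using finite_subset[OF Suc.prems finK] .
  obtain k where k: "k \<in> S" using Suc(2) by fastforce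
  have n: "n = card (S - {k})" using Suc(2) k finS by simp
  have IH: "T_ok (S - {k}) v \<theta> (TH B1 B2 n)" using Suc(1)[OF n] Suc.prems n by auto
  have "Q_ok S v \<theta> k [] (3 * (14 * (B1 + TH B1 B2 n) + TH B1 B2 n))"
    by (rule from_mean_zero[OF Suc.prems k IH]) (rule theta_mean_zero[OF Suc.prems k \<theta> T1[OF Suc.prems] IH])
  then show ?case unfolding Q_ok_Nil Suc(2)[symmetric] by simp
qed

end

section \<open>The theorem\<close>

lemma u_norm_upper:
  assumes "degree Q \<le> s - 1"
  shows "cmod (avg (Fp p) (\<lambda>y. \<theta> y * e_p p (- poly Q y))) \<le> u_norm s p \<theta>"
  unfolding u_norm_def
proof (rule cSUP_upper)
  show "Q \<in> {P. degree P \<le> s - 1}" using assms by simp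
  have "cmod (avg (Fp p) (\<lambda>y. \<theta> y * e_p p (- poly R y))) \<le> ravg (Fp p) (\<lambda>y. cmod (\<theta> y))" for R
    using norm_avg_le[of "Fp p" "\<lambda>y. \<theta> y * e_p p (- poly R y)"] by (simp add: norm_mult)
  then show "bdd_above ((\<lambda>P. cmod (avg (Fp p) (\<lambda>y. \<theta> y * e_p p (- poly P y)))) ` {P. degree P \<le> s - 1})"
    by (intro bdd_aboveI2)
qed

text \<open>p^(-c) \<le> \<delta>^(B c); choosing C < 2^M and B c \<ge> M + 2 leaves (2\<delta>)^M
  \<delta>^2 \<le> \<delta>/2.\<close>

lemma powr_decay_small:
  assumes "0 < C" "0 < c"
  shows "\<exists>B::nat. \<forall>p::nat. \<forall>\<delta>::real. 0 < \<delta> \<longrightarrow> \<delta> \<le> 1 / 2 \<longrightarrow> 1 \<le> real p * \<delta> ^ B \<longrightarrow> C * real p powr (- c) \<le> \<delta> / 2"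
proof -
  obtain M :: nat where M: "C < 2 ^ M" using real_arch_pow[of 2 C] by auto
  obtain B :: nat where "real (M + 2) / c \<le> real B" using real_arch_simple by blast
  then have B: "real (M + 2) \<le> real B * c" using assms(2) by (simp add: field_simps)
  show ?thesis
  proof (intro exI[of _ B] allI impI)
    fix p :: nat and \<delta> :: real
    assume \<delta>: "0 < \<delta>" "\<delta> \<le> 1 / 2" "1 \<le> real p * \<delta> ^ B"
    have p: "0 < real p" using \<delta>(3) by (cases "p = 0") auto
    have "real p powr (- c) = (1 / real p) powr c" using p by (simp add: powr_divide powr_minus_divide)
    also have "\<dots> \<le> (\<delta> ^ B) powr c" using \<delta> p assms(2) by (intro powr_mono2) (auto simp: field_simps)
    also have "\<dots> = \<delta> powr (real B * c)" using \<delta> by (simp add: powr_realpow[symmetric] powr_powr)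
    also have "\<dots> \<le> \<delta> powr real (M + 2)" using \<delta> B by (intro powr_mono') auto
    also have "\<dots> = \<delta> ^ (M + 2)" using \<delta> by (simp only: powr_realpow)
    finally have "C * real p powr (- c) \<le> 2 ^ M * \<delta> ^ (M + 2)" using M assms(1) \<delta> by (intro mult_mono) auto
    also have "\<dots> = (2 * \<delta>) ^ M * \<delta> * \<delta>" by (simp add: power_mult_distrib power_add power2_eq_square)
    also have "\<dots> \<le> 1 * \<delta> * (1 / 2)" using \<delta> by (intro mult_mono power_le_one) auto
    finally show "C * real p powr (- c) \<le> \<delta> / 2" by simp
  qed
qed

text \<open>The deviation of \<theta> from its mean is tested against a polynomial phase of degree
  at most \<open>d\<close>, which \<open>u_norm\<close> with index d + 1 covers; the mean itself is
  left to Weyl's inequality.\<close>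

lemma theta_empty:
  fixes \<theta> :: "nat \<Rightarrow> int \<Rightarrow> complex"
  assumes d: "\<And>i. i \<in> K \<Longrightarrow> degree (P i) \<le> d" and K: "finite K"
    and \<theta>: "\<And>p. prime p \<Longrightarrow> one_bounded_on (Fp p) (\<theta> p)" and u: "strongly_uniform (d + 1) \<theta>"
  shows "\<exists>B. \<forall>p (X :: 'x set) (act :: 'v::comm_ring_1 \<Rightarrow> 'x \<Rightarrow> 'x) v. zpoly p X act K P \<longrightarrow> zpoly.T_ok p X act K P {} v (\<theta> p) B"
proof -
  obtain C a where C: "0 < C" "0 < a" "\<And>p. prime p \<Longrightarrow> u_norm (d + 1) p (\<lambda>y. \<theta> p y - avg (Fp p) (\<theta> p)) \<le> C * real p powr (- a)"
    using u unfolding strongly_uniform_def by blast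
  obtain B1 where B1: "\<And>p \<delta>. 0 < \<delta> \<Longrightarrow> \<delta> \<le> 1 / 2 \<Longrightarrow> 1 \<le> real p * \<delta> ^ B1 \<Longrightarrow> C * real p powr (- a) \<le> \<delta> / 2"
    using powr_decay_small[OF C(1,2)] by blast
  have "\<exists>B. \<forall>p (X :: 'x set) (act :: 'v \<Rightarrow> 'x \<Rightarrow> 'x) c. zpoly p X act K P \<longrightarrow> (\<exists>i\<in>K. \<not> int p dvd c i) \<longrightarrow>
    zpoly.small p B (avg (Fp p) (\<lambda>y. e_p p (\<Sum>i\<in>K. c i * poly (P i) y)))"
    by (rule weyl_zpoly) (rule d)
  then obtain B2 where B2: "\<forall>p (X :: 'x set) (act :: 'v \<Rightarrow> 'x \<Rightarrow> 'x) c. zpoly p X act K P \<longrightarrow> (\<exists>i\<in>K. \<not> int p dvd c i) \<longrightarrow>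
    zpoly.small p B2 (avg (Fp p) (\<lambda>y. e_p p (\<Sum>i\<in>K. c i * poly (P i) y)))"
    by (elim exE)
  show ?thesis
  proof (intro exI[of _ "B1 + 2 * B2"] allI impI)
    fix p and X :: "'x set" and act :: "'v \<Rightarrow> 'x \<Rightarrow> 'x" and v
    assume z: "zpoly p X act K P"
    interpret zpoly p X act K P by (rule z)
    show "T_ok {} v (\<theta> p) (B1 + 2 * B2)"
    proof (rule T_empty, unfold small_def, intro allI impI)
      fix c :: "nat \<Rightarrow> int" and \<delta> :: real
      assume c: "\<exists>i\<in>K. \<not> int p dvd c i" and \<delta>: "0 < \<delta>" "\<delta> \<le> 1 / 2" "1 \<le> real p * \<delta> ^ (B1 + 2 * B2)"
      let ?q = "\<lambda>y. \<Sum>i\<in>K. c i * poly (P i) y" and ?m = "avg (Fp p) (\<theta> p)"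
      let ?Q = "- (\<Sum>i\<in>K. smult (c i) (P i))"
      have q: "?q y = - poly ?Q y" for y by (simp add: poly_sum)
      have "degree (\<Sum>i\<in>K. smult (c i) (P i)) \<le> d"
        using d by (intro degree_sum_le[OF K]) (auto intro: order_trans[OF degree_smult_le])
      then have "degree ?Q \<le> d + 1 - 1" by simp
      from u_norm_upper[OF this, of p "\<lambda>y. \<theta> p y - ?m"]
      have "cmod (avg (Fp p) (\<lambda>y. (\<theta> p y - ?m) * e_p p (?q y))) \<le> C * real p powr (- a)"
        unfolding q using C(3)[OF prime_p] by (rule order_trans)
      also have "\<dots> \<le> \<delta> / 2" using \<delta> power_cond_mono[OF \<delta>(3) _ \<delta>(1,2), of B1] by (intro B1) auto
      finally have 1: "cmod (avg (Fp p) (\<lambda>y. (\<theta> p y - ?m) * e_p p (?q y))) \<le> \<delta> / 2" .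
      have "cmod (avg (Fp p) (\<lambda>y. e_p p (?q y))) \<le> \<delta>\<^sup>2"
      proof (rule smallD[OF B2[rule_format, OF z c]])
        show "0 < \<delta>\<^sup>2" "\<delta>\<^sup>2 \<le> 1 / 2" using \<delta> power_le_half[of \<delta> 2] by auto
        show "1 \<le> real p * (\<delta>\<^sup>2) ^ B2" unfolding power_mult[symmetric] by (rule power_cond_mono[OF \<delta>(3) _ \<delta>(1,2)]) simp
      qed
      also have "\<delta>\<^sup>2 \<le> \<delta> / 2" using \<delta> by (simp add: power2_eq_square)
      finally have 2: "cmod (avg (Fp p) (\<lambda>y. e_p p (?q y))) \<le> \<delta> / 2" .
      have "cmod ?m \<le> 1" using \<theta>[OF prime_p] by (intro norm_avg_le_bound) (auto simp: one_bounded_on_def)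
      then have "cmod ?m * cmod (avg (Fp p) (\<lambda>y. e_p p (?q y))) \<le> 1 * (\<delta> / 2)" using 2 by (intro mult_mono) auto
      then have 3: "cmod (?m * avg (Fp p) (\<lambda>y. e_p p (?q y))) \<le> \<delta> / 2" by (simp add: norm_mult)
      have eq: "avg (Fp p) (\<lambda>y. \<theta> p y * e_p p (?q y)) =
          avg (Fp p) (\<lambda>y. (\<theta> p y - ?m) * e_p p (?q y)) + ?m * avg (Fp p) (\<lambda>y. e_p p (?q y))"
        by (simp add: left_diff_distrib avg_diff avg_cmult)
      show "cmod (avg (Fp p) (\<lambda>y. \<theta> p y * e_p p (?q y))) \<le> \<delta>"
        using norm_triangle_mono[OF 1 3] unfolding eq by simp
    qed
  qed
qed

section \<open>The action of integer vectors on F_p^D\<close>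

lemma of_int_fun: "(of_int n :: 'a \<Rightarrow> int) = (\<lambda>_. n)"
proof (cases n)
  case (nonneg m)
  then show ?thesis by (simp add: of_nat_fun)
next
  case (neg m)
  then show ?thesis by (simp add: of_nat_fun fun_eq_iff del: of_nat_Suc)
qed

definition shift :: "nat \<Rightarrow> nat \<Rightarrow> (nat \<Rightarrow> int) \<Rightarrow> (nat \<Rightarrow> int) \<Rightarrow> nat \<Rightarrow> int" where
  "shift p D a x = (if x \<in> Fp_vec p D then translate p D x 1 a else x)"

lemma translate_in: "0 < p \<Longrightarrow> translate p D x n v \<in> Fp_vec p D"
  by (auto simp: translate_def Fp_vec_def Fp_def)

lemma shift_translate: "x \<in> Fp_vec p D \<Longrightarrow> shift p D (of_int n * v) x = translate p D x n v"
  by (simp add: shift_def translate_def of_int_fun)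

lemma zact_shift: assumes "prime p" shows "zact p (Fp_vec p D) (shift p D)"
proof
  have p: "0 < p" using assms prime_gt_0_nat by blast
  show "finite (Fp_vec p D)" by (simp add: Fp_vec_def finite_PiE)
  show "Fp_vec p D \<noteq> {}" using Fp_nonempty[OF p] by (simp add: Fp_vec_def PiE_eq_empty_iff)
  show "shift p D (a + b) x = shift p D a (shift p D b x)" for a b x
  proof -
    have "translate p D x 1 (a + b) = translate p D (translate p D x 1 b) 1 a"
      by (auto simp: translate_def fun_eq_iff mod_simps algebra_simps)
    then show ?thesis by (simp add: shift_def translate_in[OF p])
  qed
  show "shift p D (of_nat p * a) x = x" for a x
  proof (cases "x \<in> Fp_vec p D")
    case True
    have "translate p D x 1 (of_nat p * a) j = x j" for j
    proof (cases "j \<in> {1..D}")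
      case j: True
      then have "x j \<in> Fp p" using True by (auto simp: Fp_vec_def)
      then show ?thesis using j by (simp add: translate_def of_nat_fun Fp_def)
    next
      case False
      then show ?thesis using True PiE_arb[of x "{1..D}" "\<lambda>_. Fp p" j] unfolding translate_def Fp_vec_def by auto
    qed
    then show ?thesis using True by (simp add: shift_def fun_eq_iff)
  qed (simp add: shift_def)
  show "shift p D a x \<in> Fp_vec p D" if "x \<in> Fp_vec p D" for a x
    using that translate_in[OF p] by (simp add: shift_def)
qed (rule assms)

theorem theorem1p3:
  fixes k d :: nat and P :: "nat \<Rightarrow> int poly" and \<theta> :: "nat \<Rightarrow> int \<Rightarrow> complex"
  assumes "k \<ge> 1"
    and "lin_indep_family {1..k} P"
    and "\<And>i. i \<in> {1..k} \<Longrightarrow> coeff (P i) 0 = 0"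
    and "d = Max ((\<lambda>i. degree (P i)) ` {1..k})"
    and "\<And>p. prime p \<Longrightarrow> one_bounded_on (Fp p) (\<theta> p)"
    and "strongly_uniform (d + 1) \<theta>"
  shows "\<exists>c>0. \<exists>C>0. \<forall>(D::nat) (v :: nat \<Rightarrow> nat \<Rightarrow> int).
    D \<ge> 1 \<and> (\<forall>i\<in>{1..k}. \<exists>j\<in>{1..D}. v i j \<noteq> 0) \<longrightarrow>
    (\<exists>p0::nat. \<forall>p. prime p \<and> p > p0 \<longrightarrow>
      (\<forall>f :: nat \<Rightarrow> (nat \<Rightarrow> int) \<Rightarrow> complex.
        (\<forall>i\<in>{0..k}. one_bounded_on (Fp_vec p D) (f i)) \<longrightarrow>
        cmod (avg (Fp_vec p D) (\<lambda>x. avg (Fp p) (\<lambda>y.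
                 \<theta> p y * f 0 x * (\<Prod>i=1..k. f i (translate p D x (poly (P i) y) (v i)))))
            - avg (Fp p) (\<theta> p) * avg (Fp_vec p D) (\<lambda>x.
                 f 0 x * (\<Prod>i=1..k. avg (Fp p) (\<lambda>n. f i (translate p D x n (v i))))))
          \<le> C * real p powr (- c)))"
proof -
  let ?K = "{1..k}"
  have d: "degree (P i) \<le> d" if "i \<in> ?K" for i using that assms(4) by simp
  obtain N where N: "\<And>p. prime p \<Longrightarrow> N < p \<Longrightarrow> goodp ?K P p" using goodp_large[OF _ assms(2)] by blast
  have "\<exists>B. \<forall>S\<in>Pow ?K. TS ?K P S (\<lambda>i. i) B"
    by (rule finite_uniform_bound[OF _ TS_mono TS_all]) auto
  then obtain B1 where B1: "\<And>S. S \<subseteq> ?K \<Longrightarrow> TS ?K P S (\<lambda>i. i) B1" by blast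
  have "\<exists>B. \<forall>p (X :: (nat \<Rightarrow> int) set) (act :: (nat \<Rightarrow> int) \<Rightarrow> (nat \<Rightarrow> int) \<Rightarrow> (nat \<Rightarrow> int)) v.
    zpoly p X act ?K P \<longrightarrow> zpoly.T_ok p X act ?K P {} v (\<theta> p) B"
    by (rule theta_empty[OF d finite_atLeastAtMost assms(5,6)])
  then obtain B2 where B2: "\<forall>p (X :: (nat \<Rightarrow> int) set) (act :: (nat \<Rightarrow> int) \<Rightarrow> (nat \<Rightarrow> int) \<Rightarrow> (nat \<Rightarrow> int)) v.
    zpoly p X act ?K P \<longrightarrow> zpoly.T_ok p X act ?K P {} v (\<theta> p) B2"
    by (elim exE)
  \<comment> \<open>Fixed before \<open>D\<close> and \<open>v\<close>, so that the exponent 1 / B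
    does not depend on them; the successor keeps \<open>B\<close> positive.\<close>
  define B where "B = Suc (zpoly.TH B1 B2 k)"
  show ?thesis
  proof (rule exI[of _ "1 / real B"], intro exI[of _ "1::real"] conjI allI impI)
    show "0 < 1 / real B" by (simp add: B_def)
    fix D and v :: "nat \<Rightarrow> nat \<Rightarrow> int"
    assume v: "D \<ge> 1 \<and> (\<forall>i\<in>{1..k}. \<exists>j\<in>{1..D}. v i j \<noteq> 0)"
    define M where "M = (\<Sum>i\<in>?K. \<Sum>j\<in>{1..D}. nat \<bar>v i j\<bar>)"
    have M: "nat \<bar>v i j\<bar> \<le> M" if "i \<in> ?K" "j \<in> {1..D}" for i j
    proof -
      have "nat \<bar>v i j\<bar> \<le> (\<Sum>j\<in>{1..D}. nat \<bar>v i j\<bar>)" using that by (intro member_le_sum) auto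
      also have "\<dots> \<le> M" unfolding M_def using that by (intro member_le_sum[of i ?K "\<lambda>i. \<Sum>j\<in>{1..D}. nat \<bar>v i j\<bar>"]) auto
      finally show ?thesis .
    qed
    show "\<exists>p0::nat. \<forall>p. prime p \<and> p > p0 \<longrightarrow>
      (\<forall>f :: nat \<Rightarrow> (nat \<Rightarrow> int) \<Rightarrow> complex.
        (\<forall>i\<in>{0..k}. one_bounded_on (Fp_vec p D) (f i)) \<longrightarrow>
        cmod (avg (Fp_vec p D) (\<lambda>x. avg (Fp p) (\<lambda>y.
                 \<theta> p y * f 0 x * (\<Prod>i=1..k. f i (translate p D x (poly (P i) y) (v i)))))
            - avg (Fp p) (\<theta> p) * avg (Fp_vec p D) (\<lambda>x.
                 f 0 x * (\<Prod>i=1..k. avg (Fp p) (\<lambda>n. f i (translate p D x n (v i))))))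
          \<le> 1 * real p powr (- (1 / real B)))"
    \<comment> \<open>\<open>N\<close> secures \<open>goodp\<close>, \<open>M\<close> makes every
      \<open>v i\<close> nonzero modulo \<open>p\<close>, and 2^B makes p^(-1/B) at most
      1/2.\<close>
    proof (intro exI[of _ "N + M + 2 ^ B"] allI impI)
      fix p and f :: "nat \<Rightarrow> (nat \<Rightarrow> int) \<Rightarrow> complex"
      assume pp: "prime p \<and> N + M + 2 ^ B < p" and f: "\<forall>i\<in>{0..k}. one_bounded_on (Fp_vec p D) (f i)"
      let ?X = "Fp_vec p D"
      have p: "prime p" "N < p" "M < p" "2 ^ B < p" using pp by auto
      interpret zact p ?X "shift p D" by (rule zact_shift[OF p(1)])
      interpret zpoly p ?X "shift p D" ?K P
        by unfold_locales (use N[OF p(1,2)] assms(3) in auto)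
      have vnz: "\<not> pz p (v i)" if i: "i \<in> ?K" for i
      proof
        assume "pz p (v i)"
        then obtain q where q: "v i = of_nat p * q" by (auto simp: pz_def)
        obtain j where j: "j \<in> {1..D}" "v i j \<noteq> 0" using v i by blast
        have "int p dvd v i j" unfolding q by (simp add: of_nat_fun)
        then have "int p \<le> \<bar>v i j\<bar>" using j by (simp add: zdvd_imp_le)
        then show False using M[OF i j(1)] p(3) by simp
      qed
      have T1: "T_ok S v one B1" if "S \<subseteq> ?K" for S
      proof -
        have "zpoly p ?X (shift p D) ?K P \<longrightarrow> (\<forall>l\<in>?K. \<not> pz p (v l)) \<longrightarrow> (\<forall>i\<in>S. \<not> int p dvd 1) \<longrightarrow>
            T_ok S (\<lambda>i. of_int 1 * v i) one B1"
          using B1[OF that, unfolded TS_def, THEN spec[of _ p], THEN spec[of _ ?X], THEN spec[of _ "shift p D"],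
            THEN spec[of _ v], THEN spec[of _ "\<lambda>_. 1"]] .
        moreover have "\<not> int p dvd 1" using p(1) by auto
        ultimately have "T_ok S (\<lambda>i. of_int 1 * v i) one B1" using zpoly_axioms vnz by blast
        then show ?thesis by simp
      qed
      have th: "cmod (\<theta> p y) \<le> 1" if "y \<in> Fp p" for y using assms(5)[OF p(1)] that by (simp add: one_bounded_on_def)
      have T: "T_ok ?K v (\<theta> p) B"
        using T_ok_mono[OF theta_all[OF th T1 B2[rule_format, OF zpoly_axioms] order_refl], of B] by (simp add: B_def)
      \<comment> \<open>Extended by 0, since \<open>bd\<close> refers to all points of the type and
        to all indices.\<close>
      define F where "F i x = (if i \<in> {0..k} \<and> x \<in> ?X then f i x else 0)" for i x
      have bdF: "bd (F i)" for i using f by (auto simp: bd_def F_def one_bounded_on_def)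
      have tr: "translate p D x n u \<in> ?X" for x n u by (rule translate_in[OF p_pos])
      have lam: "lam (?K - ?K) ?K v (\<theta> p) (F 0) F (\<lambda>_ _. 0) = avg ?X (\<lambda>x. avg (Fp p) (\<lambda>y.
                 \<theta> p y * f 0 x * (\<Prod>i=1..k. f i (translate p D x (poly (P i) y) (v i)))))"
        unfolding lam_def
      proof (intro avg_cong)
        fix x y assume x: "x \<in> ?X"
        have "(\<Prod>i\<in>?K. F i (shift p D (of_int (poly (P i) y) * v i) x)) = (\<Prod>i=1..k. f i (translate p D x (poly (P i) y) (v i)))"
          using tr by (intro prod.cong) (auto simp: shift_translate[OF x] F_def)
        then show "\<theta> p y * kern (?K - ?K) ?K v (F 0) F (\<lambda>_ _. 0) y x =
            \<theta> p y * f 0 x * (\<Prod>i=1..k. f i (translate p D x (poly (P i) y) (v i)))"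
          using x by (simp add: kern_def F_def)
      qed
      have mn: "mn (?K - ?K) ?K v (F 0) F (\<lambda>_ _. 0) = avg ?X (\<lambda>x.
                 f 0 x * (\<Prod>i=1..k. avg (Fp p) (\<lambda>n. f i (translate p D x n (v i)))))"
        unfolding mn_def
      proof (intro avg_cong)
        fix x assume x: "x \<in> ?X"
        have "(\<Prod>i\<in>?K. A (v i) (F i) x) = (\<Prod>i=1..k. avg (Fp p) (\<lambda>n. f i (translate p D x n (v i))))"
          unfolding A_def using tr by (intro prod.cong refl avg_cong) (auto simp: shift_translate[OF x] F_def)
        then show "F 0 x * (if \<forall>i\<in>?K - ?K. int p dvd 0 then 1 else 0) * (\<Prod>i\<in>?K. A (v i) (F i) x) =
            f 0 x * (\<Prod>i=1..k. avg (Fp p) (\<lambda>n. f i (translate p D x n (v i))))"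
          using x by (simp add: F_def)
      qed
      \<comment> \<open>The smallest admissible value, p \<delta>^B = 1.\<close>
      define \<delta> where "\<delta> = real p powr (- (1 / real B))"
      have rp: "0 < real p" using p_pos by simp
      have B0: "0 < real B" by (simp add: B_def)
      have \<delta>B: "\<delta> ^ B = 1 / real p"
      proof -
        have "\<delta> ^ B = \<delta> powr real B" using rp by (simp add: powr_realpow \<delta>_def)
        also have "\<dots> = real p powr (- 1)" unfolding \<delta>_def powr_powr using B0 by simp
        also have "\<dots> = 1 / real p" using rp by (simp add: powr_minus_divide)
        finally show ?thesis .
      qed
      have \<delta>0: "0 < \<delta>" using rp by (simp add: \<delta>_def)
      have \<delta>2: "\<delta> \<le> 1 / 2"
      proof (rule ccontr)
        assume "\<not> ?thesis"
        then have "(1 / 2) ^ B < \<delta> ^ B" by (intro power_strict_mono) (auto simp: B_def)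
        moreover have "(2::real) ^ B < real p" using p(4) by (metis of_nat_less_iff of_nat_numeral of_nat_power)
        ultimately show False unfolding \<delta>B using rp by (simp add: field_simps)
      qed
      have "small B (lam (?K - ?K) ?K v (\<theta> p) (F 0) F (\<lambda>_ _. 0) - avg (Fp p) (\<theta> p) * mn (?K - ?K) ?K v (F 0) F (\<lambda>_ _. 0))"
        using T bdF unfolding T_ok_def by blast
      from smallD[OF this \<delta>0 \<delta>2] show "cmod (avg ?X (\<lambda>x. avg (Fp p) (\<lambda>y.
                 \<theta> p y * f 0 x * (\<Prod>i=1..k. f i (translate p D x (poly (P i) y) (v i)))))
            - avg (Fp p) (\<theta> p) * avg ?X (\<lambda>x.
                 f 0 x * (\<Prod>i=1..k. avg (Fp p) (\<lambda>n. f i (translate p D x n (v i))))))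
          \<le> 1 * real p powr (- (1 / real B))"
        unfolding lam mn \<delta>B using rp by (simp add: \<delta>_def)
    qed
  qed simp
qed

end
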